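(* Let $\Omega\subset\subset\mathbb{C}^{n}$ be a smoothly bounded domain with Bergman projection $B$, and let $T$ be a smooth vector field on $\overline{\Omega}$ that is tangential and complex transversal at the boundary $b\Omega$. Suppose that there exist a pair $(k_{1},k_{2})\in\mathbb{N}\times\mathbb{N}$ and a constant $C_{1}>0$ such that $$\|Bf\|_{k_{2}}\leq C_{1}\|f\|_{k_{1}}\qquad\text{for all } f\in H^{k_{1}}(\Omega).$$ Then there exists a constant $C_{2}>0$ such that $$\|Bf\|_{k_{2}}\leq C_{2}\|f\|_{k_{1},T}\qquad\text{for all } f\in H^{k_{1}}_{T}(\Omega).$$ (Both inequalities include the assertion that $Bf\in H^{k_{2}}(\Omega)$ for the indicated $f$.)
   Context: $\mathbb{N}=\{1,2,\dots\}$. $\Omega\subset\subset\mathbb{C}^n$ is a bounded domain with smooth boundary $b\Omega$. $(f,g)=\int_\Omega f\bar g$ and $\|\cdot\|$ are the $L^2(\Omega)$ inner product and norm with respect to Lebesgue measure. $H^k(\Omega)$ is the $L^2$ Sobolev space of complex-valued functions with norm $\|f\|_k^2=\sum_{|\alpha|\le k}\|D^\alpha f\|^2$ (all real partial derivatives of order at most $k$). The Bergman projection $B$ is the orthogonal projection of $L^2(\Omega)$ onto its closed subspace $A^0(\Omega)$ of square-integrable holomorphic functions. A smooth vector field $T$ on $\overline\Omega$ has complex-valued coefficients in $C^\infty(\overline\Omega)$. It is tangential if at every point of $b\Omega$ it lies in the complexified tangent space $T(b\Omega)\otimes\mathbb{C}$. A tangential $T$ is complex transversal if at every point of $b\Omega$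 it does not lie in $T^{1,0}(b\Omega)\oplus T^{0,1}(b\Omega)$. Equivalently, let $\rho$ be a smooth defining function for $\Omega$ ($\Omega=\{\rho<0\}$, $d\rho\ne0$ on $b\Omega$), $L_n=\sum_{j}\frac{\partial\rho}{\partial\bar z_j}\frac{\partial}{\partial z_j}$ and $T_0=i(L_n-\overline{L_n})$; then $T=aT_0+Y_1+\overline{Y_2}$ with $Y_1,Y_2$ of type $(1,0)$ and tangential, $a$ smooth, and $a$ vanishes nowhere on $b\Omega$. For $k\in\mathbb{N}$, $H^k_T(\Omega)=\{f\in L^2(\Omega): T^jf\in L^2(\Omega),\ j=1,\dots,k\}$, where $T^jf$ ($T$ applied $j$ times) is taken in the sense of distributions, with norm $\|f\|_{k,T}^2=\sum_{j=0}^k\|T^jf\|^2$. *)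

theory Defs
  imports "HOL-Analysis.Analysis" "HOL-Library.Multiset"
begin

section \<open>Smooth functions\<close>

text \<open>For a list \<open>[b\<^sub>1, \<dots>, b\<^sub>m]\<close> of basis vectors this is the iterated partial
  derivative \<open>\<partial>\<^bsub>b\<^sub>1\<^esub> \<dots> \<partial>\<^bsub>b\<^sub>m\<^esub> f\<close>.\<close>

primrec partials :: "'a::euclidean_space list \<Rightarrow> ('a \<Rightarrow> 'b::real_normed_vector) \<Rightarrow> 'a \<Rightarrow> 'b" where
  "partials [] f = f"
| "partials (b # bs) f = (\<lambda>x. frechet_derivative (partials bs f) (at x) b)"

definition smooth :: "('a::euclidean_space \<Rightarrow> 'b::real_normed_vector) \<Rightarrow> bool" where
  "smooth f \<longleftrightarrow> (\<forall>bs. set bs \<subseteq> Basis \<longrightarrow> (\<forall>x. partials bs f differentiable at x))"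

text \<open>\<open>C\<^sup>\<infinity>\<close> up to the boundary: restrictions to the closure of smooth functions on the
  whole space.  Values outside the closure are irrelevant.\<close>

definition smooth_up_to_boundary ::
    "'a::euclidean_space set \<Rightarrow> ('a \<Rightarrow> 'b::real_normed_vector) \<Rightarrow> bool" where
  "smooth_up_to_boundary \<Omega> f \<longleftrightarrow> (\<exists>g. smooth g \<and> (\<forall>x\<in>closure \<Omega>. g x = f x))"

definition test_function ::
    "'a::euclidean_space set \<Rightarrow> ('a \<Rightarrow> complex) \<Rightarrow> bool" where
  "test_function \<Omega> \<phi> \<longleftrightarrow>
     smooth \<phi> \<and> (\<exists>K. compact K \<and> K \<subseteq> \<Omega> \<and> (\<forall>x. x \<notin> K \<longrightarrow> \<phi> x = 0))"


section \<open>The space of square-integrable functions\<close>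

text \<open>Elements are represented by functions on the whole space, of which only the
  values almost everywhere on \<open>\<Omega>\<close> matter.\<close>

definition L2 :: "'a::euclidean_space set \<Rightarrow> ('a \<Rightarrow> complex) set" where
  "L2 \<Omega> = {f. f \<in> borel_measurable (lebesgue_on \<Omega>) \<and>
               integrable (lebesgue_on \<Omega>) (\<lambda>x. (cmod (f x))\<^sup>2)}"

definition L2_inner ::
    "'a::euclidean_space set \<Rightarrow> ('a \<Rightarrow> complex) \<Rightarrow> ('a \<Rightarrow> complex) \<Rightarrow> complex" where
  "L2_inner \<Omega> f g = (\<integral>x. f x * cnj (g x) \<partial>lebesgue_on \<Omega>)"

definition L2_norm :: "'a::euclidean_space set \<Rightarrow> ('a \<Rightarrow> complex) \<Rightarrow> real" where
  "L2_norm \<Omega> f = sqrt (\<integral>x. (cmod (f x))\<^sup>2 \<partial>lebesgue_on \<Omega>)"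


section \<open>Sobolev spaces\<close>

text \<open>A multi-index \<open>\<alpha>\<close> is a multiset of (real) basis vectors; the multiplicity of
  \<open>b\<close> is the order of differentiation in direction \<open>b\<close>, and \<open>\<bar>\<alpha>\<bar> = size \<alpha>\<close>.\<close>

definition multi_indices :: "nat \<Rightarrow> 'a::euclidean_space multiset set" where
  "multi_indices k = {\<alpha>. set_mset \<alpha> \<subseteq> Basis \<and> size \<alpha> \<le> k}"

text \<open>\<open>D\<^sup>\<alpha> f = g\<close> in the sense of distributions.  Partial derivatives of a test function
  commute, so all enumerations \<open>bs\<close> of \<open>\<alpha>\<close> impose the same condition.\<close>

definition is_weak_derivative ::
    "'a::euclidean_space set \<Rightarrow> 'a multiset \<Rightarrow> ('a \<Rightarrow> complex) \<Rightarrow> ('a \<Rightarrow> complex) \<Rightarrow> bool" where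
  "is_weak_derivative \<Omega> \<alpha> f g \<longleftrightarrow>
     (\<forall>bs \<phi>. mset bs = \<alpha> \<and> test_function \<Omega> \<phi> \<longrightarrow>
        (\<integral>x. g x * \<phi> x \<partial>lebesgue_on \<Omega>) =
        (-1) ^ size \<alpha> * (\<integral>x. f x * partials bs \<phi> x \<partial>lebesgue_on \<Omega>))"

definition sobolev :: "'a::euclidean_space set \<Rightarrow> nat \<Rightarrow> ('a \<Rightarrow> complex) set" where
  "sobolev \<Omega> k =
     {f \<in> L2 \<Omega>. \<forall>\<alpha>\<in>multi_indices k. \<exists>g\<in>L2 \<Omega>. is_weak_derivative \<Omega> \<alpha> f g}"

text \<open>Weak derivatives are unique up to null sets, so the norms below do not depend on
  the choice made here.\<close>

definition weak_derivative ::
    "'a::euclidean_space set \<Rightarrow> 'a multiset \<Rightarrow> ('a \<Rightarrow> complex) \<Rightarrow> 'a \<Rightarrow> complex" where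
  "weak_derivative \<Omega> \<alpha> f = (SOME g. g \<in> L2 \<Omega> \<and> is_weak_derivative \<Omega> \<alpha> f g)"

definition sobolev_norm :: "'a::euclidean_space set \<Rightarrow> nat \<Rightarrow> ('a \<Rightarrow> complex) \<Rightarrow> real" where
  "sobolev_norm \<Omega> k f =
     sqrt (\<Sum>\<alpha>\<in>multi_indices k. (L2_norm \<Omega> (weak_derivative \<Omega> \<alpha> f))\<^sup>2)"


section \<open>The Bergman projection\<close>

definition holomorphic_fun_on ::
    "(complex ^ 'n \<Rightarrow> complex) \<Rightarrow> (complex ^ 'n) set \<Rightarrow> bool" where
  "holomorphic_fun_on f \<Omega> \<longleftrightarrow>
     (\<forall>z\<in>\<Omega>. \<exists>f'. (f has_derivative f') (at z) \<and> (\<forall>c v. f' (c *s v) = c * f' v))"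

definition bergman_space :: "(complex ^ 'n) set \<Rightarrow> (complex ^ 'n \<Rightarrow> complex) set" where
  "bergman_space \<Omega> = {h \<in> L2 \<Omega>. holomorphic_fun_on h \<Omega>}"

text \<open>The projection is represented by the holomorphic function itself, extended by \<open>0\<close>
  so as to be unique.\<close>

definition bergman_projection ::
    "(complex ^ 'n) set \<Rightarrow> (complex ^ 'n \<Rightarrow> complex) \<Rightarrow> complex ^ 'n \<Rightarrow> complex" where
  "bergman_projection \<Omega> f =
     (THE h. h \<in> bergman_space \<Omega> \<and> (\<forall>z. z \<notin> \<Omega> \<longrightarrow> h z = 0) \<and>
             (\<forall>g\<in>bergman_space \<Omega>. L2_inner \<Omega> (\<lambda>z. f z - h z) g = 0))"


section \<open>Smoothly bounded domains\<close>

definition defining_function ::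
    "(complex ^ 'n) set \<Rightarrow> (complex ^ 'n \<Rightarrow> real) \<Rightarrow> bool" where
  "defining_function \<Omega> \<rho> \<longleftrightarrow>
     smooth \<rho> \<and> \<Omega> = {z. \<rho> z < 0} \<and>
     (\<forall>p\<in>frontier \<Omega>. frechet_derivative \<rho> (at p) \<noteq> (\<lambda>v. 0))"

definition smoothly_bounded_domain :: "(complex ^ 'n) set \<Rightarrow> bool" where
  "smoothly_bounded_domain \<Omega> \<longleftrightarrow>
     open \<Omega> \<and> connected \<Omega> \<and> \<Omega> \<noteq> {} \<and> bounded \<Omega> \<and> (\<exists>\<rho>. defining_function \<Omega> \<rho>)"

text \<open>The real tangent space of the boundary at \<open>p\<close>.  The differentials at \<open>p\<close> of two
  defining functions are proportional, so they have the same kernel.\<close>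

definition boundary_tangent :: "(complex ^ 'n) set \<Rightarrow> complex ^ 'n \<Rightarrow> (complex ^ 'n) set" where
  "boundary_tangent \<Omega> p =
     {v. \<forall>\<rho>. defining_function \<Omega> \<rho> \<longrightarrow> frechet_derivative \<rho> (at p) v = 0}"


section \<open>Complex vector fields\<close>

text \<open>A pair \<open>(u, v)\<close> stands for the complexified tangent vector
  \<open>\<Sum>\<^sub>j u\<^sub>j \<partial>/\<partial>z\<^sub>j + v\<^sub>j \<partial>/\<partial>z\<^sub>j\<^sup>-\<close>, where \<open>z\<^sub>j\<^sup>-\<close> is the conjugate coordinate.\<close>

type_synonym 'n cvector = "(complex ^ 'n) \<times> (complex ^ 'n)"

definition cscale :: "complex \<Rightarrow> 'n::finite cvector \<Rightarrow> 'n::finite cvector" where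
  "cscale c \<tau> = (c *s fst \<tau>, c *s snd \<tau>)"

text \<open>The embedding of a real vector \<open>x\<close>, i.e. of differentiation in direction \<open>x\<close>.\<close>

definition of_real_vector :: "complex ^ 'n \<Rightarrow> 'n::finite cvector" where
  "of_real_vector x = (x, \<chi> j. cnj (x $ j))"

definition complexified_boundary_tangent ::
    "(complex ^ 'n) set \<Rightarrow> complex ^ 'n \<Rightarrow> 'n::finite cvector set" where
  "complexified_boundary_tangent \<Omega> p =
     {of_real_vector x + cscale \<i> (of_real_vector y) | x y.
        x \<in> boundary_tangent \<Omega> p \<and> y \<in> boundary_tangent \<Omega> p}"

definition T10_boundary :: "(complex ^ 'n) set \<Rightarrow> complex ^ 'n \<Rightarrow> 'n::finite cvector set" where
  "T10_boundary \<Omega> p = {\<tau> \<in> complexified_boundary_tangent \<Omega> p. snd \<tau> = 0}"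

definition T01_boundary :: "(complex ^ 'n) set \<Rightarrow> complex ^ 'n \<Rightarrow> 'n::finite cvector set" where
  "T01_boundary \<Omega> p = {\<tau> \<in> complexified_boundary_tangent \<Omega> p. fst \<tau> = 0}"

definition tangential :: "(complex ^ 'n) set \<Rightarrow> (complex ^ 'n \<Rightarrow> 'n::finite cvector) \<Rightarrow> bool" where
  "tangential \<Omega> T \<longleftrightarrow> (\<forall>p\<in>frontier \<Omega>. T p \<in> complexified_boundary_tangent \<Omega> p)"

definition complex_transversal ::
    "(complex ^ 'n) set \<Rightarrow> (complex ^ 'n \<Rightarrow> 'n::finite cvector) \<Rightarrow> bool" where
  "complex_transversal \<Omega> T \<longleftrightarrow>
     (\<forall>p\<in>frontier \<Omega>. T p \<notin> {\<sigma> + \<tau> | \<sigma> \<tau>. \<sigma> \<in> T10_boundary \<Omega> p \<and> \<tau> \<in> T01_boundary \<Omega> p})"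

definition wirtinger :: "'n \<Rightarrow> (complex ^ 'n \<Rightarrow> complex) \<Rightarrow> complex ^ 'n \<Rightarrow> complex" where
  "wirtinger j f z =
     (frechet_derivative f (at z) (axis j 1) - \<i> * frechet_derivative f (at z) (axis j \<i>)) / 2"

definition wirtinger_bar :: "'n \<Rightarrow> (complex ^ 'n \<Rightarrow> complex) \<Rightarrow> complex ^ 'n \<Rightarrow> complex" where
  "wirtinger_bar j f z =
     (frechet_derivative f (at z) (axis j 1) + \<i> * frechet_derivative f (at z) (axis j \<i>)) / 2"

text \<open>The formal transpose of \<open>T\<close>: \<open>\<integral> (T f) \<phi> = \<integral> f (T\<^sup>t \<phi>)\<close> for smooth \<open>f\<close>
  and test functions \<open>\<phi>\<close>.\<close>

definition transpose_field ::
    "(complex ^ 'n \<Rightarrow> 'n::finite cvector) \<Rightarrow> (complex ^ 'n \<Rightarrow> complex) \<Rightarrow> complex ^ 'n \<Rightarrow> complex" where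
  "transpose_field T \<phi> z =
     - (\<Sum>j\<in>UNIV. wirtinger j (\<lambda>w. fst (T w) $ j * \<phi> w) z +
                   wirtinger_bar j (\<lambda>w. snd (T w) $ j * \<phi> w) z)"

text \<open>\<open>T\<^sup>m f = g\<close> in the sense of distributions.\<close>

definition is_weak_field_power ::
    "(complex ^ 'n) set \<Rightarrow> (complex ^ 'n \<Rightarrow> 'n::finite cvector) \<Rightarrow> nat \<Rightarrow>
     (complex ^ 'n \<Rightarrow> complex) \<Rightarrow> (complex ^ 'n \<Rightarrow> complex) \<Rightarrow> bool" where
  "is_weak_field_power \<Omega> T m f g \<longleftrightarrow>
     (\<forall>\<phi>. test_function \<Omega> \<phi> \<longrightarrow>
        (\<integral>x. g x * \<phi> x \<partial>lebesgue_on \<Omega>) =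
        (\<integral>x. f x * (transpose_field T ^^ m) \<phi> x \<partial>lebesgue_on \<Omega>))"

definition weak_field_power ::
    "(complex ^ 'n) set \<Rightarrow> (complex ^ 'n \<Rightarrow> 'n::finite cvector) \<Rightarrow> nat \<Rightarrow>
     (complex ^ 'n \<Rightarrow> complex) \<Rightarrow> complex ^ 'n \<Rightarrow> complex" where
  "weak_field_power \<Omega> T m f = (SOME g. g \<in> L2 \<Omega> \<and> is_weak_field_power \<Omega> T m f g)"

definition sobolev_field ::
    "(complex ^ 'n) set \<Rightarrow> (complex ^ 'n \<Rightarrow> 'n::finite cvector) \<Rightarrow> nat \<Rightarrow>
     (complex ^ 'n \<Rightarrow> complex) set" where
  "sobolev_field \<Omega> T k =
     {f \<in> L2 \<Omega>. \<forall>m\<in>{1..k}. \<exists>g\<in>L2 \<Omega>. is_weak_field_power \<Omega> T m f g}"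

definition sobolev_field_norm ::
    "(complex ^ 'n) set \<Rightarrow> (complex ^ 'n \<Rightarrow> 'n::finite cvector) \<Rightarrow> nat \<Rightarrow>
     (complex ^ 'n \<Rightarrow> complex) \<Rightarrow> real" where
  "sobolev_field_norm \<Omega> T k f =
     sqrt (\<Sum>m=0..k. (L2_norm \<Omega> (weak_field_power \<Omega> T m f))\<^sup>2)"

end

theory Submission imports Defs "HOL-Complex_Analysis.Complex_Analysis" begin

text \<open>The estimate rests on one inequality: for \<open>g \<in> H\<^sup>k\<^sub>T\<close>, \<open>k = k\<^sub>1\<close>, and \<open>H\<close> holomorphic and square
integrable,

  \<open>\<bar>(g, H)\<bar> \<le> C \<parallel>g\<parallel>\<^sub>k\<^sub>,\<^sub>T \<parallel>r\<^sup>k H\<parallel>\<close>   (\<open>key_estimate\<close>),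

where \<open>r = - \<rho>\<close> is comparable to the distance from the boundary. Pairing with a holomorphic function
therefore turns derivatives along \<open>T\<close> into powers of that distance, although \<open>T\<close> is tangential.

Why it holds. Write \<open>T\<close> as the pair \<open>(u, v)\<close> and put \<open>\<kappa> = \<Sum>\<^sub>j v\<^sub>j \<partial>\<rho> / \<partial>z\<^sub>j\<^sup>-\<close>. A tangential field
annihilates \<open>\<rho>\<close>, so if \<open>\<kappa>\<close> vanished at a boundary point, both parts of \<open>T\<close> would be tangential
there; complex transversality excludes this. With \<open>\<gamma> = - cnj \<kappa>\<close> the vector field
\<open>w\<^sub>j = cnj (\<gamma> v\<^sub>j)\<close> has \<open>d\<rho>(w) = - 2 \<bar>\<kappa>\<bar>^2 < 0\<close> on the boundary and points inwards. Shift \<open>H\<close> along it: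
\<open>\<Phi>\<^sub>s(z) = cnj (H (z + s w(z)))\<close>. The function \<open>cnj H\<close> is antiholomorphic, so only the part \<open>v\<close> of \<open>T\<close> acts
on it, and

  \<open>\<gamma> T \<Phi>\<^sub>s = \<partial>\<Phi>\<^sub>s / \<partial>s + s \<Sum>\<^sub>l \<gamma> T(cnj w\<^sub>l) cnj (\<partial>\<^sub>l H (z + s w(z)))\<close>.

Differentiation in the inward parameter \<open>s\<close> is differentiation along \<open>T\<close>, up to terms in which \<open>H\<close>
gains a derivative together with a factor \<open>s\<close>, and for holomorphic \<open>H\<close> one derivative costs one
power of the distance (\<open>derivative_wmass\<close>). Integrating \<open>k\<close> times by parts in \<open>s\<close>, and each time moving
\<open>T\<close> onto \<open>g\<close>, leaves integrals \<open>\<integral> s\<^sup>j (T\<^sup>i g, \<Phi>\<^sub>s) ds\<close> with \<open>j = k - 1\<close> for \<open>H\<close> itself, and one more power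
of \<open>s\<close> for each derivative of \<open>H\<close>. A Hardy inequality bounds them by \<open>\<parallel>T\<^sup>i g\<parallel> \<parallel>r\<^sup>k H\<parallel>\<close>
(\<open>hardy_inequality\<close>, \<open>moment_estimate\<close>).

From there duality takes over. Let \<open>\<Phi>\<close> be a conjugated derivative of order at most \<open>k\<^sub>2\<close> of a test
function \<open>\<phi>\<close>, and \<open>H = B \<Phi>\<close>. Since \<open>r\<^sup>2\<^sup>k H\<close> has \<open>k\<close> derivatives in \<open>L\<^sup>2\<close> with norms bounded by a
multiple of \<open>\<parallel>r\<^sup>k H\<parallel>\<close> (\<open>weighted_sobolev\<close>), the hypothesis on \<open>B\<close> gives

  \<open>\<parallel>r\<^sup>k H\<parallel>^2 = (H, r\<^sup>2\<^sup>k H) = (\<Phi>, B (r\<^sup>2\<^sup>k H)) \<le> C \<parallel>\<phi>\<parallel> \<parallel>r\<^sup>k H\<parallel>\<close>.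

So \<open>\<parallel>r\<^sup>k H\<parallel> \<le> C \<parallel>\<phi>\<parallel>\<close>, and \<open>\<bar>(B g, \<Phi>)\<bar> = \<bar>(g, H)\<bar> \<le> C \<parallel>g\<parallel>\<^sub>k\<^sub>,\<^sub>T \<parallel>\<phi>\<parallel>\<close>. This says that the derivatives of
\<open>B g\<close> are bounded functionals on test functions, hence square integrable.\<close>

abbreviation der :: "('a::euclidean_space => 'b::real_normed_vector) => 'a => 'a => 'b" where
 "der f x \<equiv> frechet_derivative f (at x)"

lemma AE_domainI: "(\<And>z. z \<in> \<Omega> ==> P z) ==> AE z in lebesgue_on \<Omega>. P z"
 by (rule AE_I2) (simp add: space_restrict_space)

lemma nn_integral_domain_mono:
 "(\<And>z. z \<in> \<Omega> ==> f z \<le> g z) ==> (\<integral>\<^sup>+z. f z \<partial>lebesgue_on \<Omega>) \<le> (\<integral>\<^sup>+z. g z \<partial>lebesgue_on \<Omega>)"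
 by (rule nn_integral_mono) (simp add: space_restrict_space)

section \<open>Smooth functions on open sets\<close>

definition smooth_on :: "'a::euclidean_space set => ('a => 'b::real_normed_vector) => bool" where
 "smooth_on S f \<longleftrightarrow> (\<forall>bs. set bs \<subseteq> Basis --> (\<forall>x\<in>S. partials bs f differentiable at x))"

lemma smooth_iff: "smooth f \<longleftrightarrow> smooth_on UNIV f"
 by (simp add: smooth_def smooth_on_def)

lemma partials_append: "partials (xs @ ys) f = partials xs (partials ys f)"
 by (induction xs) auto

lemma frechet_derivative_cong_open:
 assumes "open S" "x \<in> S" "\<And>y. y \<in> S ==> f y = g y"
 shows "der f x = der g x"
proof -
 have "(f has_derivative F) (at x) \<longleftrightarrow> (g has_derivative F) (at x)" for F
  using has_derivative_transform_within_open[of f F x UNIV S g]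
   has_derivative_transform_within_open[of g F x UNIV S f] assms by auto
 then show ?thesis by (simp add: frechet_derivative_def)
qed

lemma differentiable_cong_open:
 assumes "open S" "x \<in> S" "\<And>y. y \<in> S ==> f y = g y" "f differentiable at x"
 shows "g differentiable at x"
 using assms has_derivative_transform_within_open[of f _ x UNIV S g]
 unfolding differentiable_def by blast

lemma partials_cong:
 assumes "open S" "\<And>y. y \<in> S ==> f y = g y" "x \<in> S"
 shows "partials bs f x = partials bs g x"
 using assms(3)
proof (induction bs arbitrary: x)
 case (Cons b bs)
 have "der (partials bs f) x = der (partials bs g) x"
  by (rule frechet_derivative_cong_open[OF assms(1) Cons.prems]) (rule Cons.IH)
 then show ?case by simp
qed (use assms in auto)

lemma smooth_on_cong:
 assumes "open S" "smooth_on S f" "\<And>y. y \<in> S ==> f y = g y"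
 shows "smooth_on S g"
 unfolding smooth_on_def
proof (intro allI impI ballI)
 fix bs :: "'a list" and x assume bs: "set bs \<subseteq> Basis" and x: "x \<in> S"
 show "partials bs g differentiable at x"
  by (rule differentiable_cong_open[OF assms(1) x, of "partials bs f"])
   (use assms partials_cong[of S f g] bs x in \<open>auto simp: smooth_on_def\<close>)
qed

lemma smooth_on_subset: "smooth_on S f ==> R \<subseteq> S ==> smooth_on R f"
 unfolding smooth_on_def by blast

lemma smooth_on_Un: "smooth_on S f ==> smooth_on R f ==> smooth_on (S \<union> R) f"
 unfolding smooth_on_def by blast

lemma smooth_imp_smooth_on: "smooth f ==> smooth_on S f"
 unfolding smooth_on_def smooth_def by blast

text \<open>Closure of \<open>smooth_on\<close> under composition and products is not provable by induction on lists of
directions, since a derivative of such an expression is a sum of expressions of the same kind. Counting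
derivatives makes the induction possible; \<open>smooth_on_iff_Ck\<close> is the bridge.\<close>

primrec Ck :: "nat => 'a::euclidean_space set => ('a => 'b::real_normed_vector) => bool" where
 "Ck 0 S f \<longleftrightarrow> (\<forall>x\<in>S. f differentiable at x)"
| "Ck (Suc n) S f \<longleftrightarrow> (\<forall>x\<in>S. f differentiable at x) \<and>
   (\<forall>b\<in>Basis. Ck n S (\<lambda>x. der f x b))"

lemma Ck_iff_partials:
 "Ck n S f \<longleftrightarrow> (\<forall>bs. set bs \<subseteq> Basis \<and> length bs \<le> n --> (\<forall>x\<in>S. partials bs f differentiable at x))"
proof (induction n arbitrary: f)
 case (Suc n)
 show ?case
 proof
  assume L: "Ck (Suc n) S f"
  show "\<forall>bs. set bs \<subseteq> Basis \<and> length bs \<le> Suc n --> (\<forall>x\<in>S. partials bs f differentiable at x)"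
  proof (intro allI impI ballI)
   fix bs :: "'a list" and x assume bs: "set bs \<subseteq> Basis \<and> length bs \<le> Suc n" and x: "x \<in> S"
   show "partials bs f differentiable at x"
   proof (cases bs rule: rev_cases)
    case Nil then show ?thesis using L x by simp
   next
    case (snoc ys y)
    then show ?thesis using L x bs Suc[of "\<lambda>x. der f x y"]
     by (simp add: partials_append)
   qed
  qed
 next
  assume R: "\<forall>bs. set bs \<subseteq> Basis \<and> length bs \<le> Suc n --> (\<forall>x\<in>S. partials bs f differentiable at x)"
  have "f differentiable at x" if "x \<in> S" for x
   using R[rule_format, of "[]" x] that by simp
  moreover have "Ck n S (\<lambda>x. der f x b)" if b: "b \<in> Basis" for b
  proof -
   have "partials bs (\<lambda>x. der f x b) differentiable at x"
    if "set bs \<subseteq> Basis \<and> length bs \<le> n" "x \<in> S" for bs x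
    using R[rule_format, of "bs @ [b]" x] that b by (simp add: partials_append)
   then show ?thesis using Suc[of "\<lambda>x. der f x b"] by blast
  qed
  ultimately show "Ck (Suc n) S f" by simp
 qed
qed simp

lemma smooth_on_iff_Ck: "smooth_on S f \<longleftrightarrow> (\<forall>n. Ck n S f)"
 unfolding smooth_on_def Ck_iff_partials by blast

lemma Ck_differentiable: "Ck n S f ==> x \<in> S ==> f differentiable at x"
 by (cases n) auto

lemma Ck_Suc_imp: "Ck (Suc n) S f ==> Ck n S f"
 unfolding Ck_iff_partials by auto

lemma Ck_cong:
 assumes "open S" "Ck n S f" "\<And>y. y \<in> S ==> f y = g y"
 shows "Ck n S g"
 unfolding Ck_iff_partials
proof (intro allI impI ballI)
 fix bs :: "'a list" and x assume bs: "set bs \<subseteq> Basis \<and> length bs \<le> n" and x: "x \<in> S"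
 show "partials bs g differentiable at x"
  by (rule differentiable_cong_open[OF assms(1) x, of "partials bs f"])
   (use assms partials_cong[of S f g] bs x in \<open>auto simp: Ck_iff_partials\<close>)
qed

lemma Ck_const: "Ck n S (\<lambda>x. c)"
 by (induction n arbitrary: c) auto

lemma Ck_linear:
 assumes L: "bounded_linear L" and S: "open S"
 shows "Ck n S f ==> Ck n S (\<lambda>x. L (f x))"
proof (induction n arbitrary: f)
 case 0
 then show ?case unfolding Ck.simps
  using differentiableI[OF bounded_linear.has_derivative[OF L]] by (metis differentiable_def)
next
 case (Suc n)
 have D: "((\<lambda>x. L (f x)) has_derivative (\<lambda>v. L (der f x v))) (at x)" if "x \<in> S" for x
  using Suc.prems that L
  by (intro bounded_linear.has_derivative[OF L]) (simp add: frechet_derivative_works[symmetric])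
 have "Ck n S (\<lambda>x. der (\<lambda>x. L (f x)) x b)" if b: "b \<in> Basis" for b
 proof (rule Ck_cong[OF S])
  show "Ck n S (\<lambda>x. L (der f x b))"
   using Suc b by simp
  show "L (der f y b) = der (\<lambda>x. L (f x)) y b" if "y \<in> S" for y
   using fun_cong[OF frechet_derivative_at[OF D[OF that]], of b] by simp
 qed
 then show ?case using differentiableI[OF D] by simp
qed

lemma Ck_add:
 assumes S: "open S"
 shows "Ck n S f ==> Ck n S g ==> Ck n S (\<lambda>x. f x + g x)"
proof (induction n arbitrary: f g)
 case (Suc n)
 have D: "((\<lambda>x. f x + g x) has_derivative (\<lambda>v. der f x v + der g x v)) (at x)"
  if "x \<in> S" for x
  using Suc.prems that
  by (intro has_derivative_add) (simp_all add: frechet_derivative_works[symmetric])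
 have "Ck n S (\<lambda>x. der (\<lambda>x. f x + g x) x b)" if b: "b \<in> Basis" for b
 proof (rule Ck_cong[OF S])
  show "Ck n S (\<lambda>x. der f x b + der g x b)"
   using Suc b by simp
  show "der f y b + der g y b
    = der (\<lambda>x. f x + g x) y b" if "y \<in> S" for y
   using fun_cong[OF frechet_derivative_at[OF D[OF that]], of b] by simp
 qed
 then show ?case using differentiableI[OF D] by simp
qed auto

lemma Ck_sum:
 assumes S: "open S" and "\<And>i. i \<in> I ==> Ck n S (f i)"
 shows "Ck n S (\<lambda>x. \<Sum>i\<in>I. f i x)"
 using assms(2)
 by (induction I rule: infinite_finite_induct) (auto intro: Ck_add[OF S] Ck_const)

lemma Ck_bilinear:
 assumes B: "bounded_bilinear B" and S: "open S"
 shows "Ck n S f ==> Ck n S g ==> Ck n S (\<lambda>x. B (f x) (g x))"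
proof (induction n arbitrary: f g)
 case 0
 show ?case unfolding Ck.simps
 proof
  fix x assume "x \<in> S"
  then have "(f has_derivative der f x) (at x)"
    "(g has_derivative der g x) (at x)"
   using 0 by (simp_all add: frechet_derivative_works[symmetric])
  from bounded_bilinear.FDERIV[OF B this]
  show "(\<lambda>x. B (f x) (g x)) differentiable at x"
   by (rule differentiableI)
 qed
next
 case (Suc n)
 have D: "((\<lambda>x. B (f x) (g x)) has_derivative
   (\<lambda>v. B (f x) (der g x v) + B (der f x v) (g x))) (at x)"
  if "x \<in> S" for x
  using Suc.prems that
  by (intro bounded_bilinear.FDERIV[OF B]) (simp_all add: frechet_derivative_works[symmetric])
 have "Ck n S (\<lambda>x. der (\<lambda>x. B (f x) (g x)) x b)" if b: "b \<in> Basis" for b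
 proof (rule Ck_cong[OF S])
  show "Ck n S (\<lambda>x. B (f x) (der g x b) + B (der f x b) (g x))"
   using Suc.prems b Ck_Suc_imp[OF Suc.prems(1)] Ck_Suc_imp[OF Suc.prems(2)] by (intro Ck_add[OF S] Suc.IH) simp_all
  show "B (f y) (der g y b) + B (der f y b) (g y)
    = der (\<lambda>x. B (f x) (g x)) y b" if "y \<in> S" for y
   using fun_cong[OF frechet_derivative_at[OF D[OF that]], of b] by simp
 qed
 then show ?case using differentiableI[OF D] by simp
qed

lemma frechet_derivative_eq_sum_Basis:
 fixes f :: "'a::euclidean_space => 'b::real_normed_vector"
 assumes "f differentiable at x"
 shows "der f x v = (\<Sum>b\<in>Basis. (v \<bullet> b) *\<^sub>R der f x b)"
proof -
 interpret L: linear "der f x"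
  using linear_frechet_derivative[OF assms] .
 have "der f x v = der f x (\<Sum>b\<in>Basis. (v \<bullet> b) *\<^sub>R b)"
  by (simp add: euclidean_representation)
 also have "\<dots> = (\<Sum>b\<in>Basis. (v \<bullet> b) *\<^sub>R der f x b)"
  by (simp add: L.sum L.scale)
 finally show ?thesis .
qed

lemma Ck_compose:
 fixes f :: "'b::euclidean_space => 'c::real_normed_vector" and g :: "'a::euclidean_space => 'b"
 assumes S: "open S" and gS: "g ` S \<subseteq> U"
 shows "Ck n U f ==> Ck n S g ==> Ck n S (\<lambda>x. f (g x))"
proof (induction n arbitrary: f)
 case 0
 then show ?case unfolding Ck.simps
  using differentiable_chain_at[of g _ f, unfolded o_def] gS by (metis image_subset_iff)
next
 case (Suc n)
 have fd: "f differentiable at (g x)" and gd: "g differentiable at x" if "x \<in> S" for x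
  using Suc.prems that gS by auto
 have D: "((\<lambda>x. f (g x)) has_derivative (\<lambda>v. der f (g x) (der g x v))) (at x)"
  if "x \<in> S" for x
  using diff_chain_at[of g _ x f, unfolded o_def] fd[OF that] gd[OF that]
  by (simp add: frechet_derivative_works)
 have "Ck n S (\<lambda>x. der (\<lambda>x. f (g x)) x b)" if b: "b \<in> Basis" for b
 proof (rule Ck_cong[OF S])
  show "Ck n S (\<lambda>x. \<Sum>c\<in>Basis. (der g x b \<bullet> c) *\<^sub>R der f (g x) c)"
  proof (intro Ck_sum[OF S] Ck_bilinear[OF bounded_bilinear_scaleR S])
   fix c :: 'b assume c: "c \<in> Basis"
   show "Ck n S (\<lambda>x. der g x b \<bullet> c)"
    using Suc.prems b by (intro Ck_linear[OF bounded_linear_inner_left S]) simp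
   show "Ck n S (\<lambda>x. der f (g x) c)"
    using Suc.prems c Ck_Suc_imp[OF Suc.prems(2)] by (intro Suc.IH) simp_all
  qed
  show "(\<Sum>c\<in>Basis. (der g y b \<bullet> c) *\<^sub>R der f (g y) c)
    = der (\<lambda>x. f (g x)) y b" if "y \<in> S" for y
   using fun_cong[OF frechet_derivative_at[OF D[OF that]], of b]
    frechet_derivative_eq_sum_Basis[OF fd[OF that], of "der g y b"] by simp
 qed
 then show ?case using differentiableI[OF D] by simp
qed

lemma Ck_id: "Ck n S (\<lambda>x. x)"
proof (cases n)
 case (Suc m)
 have "der (\<lambda>x. x) x = (\<lambda>v. v)" for x :: 'a
  using frechet_derivative_at[OF has_derivative_ident, of x] by simp
 then show ?thesis using Suc by (simp add: Ck_const)
qed simp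

lemma smooth_on_const [simp]: "smooth_on S (\<lambda>x. c)"
 by (simp add: smooth_on_iff_Ck Ck_const)
lemma smooth_on_id [simp]: "smooth_on S (\<lambda>x. x)"
 by (simp add: smooth_on_iff_Ck Ck_id)
lemma smooth_on_linear: "bounded_linear L ==> open S ==> smooth_on S f ==> smooth_on S (\<lambda>x. L (f x))"
 by (simp add: smooth_on_iff_Ck Ck_linear)
lemma smooth_on_add: "open S ==> smooth_on S f ==> smooth_on S g ==> smooth_on S (\<lambda>x. f x + g x)"
 by (simp add: smooth_on_iff_Ck Ck_add)
lemma smooth_on_sum: "open S ==> (\<And>i. i \<in> I ==> smooth_on S (f i)) ==> smooth_on S (\<lambda>x. \<Sum>i\<in>I. f i x)"
 by (simp add: smooth_on_iff_Ck Ck_sum)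
lemma smooth_on_bilinear:
 "bounded_bilinear B ==> open S ==> smooth_on S f ==> smooth_on S g ==> smooth_on S (\<lambda>x. B (f x) (g x))"
 by (simp add: smooth_on_iff_Ck Ck_bilinear)
lemma smooth_on_compose:
 "open S ==> g ` S \<subseteq> U ==> smooth_on U f ==> smooth_on S g ==> smooth_on S (\<lambda>x. f (g x))"
 by (simp add: smooth_on_iff_Ck Ck_compose)

lemmas smooth_on_mult = smooth_on_bilinear[OF bounded_bilinear_mult]
lemmas smooth_on_scaleR = smooth_on_bilinear[OF bounded_bilinear_scaleR]
lemmas smooth_on_of_real = smooth_on_linear[OF bounded_linear_of_real]
lemmas smooth_on_cnj = smooth_on_linear[OF bounded_linear_cnj]
lemmas smooth_on_minus = smooth_on_linear[OF bounded_linear_minus[OF bounded_linear_ident]]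

lemma smooth_on_diff: "open S ==> smooth_on S f ==> smooth_on S g ==> smooth_on S (\<lambda>x. f x - g x)"
 using smooth_on_add[of S f "\<lambda>x. - g x"] smooth_on_minus[of S g] by simp

lemma smooth_on_power:
 fixes f :: "'a::euclidean_space => 'b::real_normed_field"
 shows "open S ==> smooth_on S f ==> smooth_on S (\<lambda>x. f x ^ n)"
 by (induction n) (auto intro: smooth_on_mult)

lemma smooth_on_prod:
 fixes f :: "'i => 'a::euclidean_space => 'b::real_normed_field"
 assumes "open S" "\<And>i. i \<in> I ==> smooth_on S (f i)"
 shows "smooth_on S (\<lambda>x. \<Prod>i\<in>I. f i x)"
 using assms(2) by (induction I rule: infinite_finite_induct) (auto intro: smooth_on_mult assms(1))

lemma smooth_on_differentiable: "smooth_on S f ==> x \<in> S ==> f differentiable at x"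
 unfolding smooth_on_def by (drule spec[of _ "[]"]) simp

lemma smooth_on_has_derivative:
 "smooth_on S f ==> x \<in> S ==> (f has_derivative der f x) (at x)"
 using smooth_on_differentiable frechet_derivative_works by blast

lemma smooth_on_continuous_on: "smooth_on S f ==> continuous_on S f"
 by (meson continuous_at_imp_continuous_on differentiable_imp_continuous_within smooth_on_differentiable)

lemma smooth_on_partials:
 "smooth_on S f ==> set bs \<subseteq> Basis ==> smooth_on S (partials bs f)"
 unfolding smooth_on_def by (metis le_sup_iff partials_append set_append)

lemma smooth_on_deriv_Basis:
 assumes "smooth_on S f" "b \<in> Basis" shows "smooth_on S (\<lambda>x. der f x b)"
 using smooth_on_partials[OF assms(1), of "[b]"] assms(2) by simp

lemma smooth_on_deriv:
 assumes S: "open S" and f: "smooth_on S f" and X: "smooth_on S X"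
 shows "smooth_on S (\<lambda>x. der f x (X x))"
proof (rule smooth_on_cong[OF S])
 show "smooth_on S (\<lambda>x. \<Sum>b\<in>Basis. (X x \<bullet> b) *\<^sub>R der f x b)"
  by (intro smooth_on_sum smooth_on_scaleR S smooth_on_deriv_Basis f smooth_on_linear[OF bounded_linear_inner_left] X)
qed (use frechet_derivative_eq_sum_Basis[OF smooth_on_differentiable[OF f]] in simp)

text \<open>The two smooth pieces overlap in the open set \<open>U - K\<close>.\<close>

lemma smooth_extend_zero:
 assumes U: "open U" "smooth_on U f" and K: "closed K" "K \<subseteq> U" and z: "\<And>x. x \<notin> K ==> f x = 0"
 shows "smooth f"
proof -
 have "smooth_on (-K) f"
  by (rule smooth_on_cong[of _ "\<lambda>x. 0"]) (use K z in auto)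
 then have "smooth_on (U \<union> -K) f" using U smooth_on_Un by blast
 moreover have "U \<union> -K = UNIV" using K by auto
 ultimately show ?thesis by (simp add: smooth_iff)
qed

section \<open>A smooth transition function\<close>

text \<open>The standard function that is flat at \<open>0\<close>: all cut-offs below are built from it.\<close>

definition flat :: "real => real" where
 "flat t = (if t > 0 then exp (- 1 / t) else 0)"

text \<open>All derivatives of \<open>flat\<close> have this form, which makes their smoothness an induction.\<close>

definition flat_poly :: "real poly => real => real" where
 "flat_poly p t = (if t > 0 then poly p (1 / t) * exp (- 1 / t) else 0)"

lemma poly_mult_exp_minus_tendsto_0: "((\<lambda>x. poly p x * exp (- x)) \<longlongrightarrow> (0::real)) at_top"
proof -
 have "((\<lambda>x. \<Sum>i\<le>degree p. coeff p i * (x ^ i / exp x)) \<longlongrightarrow> (\<Sum>i\<le>degree p. coeff p i * 0)) at_top"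
  by (intro tendsto_intros tendsto_power_div_exp_0)
 moreover have "(\<Sum>i\<le>degree p. coeff p i * (x ^ i / exp x)) = poly p x * exp (- x)" for x :: real
  by (simp add: poly_altdef sum_distrib_right exp_minus divide_inverse mult.assoc)
 ultimately show ?thesis by simp
qed

text \<open>At \<open>0\<close> the difference quotient tends to \<open>0\<close> because \<open>exp\<close> beats every
polynomial in \<open>1 / t\<close>.\<close>

lemma flat_poly_has_derivative:
 "(flat_poly p has_real_derivative flat_poly ([:0, 0, 1:] * (p - pderiv p)) t) (at t)"
proof (cases "t = 0")
 case True
 have "((\<lambda>x. poly ([:0,1:] * p) x * exp (- x)) \<longlongrightarrow> (0::real)) at_top"
  by (rule poly_mult_exp_minus_tendsto_0)
 then have "((\<lambda>h. poly ([:0,1:] * p) (inverse h) * exp (- inverse h)) \<longlongrightarrow> (0::real)) (at_right 0)"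
  by (rule filterlim_compose) (rule filterlim_inverse_at_top_right)
 moreover have "\<forall>\<^sub>F h in at_right 0. poly ([:0,1:] * p) (inverse h) * exp (- inverse h)
   = (flat_poly p (0 + h) - flat_poly p 0) / h"
  by (auto simp: eventually_at_filter flat_poly_def field_simps)
 ultimately have R: "((\<lambda>h. (flat_poly p (0 + h) - flat_poly p 0) / h) \<longlongrightarrow> 0) (at_right 0)"
  by (rule Lim_transform_eventually)
 have "\<forall>\<^sub>F h in at_left 0. 0 = (flat_poly p (0 + h) - flat_poly p 0) / h"
  by (auto simp: eventually_at_filter flat_poly_def)
 then have L: "((\<lambda>h. (flat_poly p (0 + h) - flat_poly p 0) / h) \<longlongrightarrow> 0) (at_left 0)"
  by (rule Lim_transform_eventually[OF tendsto_const])
 have "((\<lambda>h. (flat_poly p (0 + h) - flat_poly p 0) / h) \<longlongrightarrow> 0) (at 0)"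
  using L R by (simp add: filterlim_at_split)
 then show ?thesis using True by (simp add: DERIV_def flat_poly_def)
next
 case False
 show ?thesis
 proof (cases "t > 0")
  case True
  have "((\<lambda>t. poly p (1 / t) * exp (- 1 / t)) has_real_derivative
    (poly (pderiv p) (1 / t) * (- 1 / t^2)) * exp (- 1 / t) + (exp (- 1 / t) * (1 / t^2)) * poly p (1 / t)) (at t)"
   using True
   by (auto intro!: derivative_eq_intros DERIV_chain2[OF poly_DERIV] simp: power2_eq_square)
  then have "(flat_poly p has_real_derivative
    (poly (pderiv p) (1 / t) * (- 1 / t^2)) * exp (- 1 / t) + (exp (- 1 / t) * (1 / t^2)) * poly p (1 / t)) (at t)"
   by (rule has_field_derivative_transform_within_open[of _ _ _ "{0<..}"]) (use True in \<open>auto simp: flat_poly_def\<close>)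
  moreover have "(poly (pderiv p) (1 / t) * (- 1 / t^2)) * exp (- 1 / t) + (exp (- 1 / t) * (1 / t^2)) * poly p (1 / t)
    = flat_poly ([:0, 0, 1:] * (p - pderiv p)) t"
   using True by (simp add: flat_poly_def field_simps power2_eq_square)
  ultimately show ?thesis by simp
 next
  case F: False
  have "((\<lambda>t. 0) has_real_derivative 0) (at t)" by simp
  then have "(flat_poly p has_real_derivative 0) (at t)"
   by (rule has_field_derivative_transform_within_open[of _ _ _ "{..<0}"])
    (use F False in \<open>auto simp: flat_poly_def\<close>)
  then show ?thesis using F by (simp add: flat_poly_def)
 qed
qed

lemma smooth_flat_poly: "smooth (flat_poly p)"
proof -
 have "Ck n UNIV (flat_poly p)" for n
 proof (induction n arbitrary: p)
  case 0
  show ?case using flat_poly_has_derivative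
   by (auto simp: has_field_derivative_def intro: differentiableI)
 next
  case (Suc n)
  have "der (flat_poly p) t = (\<lambda>h. flat_poly ([:0, 0, 1:] * (p - pderiv p)) t * h)" for t
   using frechet_derivative_at[OF flat_poly_has_derivative[unfolded has_field_derivative_def]] by simp
  then show ?case using Suc[of "[:0, 0, 1:] * (p - pderiv p)"] Suc[of p] Ck_differentiable[OF Suc[of p]] by simp
 qed
 then show ?thesis by (simp add: smooth_iff smooth_on_iff_Ck)
qed

lemma flat_eq_flat_poly: "flat = flat_poly 1"
 by (auto simp: flat_def flat_poly_def)

lemma smooth_flat: "smooth flat"
 by (simp add: flat_eq_flat_poly smooth_flat_poly)

definition flat' :: "real => real" where
 "flat' t = (if t > 0 then exp (- 1 / t) / t^2 else 0)"

lemma flat_has_derivative: "(flat has_real_derivative flat' t) (at t)"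
proof -
 have "flat_poly ([:0, 0, 1:] * (1 - pderiv 1)) t = flat' t"
  by (simp add: flat_poly_def flat'_def power2_eq_square)
 then show ?thesis using flat_poly_has_derivative[of 1 t] by (simp add: flat_eq_flat_poly)
qed

lemma flat_nonneg: "0 \<le> flat t" and flat_le_1: "flat t \<le> 1" and flat_pos: "t > 0 ==> 0 < flat t"
 by (auto simp: flat_def)

lemma flat_zero: "t \<le> 0 ==> flat t = 0" by (simp add: flat_def)

lemma flat_tendsto_1: "(flat \<longlongrightarrow> 1) at_top"
proof -
 have "((\<lambda>t::real. exp (- inverse t)) \<longlongrightarrow> exp (- 0)) at_top"
  by (intro tendsto_intros tendsto_inverse_0_at_top filterlim_ident)
 moreover have "\<forall>\<^sub>F t in at_top. exp (- inverse t) = flat t"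
  using eventually_gt_at_top[of 0] by eventually_elim (simp add: flat_def inverse_eq_divide)
 ultimately show ?thesis by (simp add: Lim_transform_eventually)
qed

lemma flat'_nonneg: "0 \<le> flat' t" by (simp add: flat'_def)

text \<open>Bounding \<open>(t + 1) flat' t\<close>, and not just the derivative, makes derivatives of \<open>flat (m r -
1)\<close> bounded uniformly in \<open>m\<close> along fields \<open>T\<close> with \<open>T r = O(r)\<close>:
there \<open>m r = t + 1\<close>.\<close>

lemma flat'_bound: "(t + 1) * flat' t \<le> 2"
proof (cases "t > 0")
 case True
 define x where "x = 1 / t"
 have x: "x > 0" using True by (simp add: x_def)
 have "1 + x + x^2 / 2 \<le> exp x" using exp_lower_Taylor_quadratic[of x] x by simp
 then have "x + x^2 \<le> 2 * exp x" using x by (simp add: field_simps)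
 then have "(x + x^2) * exp (- x) \<le> 2" by (simp add: exp_minus field_simps)
 moreover have "(t + 1) * flat' t = (x + x^2) * exp (- x)"
  using True by (simp add: flat'_def x_def field_simps power2_eq_square)
 ultimately show ?thesis by simp
qed (auto simp: flat'_def)

text \<open>The decay shows that these derivatives even tend to \<open>0\<close> at every point as \<open>m\<close> grows.\<close>

lemma flat'_bound2: "t > 0 ==> (t + 1) * flat' t \<le> 1 / t + (1 / t)^2"
proof -
 assume t: "t > 0"
 have "(t + 1) * flat' t = (1 / t + (1 / t)^2) * exp (- 1 / t)"
  using t by (simp add: flat'_def field_simps power2_eq_square)
 also have "\<dots> \<le> (1 / t + (1 / t)^2) * 1"
  by (rule mult_left_mono) (use t in auto)
 finally show ?thesis by simp
qed

lemma flat'_le_2: "flat' t \<le> 2"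
proof (cases "t > 0")
 case True
 then have "1 * flat' t \<le> (t + 1) * flat' t" by (intro mult_right_mono flat'_nonneg) simp
 then show ?thesis using flat'_bound[of t] by simp
qed (simp add: flat'_def)

lemma flat_lipschitz: "a \<le> b ==> flat b - flat a \<le> 2 * (b - a)"
proof (cases "a = b")
 assume "a \<le> b" "a \<noteq> b"
 then have "a < b" by simp
 from MVT2[OF this flat_has_derivative] obtain z where "flat b - flat a = (b - a) * flat' z" by blast
 then show ?thesis using mult_left_mono[OF flat'_le_2[of z], of "b - a"] \<open>a < b\<close> by simp
qed simp

lemma flat_mono: "a \<le> b ==> flat a \<le> flat b"
proof (cases "a = b")
 assume "a \<le> b" "a \<noteq> b"
 then have "a < b" by simp
 from MVT2[OF this flat_has_derivative] obtain z where "flat b - flat a = (b - a) * flat' z" by blast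
 then show ?thesis using mult_nonneg_nonneg[OF _ flat'_nonneg[of z], of "b - a"] \<open>a < b\<close> by linarith
qed simp

section \<open>Symmetry of mixed partial derivatives\<close>

text \<open>Two applications of the mean value theorem express the second difference quotient by a mixed derivative at an
intermediate point. The quotient is symmetric in \<open>a\<close> and \<open>b\<close>, so both mixed
derivatives are its limit.\<close>

lemma mixed_difference_limit:
 fixes f :: "'a::euclidean_space => real"
 assumes f: "smooth f" and a: "a \<in> Basis" and b: "b \<in> Basis"
 shows "((\<lambda>t. (f (x + t *\<^sub>R a + t *\<^sub>R b) - f (x + t *\<^sub>R a) - f (x + t *\<^sub>R b) + f x) / t^2)
   \<longlongrightarrow> partials [b, a] f x) (at_right 0)"
proof (rule tendstoI)
 fix e :: real assume e: "e > 0"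
 have sm: "smooth_on UNIV (partials bs f)" if "set bs \<subseteq> Basis" for bs
  using f that smooth_on_partials smooth_iff by blast
 have hd: "((\<lambda>s. partials bs f (y + s *\<^sub>R c)) has_real_derivative partials (c # bs) f (y + s *\<^sub>R c)) (at s)"
  if "set bs \<subseteq> Basis" for bs y s c
 proof -
  have "((\<lambda>s. y + s *\<^sub>R c) has_derivative (\<lambda>h. h *\<^sub>R c)) (at s)"
   by (auto intro!: derivative_eq_intros)
  from diff_chain_at[OF this smooth_on_has_derivative[OF sm[OF that] UNIV_I]]
  have "((\<lambda>s. partials bs f (y + s *\<^sub>R c)) has_derivative (\<lambda>h. der (partials bs f) (y + s *\<^sub>R c) (h *\<^sub>R c))) (at s)"
   by (simp add: o_def)
  moreover have "der (partials bs f) (y + s *\<^sub>R c) (h *\<^sub>R c) = partials (c # bs) f (y + s *\<^sub>R c) * h" for h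
   using linear_cmul[OF linear_frechet_derivative[OF smooth_on_differentiable[OF sm[OF that] UNIV_I]]] by simp
  ultimately show ?thesis by (simp add: has_field_derivative_def)
 qed
 have "continuous_on UNIV (partials [b, a] f)"
  using sm[of "[b, a]"] a b by (intro smooth_on_continuous_on) auto
 then have "isCont (partials [b, a] f) x" by (simp add: continuous_on_eq_continuous_at)
 then obtain d where d: "d > 0" "\<And>y. dist y x < d ==> dist (partials [b, a] f y) (partials [b, a] f x) < e"
  using e unfolding continuous_at_eps_delta by blast
 show "\<forall>\<^sub>F t in at_right 0. dist ((f (x + t *\<^sub>R a + t *\<^sub>R b) - f (x + t *\<^sub>R a) - f (x + t *\<^sub>R b) + f x) / t^2) (partials [b, a] f x) < e"
  unfolding eventually_at_right_field
 proof (intro exI[of _ "d / 2"] conjI allI impI)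
  fix t assume t: "0 < t" "t < d / 2"
  have "\<exists>\<xi>. 0 < \<xi> \<and> \<xi> < t \<and> (f (x + t *\<^sub>R b + t *\<^sub>R a) - f (x + t *\<^sub>R a)) - (f (x + t *\<^sub>R b + 0 *\<^sub>R a) - f (x + 0 *\<^sub>R a))
    = (t - 0) * (partials [a] f (x + t *\<^sub>R b + \<xi> *\<^sub>R a) - partials [a] f (x + \<xi> *\<^sub>R a))"
   using hd[of "[]"] by (intro MVT2[OF t(1)] DERIV_diff) auto
  then obtain \<xi> where \<xi>: "0 < \<xi>" "\<xi> < t" "(f (x + t *\<^sub>R b + t *\<^sub>R a) - f (x + t *\<^sub>R a)) - (f (x + t *\<^sub>R b) - f x)
    = t * (partials [a] f (x + t *\<^sub>R b + \<xi> *\<^sub>R a) - partials [a] f (x + \<xi> *\<^sub>R a))" by auto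
  have "\<exists>\<tau>. 0 < \<tau> \<and> \<tau> < t \<and> partials [a] f (x + \<xi> *\<^sub>R a + t *\<^sub>R b) - partials [a] f (x + \<xi> *\<^sub>R a + 0 *\<^sub>R b)
    = (t - 0) * partials [b, a] f (x + \<xi> *\<^sub>R a + \<tau> *\<^sub>R b)"
   using hd[of "[a]"] a by (intro MVT2[OF t(1)]) auto
  then obtain \<tau> where \<tau>: "0 < \<tau>" "\<tau> < t" "partials [a] f (x + \<xi> *\<^sub>R a + t *\<^sub>R b) - partials [a] f (x + \<xi> *\<^sub>R a)
    = t * partials [b, a] f (x + \<xi> *\<^sub>R a + \<tau> *\<^sub>R b)" by auto
  have c: "x + t *\<^sub>R b + t *\<^sub>R a = x + t *\<^sub>R a + t *\<^sub>R b"
   "x + t *\<^sub>R b + \<xi> *\<^sub>R a = x + \<xi> *\<^sub>R a + t *\<^sub>R b" by simp_all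
  have num: "f (x + t *\<^sub>R a + t *\<^sub>R b) - f (x + t *\<^sub>R a) - f (x + t *\<^sub>R b) + f x
    = t * (t * partials [b, a] f (x + \<xi> *\<^sub>R a + \<tau> *\<^sub>R b))"
   using \<xi>(3) unfolding c \<tau>(3) by linarith
  have eq: "(f (x + t *\<^sub>R a + t *\<^sub>R b) - f (x + t *\<^sub>R a) - f (x + t *\<^sub>R b) + f x) / t^2
    = partials [b, a] f (x + \<xi> *\<^sub>R a + \<tau> *\<^sub>R b)"
   unfolding num using t by (simp add: power2_eq_square del: partials.simps)
  have "norm (\<xi> *\<^sub>R a + \<tau> *\<^sub>R b) \<le> \<xi> + \<tau>"
   using norm_triangle_ineq[of "\<xi> *\<^sub>R a" "\<tau> *\<^sub>R b"] a b \<xi> \<tau> by simp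
  then have "dist (x + \<xi> *\<^sub>R a + \<tau> *\<^sub>R b) x < d"
   using \<xi> \<tau> t by (simp add: dist_norm add.assoc)
  then show "dist ((f (x + t *\<^sub>R a + t *\<^sub>R b) - f (x + t *\<^sub>R a) - f (x + t *\<^sub>R b) + f x) / t^2) (partials [b, a] f x) < e"
   unfolding eq by (rule d(2))
 qed (use d in simp)
qed

lemma partials_commute_real:
 fixes f :: "'a::euclidean_space => real"
 assumes f: "smooth f" and a: "a \<in> Basis" and b: "b \<in> Basis"
 shows "partials [a, b] f = partials [b, a] f"
proof
 fix x
 have eq: "(f (x + t *\<^sub>R b + t *\<^sub>R a) - f (x + t *\<^sub>R b) - f (x + t *\<^sub>R a) + f x) / t^2 =
   (f (x + t *\<^sub>R a + t *\<^sub>R b) - f (x + t *\<^sub>R a) - f (x + t *\<^sub>R b) + f x) / t^2" for t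
 proof -
  have "x + t *\<^sub>R b + t *\<^sub>R a = x + t *\<^sub>R a + t *\<^sub>R b" by simp
  then show ?thesis by (simp only:) simp
 qed
 show "partials [a, b] f x = partials [b, a] f x"
  using tendsto_unique[OF trivial_limit_at_right_real mixed_difference_limit[OF f b a, of x, unfolded eq]
    mixed_difference_limit[OF f a b, of x]] .
qed

lemma partials_linear:
 assumes L: "bounded_linear L" and f: "smooth f" and bs: "set bs \<subseteq> Basis"
 shows "partials bs (\<lambda>x. L (f x)) = (\<lambda>x. L (partials bs f x))"
 using bs
proof (induction bs)
 case (Cons b bs)
 have "((\<lambda>x. L (partials bs f x)) has_derivative (\<lambda>v. L (der (partials bs f) x v))) (at x)" for x
  using smooth_on_has_derivative[OF smooth_on_partials[of UNIV f bs] UNIV_I] f Cons.prems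
  by (intro bounded_linear.has_derivative[OF L]) (auto simp: smooth_iff)
 then have "der (\<lambda>x. L (partials bs f x)) x b = L (der (partials bs f) x b)" for x
  by (metis frechet_derivative_at)
 then show ?case using Cons by simp
qed simp

lemma partials_commute:
 fixes f :: "'a::euclidean_space => complex"
 assumes f: "smooth f" and a: "a \<in> Basis" and b: "b \<in> Basis"
 shows "partials [a, b] f = partials [b, a] f"
proof
 fix x
 have s: "smooth (\<lambda>x. Re (f x))" "smooth (\<lambda>x. Im (f x))"
  using f smooth_on_linear[of Re UNIV f] smooth_on_linear[of Im UNIV f]
  by (auto simp: smooth_iff bounded_linear_Re bounded_linear_Im)
 have "Re (partials bs f x) = partials bs (\<lambda>x. Re (f x)) x" "Im (partials bs f x) = partials bs (\<lambda>x. Im (f x)) x"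
  if "set bs \<subseteq> Basis" for bs
  using partials_linear[OF bounded_linear_Re f that] partials_linear[OF bounded_linear_Im f that] by auto
 note this[of "[a,b]"] this[of "[b,a]"]
 then show "partials [a, b] f x = partials [b, a] f x"
  using partials_commute_real[OF s(1) a b] partials_commute_real[OF s(2) a b] a b
  by (intro complex_eqI) (simp_all del: partials.simps)
qed

lemma partials_move_front:
 fixes f :: "'a::euclidean_space => complex"
 assumes f: "smooth f" and "set (xs @ b # ys) \<subseteq> Basis"
 shows "partials (xs @ b # ys) f = partials (b # xs @ ys) f"
 using assms(2)
proof (induction xs)
 case (Cons x xs)
 have "smooth (partials (xs @ ys) f)"
  using Cons.prems f smooth_on_partials[of UNIV f "xs @ ys"] by (auto simp: smooth_iff)
 then have "partials [x, b] (partials (xs @ ys) f) = partials [b, x] (partials (xs @ ys) f)"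
  using Cons.prems by (intro partials_commute) auto
 then show ?case using Cons by simp
qed simp

text \<open>A permutation of the directions is reached by moving one direction at a time to the front.\<close>

lemma partials_permute:
 fixes f :: "'a::euclidean_space => complex"
 assumes f: "smooth f"
 shows "set bs \<subseteq> Basis ==> mset bs = mset cs ==> partials bs f = partials cs f"
proof (induction bs arbitrary: cs)
 case (Cons b bs)
 have "b \<in> set cs" using Cons.prems(2) by (metis list.set_intros(1) mset_eq_setD)
 then obtain xs ys where cs: "cs = xs @ b # ys" by (meson split_list)
 have m: "mset bs = mset (xs @ ys)" using Cons.prems(2) cs by simp
 have "set cs \<subseteq> Basis" using Cons.prems by (metis mset_eq_setD)
 then have "partials cs f = partials (b # xs @ ys) f"
  unfolding cs by (intro partials_move_front f)
 then show ?case using Cons.IH[OF _ m] Cons.prems by simp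
qed simp

section \<open>Test functions and integration by parts\<close>

lemma integral_lborel_translate:
 fixes F :: "'a::euclidean_space => 'b::{banach, second_countable_topology}"
 assumes "F \<in> borel_measurable borel"
 shows "(\<integral>x. F (x + c) \<partial>lborel) = (\<integral>x. F x \<partial>lborel)"
proof -
 have "(\<integral>x. F x \<partial>lborel) = (\<integral>x. F x \<partial>(distr lborel borel ((+) c)))"
  by (simp add: lborel_distr_plus)
 also have "\<dots> = (\<integral>x. F (c + x) \<partial>lborel)"
  by (rule integral_distr) (use assms in auto)
 finally show ?thesis by (simp add: add.commute)
qed

lemma continuous_compact_support_integrable:
 fixes F :: "'a::euclidean_space => 'b::{banach, second_countable_topology}"
 assumes "continuous_on UNIV F" "compact K" "\<And>x. x \<notin> K ==> F x = 0"
 shows "integrable lborel F"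
proof -
 have "integrable lborel (\<lambda>x. indicator K x *\<^sub>R F x)"
  using assms by (intro borel_integrable_compact) (auto intro: continuous_on_subset)
 moreover have "(\<lambda>x. indicator K x *\<^sub>R F x) = F"
  using assms(3) by (auto simp: fun_eq_iff indicator_def)
 ultimately show ?thesis by simp
qed

lemma has_vector_derivative_iff_quotient:
 fixes f :: "real => 'a::real_normed_vector"
 shows "(f has_vector_derivative D) (at x) \<longleftrightarrow> ((\<lambda>h. (f (x + h) - f x) /\<^sub>R h) \<longlongrightarrow> D) (at 0)"
proof -
 have "(f has_vector_derivative D) (at x) \<longleftrightarrow>
   ((\<lambda>h. norm (f (x + h) - f x - h *\<^sub>R D) / norm h) \<longlongrightarrow> 0) (at 0)"
  by (simp add: has_vector_derivative_def has_derivative_at bounded_linear_scaleR_left)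
 also have "\<dots> \<longleftrightarrow> ((\<lambda>h. norm ((f (x + h) - f x) /\<^sub>R h - D)) \<longlongrightarrow> 0) (at 0)"
 proof (rule filterlim_cong[OF refl refl])
  have "norm (f (x + h) - f x - h *\<^sub>R D) / norm h = norm ((f (x + h) - f x) /\<^sub>R h - D)" if "h \<noteq> 0" for h
  proof -
   have "(f (x + h) - f x) /\<^sub>R h - D = (f (x + h) - f x - h *\<^sub>R D) /\<^sub>R h"
    using that by (simp add: algebra_simps)
   then show ?thesis by (simp add: divide_inverse mult.commute)
  qed
  then show "\<forall>\<^sub>F h in at 0. norm (f (x + h) - f x - h *\<^sub>R D) / norm h = norm ((f (x + h) - f x) /\<^sub>R h - D)"
   by (simp add: eventually_at_filter)
 qed
 also have "\<dots> \<longleftrightarrow> ((\<lambda>h. (f (x + h) - f x) /\<^sub>R h) \<longlongrightarrow> D) (at 0)"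
  by (simp add: tendsto_norm_zero_iff LIM_zero_iff)
 finally show ?thesis .
qed

lemma smooth_has_vector_derivative_line:
 assumes "smooth_on S F" "x + t *\<^sub>R b \<in> S"
 shows "((\<lambda>t. F (x + t *\<^sub>R b)) has_vector_derivative der F (x + t *\<^sub>R b) b) (at t)"
proof -
 have "((\<lambda>s. x + s *\<^sub>R b) has_derivative (\<lambda>h. h *\<^sub>R b)) (at t)"
  by (auto intro!: derivative_eq_intros)
 from diff_chain_at[OF this smooth_on_has_derivative[OF assms]]
 have "((\<lambda>s. F (x + s *\<^sub>R b)) has_derivative (\<lambda>h. der F (x + t *\<^sub>R b) (h *\<^sub>R b))) (at t)"
  by (simp add: o_def)
 moreover have "der F (x + t *\<^sub>R b) (h *\<^sub>R b) = h *\<^sub>R der F (x + t *\<^sub>R b) b" for h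
  using linear_cmul[OF linear_frechet_derivative[OF smooth_on_differentiable[OF assms]]] by simp
 ultimately show ?thesis by (simp add: has_vector_derivative_def)
qed

lemma frechet_derivative_zero_outside:
 assumes "closed K" "\<And>x. x \<notin> K ==> f x = 0" "x \<notin> K"
 shows "der f x = (\<lambda>v. 0)"
 using frechet_derivative_cong_open[of "-K" x f "\<lambda>x. 0"] assms by auto

text \<open>By translation invariance the difference quotients have integral \<open>0\<close>; they are bounded and
supported in a fixed ball, so their limit has integral \<open>0\<close> too.\<close>

lemma integral_frechet_derivative_zero:
 fixes F :: "'a::euclidean_space => complex"
 assumes F: "smooth F" and K: "compact K" and z: "\<And>x. x \<notin> K ==> F x = 0" and b: "b \<in> Basis"
 shows "(\<integral>x. der F x b \<partial>lborel) = 0"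
proof -
 let ?D = "\<lambda>x. der F x b"
 have FU: "smooth_on UNIV F" using F by (simp add: smooth_iff)
 have cF: "continuous_on UNIV F" using FU by (rule smooth_on_continuous_on)
 have cD: "continuous_on UNIV ?D" using smooth_on_deriv_Basis[OF FU b] by (rule smooth_on_continuous_on)
 have zD: "?D x = 0" if "x \<notin> K" for x
  using frechet_derivative_zero_outside[OF compact_imp_closed[OF K] z that] by simp
 have "bounded (?D ` K)"
  by (intro compact_imp_bounded compact_continuous_image continuous_on_subset[OF cD] K) simp
 then obtain M where M0: "\<And>x. x \<in> K ==> norm (?D x) \<le> M"
  unfolding bounded_iff by blast
 define M' where "M' = max M 0"
 have M: "norm (?D x) \<le> M'" for x
  using M0[of x] zD[of x] by (cases "x \<in> K") (auto simp: M'_def)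
 have M'0: "M' \<ge> 0" by (simp add: M'_def)
 obtain R where R: "\<And>x. x \<in> K ==> norm x \<le> R"
  using compact_imp_bounded[OF K] bounded_iff by blast
 define s where "s n = inverse (real (Suc n))" for n
 have s: "s n > 0" "s n \<le> 1" for n by (auto simp: s_def inverse_le_1_iff)
 have s0: "s \<longlonglongrightarrow> 0" unfolding s_def by (rule LIMSEQ_inverse_real_of_nat)
 define q where "q n x = (F (x + s n *\<^sub>R b) - F x) /\<^sub>R s n" for n x
 have hd: "((\<lambda>t. F (x + t *\<^sub>R b)) has_vector_derivative ?D (x + t *\<^sub>R b)) (at t)" for x t
  by (rule smooth_has_vector_derivative_line[OF FU UNIV_I])
 have qM: "norm (q n x) \<le> M'" for n x
 proof -
  have "norm (F (x + s n *\<^sub>R b) - F (x + 0 *\<^sub>R b)) \<le> M' * norm (s n - 0)"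
  proof (rule differentiable_bound[where S="UNIV" and f="\<lambda>t. F (x + t *\<^sub>R b)" and f'="\<lambda>t h. h *\<^sub>R ?D (x + t *\<^sub>R b)"])
   show "((\<lambda>t. F (x + t *\<^sub>R b)) has_derivative (\<lambda>h. h *\<^sub>R ?D (x + t *\<^sub>R b))) (at t)" for t
    using hd by (simp add: has_vector_derivative_def)
   show "onorm (\<lambda>h. h *\<^sub>R ?D (x + t *\<^sub>R b)) \<le> M'" for t
    by (rule onorm_bound[OF M'0]) (use mult_right_mono[OF M, of "\<bar>_\<bar>"] in \<open>simp add: mult.commute\<close>)
  qed auto
  then show ?thesis using s(1)[of n] by (simp add: q_def divide_inverse[symmetric] pos_divide_le_eq mult.commute[of "inverse _"])
 qed
 have qz: "q n x = 0" if "norm x > R + 1" for n x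
 proof -
  have "norm x \<le> norm (x + s n *\<^sub>R b) + norm (s n *\<^sub>R b)" using norm_triangle_ineq4[of "x + s n *\<^sub>R b" "s n *\<^sub>R b"] by simp
  then have "norm (x + s n *\<^sub>R b) > R" using that s[of n] b by simp
  then have "x + s n *\<^sub>R b \<notin> K" "x \<notin> K" using R[of x] R[of "x + s n *\<^sub>R b"] that by force+
  then show ?thesis by (simp add: q_def z)
 qed
 have lim: "(\<lambda>n. \<integral>x. q n x \<partial>lborel) \<longlonglongrightarrow> (\<integral>x. ?D x \<partial>lborel)"
 proof (rule integral_dominated_convergence[where w="\<lambda>x. indicator (cball 0 (R + 1)) x *\<^sub>R M'"])
  show "?D \<in> borel_measurable lborel" using cD by (simp add: borel_measurable_continuous_onI)
  have "continuous_on UNIV (q n)" for n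
   unfolding q_def by (intro continuous_intros continuous_on_compose2[OF cF]) auto
  then show "q n \<in> borel_measurable lborel" for n by (simp add: borel_measurable_continuous_onI)
  show "integrable lborel (\<lambda>x. indicator (cball 0 (R + 1)) x *\<^sub>R M')"
   by (rule borel_integrable_compact) auto
  show "AE x in lborel. (\<lambda>n. q n x) \<longlonglongrightarrow> ?D x"
  proof (rule AE_I2)
   fix x
   have "((\<lambda>h. (F (x + h *\<^sub>R b) - F x) /\<^sub>R h) \<longlongrightarrow> ?D x) (at 0)"
    using hd[of x 0] by (simp add: has_vector_derivative_iff_quotient)
   moreover have "filterlim s (at 0) sequentially"
    using s0 less_imp_neq[OF s(1)] by (simp add: filterlim_at)
   ultimately show "(\<lambda>n. q n x) \<longlonglongrightarrow> ?D x"
    unfolding q_def by (rule filterlim_compose)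
  qed
  show "AE x in lborel. norm (q n x) \<le> indicator (cball 0 (R + 1)) x *\<^sub>R M'" for n
   using qM qz by (intro AE_I2) (auto simp: indicator_def not_le)
 qed
 have "(\<integral>x. q n x \<partial>lborel) = 0" for n
 proof -
  have iF: "integrable lborel F" by (rule continuous_compact_support_integrable[OF cF K z])
  have "integrable lborel (\<lambda>x. F (x + s n *\<^sub>R b))"
   by (rule continuous_compact_support_integrable[of _ "(\<lambda>x. x - s n *\<^sub>R b) ` K"])
    (use cF K z in \<open>auto intro!: continuous_intros continuous_on_compose2[OF cF] compact_continuous_image
      simp: image_iff algebra_simps\<close>)
  then show ?thesis
   unfolding q_def using iF integral_lborel_translate[of F "s n *\<^sub>R b"] cF
   by (simp add: borel_measurable_continuous_onI)
 qed
 with lim show ?thesis by (simp add: LIMSEQ_const_iff)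
qed

lemma integral_lebesgue_on_eq_lborel:
 fixes F :: "'a::euclidean_space => 'b::{banach, second_countable_topology}"
 assumes "\<Omega> \<in> sets lebesgue" "F \<in> borel_measurable borel" "\<And>x. x \<notin> \<Omega> ==> F x = 0"
 shows "(\<integral>x. F x \<partial>lebesgue_on \<Omega>) = (\<integral>x. F x \<partial>lborel)"
proof -
 have e: "(\<lambda>x. indicator \<Omega> x *\<^sub>R F x) = F" using assms(3) by (auto simp: fun_eq_iff indicator_def)
 have "(\<integral>x. F x \<partial>lebesgue_on \<Omega>) = (\<integral>x. indicator \<Omega> x *\<^sub>R F x \<partial>lebesgue)"
  by (rule integral_restrict_space) (use assms in simp)
 also have "\<dots> = (\<integral>x. F x \<partial>lborel)"
  unfolding e by (rule integral_completion) (use assms in simp)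
 finally show ?thesis .
qed

lemma integrable_lebesgue_on_iff_lborel:
 fixes F :: "'a::euclidean_space => 'b::{banach, second_countable_topology}"
 assumes "\<Omega> \<in> sets lebesgue" "F \<in> borel_measurable borel" "\<And>x. x \<notin> \<Omega> ==> F x = 0"
 shows "integrable (lebesgue_on \<Omega>) F \<longleftrightarrow> integrable lborel F"
proof -
 have e: "(\<lambda>x. indicator \<Omega> x *\<^sub>R F x) = F" using assms(3) by (auto simp: fun_eq_iff indicator_def)
 have "integrable (lebesgue_on \<Omega>) F \<longleftrightarrow> integrable lebesgue (\<lambda>x. indicator \<Omega> x *\<^sub>R F x)"
  by (rule integrable_restrict_space) (use assms in simp)
 also have "\<dots> \<longleftrightarrow> integrable lborel F"
  unfolding e by (rule integrable_completion) (use assms in simp)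
 finally show ?thesis .
qed

lemma test_function_mult:
 assumes "open \<Omega>" "smooth_on \<Omega> f" "test_function \<Omega> \<phi>"
 shows "test_function \<Omega> (\<lambda>x. f x * \<phi> x)"
proof -
 from assms(3) obtain K where K: "smooth \<phi>" "compact K" "K \<subseteq> \<Omega>" "\<And>x. x \<notin> K ==> \<phi> x = 0"
  unfolding test_function_def by blast
 have "smooth (\<lambda>x. f x * \<phi> x)"
  using assms K smooth_on_mult[OF assms(1,2) smooth_imp_smooth_on[OF K(1)]]
  by (intro smooth_extend_zero[of \<Omega> _ K]) (auto intro: compact_imp_closed)
 then show ?thesis unfolding test_function_def using K by auto
qed

lemma test_function_deriv:
 assumes \<phi>: "test_function \<Omega> \<phi>" and X: "smooth X"
 shows "test_function \<Omega> (\<lambda>x. der \<phi> x (X x))"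
proof -
 from \<phi> obtain K where K: "smooth \<phi>" "compact K" "K \<subseteq> \<Omega>" "\<And>x. x \<notin> K ==> \<phi> x = 0"
  unfolding test_function_def by blast
 have "smooth (\<lambda>x. der \<phi> x (X x))"
  using K X smooth_on_deriv[of UNIV \<phi> X] by (simp add: smooth_iff)
 moreover have "der \<phi> x (X x) = 0" if "x \<notin> K" for x
  using frechet_derivative_zero_outside[of K \<phi> x] K that by (simp add: compact_imp_closed)
 ultimately show ?thesis unfolding test_function_def using K by auto
qed

lemma test_function_deriv_Basis:
 "test_function \<Omega> \<phi> ==> test_function \<Omega> (\<lambda>x. der \<phi> x b)"
 by (rule test_function_deriv[of \<Omega> \<phi> "\<lambda>_. b"]) (auto simp: smooth_iff)

lemma test_function_partials:
 "test_function \<Omega> \<phi> ==> test_function \<Omega> (partials bs \<phi>)"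
 by (induction bs) (auto intro: test_function_deriv_Basis)

lemma test_function_cnj: "test_function \<Omega> \<phi> ==> test_function \<Omega> (\<lambda>x. cnj (\<phi> x))"
 unfolding test_function_def smooth_iff by (auto intro: smooth_on_cnj)

lemma test_function_continuous: "test_function \<Omega> \<phi> ==> continuous_on UNIV \<phi>"
 unfolding test_function_def smooth_iff using smooth_on_continuous_on by blast

lemma test_function_zero: "test_function \<Omega> \<phi> ==> x \<notin> \<Omega> ==> \<phi> x = 0"
 unfolding test_function_def by blast

lemma test_function_integrable:
 assumes "test_function \<Omega> \<phi>" "open \<Omega>"
 shows "integrable (lebesgue_on \<Omega>) \<phi>" "integrable lborel \<phi>"
proof -
 from assms(1) obtain K where K: "smooth \<phi>" "compact K" "K \<subseteq> \<Omega>" "\<And>x. x \<notin> K ==> \<phi> x = 0"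
  unfolding test_function_def by blast
 show 1: "integrable lborel \<phi>"
  by (rule continuous_compact_support_integrable[OF test_function_continuous[OF assms(1)] K(2,4)])
 then show "integrable (lebesgue_on \<Omega>) \<phi>"
  using integrable_lebesgue_on_iff_lborel[of \<Omega> \<phi>] assms test_function_continuous[OF assms(1)] test_function_zero[OF assms(1)]
  by (simp add: borel_measurable_continuous_onI)
qed

lemma integration_by_parts:
 fixes f \<phi> :: "'a::euclidean_space => complex"
 assumes \<Omega>: "open \<Omega>" and f: "smooth_on \<Omega> f" and \<phi>: "test_function \<Omega> \<phi>" and b: "b \<in> Basis"
 shows "(\<integral>x. der f x b * \<phi> x \<partial>lebesgue_on \<Omega>)
  = - (\<integral>x. f x * der \<phi> x b \<partial>lebesgue_on \<Omega>)"
proof -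
 let ?F = "\<lambda>x. f x * \<phi> x"
 have t: "test_function \<Omega> ?F" by (rule test_function_mult[OF \<Omega> f \<phi>])
 have t1: "test_function \<Omega> (\<lambda>x. der f x b * \<phi> x)"
  by (rule test_function_mult[OF \<Omega> smooth_on_deriv_Basis[OF f b] \<phi>])
 have t2: "test_function \<Omega> (\<lambda>x. f x * der \<phi> x b)"
  by (rule test_function_mult[OF \<Omega> f test_function_deriv_Basis[OF \<phi>]])
 have D: "der ?F x b = f x * der \<phi> x b + der f x b * \<phi> x"
  if "x \<in> \<Omega>" for x
 proof -
  have "\<phi> differentiable at x" using \<phi> smooth_on_differentiable[of UNIV \<phi>] by (auto simp: test_function_def smooth_iff)
  then have "(?F has_derivative (\<lambda>v. f x * der \<phi> x v + der f x v * \<phi> x)) (at x)"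
   using smooth_on_has_derivative[OF f that]
   by (intro has_derivative_mult) (auto simp: frechet_derivative_works[symmetric])
  from fun_cong[OF frechet_derivative_at[OF this], of b] show ?thesis by simp
 qed
 from t obtain K where K: "smooth ?F" "compact K" "K \<subseteq> \<Omega>" "\<And>x. x \<notin> K ==> ?F x = 0"
  unfolding test_function_def by blast
 have "0 = (\<integral>x. der ?F x b \<partial>lborel)"
  using integral_frechet_derivative_zero[OF K(1,2,4) b] by simp
 also have "\<dots> = (\<integral>x. f x * der \<phi> x b + der f x b * \<phi> x \<partial>lborel)"
 proof (rule Bochner_Integration.integral_cong[OF refl])
  fix x show "der ?F x b = f x * der \<phi> x b + der f x b * \<phi> x"
  proof (cases "x \<in> \<Omega>")
   case False
   then have "x \<notin> K" using K by blast
   then have "der ?F x b = 0"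
    using frechet_derivative_zero_outside[OF compact_imp_closed[OF K(2)] K(4)] by simp
   then show ?thesis using test_function_zero[OF t1 False] test_function_zero[OF t2 False] by auto
  qed (rule D)
 qed
 also have "\<dots> = (\<integral>x. f x * der \<phi> x b \<partial>lborel) + (\<integral>x. der f x b * \<phi> x \<partial>lborel)"
  by (rule Bochner_Integration.integral_add) (rule test_function_integrable[OF t2 \<Omega>] test_function_integrable[OF t1 \<Omega>])+
 also have "(\<integral>x. f x * der \<phi> x b \<partial>lborel) = (\<integral>x. f x * der \<phi> x b \<partial>lebesgue_on \<Omega>)"
  by (rule integral_lebesgue_on_eq_lborel[symmetric])
   (use \<Omega> t2 in \<open>auto simp: borel_measurable_continuous_onI test_function_continuous dest: test_function_zero\<close>)
 also have "(\<integral>x. der f x b * \<phi> x \<partial>lborel) = (\<integral>x. der f x b * \<phi> x \<partial>lebesgue_on \<Omega>)"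
  by (rule integral_lebesgue_on_eq_lborel[symmetric])
   (use \<Omega> t1 in \<open>auto simp: borel_measurable_continuous_onI test_function_continuous dest: test_function_zero\<close>)
 finally show ?thesis by (simp add: eq_neg_iff_add_eq_0 add.commute)
qed

lemma integration_by_parts_partials:
 assumes \<Omega>: "open \<Omega>" and f: "smooth_on \<Omega> f" and \<phi>: "test_function \<Omega> \<phi>" and bs: "set bs \<subseteq> Basis"
 shows "(\<integral>x. partials bs f x * \<phi> x \<partial>lebesgue_on \<Omega>)
  = (-1) ^ length bs * (\<integral>x. f x * partials (rev bs) \<phi> x \<partial>lebesgue_on \<Omega>)"
 using \<phi> bs
proof (induction bs arbitrary: \<phi>)
 case (Cons b bs)
 have "(\<integral>x. partials (b # bs) f x * \<phi> x \<partial>lebesgue_on \<Omega>) =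
   - (\<integral>x. partials bs f x * der \<phi> x b \<partial>lebesgue_on \<Omega>)"
  using integration_by_parts[OF \<Omega> smooth_on_partials[OF f, where bs=bs] Cons.prems(1), where b=b] Cons.prems(2) by simp
 also have "\<dots> = - ((-1) ^ length bs * (\<integral>x. f x * partials (rev bs) (\<lambda>x. der \<phi> x b) x \<partial>lebesgue_on \<Omega>))"
  by (subst Cons.IH) (use Cons.prems in \<open>auto intro: test_function_deriv_Basis\<close>)
 finally show ?case by (simp add: partials_append)
qed simp

lemma is_weak_derivative_partials:
 assumes \<Omega>: "open \<Omega>" and f: "smooth_on \<Omega> f" and bs: "set bs \<subseteq> Basis"
 shows "is_weak_derivative \<Omega> (mset bs) f (partials bs f)"
 unfolding is_weak_derivative_def
proof (intro allI impI, elim conjE)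
 fix cs \<phi> assume cs: "mset cs = mset bs" and \<phi>: "test_function \<Omega> \<phi>"
 have "partials (rev bs) \<phi> = partials cs \<phi>"
  by (rule partials_permute) (use \<phi> bs cs in \<open>auto simp: test_function_def\<close>)
 then show "(\<integral>x. partials bs f x * \<phi> x \<partial>lebesgue_on \<Omega>) =
   (- 1) ^ size (mset bs) * (\<integral>x. f x * partials cs \<phi> x \<partial>lebesgue_on \<Omega>)"
  using integration_by_parts_partials[OF \<Omega> f \<phi> bs] by simp
qed

section \<open>Functions orthogonal to all test functions\<close>

text \<open>The positive and the negative part of \<open>E\<close> are densities of two measures that agree on the
\<open>\<pi>\<close>-system of boxes, hence everywhere; evaluate them on \<open>{E > 0}\<close>.\<close>

lemma AE_nonpos_if_box_integrals_zero:
 fixes E :: "'a::euclidean_space => real"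
 assumes int: "integrable lborel E" and z: "\<And>a b. (\<integral>x. indicator (box a b) x * E x \<partial>lborel) = 0"
 shows "AE x in lborel. E x \<le> 0"
proof -
 have [measurable]: "E \<in> borel_measurable borel" using int by auto
 define P where "P = density lborel (\<lambda>x. ennreal (E x))"
 define N where "N = density lborel (\<lambda>x. ennreal (- E x))"
 have P_eq: "emeasure P S = ennreal (\<integral>x. indicator S x * max 0 (E x) \<partial>lborel)"
  and N_eq: "emeasure N S = ennreal (\<integral>x. indicator S x * max 0 (- E x) \<partial>lborel)"
  and diff: "(\<integral>x. indicator S x * max 0 (E x) \<partial>lborel) - (\<integral>x. indicator S x * max 0 (- E x) \<partial>lborel)
   = (\<integral>x. indicator S x * E x \<partial>lborel)"
  if S[measurable]: "S \<in> sets borel" for S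
 proof -
  have i1: "integrable lborel (\<lambda>x. indicator S x * max 0 (E x))"
   by (rule Bochner_Integration.integrable_bound[OF int]) (auto simp: indicator_def)
  have i2: "integrable lborel (\<lambda>x. indicator S x * max 0 (- E x))"
   by (rule Bochner_Integration.integrable_bound[OF int]) (auto simp: indicator_def)
  have "emeasure P S = (\<integral>\<^sup>+x. ennreal (E x) * indicator S x \<partial>lborel)"
   unfolding P_def by (rule emeasure_density) auto
  also have "\<dots> = (\<integral>\<^sup>+x. ennreal (indicator S x * max 0 (E x)) \<partial>lborel)"
   by (rule nn_integral_cong) (auto simp: indicator_def max_def ennreal_neg)
  also have "\<dots> = ennreal (\<integral>x. indicator S x * max 0 (E x) \<partial>lborel)"
   by (rule nn_integral_eq_integral[OF i1]) (auto simp: indicator_def)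
  finally show "emeasure P S = ennreal (\<integral>x. indicator S x * max 0 (E x) \<partial>lborel)" .
  have "emeasure N S = (\<integral>\<^sup>+x. ennreal (- E x) * indicator S x \<partial>lborel)"
   unfolding N_def by (rule emeasure_density) auto
  also have "\<dots> = (\<integral>\<^sup>+x. ennreal (indicator S x * max 0 (- E x)) \<partial>lborel)"
   by (rule nn_integral_cong) (auto simp: indicator_def max_def ennreal_neg)
  also have "\<dots> = ennreal (\<integral>x. indicator S x * max 0 (- E x) \<partial>lborel)"
   by (rule nn_integral_eq_integral[OF i2]) (auto simp: indicator_def)
  finally show "emeasure N S = ennreal (\<integral>x. indicator S x * max 0 (- E x) \<partial>lborel)" .
  show "(\<integral>x. indicator S x * max 0 (E x) \<partial>lborel) - (\<integral>x. indicator S x * max 0 (- E x) \<partial>lborel)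
   = (\<integral>x. indicator S x * E x \<partial>lborel)"
   unfolding Bochner_Integration.integral_diff[OF i1 i2, symmetric]
   by (rule Bochner_Integration.integral_cong) (auto simp: indicator_def max_def)
 qed
 have "P = N"
 proof (rule measure_eqI_generator_eq)
  let ?E = "range (\<lambda>(a, b). box a b::'a set)"
  show "Int_stable ?E" by (auto simp: Int_stable_def box_Int_box)
  show "?E \<subseteq> Pow UNIV" "sets P = sigma_sets UNIV ?E" "sets N = sigma_sets UNIV ?E"
   by (simp_all add: borel_eq_box P_def N_def)
  let ?A = "\<lambda>n::nat. box (- (real n *\<^sub>R One)) (real n *\<^sub>R One) :: 'a set"
  show "range ?A \<subseteq> ?E" "(\<Union>i. ?A i) = UNIV"
   unfolding UN_box_eq_UNIV by auto
  show "emeasure P (?A i) \<noteq> \<infinity>" for i by (simp add: P_eq)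
  show "emeasure P X = emeasure N X" if "X \<in> ?E" for X
  proof -
   from that obtain a b where X: "X = box a b" by auto
   then show ?thesis using diff[of X] z[of a b] P_eq[of X] N_eq[of X] by simp
  qed
 qed
 then have "emeasure P {x. E x > 0} = emeasure N {x. E x > 0}" by simp
 also have "\<dots> = 0"
 proof -
  have "(\<lambda>x. indicator {x. E x > 0} x * max 0 (- E x)) = (\<lambda>x. 0)"
   by (auto simp: fun_eq_iff indicator_def max_def)
  then show ?thesis using N_eq[of "{x. E x > 0}"] by simp
 qed
 finally have "(\<integral>\<^sup>+x. ennreal (E x) * indicator {x. E x > 0} x \<partial>lborel) = 0"
  by (simp add: P_def emeasure_density)
 then have "AE x in lborel. ennreal (E x) * indicator {x. E x > 0} x = 0"
  by (subst (asm) nn_integral_0_iff_AE) auto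
 then show ?thesis by eventually_elim (auto simp: indicator_def ennreal_eq_0_iff split: if_splits)
qed

lemma AE_zero_if_box_integrals_zero:
 fixes E :: "'a::euclidean_space => complex"
 assumes int: "integrable lborel E" and z: "\<And>a b. (\<integral>x. indicator (box a b) x *\<^sub>R E x \<partial>lborel) = 0"
 shows "AE x in lborel. E x = 0"
proof -
 have i: "integrable lborel (\<lambda>x. indicator (box a b) x *\<^sub>R E x)" for a b
  by (rule Bochner_Integration.integrable_bound[OF int]) (use int in \<open>auto simp: indicator_def\<close>)
 have r: "(\<integral>x. indicator (box a b) x * Re (E x) \<partial>lborel) = 0" "(\<integral>x. indicator (box a b) x * Im (E x) \<partial>lborel) = 0" for a b
  using integral_Re[OF i[of a b]] integral_Im[OF i[of a b]] z[of a b] by simp_all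
 have "AE x in lborel. Re (E x) \<le> 0" "AE x in lborel. Im (E x) \<le> 0"
   "AE x in lborel. - Re (E x) \<le> 0" "AE x in lborel. - Im (E x) \<le> 0"
  by (rule AE_nonpos_if_box_integrals_zero; use int r in simp)+
 then show ?thesis by eventually_elim (auto intro: complex_eqI)
qed

text \<open>Compactly supported in the box, and tending to its indicator as \<open>n\<close> grows.\<close>

definition box_bump :: "'a::euclidean_space => 'a => nat => 'a => complex" where
 "box_bump a b n x = of_real (\<Prod>i\<in>Basis. flat (real (Suc n) * (x \<bullet> i - a \<bullet> i) - 1) * flat (real (Suc n) * (b \<bullet> i - x \<bullet> i) - 1))"

lemma smooth_box_bump: "smooth (box_bump a b n)"
proof -
 have *: "smooth_on UNIV (\<lambda>x::'a. flat (f x))" if "smooth_on UNIV f" for f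
  using smooth_flat that by (intro smooth_on_compose[of UNIV f UNIV flat]) (auto simp: smooth_iff)
 have l: "smooth_on UNIV (\<lambda>x::'a. x \<bullet> i)" for i
  by (rule smooth_on_linear[OF bounded_linear_inner_left]) auto
 show ?thesis unfolding smooth_iff box_bump_def
  by (intro smooth_on_of_real open_UNIV smooth_on_prod smooth_on_mult * smooth_on_diff smooth_on_const l)
qed

lemma box_bump_test_function:
 assumes "box a b \<subseteq> \<Omega>"
 shows "test_function \<Omega> (box_bump a b n)"
proof -
 define e where "e = 1 / real (Suc n)"
 have e: "e > 0" "real (Suc n) * e = 1" by (auto simp: e_def)
 let ?K = "cbox (a + e *\<^sub>R One) (b - e *\<^sub>R One)"
 have "box_bump a b n x = 0" if x: "x \<notin> ?K" for x
 proof -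
  from x obtain i where i: "i \<in> Basis" "x \<bullet> i - a \<bullet> i \<le> e \<or> b \<bullet> i - x \<bullet> i \<le> e"
   by (force simp: mem_box inner_add_left inner_diff_left not_le)
  then have "real (Suc n) * (x \<bullet> i - a \<bullet> i) \<le> 1 \<or> real (Suc n) * (b \<bullet> i - x \<bullet> i) \<le> 1"
   using mult_left_mono[of _ e "real (Suc n)"] e(2) by (metis of_nat_0_le_iff)
  then have "flat (real (Suc n) * (x \<bullet> i - a \<bullet> i) - 1) * flat (real (Suc n) * (b \<bullet> i - x \<bullet> i) - 1) = 0"
   by (metis diff_le_0_iff_le flat_zero mult_eq_0_iff)
  then have "(\<Prod>i\<in>Basis. flat (real (Suc n) * (x \<bullet> i - a \<bullet> i) - 1) * flat (real (Suc n) * (b \<bullet> i - x \<bullet> i) - 1)) = 0"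
   by (intro prod_zero[OF finite_Basis] bexI[OF _ i(1)])
  then show ?thesis unfolding box_bump_def by simp
 qed
 moreover have "?K \<subseteq> box a b"
 proof
  fix x assume "x \<in> ?K"
  then have "a \<bullet> i + e \<le> x \<bullet> i \<and> x \<bullet> i \<le> b \<bullet> i - e" if "i \<in> Basis" for i
   using that by (simp add: mem_box inner_add_left inner_diff_left)
  then show "x \<in> box a b" using e(1) by (fastforce simp: mem_box)
 qed
 ultimately show ?thesis unfolding test_function_def using smooth_box_bump assms
  by (intro conjI exI[of _ ?K]) auto
qed

lemma norm_box_bump_le_1: "norm (box_bump a b n x) \<le> 1"
 unfolding box_bump_def norm_of_real abs_prod
 by (rule prod_le_1) (auto simp: abs_mult flat_nonneg flat_le_1 mult_le_one)

lemma box_bump_tendsto: "(\<lambda>n. box_bump a b n x) \<longlonglongrightarrow> of_real (indicator (box a b) x)"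
proof (cases "x \<in> box a b")
 case True
 have l: "(\<lambda>n. flat (real (Suc n) * c - 1)) \<longlonglongrightarrow> 1" if "c > 0" for c
 proof (rule filterlim_compose[OF flat_tendsto_1])
  have "filterlim (\<lambda>n. c * real (Suc n)) at_top sequentially"
   using filterlim_compose[OF filterlim_real_sequentially filterlim_Suc] that
   by (intro filterlim_tendsto_pos_mult_at_top[OF tendsto_const]) auto
  from filterlim_tendsto_add_at_top[OF tendsto_const[of "-1"] this]
  show "filterlim (\<lambda>n. real (Suc n) * c - 1) at_top sequentially" by (simp add: mult.commute)
 qed
 have "(\<lambda>n. box_bump a b n x) \<longlonglongrightarrow> of_real (\<Prod>i\<in>(Basis::'a set). 1 * 1)"
  unfolding box_bump_def using True by (intro tendsto_intros l) (auto simp: mem_box)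
 then show ?thesis using True by simp
next
 case False
 have "box_bump a b n x = 0" for n
  using box_bump_test_function[of a b "box a b" n] False test_function_zero by blast
 then show ?thesis using False by simp
qed

text \<open>Box bumps show that the integral of \<open>d\<close> over every box inside \<open>\<Omega>\<close> vanishes;
\<open>\<Omega>\<close> is a countable union of such boxes.\<close>

lemma fundamental_lemma:
 fixes d :: "'a::euclidean_space => complex"
 assumes \<Omega>: "open \<Omega>" and d: "integrable (lebesgue_on \<Omega>) d"
  and z: "\<And>\<phi>. test_function \<Omega> \<phi> ==> (\<integral>x. d x * \<phi> x \<partial>lebesgue_on \<Omega>) = 0"
 shows "AE x in lebesgue_on \<Omega>. d x = 0"
proof -
 have \<Omega>l: "\<Omega> \<inter> space lebesgue \<in> sets lebesgue" using \<Omega> by simp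
 have di: "integrable lebesgue (\<lambda>x. indicator \<Omega> x *\<^sub>R d x)"
  using d \<Omega>l by (simp add: integrable_restrict_space)
 have box0: "(\<integral>x. indicator (box a b) x *\<^sub>R d x \<partial>lebesgue_on \<Omega>) = 0" if ab: "box a b \<subseteq> \<Omega>" for a b
 proof -
  have "(\<lambda>n. \<integral>x. d x * box_bump a b n x \<partial>lebesgue_on \<Omega>) \<longlonglongrightarrow> (\<integral>x. d x * of_real (indicator (box a b) x) \<partial>lebesgue_on \<Omega>)"
  proof (rule integral_dominated_convergence[where w="\<lambda>x. norm (d x)"])
   have [measurable]: "d \<in> borel_measurable (lebesgue_on \<Omega>)" using d by auto
   have "box_bump a b n \<in> borel_measurable lebesgue" for n
    using borel_measurable_continuous_onI[OF test_function_continuous[OF box_bump_test_function[OF ab]]]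
    by (intro measurable_completion) simp
   then have [measurable]: "box_bump a b n \<in> borel_measurable (lebesgue_on \<Omega>)" for n
    by (simp add: measurable_restrict_space1)
   show "(\<lambda>x. d x * box_bump a b n x) \<in> borel_measurable (lebesgue_on \<Omega>)" for n by measurable
   have "(\<lambda>x. of_real (indicator (box a b) x) :: complex) \<in> borel_measurable lebesgue"
    by (intro measurable_completion borel_measurable_of_real borel_measurable_indicator) simp
   then have [measurable]: "(\<lambda>x. of_real (indicator (box a b) x) :: complex) \<in> borel_measurable (lebesgue_on \<Omega>)"
    by (simp add: measurable_restrict_space1)
   show "(\<lambda>x. d x * of_real (indicator (box a b) x)) \<in> borel_measurable (lebesgue_on \<Omega>)" by measurable
   show "integrable (lebesgue_on \<Omega>) (\<lambda>x. norm (d x))" using d by simp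
   show "AE x in lebesgue_on \<Omega>. (\<lambda>n. d x * box_bump a b n x) \<longlonglongrightarrow> d x * of_real (indicator (box a b) x)"
    by (intro AE_I2 tendsto_intros box_bump_tendsto)
   show "AE x in lebesgue_on \<Omega>. norm (d x * box_bump a b n x) \<le> norm (d x)" for n
    by (intro AE_I2) (simp add: norm_mult mult_left_le norm_box_bump_le_1)
  qed
  then have "(\<integral>x. d x * of_real (indicator (box a b) x) \<partial>lebesgue_on \<Omega>) = 0"
   using z[OF box_bump_test_function[OF ab]] by (simp add: LIMSEQ_const_iff)
  then show ?thesis by (simp add: scaleR_conv_of_real mult.commute)
 qed
 obtain e where e: "e \<in> borel_measurable lborel" "AE x in lborel. indicator \<Omega> x *\<^sub>R d x = e x"
 proof -
  have m: "(\<lambda>x. Re (indicator \<Omega> x *\<^sub>R d x)) \<in> borel_measurable lebesgue"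
   "(\<lambda>x. Im (indicator \<Omega> x *\<^sub>R d x)) \<in> borel_measurable lebesgue"
   using borel_measurable_integrable[OF di] by measurable
  from m[THEN completion_ex_borel_measurable_real] obtain e1 e2 where
   e: "e1 \<in> borel_measurable lborel" "e2 \<in> borel_measurable lborel"
    "AE x in lborel. Re (indicator \<Omega> x *\<^sub>R d x) = e1 x" "AE x in lborel. Im (indicator \<Omega> x *\<^sub>R d x) = e2 x"
   by blast
  have "AE x in lborel. indicator \<Omega> x *\<^sub>R d x = Complex (e1 x) (e2 x)"
   using e(3,4) by eventually_elim (auto intro: complex_eqI)
  moreover have "(\<lambda>x. Complex (e1 x) (e2 x)) \<in> borel_measurable lborel"
   unfolding Complex_eq using e(1,2) by measurable
  ultimately show ?thesis by (rule that[rotated])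
 qed
 have eL: "AE x in lebesgue. indicator \<Omega> x *\<^sub>R d x = e x"
  by (rule AE_completion[OF e(2)])
 have em: "e \<in> borel_measurable lebesgue" using e(1) by (rule measurable_completion)
 have "integrable lebesgue e"
  using integrable_cong_AE[OF _ em eL] di by simp
 then have ei: "integrable lborel e" using integrable_completion[OF e(1)] by simp
 have zero: "AE x in lborel. x \<in> box a b --> e x = 0" if ab: "box a b \<subseteq> \<Omega>" for a b
 proof -
  have "AE x in lborel. indicator (box a b) x *\<^sub>R e x = 0"
  proof (rule AE_zero_if_box_integrals_zero)
   show "integrable lborel (\<lambda>x. indicator (box a b) x *\<^sub>R e x)"
    by (rule Bochner_Integration.integrable_bound[OF ei]) (use e in \<open>auto simp: indicator_def\<close>)
   fix p q :: 'a
   obtain u v where uv: "box p q \<inter> box a b = box u v" unfolding box_Int_box by blast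
   have "(\<integral>x. indicator (box p q) x *\<^sub>R indicator (box a b) x *\<^sub>R e x \<partial>lborel) = (\<integral>x. indicator (box u v) x *\<^sub>R e x \<partial>lborel)"
    unfolding uv[symmetric] by (rule Bochner_Integration.integral_cong) (auto simp: indicator_def)
   also have "\<dots> = (\<integral>x. indicator (box u v) x *\<^sub>R e x \<partial>lebesgue)"
    by (rule integral_completion[symmetric]) (use e in auto)
   also have "\<dots> = (\<integral>x. indicator \<Omega> x *\<^sub>R indicator (box u v) x *\<^sub>R d x \<partial>lebesgue)"
   proof (rule integral_cong_AE)
    show "(\<lambda>x. indicator (box u v) x *\<^sub>R e x) \<in> borel_measurable lebesgue"
     using em by (intro borel_measurable_scaleR borel_measurable_indicator) auto
    have "(\<lambda>x. indicator (box u v) x *\<^sub>R (indicator \<Omega> x *\<^sub>R d x)) \<in> borel_measurable lebesgue"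
     by (rule borel_measurable_scaleR[OF borel_measurable_indicator borel_measurable_integrable[OF di]]) simp
    then show "(\<lambda>x. indicator \<Omega> x *\<^sub>R indicator (box u v) x *\<^sub>R d x) \<in> borel_measurable lebesgue"
     by (simp only: scaleR_left_commute)
    show "AE x in lebesgue. indicator (box u v) x *\<^sub>R e x = indicator \<Omega> x *\<^sub>R indicator (box u v) x *\<^sub>R d x"
     using eL by eventually_elim (auto simp: mult.commute indicator_def split: if_splits)
   qed
   also have "\<dots> = (\<integral>x. indicator (box u v) x *\<^sub>R d x \<partial>lebesgue_on \<Omega>)"
    by (rule integral_restrict_space[OF \<Omega>l, symmetric])
   also have "\<dots> = 0"
    by (rule box0) (use uv ab in auto)
   finally show "(\<integral>x. indicator (box p q) x *\<^sub>R indicator (box a b) x *\<^sub>R e x \<partial>lborel) = 0" .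
  qed
  then show ?thesis by eventually_elim (auto simp: indicator_def)
 qed
 obtain I where I: "countable I" "I \<subseteq> Pow \<Omega>" "\<Omega> = \<Union>I" "\<And>X. X \<in> I ==> \<exists>a b. X = box a b"
 proof -
  define a' :: "('a => real \<times> real) => 'a" where "a' f = (\<Sum>(i::'a)\<in>Basis. fst (f i) *\<^sub>R i)" for f
  define b' :: "('a => real \<times> real) => 'a" where "b' f = (\<Sum>(i::'a)\<in>Basis. snd (f i) *\<^sub>R i)" for f
  define J where "J = {f\<in>Basis \<rightarrow>\<^sub>E \<rat> \<times> \<rat>. box (a' f) (b' f) \<subseteq> \<Omega>}"
  have "countable J" unfolding J_def
   by (rule countable_Collect) (auto intro!: countable_PiE countable_rat)
  moreover have "\<Omega> = (\<Union>f\<in>J. box (a' f) (b' f))"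
   unfolding J_def a'_def b'_def by (rule open_UNION_box[OF \<Omega>])
  moreover have "(\<lambda>f. box (a' f) (b' f)) ` J \<subseteq> Pow \<Omega>" by (auto simp: J_def)
  ultimately show ?thesis
   by (intro that[of "(\<lambda>f. box (a' f) (b' f)) ` J"]) (blast intro: countable_image)+
 qed
 have "AE x in lborel. \<forall>X\<in>I. x \<in> X --> e x = 0"
 proof (subst AE_ball_countable[OF I(1)], intro ballI)
  fix X assume "X \<in> I"
  then obtain a b where "X = box a b" using I(4) by blast
  moreover have "X \<subseteq> \<Omega>" using I(2) \<open>X \<in> I\<close> by (rule subsetD[THEN PowD])
  ultimately have "X = box a b" "box a b \<subseteq> \<Omega>" by simp_all
  then show "AE x in lborel. x \<in> X --> e x = 0" using zero by simp
 qed
 with e(2) have "AE x in lborel. x \<in> \<Omega> --> d x = 0"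
 proof eventually_elim
  case (elim x)
  show ?case
  proof
   assume x: "x \<in> \<Omega>"
   then obtain X where "X \<in> I" "x \<in> X" using I(3) by (metis UnionE)
   then show "d x = 0" using elim x by simp
  qed
 qed
 then have "AE x in lebesgue. x \<in> \<Omega> --> d x = 0" by (rule AE_completion)
 then show ?thesis using \<Omega>l by (simp add: AE_restrict_space_iff)
qed

section \<open>Square-integrable functions and Sobolev norms\<close>

lemma L2_measurable: "f \<in> L2 \<Omega> ==> f \<in> borel_measurable (lebesgue_on \<Omega>)"
 and L2_integrable_sq: "f \<in> L2 \<Omega> ==> integrable (lebesgue_on \<Omega>) (\<lambda>x. (cmod (f x))^2)"
 by (auto simp: L2_def)

lemma L2I: "f \<in> borel_measurable (lebesgue_on \<Omega>) ==> integrable (lebesgue_on \<Omega>) (\<lambda>x. (cmod (f x))^2) ==> f \<in> L2 \<Omega>"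
 by (auto simp: L2_def)

lemma L2_mult_integrable:
 assumes "f \<in> L2 \<Omega>" "g \<in> L2 \<Omega>"
 shows "integrable (lebesgue_on \<Omega>) (\<lambda>x. f x * g x)"
proof (rule Bochner_Integration.integrable_bound)
 show "integrable (lebesgue_on \<Omega>) (\<lambda>x. (cmod (f x))^2 + (cmod (g x))^2)"
  using assms by (intro Bochner_Integration.integrable_add L2_integrable_sq)
 show "(\<lambda>x. f x * g x) \<in> borel_measurable (lebesgue_on \<Omega>)"
  using assms[THEN L2_measurable] by measurable
 have "cmod a * cmod b \<le> (cmod a)^2 + (cmod b)^2" for a b
 proof -
  have "0 \<le> cmod a * cmod b" by simp
  then show ?thesis using sum_squares_bound[of "cmod a" "cmod b"] by linarith
 qed
 then show "AE x in lebesgue_on \<Omega>. norm (f x * g x) \<le> norm ((cmod (f x))^2 + (cmod (g x))^2)"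
  by (simp add: norm_mult)
qed

lemma L2_cnj: "f \<in> L2 \<Omega> ==> (\<lambda>x. cnj (f x)) \<in> L2 \<Omega>"
 by (auto simp: L2_def intro: borel_measurable_continuous_on[OF continuous_on_cnj[OF continuous_on_id]])

lemma L2_add:
 assumes "f \<in> L2 \<Omega>" "g \<in> L2 \<Omega>"
 shows "(\<lambda>x. f x + g x) \<in> L2 \<Omega>"
proof (rule L2I)
 show m: "(\<lambda>x. f x + g x) \<in> borel_measurable (lebesgue_on \<Omega>)"
  using assms[THEN L2_measurable] by measurable
 show "integrable (lebesgue_on \<Omega>) (\<lambda>x. (cmod (f x + g x))^2)"
 proof (rule Bochner_Integration.integrable_bound)
  show "integrable (lebesgue_on \<Omega>) (\<lambda>x. 2 * (cmod (f x))^2 + 2 * (cmod (g x))^2)"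
   using assms by (intro Bochner_Integration.integrable_add integrable_mult_right L2_integrable_sq)
  show "(\<lambda>x. (cmod (f x + g x))^2) \<in> borel_measurable (lebesgue_on \<Omega>)" using m by measurable
  have "(cmod (a + b))^2 \<le> 2 * (cmod a)^2 + 2 * (cmod b)^2" for a b
  proof -
   have "(cmod (a + b))^2 \<le> (cmod a + cmod b)^2" by (intro power_mono norm_triangle_ineq) simp
   also have "\<dots> \<le> 2 * (cmod a)^2 + 2 * (cmod b)^2"
    using sum_squares_bound[of "cmod a" "cmod b"] by (simp add: power2_sum)
   finally show ?thesis .
  qed
  then show "AE x in lebesgue_on \<Omega>. norm ((cmod (f x + g x))^2) \<le> norm (2 * (cmod (f x))^2 + 2 * (cmod (g x))^2)"
   by simp
 qed
qed

lemma L2_bounded_mult: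
 assumes f: "f \<in> L2 \<Omega>" and b: "b \<in> borel_measurable (lebesgue_on \<Omega>)" and M: "\<And>x. x \<in> \<Omega> ==> cmod (b x) \<le> M"
 shows "(\<lambda>x. b x * f x) \<in> L2 \<Omega>"
proof (rule L2I)
 show m: "(\<lambda>x. b x * f x) \<in> borel_measurable (lebesgue_on \<Omega>)"
  using f[THEN L2_measurable] b by measurable
 show "integrable (lebesgue_on \<Omega>) (\<lambda>x. (cmod (b x * f x))^2)"
 proof (rule Bochner_Integration.integrable_bound)
  show "integrable (lebesgue_on \<Omega>) (\<lambda>x. M^2 * (cmod (f x))^2)"
   using f by (intro integrable_mult_right L2_integrable_sq)
  show "(\<lambda>x. (cmod (b x * f x))^2) \<in> borel_measurable (lebesgue_on \<Omega>)" using m by measurable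
  show "AE x in lebesgue_on \<Omega>. norm ((cmod (b x * f x))^2) \<le> norm (M^2 * (cmod (f x))^2)"
   using M by (intro AE_I2) (auto simp: norm_mult power_mult_distrib space_restrict_space intro!: mult_right_mono power_mono)
 qed
qed

lemma L2_scale: "f \<in> L2 \<Omega> ==> (\<lambda>x. c * f x) \<in> L2 \<Omega>"
 by (rule L2_bounded_mult[where M="cmod c"]) auto

lemma L2_diff: "f \<in> L2 \<Omega> ==> g \<in> L2 \<Omega> ==> (\<lambda>x. f x - g x) \<in> L2 \<Omega>"
 using L2_add[of f \<Omega> "\<lambda>x. (-1) * g x"] L2_scale[of g \<Omega> "-1"] by simp

lemma L2_norm_nonneg [simp]: "0 \<le> L2_norm \<Omega> f"
 by (simp add: L2_norm_def)

lemma L2_norm_sq: "(L2_norm \<Omega> f)^2 = (\<integral>x. (cmod (f x))^2 \<partial>lebesgue_on \<Omega>)"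
 by (simp add: L2_norm_def)

lemma L2_nn_integral:
 "f \<in> L2 \<Omega> ==> (\<integral>\<^sup>+x. ennreal ((cmod (f x))^2) \<partial>lebesgue_on \<Omega>) = ennreal ((L2_norm \<Omega> f)^2)"
 unfolding L2_norm_sq by (rule nn_integral_eq_integral) (auto simp: L2_def)

lemma L2_from_nn_integral:
 assumes "f \<in> borel_measurable (lebesgue_on \<Omega>)" "(\<integral>\<^sup>+x. ennreal ((cmod (f x))^2) \<partial>lebesgue_on \<Omega>) \<le> ennreal (M^2)" "0 \<le> M"
 shows "f \<in> L2 \<Omega>" "L2_norm \<Omega> f \<le> M"
proof -
 have "(\<integral>\<^sup>+x. ennreal (norm ((cmod (f x))^2)) \<partial>lebesgue_on \<Omega>) < \<infinity>"
  using assms(2) by (simp add: le_less_trans)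
 then show f: "f \<in> L2 \<Omega>" using assms(1) by (intro L2I integrableI_bounded) auto
 have "(L2_norm \<Omega> f)^2 \<le> M^2" using assms(2) L2_nn_integral[OF f] by simp
 then show "L2_norm \<Omega> f \<le> M" using assms(3) power2_le_imp_le by blast
qed

lemma L2_norm_mono:
 assumes g: "g \<in> L2 \<Omega>" and f: "f \<in> borel_measurable (lebesgue_on \<Omega>)"
  and le: "\<And>x. x \<in> \<Omega> ==> cmod (f x) \<le> M * cmod (g x)" and M: "M \<ge> 0"
 shows "f \<in> L2 \<Omega>" "L2_norm \<Omega> f \<le> M * L2_norm \<Omega> g"
proof -
 have "(\<integral>\<^sup>+x. ennreal ((cmod (f x))^2) \<partial>lebesgue_on \<Omega>) \<le> (\<integral>\<^sup>+x. ennreal (M^2) * ennreal ((cmod (g x))^2) \<partial>lebesgue_on \<Omega>)"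
 proof (rule nn_integral_mono)
  fix x assume "x \<in> space (lebesgue_on \<Omega>)"
  then have "(cmod (f x))^2 \<le> (M * cmod (g x))^2" by (intro power_mono le) (auto simp: space_restrict_space)
  then show "ennreal ((cmod (f x))^2) \<le> ennreal (M^2) * ennreal ((cmod (g x))^2)"
   by (simp add: ennreal_mult[symmetric] power_mult_distrib)
 qed
 also have "\<dots> = ennreal (M^2) * (\<integral>\<^sup>+x. ennreal ((cmod (g x))^2) \<partial>lebesgue_on \<Omega>)"
  using L2_measurable[OF g] by (intro nn_integral_cmult) measurable
 also have "\<dots> = ennreal ((M * L2_norm \<Omega> g)^2)"
  by (simp add: L2_nn_integral[OF g] ennreal_mult[symmetric] power_mult_distrib)
 finally show "f \<in> L2 \<Omega>" "L2_norm \<Omega> f \<le> M * L2_norm \<Omega> g"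
  using L2_from_nn_integral[OF f, of "M * L2_norm \<Omega> g"] M by auto
qed

lemma L2_Cauchy_Schwarz_abs:
 assumes f: "f \<in> L2 \<Omega>" and g: "g \<in> L2 \<Omega>"
 shows "(\<integral>x. cmod (f x * g x) \<partial>lebesgue_on \<Omega>) \<le> L2_norm \<Omega> f * L2_norm \<Omega> g"
proof -
 have i: "integrable (lebesgue_on \<Omega>) (\<lambda>x. cmod (f x * g x))" using L2_mult_integrable[OF f g] by simp
 have m: "(\<lambda>x. ennreal (cmod (f x))) \<in> borel_measurable (lebesgue_on \<Omega>)"
   "(\<lambda>x. ennreal (cmod (g x))) \<in> borel_measurable (lebesgue_on \<Omega>)"
  using f[THEN L2_measurable] g[THEN L2_measurable] by measurable
 have "ennreal ((\<integral>x. cmod (f x * g x) \<partial>lebesgue_on \<Omega>)^2) = (\<integral>\<^sup>+x. ennreal (cmod (f x)) * ennreal (cmod (g x)) \<partial>lebesgue_on \<Omega>)^2"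
  using nn_integral_eq_integral[OF i] by (simp add: norm_mult ennreal_mult ennreal_power[symmetric])
 also have "\<dots> \<le> (\<integral>\<^sup>+x. (ennreal (cmod (f x)))^2 \<partial>lebesgue_on \<Omega>) * (\<integral>\<^sup>+x. (ennreal (cmod (g x)))^2 \<partial>lebesgue_on \<Omega>)"
  by (rule Cauchy_Schwarz_nn_integral[OF m])
 also have "\<dots> = ennreal ((L2_norm \<Omega> f * L2_norm \<Omega> g)^2)"
  using L2_nn_integral[OF f] L2_nn_integral[OF g] by (simp add: ennreal_power ennreal_mult power_mult_distrib)
 finally have "(\<integral>x. cmod (f x * g x) \<partial>lebesgue_on \<Omega>)^2 \<le> (L2_norm \<Omega> f * L2_norm \<Omega> g)^2"
  by simp
 then show ?thesis by (rule power2_le_imp_le) simp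
qed

lemma L2_Cauchy_Schwarz:
 assumes "f \<in> L2 \<Omega>" "g \<in> L2 \<Omega>"
 shows "cmod (\<integral>x. f x * g x \<partial>lebesgue_on \<Omega>) \<le> L2_norm \<Omega> f * L2_norm \<Omega> g"
 using L2_Cauchy_Schwarz_abs[OF assms] integral_norm_bound[of "lebesgue_on \<Omega>" "\<lambda>x. f x * g x"] by linarith

lemma L2_norm_cong_AE:
 assumes "f \<in> L2 \<Omega>" "g \<in> L2 \<Omega>" "AE x in lebesgue_on \<Omega>. f x - g x = 0"
 shows "L2_norm \<Omega> f = L2_norm \<Omega> g"
proof -
 have "(\<integral>x. (cmod (f x))^2 \<partial>lebesgue_on \<Omega>) = (\<integral>x. (cmod (g x))^2 \<partial>lebesgue_on \<Omega>)"
  by (rule integral_cong_AE) (use assms in \<open>auto dest: L2_integrable_sq\<close>)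
 then show ?thesis by (simp add: L2_norm_def)
qed

lemma L2_integrable:
 assumes "open \<Omega>" "bounded \<Omega>" "f \<in> L2 \<Omega>"
 shows "integrable (lebesgue_on \<Omega>) f"
proof -
 have "integrable (lebesgue_on \<Omega>) (\<lambda>x. 1::real)"
  using finite_measure.integrable_const[OF finite_measure_lebesgue_on[OF lmeasurable_open[OF assms(2,1)]]] .
 then have "(\<lambda>x. 1) \<in> L2 \<Omega>" by (intro L2I) auto
 from L2_mult_integrable[OF assms(3) this] show ?thesis by simp
qed

lemma test_function_L2:
 assumes "open \<Omega>" "test_function \<Omega> \<phi>"
 shows "\<phi> \<in> L2 \<Omega>"
proof -
 from assms(2) have p: "test_function \<Omega> (\<lambda>x. cnj (\<phi> x) * \<phi> x)"
  using test_function_cnj[OF assms(2)]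
  by (intro test_function_mult[OF assms(1)] smooth_imp_smooth_on) (auto simp: test_function_def)
 have "integrable (lebesgue_on \<Omega>) (\<lambda>x. Re (cnj (\<phi> x) * \<phi> x))"
  using integrable_Re[OF test_function_integrable(1)[OF p assms(1)]] .
 moreover have "Re (cnj z * z) = (cmod z)^2" for z by (simp add: cmod_power2) (simp add: power2_eq_square)
 ultimately show ?thesis
  using test_function_integrable(1)[OF assms(2,1)] by (intro L2I) auto
qed

lemma continuous_on_measurable_lebesgue_on:
 assumes "open \<Omega>" "continuous_on \<Omega> f"
 shows "f \<in> borel_measurable (lebesgue_on \<Omega>)"
 using assms by (simp add: continuous_imp_measurable_on_sets_lebesgue)

text \<open>The Sobolev norm is defined through a choice of weak derivatives; this makes it computable from any other one.\<close>

lemma weak_derivative_unique: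
 assumes \<Omega>: "open \<Omega>" "bounded \<Omega>" and g: "g1 \<in> L2 \<Omega>" "g2 \<in> L2 \<Omega>"
  and w: "is_weak_derivative \<Omega> \<alpha> f g1" "is_weak_derivative \<Omega> \<alpha> f g2"
 shows "L2_norm \<Omega> g1 = L2_norm \<Omega> g2"
proof (rule L2_norm_cong_AE[OF g])
 obtain bs where bs: "mset bs = \<alpha>" using ex_mset by blast
 show "AE x in lebesgue_on \<Omega>. g1 x - g2 x = 0"
 proof (rule fundamental_lemma[OF \<Omega>(1)])
  show "integrable (lebesgue_on \<Omega>) (\<lambda>x. g1 x - g2 x)"
   by (intro Bochner_Integration.integrable_diff L2_integrable \<Omega> g)
  fix \<phi> assume \<phi>: "test_function \<Omega> \<phi>"
  have "(\<integral>x. (g1 x - g2 x) * \<phi> x \<partial>lebesgue_on \<Omega>) = (\<integral>x. g1 x * \<phi> x \<partial>lebesgue_on \<Omega>) - (\<integral>x. g2 x * \<phi> x \<partial>lebesgue_on \<Omega>)"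
   by (simp add: left_diff_distrib L2_mult_integrable g test_function_L2[OF \<Omega>(1) \<phi>])
  also have "\<dots> = 0"
   using w[unfolded is_weak_derivative_def, rule_format, of bs \<phi>] bs \<phi> by simp
  finally show "(\<integral>x. (g1 x - g2 x) * \<phi> x \<partial>lebesgue_on \<Omega>) = 0" .
 qed
qed

lemma weak_derivative_props:
 assumes "g \<in> L2 \<Omega>" "is_weak_derivative \<Omega> \<alpha> f g"
 shows "weak_derivative \<Omega> \<alpha> f \<in> L2 \<Omega>" "is_weak_derivative \<Omega> \<alpha> f (weak_derivative \<Omega> \<alpha> f)"
 using someI[of "\<lambda>g. g \<in> L2 \<Omega> \<and> is_weak_derivative \<Omega> \<alpha> f g" g] assms
 by (auto simp: weak_derivative_def)

lemma weak_derivative_smooth: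
 assumes \<Omega>: "open \<Omega>" "bounded \<Omega>" and f: "smooth_on \<Omega> f" and bs: "set bs \<subseteq> Basis" "partials bs f \<in> L2 \<Omega>"
 shows "L2_norm \<Omega> (weak_derivative \<Omega> (mset bs) f) = L2_norm \<Omega> (partials bs f)"
 using weak_derivative_unique[OF \<Omega>] weak_derivative_props[OF bs(2)]
  is_weak_derivative_partials[OF \<Omega>(1) f bs(1)] bs(2) by blast

lemma finite_multi_indices: "finite (multi_indices k :: 'a::euclidean_space multiset set)"
proof -
 have "multi_indices k \<subseteq> mset ` {bs :: 'a list. set bs \<subseteq> Basis \<and> length bs \<le> k}"
 proof
  fix \<alpha> :: "'a multiset" assume a: "\<alpha> \<in> multi_indices k"
  obtain bs where "mset bs = \<alpha>" using ex_mset by blast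
  then show "\<alpha> \<in> mset ` {bs. set bs \<subseteq> Basis \<and> length bs \<le> k}"
   using a by (auto simp: multi_indices_def intro!: image_eqI[of _ _ bs])
 qed
 then show ?thesis by (rule finite_subset) (simp add: finite_lists_length_le)
qed

text \<open>For a function that is smooth inside \<open>\<Omega>\<close> the classical derivatives are weak ones, so the
Sobolev norm can be read off from them.\<close>

lemma sobolev_smoothI:
 fixes \<Omega> :: "'a::euclidean_space set"
 assumes \<Omega>: "open \<Omega>" "bounded \<Omega>" and f: "smooth_on \<Omega> f"
  and D: "\<And>bs. set bs \<subseteq> Basis ==> length bs \<le> k ==> partials bs f \<in> L2 \<Omega> \<and> L2_norm \<Omega> (partials bs f) \<le> M"
 shows "f \<in> sobolev \<Omega> k"
  "sobolev_norm \<Omega> k f \<le> sqrt (card (multi_indices k :: 'a::euclidean_space multiset set)) * M"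
proof -
 have ex: "\<exists>bs. mset bs = \<alpha> \<and> set bs \<subseteq> Basis \<and> length bs \<le> k" if "\<alpha> \<in> multi_indices k" for \<alpha> :: "'a multiset"
 proof -
  obtain bs where "mset bs = \<alpha>" using ex_mset by blast
  then show ?thesis using that by (auto simp: multi_indices_def)
 qed
 show "f \<in> sobolev \<Omega> k"
  unfolding sobolev_def
 proof (intro CollectI conjI ballI)
  show "f \<in> L2 \<Omega>" using D[of "[]"] by simp
  fix \<alpha> :: "'a multiset" assume "\<alpha> \<in> multi_indices k"
  then obtain bs where bs: "mset bs = \<alpha>" "set bs \<subseteq> Basis" "length bs \<le> k" using ex by blast
  then show "\<exists>g\<in>L2 \<Omega>. is_weak_derivative \<Omega> \<alpha> f g"
   using is_weak_derivative_partials[OF \<Omega>(1) f bs(2)] D[OF bs(2,3)] by blast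
 qed
 have M: "0 \<le> M" using D[of "[]"] order_trans[OF L2_norm_nonneg[of \<Omega> f]] by simp
 have "(\<Sum>\<alpha>\<in>multi_indices k. (L2_norm \<Omega> (weak_derivative \<Omega> \<alpha> f))^2) \<le> of_nat (card (multi_indices k :: 'a multiset set)) * M^2"
 proof (rule sum_bounded_above)
  fix \<alpha> :: "'a multiset" assume "\<alpha> \<in> multi_indices k"
  then obtain bs where bs: "mset bs = \<alpha>" "set bs \<subseteq> Basis" "length bs \<le> k" using ex by blast
  show "(L2_norm \<Omega> (weak_derivative \<Omega> \<alpha> f))^2 \<le> M^2"
   using weak_derivative_smooth[OF \<Omega> f bs(2)] D[OF bs(2,3)] bs(1) by (intro power_mono) auto
 qed
 then have "sobolev_norm \<Omega> k f \<le> sqrt (of_nat (card (multi_indices k :: 'a multiset set)) * M^2)"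
  unfolding sobolev_norm_def by (rule real_sqrt_le_mono)
 then show "sobolev_norm \<Omega> k f \<le> sqrt (card (multi_indices k :: 'a multiset set)) * M"
  using M by (simp add: real_sqrt_mult)
qed

lemma weak_derivative_le_sobolev_norm:
 fixes \<Omega> :: "'a::euclidean_space set"
 assumes "\<alpha> \<in> multi_indices k"
 shows "L2_norm \<Omega> (weak_derivative \<Omega> \<alpha> f) \<le> sobolev_norm \<Omega> k f"
proof -
 have "(L2_norm \<Omega> (weak_derivative \<Omega> \<alpha> f))^2 \<le> (\<Sum>\<alpha>\<in>multi_indices k. (L2_norm \<Omega> (weak_derivative \<Omega> \<alpha> f))^2)"
  by (rule member_le_sum[OF assms]) (auto simp: finite_multi_indices)
 then show ?thesis unfolding sobolev_norm_def by (rule real_le_rsqrt)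
qed

section \<open>Holomorphic functions of several variables\<close>

lemma norm_cscaleV: "norm (c *s (v::complex^'n)) = cmod c * norm v"
 by (simp add: norm_vec_def norm_mult L2_set_right_distrib)

lemma bounded_linear_cscaleV: "bounded_linear (\<lambda>h. h *s (v::complex^'n))"
 by (rule bounded_linear_intro[where K="norm v"])
  (auto simp: norm_cscaleV vec_eq_iff algebra_simps)

lemma bounded_linear_cscaleV_right: "bounded_linear (\<lambda>v::complex^'n. c *s v)"
 by (rule bounded_linear_intro[where K="cmod c"])
  (auto simp: norm_cscaleV vec_eq_iff algebra_simps)

lemma holo_has_derivative:
 assumes "holomorphic_fun_on f \<Omega>" "z \<in> \<Omega>"
 shows "(f has_derivative der f z) (at z)"
  and "der f z (c *s v) = c * der f z v"
proof -
 obtain f' where f': "(f has_derivative f') (at z)" "\<And>c v. f' (c *s v) = c * f' v"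
  using assms unfolding holomorphic_fun_on_def by blast
 have "f' = der f z" by (rule frechet_derivative_at[OF f'(1)])
 with f' show "(f has_derivative der f z) (at z)"
  and "der f z (c *s v) = c * der f z v" by simp_all
qed

lemma holoI:
 assumes "\<And>z. z \<in> \<Omega> ==> (f has_derivative f' z) (at z)" "\<And>z c v. z \<in> \<Omega> ==> f' z (c *s v) = c * f' z v"
 shows "holomorphic_fun_on f \<Omega>"
 unfolding holomorphic_fun_on_def using assms by blast

lemma holo_continuous_on: "holomorphic_fun_on f \<Omega> ==> continuous_on \<Omega> f"
 by (intro continuous_at_imp_continuous_on ballI has_derivative_continuous[OF holo_has_derivative(1)])

lemma holo_cong:
 assumes "open \<Omega>" "holomorphic_fun_on f \<Omega>" "\<And>z. z \<in> \<Omega> ==> f z = g z"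
 shows "holomorphic_fun_on g \<Omega>"
proof (rule holoI)
 fix z assume z: "z \<in> \<Omega>"
 show "(g has_derivative der f z) (at z)"
  by (rule has_derivative_transform_within_open[OF holo_has_derivative(1)[OF assms(2) z] assms(1) z])
   (simp add: assms(3))
 show "der f z (c *s v) = c * der f z v" for c v
  by (rule holo_has_derivative(2)[OF assms(2) z])
qed

text \<open>Restricting to complex lines makes one-variable theory available.\<close>

lemma holo_line_derivative:
 assumes f: "holomorphic_fun_on f \<Omega>" and z: "z + \<zeta> *s v \<in> \<Omega>"
 shows "((\<lambda>\<zeta>. f (z + \<zeta> *s v)) has_field_derivative der f (z + \<zeta> *s v) v) (at \<zeta>)"
proof -
 have "((\<lambda>\<zeta>. z + \<zeta> *s v) has_derivative (\<lambda>h. h *s v)) (at \<zeta>)"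
  using has_derivative_add[OF has_derivative_const bounded_linear_imp_has_derivative[OF bounded_linear_cscaleV[of v]], of z "at \<zeta>"] by simp
 from diff_chain_at[OF this holo_has_derivative(1)[OF f z]]
 show ?thesis
  by (simp add: o_def has_field_derivative_def holo_has_derivative(2)[OF f z] mult_commute_abs)
qed

lemma holo_line:
 assumes "holomorphic_fun_on f \<Omega>" "\<And>\<zeta>. \<zeta> \<in> S ==> z + \<zeta> *s v \<in> \<Omega>"
 shows "(\<lambda>\<zeta>. f (z + \<zeta> *s v)) holomorphic_on S"
 unfolding holomorphic_on_def
proof
 fix \<zeta> assume "\<zeta> \<in> S"
 then show "(\<lambda>\<zeta>. f (z + \<zeta> *s v)) field_differentiable at \<zeta> within S"
  using has_field_derivative_at_within[OF holo_line_derivative[OF assms(1) assms(2)]]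
  unfolding field_differentiable_def by blast
qed

text \<open>Cauchy's estimate on the complex line through \<open>z\<close> in direction \<open>v\<close>.\<close>

lemma deriv_bound_on_ball:
 assumes f: "holomorphic_fun_on f \<Omega>" and R: "R > 0" "cball z R \<subseteq> \<Omega>" and M: "\<And>w. w \<in> cball z R ==> cmod (f w) \<le> M"
 shows "cmod (der f z v) \<le> M / R * norm v"
proof (cases "v = 0")
 case True
 have "z \<in> \<Omega>" using R centre_in_cball[of z R] by (simp add: subset_iff)
 from linear_0[OF has_derivative_linear[OF holo_has_derivative(1)[OF f this]]] True
 show ?thesis by simp
next
 case False
 define r where "r = R / norm v"
 have r: "r > 0" using False R by (simp add: r_def)
 have inn: "z + \<zeta> *s v \<in> cball z R" if "\<zeta> \<in> cball 0 r" for \<zeta>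
 proof -
  have "cmod \<zeta> * norm v \<le> r * norm v" using that by (intro mult_right_mono) auto
  then show ?thesis using False by (simp add: dist_norm norm_cscaleV r_def)
 qed
 let ?g = "\<lambda>\<zeta>. f (z + \<zeta> *s v)"
 have hol: "?g holomorphic_on (cball 0 r)" by (rule holo_line[OF f]) (use inn R in auto)
 have "cmod ((deriv ^^ 1) ?g 0) \<le> fact 1 * M / r ^ 1"
 proof (rule Cauchy_inequality)
  show "?g holomorphic_on ball 0 r" using hol by (rule holomorphic_on_subset) auto
  show "continuous_on (cball 0 r) ?g" using hol by (rule holomorphic_on_imp_continuous_on)
  show "cmod (?g x) \<le> M" if "cmod (0 - x) = r" for x using that inn[of x] M by auto
 qed (rule r)
 moreover have "deriv ?g 0 = der f z v"
 proof -
  have "z \<in> \<Omega>" using R centre_in_cball[of z R] by (simp add: subset_iff)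
  then show ?thesis using DERIV_imp_deriv[OF holo_line_derivative[OF f, of z 0 v]] by simp
 qed
 ultimately show ?thesis using False R by (simp add: r_def)
qed

text \<open>Weierstrass: Cauchy's estimate for \<open>F n - F m\<close> turns uniform convergence of the functions into
uniform convergence of their derivatives on a smaller ball.\<close>

lemma holo_limit_ball:
 fixes F :: "nat => complex^'n => complex"
 assumes F: "\<And>n. holomorphic_fun_on (F n) \<Omega>" and r: "r > 0" "cball z r \<subseteq> \<Omega>"
  and lim: "uniform_limit (cball z r) F f sequentially"
 shows "\<exists>f'. (f has_derivative f') (at z) \<and> (\<forall>c v. f' (c *s v) = c * f' v)"
proof -
 let ?S = "ball z (r/2)"
 define D where "D n x = der (F n) x" for n x
 have S: "?S \<subseteq> \<Omega>" using r by (auto simp: subset_eq)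
 have derF: "(F n has_derivative D n x) (at x)" if "x \<in> ?S" for n x
  unfolding D_def by (rule holo_has_derivative(1)[OF F]) (use that S in auto)
 have sub: "cball x (r/2) \<subseteq> cball z r" if "x \<in> ?S" for x
 proof
  fix y assume "y \<in> cball x (r/2)"
  then show "y \<in> cball z r" using that dist_triangle[of z y x] by (simp add: dist_commute)
 qed
 have cau: "\<forall>\<^sub>F n in sequentially. \<forall>m\<ge>n. \<forall>x\<in>?S. \<forall>h. cmod (D n x h - D m x h) \<le> e * norm h" if e: "e > 0" for e
 proof -
  have "e * r / 8 > 0" using e r by simp
  then have "\<forall>\<^sub>F n in sequentially. \<forall>x\<in>cball z r. dist (F n x) (f x) < e * r / 8"
   using lim unfolding uniform_limit_iff by blast
  then obtain N where N: "\<And>n x. n \<ge> N ==> x \<in> cball z r ==> dist (F n x) (f x) < e * r / 8"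
   unfolding eventually_sequentially by blast
  have "cmod (D n x h - D m x h) \<le> e * norm h" if nm: "n \<ge> N" "m \<ge> n" and x: "x \<in> ?S" for n m x h
  proof -
   let ?G = "\<lambda>w. F n w - F m w"
   have G: "holomorphic_fun_on ?G \<Omega>"
   proof (rule holoI)
    fix w assume w: "w \<in> \<Omega>"
    show "(?G has_derivative (\<lambda>h. der (F n) w h - der (F m) w h)) (at w)"
     by (intro has_derivative_diff holo_has_derivative(1)[OF F w])
    show "der (F n) w (c *s v) - der (F m) w (c *s v)
     = c * (der (F n) w v - der (F m) w v)" for c v
     by (simp add: holo_has_derivative(2)[OF F w] right_diff_distrib)
   qed
   have *: "cmod (?G w) \<le> e * r / 4" if "w \<in> cball x (r/2)" for w
   proof -
    have w: "w \<in> cball z r" using that sub[OF x] by blast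
    have "dist (F n w) (F m w) \<le> dist (F n w) (f w) + dist (F m w) (f w)" by (rule dist_triangle2)
    also have "\<dots> \<le> e * r / 8 + e * r / 8" using N[OF _ w, of n] N[OF _ w, of m] nm by fastforce
    finally show ?thesis by (simp add: dist_norm)
   qed
   have "r / 2 > 0" using r by simp
   have "cmod (der ?G x h) \<le> e * r / 4 / (r / 2) * norm h"
    by (rule deriv_bound_on_ball[OF G \<open>r / 2 > 0\<close> order_trans[OF sub[OF x] r(2)]]) (rule *)
   also have "\<dots> = e / 2 * norm h" using r by simp
   also have "\<dots> \<le> e * norm h" using e by (intro mult_right_mono) auto
   finally have "cmod (der ?G x h) \<le> e * norm h" .
   moreover have "der ?G x = (\<lambda>h. D n x h - D m x h)"
    by (rule frechet_derivative_at[symmetric]) (intro has_derivative_diff derF x)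
   ultimately show ?thesis by simp
  qed
  then show ?thesis unfolding eventually_sequentially by blast
 qed
 define g' where "g' x h = lim (\<lambda>n. D n x h)" for x h
 have conv: "(\<lambda>n. D n x h) \<longlonglongrightarrow> g' x h" if x: "x \<in> ?S" for x h
 proof -
  have "Cauchy (\<lambda>n. D n x h)"
  proof (rule CauchyI')
   fix e :: real assume e: "e > 0"
   then have "e / (norm h + 1) > 0" by (simp add: add_nonneg_pos)
   from cau[OF this] obtain N where N: "\<And>n m. n \<ge> N ==> m \<ge> n ==> cmod (D n x h - D m x h) \<le> e / (norm h + 1) * norm h"
    using x unfolding eventually_sequentially by blast
   have "e / (norm h + 1) * norm h < e" using e by (simp add: divide_simps add_nonneg_pos)
   then have "dist (D m x h) (D n x h) < e" if "m \<ge> N" "n > m" for m n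
    using N[OF that(1) less_imp_le[OF that(2)]] by (simp add: dist_norm)
   then show "\<exists>M. \<forall>m\<ge>M. \<forall>n>m. dist (D m x h) (D n x h) < e" by blast
  qed
  then show ?thesis unfolding g'_def by (simp add: Cauchy_convergent_iff convergent_LIMSEQ_iff)
 qed
 have "\<exists>g. \<forall>x\<in>?S. (\<lambda>n. F n x) \<longlonglongrightarrow> g x \<and> (g has_derivative g' x) (at x within ?S)"
 proof (rule has_derivative_sequence)
  show "convex ?S" by simp
  show "(F n has_derivative D n x) (at x within ?S)" if "x \<in> ?S" for n x
   using derF[OF that] by (rule has_derivative_at_withinI)
  show "\<forall>\<^sub>F n in sequentially. \<forall>x\<in>?S. \<forall>h. cmod (D n x h - g' x h) \<le> e * norm h" if e: "e > 0" for e
   using cau[OF e]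
  proof eventually_elim
   case (elim n)
   show ?case
   proof (intro ballI allI)
    fix x h assume x: "x \<in> ?S"
    have "(\<lambda>m. cmod (D n x h - D m x h)) \<longlonglongrightarrow> cmod (D n x h - g' x h)"
     by (intro tendsto_intros conv x)
    then show "cmod (D n x h - g' x h) \<le> e * norm h"
     by (rule LIMSEQ_le_const2) (use elim x in blast)
   qed
  qed
  show "z \<in> ?S" using r by simp
  show "(\<lambda>n. F n z) \<longlonglongrightarrow> f z"
   by (rule tendsto_uniform_limitI[OF lim]) (use r in simp)
 qed
 then obtain g where g: "\<And>x. x \<in> ?S ==> (\<lambda>n. F n x) \<longlonglongrightarrow> g x" "\<And>x. x \<in> ?S ==> (g has_derivative g' x) (at x within ?S)"
  by blast
 have gf: "g x = f x" if "x \<in> ?S" for x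
 proof (rule LIMSEQ_unique[OF g(1)[OF that]])
  have "x \<in> cball z r" using that r by auto
  then show "(\<lambda>n. F n x) \<longlonglongrightarrow> f x" by (rule tendsto_uniform_limitI[OF lim])
 qed
 have zS: "z \<in> ?S" using r by simp
 have "(g has_derivative g' z) (at z)" using g(2)[OF zS] at_within_open[OF zS open_ball] by simp
 then have "(f has_derivative g' z) (at z)"
  by (rule has_derivative_transform_within_open[OF _ open_ball zS gf])
 moreover have "g' z (c *s v) = c * g' z v" for c v
 proof (rule LIMSEQ_unique[OF conv[OF zS]])
  have "D n z (c *s v) = c * D n z v" for n
   unfolding D_def by (rule holo_has_derivative(2)[OF F]) (use r in auto)
  then show "(\<lambda>n. D n z (c *s v)) \<longlonglongrightarrow> c * g' z v" by (simp add: tendsto_mult_left conv[OF zS])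
 qed
 ultimately show ?thesis by blast
qed

text \<open>The difference quotients in direction \<open>v\<close> are holomorphic, and by the second-order Taylor
estimate on complex lines they converge locally uniformly; so their limit is holomorphic.\<close>

lemma holo_deriv:
 fixes f :: "complex^'n => complex"
 assumes \<Omega>: "open \<Omega>" and f: "holomorphic_fun_on f \<Omega>"
 shows "holomorphic_fun_on (\<lambda>z. der f z v) \<Omega>"
 unfolding holomorphic_fun_on_def
proof
 fix z assume z: "z \<in> \<Omega>"
 obtain R where R: "R > 0" "cball z R \<subseteq> \<Omega>" using \<Omega> z open_contains_cball by blast
 define r where "r = R / 4"
 define \<rho> where "\<rho> = r / (norm v + 1)"
 have r: "r > 0" using R by (simp add: r_def)
 have \<rho>: "\<rho> > 0" "\<rho> * norm v \<le> r" using r by (simp_all add: \<rho>_def add_nonneg_pos divide_simps)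
 have inn: "x + \<zeta> *s v \<in> cball z R" if "dist z x < 2 * r" "cmod \<zeta> \<le> 2 * \<rho>" for x \<zeta>
 proof -
  have "cmod \<zeta> * norm v \<le> 2 * \<rho> * norm v" using that by (intro mult_right_mono) auto
  then have "dist x (x + \<zeta> *s v) \<le> 2 * r" using \<rho>(2) by (simp add: dist_norm norm_cscaleV)
  then show ?thesis using dist_triangle[of z "x + \<zeta> *s v" x] that by (simp add: r_def)
 qed
 have "bounded (f ` cball z R)"
  by (intro compact_imp_bounded compact_continuous_image continuous_on_subset[OF holo_continuous_on[OF f]] R) simp
 then obtain M where M: "\<And>x. x \<in> cball z R ==> cmod (f x) \<le> M" unfolding bounded_iff by blast
 define B where "B = 2 * M / \<rho> ^ 2"
 define t where "t n = \<rho> / real (n + 2)" for n :: nat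
 have t: "0 < t n" "t n < \<rho>" for n using \<rho> by (simp_all add: t_def divide_simps)
 have quad: "cmod (f (x + of_real s *s v) - (f x + der f x v * of_real s)) \<le> B * s^2"
  if x: "dist z x < 2 * r" and s: "0 < s" "s < \<rho>" for x s
 proof -
  let ?g = "\<lambda>\<zeta>. f (x + \<zeta> *s v)"
  have hol: "?g holomorphic_on (ball 0 (2 * \<rho>))"
   by (rule holo_line[OF f]) (use inn[OF x] R in \<open>auto simp: subset_eq\<close>)
  have hol': "?g holomorphic_on (cball 0 (2 * \<rho>))"
   by (rule holo_line[OF f]) (use inn[OF x] R in \<open>auto simp: subset_eq\<close>)
  have der: "((deriv ^^ i) ?g has_field_derivative (deriv ^^ Suc i) ?g \<zeta>) (at \<zeta> within ball 0 \<rho>)" if "\<zeta> \<in> ball 0 \<rho>" for i \<zeta>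
  proof -
   have "(deriv ^^ i) ?g holomorphic_on ball 0 (2 * \<rho>)" by (rule holomorphic_higher_deriv[OF hol]) simp
   then have "((deriv ^^ i) ?g has_field_derivative deriv ((deriv ^^ i) ?g) \<zeta>) (at \<zeta>)"
    by (rule holomorphic_derivI) (use that \<rho> in auto)
   then show ?thesis by (simp add: has_field_derivative_at_within)
  qed
  have bd: "cmod ((deriv ^^ Suc 1) ?g \<zeta>) \<le> B" if "\<zeta> \<in> ball 0 \<rho>" for \<zeta>
  proof -
   have sub: "cball \<zeta> \<rho> \<subseteq> cball 0 (2 * \<rho>)"
   proof
    fix y assume "y \<in> cball \<zeta> \<rho>"
    then show "y \<in> cball 0 (2 * \<rho>)" using that dist_triangle[of 0 y \<zeta>] by (simp add: dist_commute)
   qed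
   have "cmod ((deriv ^^ 2) ?g \<zeta>) \<le> fact 2 * M / \<rho> ^ 2"
   proof (rule Cauchy_inequality)
    show "?g holomorphic_on ball \<zeta> \<rho>" using hol' sub by (meson ball_subset_cball holomorphic_on_subset order_trans)
    show "continuous_on (cball \<zeta> \<rho>) ?g" using hol' sub by (meson holomorphic_on_imp_continuous_on holomorphic_on_subset)
    show "cmod (?g y) \<le> M" if "cmod (\<zeta> - y) = \<rho>" for y
    proof -
     have "y \<in> cball 0 (2 * \<rho>)" using sub that by (auto simp: dist_norm)
     then show ?thesis by (intro M inn[OF x]) simp
    qed
   qed (rule \<rho>)
   then show ?thesis by (simp add: B_def numeral_2_eq_2)
  qed
  have "cmod ((deriv ^^ 0) ?g (of_real s) - (\<Sum>i\<le>1. (deriv ^^ i) ?g 0 * (of_real s - 0) ^ i / fact i)) \<le> B * cmod (of_real s - 0) ^ Suc 1 / fact 1"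
   by (rule complex_Taylor[where S="ball 0 \<rho>"]) (use der bd s \<rho> in \<open>auto simp del: funpow.simps\<close>)
  moreover have "x \<in> \<Omega>" using inn[OF x, of 0] \<rho> R by auto
  then have "deriv ?g 0 = der f x v"
   using DERIV_imp_deriv[OF holo_line_derivative[OF f, of x 0 v]] by simp
  ultimately show ?thesis by (simp add: power2_eq_square)
 qed
 define F where "F n x = (f (x + of_real (t n) *s v) - f x) / of_real (t n)" for n x
 show "\<exists>f'. ((\<lambda>z. der f z v) has_derivative f') (at z) \<and> (\<forall>c v. f' (c *s v) = c * f' v)"
 proof (rule holo_limit_ball[of F "ball z (2 * r)" r])
  show "cball z r \<subseteq> ball z (2 * r)" using r by auto
  show "holomorphic_fun_on (F n) (ball z (2 * r))" for n
  proof (rule holoI)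
   fix x assume x: "x \<in> ball z (2 * r)"
   have m: "x + of_real (t n) *s v \<in> \<Omega>" "x \<in> \<Omega>"
    using inn[of x "of_real (t n)"] inn[of x 0] x t[of n] \<rho> R by auto
   have "((\<lambda>x. x + of_real (t n) *s v) has_derivative (\<lambda>h. h)) (at x)" by (auto intro!: derivative_eq_intros)
   from diff_chain_at[OF this holo_has_derivative(1)[OF f m(1)]]
   have "((\<lambda>x. f (x + of_real (t n) *s v)) has_derivative der f (x + of_real (t n) *s v)) (at x)"
    by (simp add: o_def)
   then show "(F n has_derivative (\<lambda>h. (der f (x + of_real (t n) *s v) h - der f x h) * inverse (of_real (t n)))) (at x)"
    unfolding F_def divide_inverse
    by (intro has_derivative_mult_left has_derivative_diff holo_has_derivative(1)[OF f m(2)])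
   show "(der f (x + of_real (t n) *s v) (c *s h) - der f x (c *s h)) * inverse (of_real (t n))
    = c * ((der f (x + of_real (t n) *s v) h - der f x h) * inverse (of_real (t n)))" for c h
    by (simp add: holo_has_derivative(2)[OF f m(1)] holo_has_derivative(2)[OF f m(2)] algebra_simps)
  qed
  show "uniform_limit (cball z r) F (\<lambda>z. der f z v) sequentially"
   unfolding uniform_limit_iff
  proof (intro allI impI)
   fix e :: real assume e: "e > 0"
   have "(\<lambda>n. inverse (real (Suc n))) \<longlonglongrightarrow> 0" by (rule LIMSEQ_inverse_real_of_nat)
   from LIMSEQ_Suc[OF this] have "(\<lambda>n. B * (\<rho> * inverse (real (Suc (Suc n))))) \<longlonglongrightarrow> B * (\<rho> * 0)"
    by (intro tendsto_intros)
   then have "(\<lambda>n. B * t n) \<longlonglongrightarrow> 0" by (simp add: t_def divide_inverse add.commute)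
   then have "\<forall>\<^sub>F n in sequentially. B * t n < e" using e by (rule order_tendstoD)
   then show "\<forall>\<^sub>F n in sequentially. \<forall>x\<in>cball z r. dist (F n x) (der f x v) < e"
   proof eventually_elim
    case (elim n)
    show ?case
    proof
     fix x assume "x \<in> cball z r"
     then have x: "dist z x < 2 * r" using r by simp
     have "F n x - der f x v = (f (x + of_real (t n) *s v) - (f x + der f x v * of_real (t n))) / of_real (t n)"
      using t(1)[of n] by (simp add: F_def field_simps)
     then have "dist (F n x) (der f x v) \<le> B * (t n)^2 / t n"
      using quad[OF x t] t(1)[of n] by (simp add: dist_norm norm_divide divide_right_mono)
     also have "\<dots> = B * t n" using t(1)[of n] by (simp add: power2_eq_square)
     finally show "dist (F n x) (der f x v) < e" using elim by simp
    qed
   qed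
  qed
 qed (rule r)
qed

lemma holo_smooth_on:
 fixes f :: "complex^'n => complex"
 assumes \<Omega>: "open \<Omega>" and f: "holomorphic_fun_on f \<Omega>"
 shows "smooth_on \<Omega> f"
proof -
 have "Ck n \<Omega> f" for n
  using f
 proof (induction n arbitrary: f)
  case 0
  show ?case using differentiableI[OF holo_has_derivative(1)[OF 0]] by simp
 next
  case (Suc n)
  show ?case using Suc.IH[OF holo_deriv[OF \<Omega> Suc.prems]] differentiableI[OF holo_has_derivative(1)[OF Suc.prems]] by simp
 qed
 then show ?thesis by (simp add: smooth_on_iff_Ck)
qed

lemma nn_integral_lborel_translate:
 fixes f :: "'a::euclidean_space => ennreal"
 assumes [measurable]: "f \<in> borel_measurable borel"
 shows "(\<integral>\<^sup>+x. f (c + x) \<partial>lborel) = (\<integral>\<^sup>+x. f x \<partial>lborel)"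
  and "(\<integral>\<^sup>+x. f (c - x) \<partial>lborel) = (\<integral>\<^sup>+x. f x \<partial>lborel)"
proof -
 have "(\<integral>\<^sup>+x. f x \<partial>lborel) = (\<integral>\<^sup>+x. f x \<partial>distr lborel borel ((+) c))" by (simp add: lborel_distr_plus)
 also have "\<dots> = (\<integral>\<^sup>+x. f (c + x) \<partial>lborel)" by (rule nn_integral_distr) auto
 finally show "(\<integral>\<^sup>+x. f (c + x) \<partial>lborel) = (\<integral>\<^sup>+x. f x \<partial>lborel)" by simp
 have "(lborel :: 'a measure) = density (distr lborel borel (\<lambda>x. c + (-1) *\<^sub>R x)) (\<lambda>_. ennreal (\<bar>-1\<bar>^DIM('a)))"
  using lborel_affine[of "-1::real" c] by simp
 then have l: "(lborel :: 'a measure) = distr lborel borel (\<lambda>x. c - x)" by (simp add: density_1)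
 have "(\<integral>\<^sup>+x. f x \<partial>lborel) = (\<integral>\<^sup>+x. f x \<partial>distr lborel borel (\<lambda>x. c - x))" using l by metis
 also have "\<dots> = (\<integral>\<^sup>+x. f (c - x) \<partial>lborel)" by (rule nn_integral_distr) auto
 finally show "(\<integral>\<^sup>+x. f (c - x) \<partial>lborel) = (\<integral>\<^sup>+x. f x \<partial>lborel)" by simp
qed

text \<open>The uniqueness argument for Haar measure: multiply \<open>f\<close> by the indicator \<open>g\<close> of the
unit ball, which \<open>U\<close> preserves, in a double integral; Fubini and translation invariance then
replace \<open>f\<close> by \<open>f \<circ> U\<close>.\<close>

lemma nn_integral_linear_isometry:
 fixes f :: "'a::euclidean_space => ennreal" and U V :: "'a => 'a"
 assumes f [measurable]: "f \<in> borel_measurable borel" and U: "linear U" "\<And>x. norm (U x) = norm x" and V: "\<And>x. U (V x) = x"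
 shows "(\<integral>\<^sup>+x. f (U x) \<partial>lborel) = (\<integral>\<^sup>+x. f x \<partial>lborel)"
proof -
 define g where "g = (indicator (ball 0 1) :: 'a => ennreal)"
 have gm [measurable]: "g \<in> borel_measurable borel" unfolding g_def by (rule borel_measurable_indicator) simp
 have "continuous_on UNIV U" using U(1) by (simp add: linear_continuous_on linear_conv_bounded_linear)
 then have [measurable]: "U \<in> borel_measurable borel" by (rule borel_measurable_continuous_onI)
 have gU: "g (U y) = g y" for y :: 'a by (simp add: g_def indicator_def U(2))
 define c where "c = emeasure lborel (ball (0::'a) 1)"
 have c: "c \<noteq> 0" "c \<noteq> \<infinity>"
  using content_ball_pos[of 1 "0::'a"] emeasure_lborel_ball_finite[of "0::'a" 1]
  by (auto simp: c_def measure_def zero_less_measure_iff)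
 have "(\<integral>\<^sup>+x. f x \<partial>lborel) * c = (\<integral>\<^sup>+y. (\<integral>\<^sup>+x. f x \<partial>lborel) * g y \<partial>lborel)"
  unfolding g_def by (subst nn_integral_cmult_indicator) (simp_all add: c_def)
 also have "\<dots> = (\<integral>\<^sup>+y. (\<integral>\<^sup>+x. f (U y + x) * g (U y) \<partial>lborel) \<partial>lborel)"
 proof (rule nn_integral_cong)
  fix y
  have "(\<integral>\<^sup>+x. f (U y + x) * g (U y) \<partial>lborel) = (\<integral>\<^sup>+x. f (U y + x) \<partial>lborel) * g (U y)"
   by (rule nn_integral_multc) measurable
  then show "(\<integral>\<^sup>+x. f x \<partial>lborel) * g y = (\<integral>\<^sup>+x. f (U y + x) * g (U y) \<partial>lborel)"
   by (simp only: nn_integral_lborel_translate(1)[OF f] gU)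
 qed
 also have "\<dots> = (\<integral>\<^sup>+x. (\<integral>\<^sup>+y. f (U y + x) * g (U y) \<partial>lborel) \<partial>lborel)"
  by (rule lborel_pair.Fubini'[symmetric]) measurable
 also have "\<dots> = (\<integral>\<^sup>+x. (\<integral>\<^sup>+y. f (U y) * g (U y - x) \<partial>lborel) \<partial>lborel)"
 proof (rule nn_integral_cong)
  fix x
  have "(\<integral>\<^sup>+y. f (U y + x) * g (U y) \<partial>lborel) = (\<integral>\<^sup>+y. (\<lambda>y. f (U y) * g (U y - x)) (V x + y) \<partial>lborel)"
   by (simp add: linear_add[OF U(1)] V add.commute)
  also have "\<dots> = (\<integral>\<^sup>+y. f (U y) * g (U y - x) \<partial>lborel)"
   by (rule nn_integral_lborel_translate) measurable
  finally show "(\<integral>\<^sup>+y. f (U y + x) * g (U y) \<partial>lborel) = (\<integral>\<^sup>+y. f (U y) * g (U y - x) \<partial>lborel)" .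
 qed
 also have "\<dots> = (\<integral>\<^sup>+y. (\<integral>\<^sup>+x. f (U y) * g (U y - x) \<partial>lborel) \<partial>lborel)"
  by (rule lborel_pair.Fubini') measurable
 also have "\<dots> = (\<integral>\<^sup>+y. f (U y) * (\<integral>\<^sup>+x. g x \<partial>lborel) \<partial>lborel)"
 proof (rule nn_integral_cong)
  fix y
  have "(\<integral>\<^sup>+x. f (U y) * g (U y - x) \<partial>lborel) = f (U y) * (\<integral>\<^sup>+x. g (U y - x) \<partial>lborel)"
   by (rule nn_integral_cmult) measurable
  also have "(\<integral>\<^sup>+x. g (U y - x) \<partial>lborel) = (\<integral>\<^sup>+x. g x \<partial>lborel)"
   by (rule nn_integral_lborel_translate(2)) measurable
  finally show "(\<integral>\<^sup>+x. f (U y) * g (U y - x) \<partial>lborel) = f (U y) * (\<integral>\<^sup>+x. g x \<partial>lborel)" .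
 qed
 also have "\<dots> = (\<integral>\<^sup>+y. f (U y) \<partial>lborel) * c"
  by (subst nn_integral_multc) (simp_all add: c_def g_def)
 finally have "c * (\<integral>\<^sup>+x. f x \<partial>lborel) = c * (\<integral>\<^sup>+x. f (U x) \<partial>lborel)" by (simp add: mult.commute)
 then show ?thesis using c by (simp add: ennreal_mult_cancel_left)
qed

text \<open>Cauchy's formula on the unit circle.\<close>

lemma circle_mean:
 assumes g: "g holomorphic_on (cball 0 1)"
 shows "ennreal (cmod (g 0)) \<le> (\<integral>\<^sup>+t. ennreal (cmod (g (exp (2 * of_real pi * \<i> * of_real t)))) * indicator {0..1} t \<partial>lborel)"
proof -
 let ?e = "\<lambda>t::real. exp (2 * of_real pi * \<i> * of_real t) :: complex"
 have e0: "?e t \<noteq> 0" and e1: "cmod (?e t) = 1" for t by (simp_all add: norm_exp_eq_Re)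
 have "((\<lambda>u. g u / (u - 0)) has_contour_integral (2 * of_real pi * \<i> * g 0)) (circlepath 0 1)"
  by (rule Cauchy_integral_circlepath_simple[OF g]) simp
 then have "((\<lambda>t. g (circlepath 0 1 t) / circlepath 0 1 t * vector_derivative (circlepath 0 1) (at t)) has_integral (2 * of_real pi * \<i> * g 0)) {0..1}"
  by (simp add: has_contour_integral)
 then have cI: "((\<lambda>t. (2 * of_real pi * \<i>) * g (?e t)) has_integral (2 * of_real pi * \<i>) * g 0) {0..1}"
  by (rule has_integral_eq[rotated]) (simp only: vector_derivative_circlepath, simp add: circlepath_def part_circlepath_def linepath_def mult_ac)
 have i: "((\<lambda>t. g (?e t)) has_integral g 0) {0..1}"
 proof -
  have "inverse (2 * of_real pi * \<i>) * ((2 * of_real pi * \<i>) * w) = w" for w :: complex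
   by (subst mult.assoc[symmetric], subst left_inverse) simp_all
  with has_integral_mult_right[OF cI, of "inverse (2 * of_real pi * \<i>)"] show ?thesis by (simp only:)
 qed
 have c: "continuous_on {0..1} (\<lambda>t. g (?e t))"
  by (rule continuous_on_compose2[OF holomorphic_on_imp_continuous_on[OF g]])
   (auto intro!: continuous_intros simp: e1)
 have "(\<lambda>t. cmod (g (?e t))) integrable_on {0..1}"
  by (intro integrable_continuous_interval continuous_intros c)
 then have J: "((\<lambda>t. cmod (g (?e t))) has_integral (integral {0..1} (\<lambda>t. cmod (g (?e t))))) {0..1}"
  by (rule integrable_integral)
 have "cmod (g 0) \<le> integral {0..1} (\<lambda>t. cmod (g (?e t)))"
  using integral_norm_bound_integral[of "\<lambda>t. g (?e t)" "{0..1}" "\<lambda>t. cmod (g (?e t))"] i J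
  by (auto simp: has_integral_iff)
 then show ?thesis
  using nn_integral_has_integral_lebesgue'[OF _ J] by (simp add: ennreal_leI)
qed

text \<open>Average the mean value inequality over the circles \<open>t \<mapsto> z + exp (2\<pi>it) y\<close> and
integrate over \<open>y\<close>; multiplication by \<open>exp (2\<pi>it)\<close> preserves Lebesgue measure.
Only complex lines through \<open>z\<close> enter, so one-variable theory suffices.\<close>

lemma holo_mean_value:
 fixes f :: "complex^'n => complex"
 assumes \<Omega>: "open \<Omega>" and f: "holomorphic_fun_on f \<Omega>" and R: "ball z R \<subseteq> \<Omega>"
 shows "ennreal ((cmod (f z))^2) * emeasure lborel (ball z R) \<le> (\<integral>\<^sup>+w. ennreal ((cmod (f w))^2) * indicator (ball z R) w \<partial>lborel)"
proof -
 let ?e = "\<lambda>t::real. exp (2 * of_real pi * \<i> * of_real t) :: complex"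
 have e1: "cmod (?e t) = 1" for t by (simp add: norm_exp_eq_Re)
 define h where "h w = ennreal ((cmod (f w))^2) * indicator (ball z R) w" for w
 have hm[measurable]: "h \<in> borel_measurable borel"
 proof -
  have "(\<lambda>w. indicator (ball z R) w *\<^sub>R f w) \<in> borel_measurable borel"
   using continuous_on_subset[OF holo_continuous_on[OF f] R] by (simp add: borel_measurable_continuous_on_indicator)
  then have m: "(\<lambda>w. ennreal ((cmod (indicator (ball z R) w *\<^sub>R f w))^2)) \<in> borel_measurable borel" by measurable
  have "(\<lambda>w. ennreal ((cmod (indicator (ball z R) w *\<^sub>R f w))^2)) = h" by (auto simp: h_def indicator_def fun_eq_iff)
  from m[unfolded this] show ?thesis .
 qed
 have pt: "ennreal ((cmod (f z))^2) * indicator (ball (0::complex^'n) R) y \<le> (\<integral>\<^sup>+t. h (z + ?e t *s y) * indicator {0..1} t \<partial>lborel)" for y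
 proof (cases "y \<in> ball 0 R")
  case True
  have inn: "z + \<zeta> *s y \<in> ball z R" if "\<zeta> \<in> cball 0 1" for \<zeta>
  proof -
   have "cmod \<zeta> * norm y \<le> 1 * norm y" using that by (intro mult_right_mono) auto
   then show ?thesis using True by (simp add: dist_norm norm_cscaleV)
  qed
  have "(\<lambda>\<zeta>. f (z + \<zeta> *s y)) holomorphic_on (cball 0 1)"
   by (rule holo_line[OF f]) (use inn R in blast)
  then have "(\<lambda>\<zeta>. (f (z + \<zeta> *s y))^2) holomorphic_on (cball 0 1)" by (intro holomorphic_intros)
  from circle_mean[OF this]
  have "ennreal ((cmod (f z))^2) \<le> (\<integral>\<^sup>+t. ennreal ((cmod (f (z + ?e t *s y)))^2) * indicator {0..1} t \<partial>lborel)"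
   by (simp add: norm_power)
  also have "\<dots> = (\<integral>\<^sup>+t. h (z + ?e t *s y) * indicator {0..1} t \<partial>lborel)"
   using inn e1 by (intro nn_integral_cong) (auto simp: h_def)
  finally show ?thesis using True by simp
 qed simp
 have "continuous_on UNIV (\<lambda>p. z + ?e (snd p) *s fst p)"
 proof -
  have "continuous_on UNIV (\<lambda>p. \<chi> i. ?e (snd p) * fst p $ i)"
   by (intro continuous_intros)
  then have "continuous_on UNIV (\<lambda>p. ?e (snd p) *s fst p)" by (simp add: vector_scalar_mult_def)
  then show ?thesis by (intro continuous_intros)
 qed
 then have m1: "(\<lambda>p. z + ?e (snd p) *s fst p) \<in> borel_measurable (borel \<Otimes>\<^sub>M borel)"
  by (subst borel_prod) (rule borel_measurable_continuous_onI)
 have m2: "(\<lambda>(y, t). h (z + ?e t *s y) * indicator {0..1} t) \<in> borel_measurable (lborel \<Otimes>\<^sub>M lborel)"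
 proof -
  have "(\<lambda>p. h (z + ?e (snd p) *s fst p) * indicator {0..1} (snd p)) \<in> borel_measurable (borel \<Otimes>\<^sub>M borel)"
   using m1 by measurable
  then show ?thesis by (simp add: case_prod_beta')
 qed
 have "ennreal ((cmod (f z))^2) * emeasure lborel (ball z R) = ennreal ((cmod (f z))^2) * (\<integral>\<^sup>+y. indicator (ball (0::complex^'n) R) y \<partial>lborel)"
 proof -
  have "emeasure lborel (ball z R) = (\<integral>\<^sup>+y. indicator (ball z R) (z + y) \<partial>lborel)"
   by (subst nn_integral_lborel_translate) (auto intro: borel_measurable_indicator)
  also have "\<dots> = (\<integral>\<^sup>+y. indicator (ball (0::complex^'n) R) y \<partial>lborel)"
  proof -
   have "(\<lambda>y. indicator (ball z R) (z + y)) = (indicator (ball 0 R) :: complex^'n => ennreal)"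
    by (auto simp: fun_eq_iff indicator_def dist_norm)
   then show ?thesis by (simp only:)
  qed
  finally show ?thesis by simp
 qed
 also have "\<dots> = (\<integral>\<^sup>+y. ennreal ((cmod (f z))^2) * indicator (ball (0::complex^'n) R) y \<partial>lborel)"
  by (rule nn_integral_cmult[symmetric]) (rule borel_measurable_indicator, simp)
 also have "\<dots> \<le> (\<integral>\<^sup>+y. (\<integral>\<^sup>+t. h (z + ?e t *s y) * indicator {0..1} t \<partial>lborel) \<partial>lborel)"
  by (intro nn_integral_mono pt)
 also have "\<dots> = (\<integral>\<^sup>+t. (\<integral>\<^sup>+y. h (z + ?e t *s y) * indicator {0..1} t \<partial>lborel) \<partial>lborel)"
  by (rule lborel_pair.Fubini'[symmetric, OF m2])
 also have "\<dots> = (\<integral>\<^sup>+t. (\<integral>\<^sup>+y. h y \<partial>lborel) * indicator {0..1} (t::real) \<partial>lborel)"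
 proof (rule nn_integral_cong)
  fix t :: real
  have "continuous_on UNIV (\<lambda>y::complex^'n. z + ?e t *s y)"
   by (intro continuous_intros linear_continuous_on bounded_linear_cscaleV_right)
  then have [measurable]: "(\<lambda>y. z + ?e t *s y) \<in> borel_measurable borel" by (rule borel_measurable_continuous_onI)
  have "(\<integral>\<^sup>+y. h (z + ?e t *s y) * indicator {0..1} t \<partial>lborel) = (\<integral>\<^sup>+y. h (z + ?e t *s y) \<partial>lborel) * indicator {0..1} t"
   by (rule nn_integral_multc) measurable
  also have "(\<integral>\<^sup>+y. h (z + ?e t *s y) \<partial>lborel) = (\<integral>\<^sup>+y. h (z + y) \<partial>lborel)"
  proof (rule nn_integral_linear_isometry[of "\<lambda>y. h (z + y)" "\<lambda>y. ?e t *s y" "\<lambda>y. inverse (?e t) *s y"])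
   show "linear (\<lambda>y::complex^'n. ?e t *s y)" using bounded_linear_cscaleV_right bounded_linear.linear by blast
   show "?e t *s (inverse (?e t) *s y) = y" for y :: "complex^'n" by (simp add: vec_eq_iff)
  qed (auto simp: norm_cscaleV e1)
  also have "\<dots> = (\<integral>\<^sup>+y. h y \<partial>lborel)" by (rule nn_integral_lborel_translate) simp
  finally show "(\<integral>\<^sup>+y. h (z + ?e t *s y) * indicator {0..1} t \<partial>lborel) = (\<integral>\<^sup>+y. h y \<partial>lborel) * indicator {0..1} t" .
 qed
 also have "\<dots> = (\<integral>\<^sup>+y. h y \<partial>lborel)" by (subst nn_integral_cmult_indicator) simp_all
 finally show ?thesis by (simp add: h_def)
qed

section \<open>The Bergman projection\<close>

lemma nn_integral_lebesgue_on_lborel: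
 assumes "\<Omega> \<in> sets lebesgue"
 shows "(\<integral>\<^sup>+x. F x \<partial>lebesgue_on \<Omega>) = (\<integral>\<^sup>+x. F x * indicator \<Omega> x \<partial>lborel)"
 using assms by (simp add: nn_integral_restrict_space nn_integral_completion)

lemma bergman_spaceD:
 assumes "h \<in> bergman_space \<Omega>"
 shows "h \<in> L2 \<Omega>" "holomorphic_fun_on h \<Omega>"
 using assms by (auto simp: bergman_space_def)

lemma holo_linear_combination:
 assumes "holomorphic_fun_on f \<Omega>" "holomorphic_fun_on g \<Omega>"
 shows "holomorphic_fun_on (\<lambda>z. a * f z + b * g z) \<Omega>"
proof (rule holoI)
 fix z assume z: "z \<in> \<Omega>"
 show "((\<lambda>z. a * f z + b * g z) has_derivative (\<lambda>h. a * der f z h + b * der g z h)) (at z)"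
  by (intro has_derivative_add has_derivative_mult_right holo_has_derivative(1)[OF _ z] assms)
 show "a * der f z (c *s v) + b * der g z (c *s v)
   = c * (a * der f z v + b * der g z v)" for c v
  by (simp add: holo_has_derivative(2)[OF assms(1) z] holo_has_derivative(2)[OF assms(2) z] algebra_simps)
qed

lemma bergman_space_linear_combination:
 assumes "f \<in> bergman_space \<Omega>" "g \<in> bergman_space \<Omega>"
 shows "(\<lambda>z. a * f z + b * g z) \<in> bergman_space \<Omega>"
 using assms by (simp add: bergman_space_def holo_linear_combination L2_add L2_scale)

lemma bergman_space_diff:
 "f \<in> bergman_space \<Omega> ==> g \<in> bergman_space \<Omega> ==> (\<lambda>z. f z - g z) \<in> bergman_space \<Omega>"
 using bergman_space_linear_combination[of f \<Omega> g 1 "-1"] by simp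

lemma bergman_point_evaluation:
 fixes h :: "complex^'n => complex"
 assumes \<Omega>: "open \<Omega>" and h: "h \<in> bergman_space \<Omega>" and R: "R > 0" "ball z R \<subseteq> \<Omega>"
 shows "cmod (h z) \<le> L2_norm \<Omega> h / sqrt (measure lborel (ball (0::complex^'n) R))"
proof -
 let ?c = "measure lborel (ball (0::complex^'n) R)"
 have c: "?c > 0" using R by (simp add: content_ball_pos)
 have e: "emeasure lborel (ball z R) = ennreal ?c"
  using emeasure_lborel_ball_finite[of z R] content_ball_conv_unit_ball[of R z] content_ball_conv_unit_ball[of R "0::complex^'n"] R
  by (simp add: emeasure_eq_ennreal_measure)
 have "ennreal ((cmod (h z))^2) * ennreal ?c \<le> (\<integral>\<^sup>+w. ennreal ((cmod (h w))^2) * indicator (ball z R) w \<partial>lborel)"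
  using holo_mean_value[OF \<Omega> bergman_spaceD(2)[OF h] R(2)] e by simp
 also have "\<dots> \<le> (\<integral>\<^sup>+w. ennreal ((cmod (h w))^2) * indicator \<Omega> w \<partial>lborel)"
  using R(2) by (intro nn_integral_mono mult_left_mono) (auto simp: indicator_def)
 also have "\<dots> = ennreal ((L2_norm \<Omega> h)^2)"
  using L2_nn_integral[OF bergman_spaceD(1)[OF h]] \<Omega> by (simp add: nn_integral_lebesgue_on_lborel)
 finally have "(cmod (h z))^2 * ?c \<le> (L2_norm \<Omega> h)^2"
  using c by (simp add: ennreal_mult[symmetric])
 then have "(cmod (h z))^2 \<le> (L2_norm \<Omega> h / sqrt ?c)^2"
  using c by (simp add: power_divide pos_le_divide_eq)
 then show ?thesis by (rule power2_le_imp_le) (use c in simp)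
qed

lemma L2_inner_simps:
 assumes "f \<in> L2 \<Omega>" "g \<in> L2 \<Omega>" "k \<in> L2 \<Omega>"
 shows "L2_inner \<Omega> (\<lambda>z. f z - g z) k = L2_inner \<Omega> f k - L2_inner \<Omega> g k"
  and "cnj (L2_inner \<Omega> f k) = L2_inner \<Omega> k f"
  and "L2_inner \<Omega> f (\<lambda>z. c * k z) = cnj c * L2_inner \<Omega> f k"
proof -
 show "L2_inner \<Omega> (\<lambda>z. f z - g z) k = L2_inner \<Omega> f k - L2_inner \<Omega> g k"
  unfolding L2_inner_def left_diff_distrib
  by (rule Bochner_Integration.integral_diff) (intro L2_mult_integrable L2_cnj assms)+
 show "cnj (L2_inner \<Omega> f k) = L2_inner \<Omega> k f"
 proof -
  have "(\<lambda>x. k x * cnj (f x)) = (\<lambda>x. cnj (f x * cnj (k x)))" by (simp add: fun_eq_iff mult.commute)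
  then show ?thesis unfolding L2_inner_def by (simp only: Bochner_Integration.integral_cnj)
 qed
 have "(\<lambda>x. f x * cnj (c * k x)) = (\<lambda>x. cnj c * (f x * cnj (k x)))" by (simp add: fun_eq_iff mult_ac)
 then show "L2_inner \<Omega> f (\<lambda>z. c * k z) = cnj c * L2_inner \<Omega> f k"
  unfolding L2_inner_def by simp
qed

lemma L2_inner_self: "L2_inner \<Omega> f f = of_real ((L2_norm \<Omega> f)^2)"
 unfolding L2_inner_def L2_norm_sq complex_norm_square[symmetric] by (rule integral_complex_of_real)

lemma L2_norm_diff_sq:
 assumes "f \<in> L2 \<Omega>" "g \<in> L2 \<Omega>"
 shows "(L2_norm \<Omega> (\<lambda>z. f z - g z))^2 = (L2_norm \<Omega> f)^2 - 2 * Re (L2_inner \<Omega> f g) + (L2_norm \<Omega> g)^2"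
proof -
 have pt: "(cmod (a - b))^2 = (cmod a)^2 - 2 * Re (a * cnj b) + (cmod b)^2" for a b
  by (simp add: cmod_power2) (simp add: power2_eq_square algebra_simps)
 have i: "integrable (lebesgue_on \<Omega>) (\<lambda>x. f x * cnj (g x))" by (intro L2_mult_integrable L2_cnj assms)
 have "(L2_norm \<Omega> (\<lambda>z. f z - g z))^2 = (\<integral>x. (cmod (f x))^2 - 2 * Re (f x * cnj (g x)) + (cmod (g x))^2 \<partial>lebesgue_on \<Omega>)"
  unfolding L2_norm_sq pt ..
 also have "\<dots> = (\<integral>x. (cmod (f x))^2 \<partial>lebesgue_on \<Omega>) - 2 * (\<integral>x. Re (f x * cnj (g x)) \<partial>lebesgue_on \<Omega>) + (\<integral>x. (cmod (g x))^2 \<partial>lebesgue_on \<Omega>)"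
  using L2_integrable_sq[OF assms(1)] L2_integrable_sq[OF assms(2)] integrable_Re[OF i]
  by (simp del: times_complex.sel complex_cnj)
 also have "(\<integral>x. Re (f x * cnj (g x)) \<partial>lebesgue_on \<Omega>) = Re (L2_inner \<Omega> f g)"
  unfolding L2_inner_def by (rule integral_Re[OF i])
 finally show ?thesis by (simp add: L2_norm_sq)
qed

text \<open>By the parallelogram law a minimizing sequence is Cauchy, by bounded point evaluations it converges locally
uniformly, so its limit is holomorphic, and Fatou's lemma shows that the limit is a minimizer.\<close>

lemma bergman_minimizer:
 fixes f :: "complex^'n => complex"
 assumes \<Omega>: "open \<Omega>" and f: "f \<in> L2 \<Omega>"
 shows "\<exists>h\<in>bergman_space \<Omega>. \<forall>g\<in>bergman_space \<Omega>. L2_norm \<Omega> (\<lambda>z. f z - h z) \<le> L2_norm \<Omega> (\<lambda>z. f z - g z)"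
proof -
 let ?A = "bergman_space \<Omega>"
 let ?N = "\<lambda>h. (L2_norm \<Omega> (\<lambda>z. f z - h z))^2"
 define d where "d = (INF h\<in>?A. ?N h)"
 have ne: "?A \<noteq> {}"
 proof -
  have "(\<lambda>z. 0) \<in> L2 \<Omega>" by (auto simp: L2_def)
  moreover have "holomorphic_fun_on (\<lambda>z. 0) \<Omega>" by (rule holoI[of _ _ "\<lambda>_ _. 0"]) auto
  ultimately show ?thesis unfolding bergman_space_def by blast
 qed
 have bb: "bdd_below (?N ` ?A)" by (rule bdd_belowI[of _ 0]) auto
 have dle: "d \<le> ?N h" if "h \<in> ?A" for h unfolding d_def by (rule cINF_lower[OF bb that])
 have "\<exists>h\<in>?A. ?N h < d + 1 / real (Suc n)" for n
 proof -
  have "(INF h\<in>?A. ?N h) < d + 1 / real (Suc n)" unfolding d_def by simp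
  then show ?thesis unfolding cINF_less_iff[OF ne bb] .
 qed
 then obtain H where H: "\<And>n. H n \<in> ?A" "\<And>n. ?N (H n) < d + 1 / real (Suc n)" by metis
 have HL: "H n \<in> L2 \<Omega>" for n by (rule bergman_spaceD[OF H(1)])
 \<comment> \<open>The parallelogram law for \<open>f - H n\<close> and \<open>f - H m\<close>, whose midpoint is again a competitor.\<close>
 have diffsq: "(L2_norm \<Omega> (\<lambda>z. H n z - H m z))^2 \<le> 2 / real (Suc n) + 2 / real (Suc m)" for n m
 proof -
  have mid: "(\<lambda>z. (1/2) * H n z + (1/2) * H m z) \<in> ?A" by (intro bergman_space_linear_combination H)
  have pt: "(cmod (b - c))^2 = 2 * (cmod (a - b))^2 + 2 * (cmod (a - c))^2 - 4 * (cmod (a - ((1/2) * b + (1/2) * c)))^2" for a b c :: complex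
   by (simp add: cmod_power2) (simp add: power2_eq_square field_simps)
  have i: "integrable (lebesgue_on \<Omega>) (\<lambda>z. (cmod (f z - H n z))^2)" "integrable (lebesgue_on \<Omega>) (\<lambda>z. (cmod (f z - H m z))^2)"
   "integrable (lebesgue_on \<Omega>) (\<lambda>z. (cmod (f z - ((1/2) * H n z + (1/2) * H m z)))^2)"
   by (intro L2_integrable_sq L2_diff f HL bergman_spaceD[OF mid])+
  have "(L2_norm \<Omega> (\<lambda>z. H n z - H m z))^2 = (\<integral>z. 2 * (cmod (f z - H n z))^2 + 2 * (cmod (f z - H m z))^2
    - 4 * (cmod (f z - ((1/2) * H n z + (1/2) * H m z)))^2 \<partial>lebesgue_on \<Omega>)"
   unfolding L2_norm_sq by (rule Bochner_Integration.integral_cong[OF refl]) (rule pt)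
  also have "\<dots> = 2 * ?N (H n) + 2 * ?N (H m) - 4 * ?N (\<lambda>z. (1/2) * H n z + (1/2) * H m z)"
   unfolding L2_norm_sq using i
   by (subst Bochner_Integration.integral_diff, simp, simp) (subst Bochner_Integration.integral_add, auto)
  also have "\<dots> \<le> 2 / real (Suc n) + 2 / real (Suc m)"
   using H(2)[of n] H(2)[of m] dle[OF mid] by simp
  finally show ?thesis .
 qed
 have loc: "\<exists>r>0. cball z r \<subseteq> \<Omega> \<and> uniformly_Cauchy_on (cball z r) H" if z: "z \<in> \<Omega>" for z
 proof -
  obtain R where R: "R > 0" "cball z R \<subseteq> \<Omega>" using \<Omega> z open_contains_cball by blast
  define r where "r = R / 2"
  have r: "r > 0" using R by (simp add: r_def)
  define c where "c = sqrt (measure lborel (ball (0::complex^'n) r))"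
  have c: "c > 0" using r by (simp add: c_def content_ball_pos)
  have b: "cmod (H n w - H m w) \<le> sqrt (2 / real (Suc n) + 2 / real (Suc m)) / c" if w: "w \<in> cball z r" for w n m
  proof -
   have "ball w r \<subseteq> \<Omega>"
   proof
    fix y assume "y \<in> ball w r"
    then have "y \<in> cball z R" using w dist_triangle[of z y w] by (simp add: r_def)
    then show "y \<in> \<Omega>" using R by blast
   qed
   from bergman_point_evaluation[OF \<Omega> bergman_space_diff[OF H(1) H(1)] r this]
   have "cmod (H n w - H m w) \<le> L2_norm \<Omega> (\<lambda>z. H n z - H m z) / c" by (simp add: c_def)
   also have "\<dots> \<le> sqrt (2 / real (Suc n) + 2 / real (Suc m)) / c"
    using diffsq[of n m] c by (intro divide_right_mono) (simp_all add: real_le_rsqrt)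
   finally show ?thesis .
  qed
  have "uniformly_Cauchy_on (cball z r) H"
  proof (rule uniformly_Cauchy_onI)
   fix e :: real assume e: "e > 0"
   define N where "N = nat \<lceil>4 / (e * c)^2\<rceil>"
   have small: "sqrt (2 / real (Suc n) + 2 / real (Suc m)) / c < e" if "n \<ge> N" "m \<ge> N" for n m
   proof -
    have k: "2 / real (Suc i) < (e * c)^2 / 2" if "i \<ge> N" for i
    proof -
     have "4 / (e * c)^2 \<le> real N" unfolding N_def by linarith
     also have "\<dots> < real (Suc i)" using that by simp
     finally show ?thesis using e c by (simp add: field_simps)
    qed
    have "2 / real (Suc n) + 2 / real (Suc m) < (e * c)^2" using k[OF that(1)] k[OF that(2)] by simp
    then have "sqrt (2 / real (Suc n) + 2 / real (Suc m)) < e * c"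
     using e c by (intro real_less_lsqrt) auto
    then show ?thesis using c by (simp add: pos_divide_less_eq)
   qed
   show "\<exists>M. \<forall>x\<in>cball z r. \<forall>m\<ge>M. \<forall>n\<ge>M. dist (H m x) (H n x) < e"
   proof (intro exI ballI allI impI)
    fix x m n assume "x \<in> cball z r" "N \<le> m" "N \<le> n"
    then show "dist (H m x) (H n x) < e"
     using le_less_trans[OF b small] by (simp add: dist_norm)
   qed
  qed
  moreover have "cball z r \<subseteq> \<Omega>" using R by (auto simp: r_def)
  ultimately show ?thesis using r by blast
 qed
 define h where "h z = lim (\<lambda>n. H n z)" for z
 have unif: "\<exists>r>0. cball z r \<subseteq> \<Omega> \<and> uniform_limit (cball z r) H h sequentially" if z: "z \<in> \<Omega>" for z
 proof -
  from loc[OF z] obtain r where r: "r > 0" "cball z r \<subseteq> \<Omega>" "uniformly_Cauchy_on (cball z r) H" by blast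
  have "uniformly_convergent_on (cball z r) H" by (rule Cauchy_uniformly_convergent[OF r(3)])
  then show ?thesis using r unfolding uniformly_convergent_uniform_limit_iff h_def by blast
 qed
 have pt: "(\<lambda>n. H n z) \<longlonglongrightarrow> h z" if z: "z \<in> \<Omega>" for z
 proof -
  from unif[OF z] obtain r where r: "r > 0" "uniform_limit (cball z r) H h sequentially" by blast
  show ?thesis by (rule tendsto_uniform_limitI[OF r(2)]) (use r in simp)
 qed
 have hol: "holomorphic_fun_on h \<Omega>"
  unfolding holomorphic_fun_on_def
 proof
  fix z assume "z \<in> \<Omega>"
  from unif[OF this] obtain r where r: "r > 0" "cball z r \<subseteq> \<Omega>" "uniform_limit (cball z r) H h sequentially" by blast
  show "\<exists>f'. (h has_derivative f') (at z) \<and> (\<forall>c v. f' (c *s v) = c * f' v)"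
   by (rule holo_limit_ball[OF bergman_spaceD(2)[OF H(1)] r])
 qed
 have hm: "h \<in> borel_measurable (lebesgue_on \<Omega>)"
  by (rule continuous_on_measurable_lebesgue_on[OF \<Omega> holo_continuous_on[OF hol]])
 have d0: "0 \<le> d" unfolding d_def by (rule cINF_greatest[OF ne]) simp
 have fm: "(\<lambda>z. f z - h z) \<in> borel_measurable (lebesgue_on \<Omega>)" using L2_measurable[OF f] hm by measurable
 have "(\<integral>\<^sup>+z. ennreal ((cmod (f z - h z))^2) \<partial>lebesgue_on \<Omega>) = (\<integral>\<^sup>+z. liminf (\<lambda>n. ennreal ((cmod (f z - H n z))^2)) \<partial>lebesgue_on \<Omega>)"
 proof (rule nn_integral_cong)
  fix z assume "z \<in> space (lebesgue_on \<Omega>)"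
  then have "(\<lambda>n. ennreal ((cmod (f z - H n z))^2)) \<longlonglongrightarrow> ennreal ((cmod (f z - h z))^2)"
   by (intro tendsto_ennrealI tendsto_intros pt) (auto simp: space_restrict_space)
  then show "ennreal ((cmod (f z - h z))^2) = liminf (\<lambda>n. ennreal ((cmod (f z - H n z))^2))"
   using lim_imp_Liminf[OF sequentially_bot] by metis
 qed
 also have "\<dots> \<le> liminf (\<lambda>n. \<integral>\<^sup>+z. ennreal ((cmod (f z - H n z))^2) \<partial>lebesgue_on \<Omega>)"
  using L2_measurable[OF f] L2_measurable[OF HL] by (intro nn_integral_liminf) measurable
 also have "\<dots> \<le> liminf (\<lambda>n. ennreal (d + 1 / real (Suc n)))"
  using H(2) by (intro Liminf_mono always_eventually allI) (simp add: L2_nn_integral[OF L2_diff[OF f HL]] ennreal_leI less_imp_le)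
 also have "\<dots> = ennreal d"
 proof -
  have "(\<lambda>n. d + 1 / real (Suc n)) \<longlonglongrightarrow> d + 0"
   by (intro tendsto_intros) (use LIMSEQ_inverse_real_of_nat in \<open>simp add: inverse_eq_divide\<close>)
  then have "(\<lambda>n. ennreal (d + 1 / real (Suc n))) \<longlonglongrightarrow> ennreal d" by (intro tendsto_ennrealI) simp
  then show ?thesis by (rule lim_imp_Liminf[OF sequentially_bot])
 qed
 finally have "(\<integral>\<^sup>+z. ennreal ((cmod (f z - h z))^2) \<partial>lebesgue_on \<Omega>) \<le> ennreal ((sqrt d)^2)" using d0 by simp
 from L2_from_nn_integral[OF fm this] d0
 have fh: "(\<lambda>z. f z - h z) \<in> L2 \<Omega>" "L2_norm \<Omega> (\<lambda>z. f z - h z) \<le> sqrt d" by simp_all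
 have "h \<in> L2 \<Omega>" using L2_diff[OF f fh(1)] by simp
 then have "h \<in> ?A" using hol by (simp add: bergman_space_def)
 moreover have "L2_norm \<Omega> (\<lambda>z. f z - h z) \<le> L2_norm \<Omega> (\<lambda>z. f z - g z)" if "g \<in> ?A" for g
  using fh(2) real_le_lsqrt[OF L2_norm_nonneg dle[OF that]] by simp
 ultimately show ?thesis by blast
qed

text \<open>If \<open>f - h\<close> had an inner product \<open>c \<noteq> 0\<close> with \<open>g\<close>, then moving
\<open>h\<close> by a small multiple of \<open>c g\<close> would decrease the distance to \<open>f\<close>.\<close>

lemma bergman_minimizer_orthogonal:
 fixes f :: "complex^'n => complex"
 assumes f: "f \<in> L2 \<Omega>" and h: "h \<in> bergman_space \<Omega>"
  and min: "\<And>g. g \<in> bergman_space \<Omega> ==> L2_norm \<Omega> (\<lambda>z. f z - h z) \<le> L2_norm \<Omega> (\<lambda>z. f z - g z)"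
  and g: "g \<in> bergman_space \<Omega>"
 shows "L2_inner \<Omega> (\<lambda>z. f z - h z) g = 0"
proof -
 let ?u = "\<lambda>z. f z - h z"
 define c where "c = L2_inner \<Omega> ?u g"
 have u: "?u \<in> L2 \<Omega>" by (intro L2_diff f bergman_spaceD[OF h])
 have gL: "g \<in> L2 \<Omega>" by (rule bergman_spaceD[OF g])
 define b where "b = (L2_norm \<Omega> g)^2"
 have ineq: "2 * s * (cmod c)^2 \<le> s^2 * (cmod c)^2 * b" if s: "s > 0" for s :: real
 proof -
  let ?t = "of_real s * c"
  have "(\<lambda>z. 1 * h z + ?t * g z) \<in> bergman_space \<Omega>" by (intro bergman_space_linear_combination h g)
  from min[OF this] have "(L2_norm \<Omega> ?u)^2 \<le> (L2_norm \<Omega> (\<lambda>z. f z - (1 * h z + ?t * g z)))^2"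
   by (intro power_mono) auto
  also have "(\<lambda>z. f z - (1 * h z + ?t * g z)) = (\<lambda>z. ?u z - ?t * g z)" by (simp add: fun_eq_iff)
  also have "(L2_norm \<Omega> (\<lambda>z. ?u z - ?t * g z))^2 = (L2_norm \<Omega> ?u)^2 - 2 * Re (L2_inner \<Omega> ?u (\<lambda>z. ?t * g z)) + (L2_norm \<Omega> (\<lambda>z. ?t * g z))^2"
   by (rule L2_norm_diff_sq[OF u L2_scale[OF gL]])
  also have "L2_inner \<Omega> ?u (\<lambda>z. ?t * g z) = cnj ?t * c" unfolding c_def by (rule L2_inner_simps(3)[OF u u gL])
  also have "Re (cnj ?t * c) = s * (cmod c)^2" by (simp add: cmod_power2) (simp add: power2_eq_square algebra_simps)
  also have "(L2_norm \<Omega> (\<lambda>z. ?t * g z))^2 = s^2 * (cmod c)^2 * b"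
   unfolding L2_norm_sq b_def by (simp add: norm_mult power_mult_distrib)
  finally show ?thesis by simp
 qed
 have "c = 0"
 proof (rule ccontr)
  assume "c \<noteq> 0"
  then have c: "(cmod c)^2 > 0" by simp
  have "2 * s \<le> s^2 * b" if s: "s > 0" for s
  proof -
   have "(2 * s) * (cmod c)^2 \<le> (s^2 * b) * (cmod c)^2" using ineq[OF s] by (simp add: mult_ac)
   then show ?thesis using c by (simp add: mult_le_cancel_right)
  qed
  define s where "s = 1 / (b + 1)"
  have s: "s > 0" by (simp add: s_def b_def add_nonneg_pos)
  from \<open>\<And>s. s > 0 ==> 2 * s \<le> s^2 * b\<close>[OF s] have "s * 2 \<le> s * (s * b)" by (simp add: power2_eq_square mult_ac)
  then have "2 \<le> s * b" using s by (rule mult_left_le_imp_le)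
  moreover have "s * b \<le> 1" by (simp add: s_def b_def add_nonneg_pos)
  ultimately show False by simp
 qed
 then show ?thesis by (simp add: c_def)
qed

text \<open>The projection is given by a definite description; existence and uniqueness identify it with the minimizer
that is extended by \<open>0\<close>.\<close>

lemma bergman_projection_props:
 fixes f :: "complex^'n => complex"
 assumes \<Omega>: "open \<Omega>" and f: "f \<in> L2 \<Omega>"
 shows "bergman_projection \<Omega> f \<in> bergman_space \<Omega>"
  and "\<And>z. z \<notin> \<Omega> ==> bergman_projection \<Omega> f z = 0"
  and "\<And>g. g \<in> bergman_space \<Omega> ==> L2_inner \<Omega> (\<lambda>z. f z - bergman_projection \<Omega> f z) g = 0"
proof -
 let ?P = "\<lambda>h. h \<in> bergman_space \<Omega> \<and> (\<forall>z. z \<notin> \<Omega> --> h z = 0) \<and> (\<forall>g\<in>bergman_space \<Omega>. L2_inner \<Omega> (\<lambda>z. f z - h z) g = 0)"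
 have "\<exists>!h. ?P h"
 proof (rule ex_ex1I)
  obtain h where h: "h \<in> bergman_space \<Omega>" "\<And>g. g \<in> bergman_space \<Omega> ==> L2_norm \<Omega> (\<lambda>z. f z - h z) \<le> L2_norm \<Omega> (\<lambda>z. f z - g z)"
   using bergman_minimizer[OF \<Omega> f] by blast
  define k where "k z = (if z \<in> \<Omega> then h z else 0)" for z
  have m: "k \<in> borel_measurable (lebesgue_on \<Omega>)"
   using L2_measurable[OF bergman_spaceD(1)[OF h(1)]] by (rule measurable_cong[THEN iffD1, rotated]) (simp add: k_def space_restrict_space)
  have "k \<in> L2 \<Omega>" by (rule L2_norm_mono(1)[OF bergman_spaceD(1)[OF h(1)] m, of 1]) (auto simp: k_def)
  moreover have "holomorphic_fun_on k \<Omega>" by (rule holo_cong[OF \<Omega> bergman_spaceD(2)[OF h(1)]]) (simp add: k_def)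
  moreover have "L2_inner \<Omega> (\<lambda>z. f z - k z) g = 0" if "g \<in> bergman_space \<Omega>" for g
  proof -
   have "L2_inner \<Omega> (\<lambda>z. f z - k z) g = L2_inner \<Omega> (\<lambda>z. f z - h z) g"
    unfolding L2_inner_def by (rule Bochner_Integration.integral_cong[OF refl]) (simp add: k_def space_restrict_space)
   then show ?thesis using bergman_minimizer_orthogonal[OF f h that] by simp
  qed
  ultimately show "\<exists>h. ?P h" by (intro exI[of _ k]) (simp add: bergman_space_def k_def)
 next
  fix h k assume h: "?P h" and k: "?P k"
  let ?d = "\<lambda>z. h z - k z"
  have d: "?d \<in> bergman_space \<Omega>" using h k by (blast intro: bergman_space_diff)
  have hL: "h \<in> L2 \<Omega>" "k \<in> L2 \<Omega>" using h k bergman_spaceD by blast+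
  have "L2_inner \<Omega> ?d ?d = L2_inner \<Omega> (\<lambda>z. (f z - k z) - (f z - h z)) ?d" by simp
  also have "\<dots> = L2_inner \<Omega> (\<lambda>z. f z - k z) ?d - L2_inner \<Omega> (\<lambda>z. f z - h z) ?d"
   by (intro L2_inner_simps(1) L2_diff f hL)
  also have "\<dots> = 0" using h k d by simp
  finally have z: "L2_norm \<Omega> ?d = 0" by (simp add: L2_inner_self)
  show "h = k"
  proof
   fix z show "h z = k z"
   proof (cases "z \<in> \<Omega>")
    case True
    then obtain R where R: "R > 0" "ball z R \<subseteq> \<Omega>" using \<Omega> open_contains_ball by blast
    show ?thesis using bergman_point_evaluation[OF \<Omega> d R] z by simp
   qed (use h k in simp)
  qed
 qed
 from theI'[OF this] have "?P (bergman_projection \<Omega> f)" unfolding bergman_projection_def .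
 then show "bergman_projection \<Omega> f \<in> bergman_space \<Omega>"
  and "\<And>z. z \<notin> \<Omega> ==> bergman_projection \<Omega> f z = 0"
  and "\<And>g. g \<in> bergman_space \<Omega> ==> L2_inner \<Omega> (\<lambda>z. f z - bergman_projection \<Omega> f z) g = 0" by simp_all
qed

lemma bergman_projection_selfadjoint:
 fixes f :: "complex^'n => complex"
 assumes \<Omega>: "open \<Omega>" and f: "f \<in> L2 \<Omega>" and g: "g \<in> L2 \<Omega>"
 shows "L2_inner \<Omega> (bergman_projection \<Omega> f) g = L2_inner \<Omega> f (bergman_projection \<Omega> g)"
proof -
 let ?B = "bergman_projection \<Omega>"
 note p = bergman_projection_props[OF \<Omega>]
 have L: "?B f \<in> L2 \<Omega>" "?B g \<in> L2 \<Omega>" using p(1)[OF f] p(1)[OF g] bergman_spaceD by blast+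
 have 1: "L2_inner \<Omega> f (?B g) = L2_inner \<Omega> (?B f) (?B g)"
  using p(3)[OF f p(1)[OF g]] L2_inner_simps(1)[OF f L(1) L(2)] by simp
 have "L2_inner \<Omega> g (?B f) = L2_inner \<Omega> (?B g) (?B f)"
  using p(3)[OF g p(1)[OF f]] L2_inner_simps(1)[OF g L(2) L(1)] by simp
 from arg_cong[OF this, of cnj] have "L2_inner \<Omega> (?B f) g = L2_inner \<Omega> (?B f) (?B g)"
  by (simp add: L2_inner_simps(2)[OF g f L(1)] L2_inner_simps(2)[OF L(2) f L(1)])
 with 1 show ?thesis by simp
qed

section \<open>Defining functions\<close>

lemma compact_uniform_bound:
 fixes P :: "real => 'a::metric_space => bool"
 assumes K: "compact K" and loc: "\<And>p. p \<in> K ==> \<exists>e>0. \<exists>C. \<forall>z\<in>ball p e. P C z"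
  and mono: "\<And>C C' z. P C z ==> C \<le> C' ==> P C' z"
 shows "\<exists>C. \<forall>z\<in>K. P C z"
proof -
 from loc obtain e C where e: "\<And>p. p \<in> K ==> e p > 0 \<and> (\<forall>z\<in>ball p (e p). P (C p) z)" by metis
 have "K \<subseteq> (\<Union>p\<in>K. ball p (e p))" using e by force
 from compactE_image[OF K _ this] obtain F where F: "F \<subseteq> K" "finite F" "K \<subseteq> (\<Union>p\<in>F. ball p (e p))"
  by auto
 show ?thesis
 proof (intro exI ballI)
  fix z assume "z \<in> K"
  then obtain p where p: "p \<in> F" "z \<in> ball p (e p)" using F(3) by blast
  then have "P (C p) z" using e F(1) by blast
  moreover have "C p \<le> Max (C ` F)" using p F(2) by simp
  ultimately show "P (Max (C ` F)) z" by (rule mono)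
 qed
qed

lemma isCont_dist:
 assumes "isCont f p" "e > 0"
 shows "\<exists>d>0. \<forall>x. dist x p < d --> dist (f x) (f p) < e"
 using assms unfolding continuous_at_eps_delta by blast

locale smooth_domain =
 fixes \<Omega> :: "'a::euclidean_space set" and \<rho> :: "'a => real"
 assumes bounded_domain: "bounded \<Omega>" and smooth_rho: "smooth \<rho>" and domain_eq: "\<Omega> = {z. \<rho> z < 0}"
  and nondegenerate: "\<And>p. p \<in> frontier \<Omega> ==> der \<rho> p \<noteq> (\<lambda>v. 0)"
begin

abbreviation r :: "'a => real" where "r z \<equiv> - \<rho> z"
abbreviation \<mu> :: "'a measure" where "\<mu> \<equiv> lebesgue_on \<Omega>"

lemma smooth_on_rho: "smooth_on UNIV \<rho>" using smooth_rho by (simp add: smooth_iff)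

lemma continuous_rho: "continuous_on A \<rho>"
 using smooth_on_continuous_on[OF smooth_on_rho] continuous_on_subset by blast

lemma open_domain: "open \<Omega>"
 unfolding domain_eq by (rule open_Collect_less[OF continuous_rho]) simp

lemma r_pos: "z \<in> \<Omega> ==> 0 < r z" using domain_eq by simp

lemma frontier_zero:
 assumes "p \<in> frontier \<Omega>" shows "\<rho> p = 0"
proof -
 have "closure \<Omega> \<subseteq> {z. \<rho> z \<le> 0}"
  by (rule closure_minimal) (auto simp: domain_eq intro: closed_Collect_le[OF continuous_rho])
 moreover have "p \<in> closure \<Omega>" "p \<notin> \<Omega>"
  using assms open_domain by (auto simp: frontier_def interior_open)
 ultimately show ?thesis using domain_eq by force
qed

lemma compact_closure_domain: "compact (closure \<Omega>)" using bounded_domain by simp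

lemma closure_cases: "p \<in> closure \<Omega> ==> p \<in> \<Omega> \<or> p \<in> frontier \<Omega>"
 using open_domain by (auto simp: frontier_def interior_open)

lemma line_derivative:
 "smooth F ==> ((\<lambda>t. F (x + t *\<^sub>R b)) has_vector_derivative der F (x + t *\<^sub>R b) b) (at t)"
 by (rule smooth_has_vector_derivative_line[where S=UNIV]) (simp_all add: smooth_iff)

lemma continuous_derivative:
 assumes "smooth F" shows "continuous_on A (\<lambda>x. der F x b)"
proof -
 have "smooth_on UNIV (\<lambda>x. der F x b)"
  using assms by (intro smooth_on_deriv) (auto simp: smooth_iff)
 then show ?thesis using smooth_on_continuous_on continuous_on_subset by blast
qed

lemma slope_bound:
 assumes ab: "a \<le> b" and sl: "\<And>t. a \<le> t ==> t \<le> b ==> c \<le> der \<rho> (x + t *\<^sub>R e) e"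
 shows "c * (b - a) \<le> \<rho> (x + b *\<^sub>R e) - \<rho> (x + a *\<^sub>R e)"
proof (cases "a = b")
 case False
 with ab have "a < b" by simp
 from MVT2[OF this, of "\<lambda>t. \<rho> (x + t *\<^sub>R e)" "\<lambda>t. der \<rho> (x + t *\<^sub>R e) e"]
 obtain \<xi> where \<xi>: "a < \<xi>" "\<xi> < b" "\<rho> (x + b *\<^sub>R e) - \<rho> (x + a *\<^sub>R e) = (b - a) * der \<rho> (x + \<xi> *\<^sub>R e) e"
  using line_derivative[OF smooth_rho] by (auto simp: has_real_derivative_iff_has_vector_derivative)
 have "c * (b - a) \<le> der \<rho> (x + \<xi> *\<^sub>R e) e * (b - a)"
  using \<xi> ab by (intro mult_right_mono sl) auto
 then show ?thesis using \<xi>(3) by (simp add: mult.commute)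
qed simp

lemma slope_bound_upper:
 assumes ab: "a \<le> b" and sl: "\<And>t. a \<le> t ==> t \<le> b ==> der \<rho> (x + t *\<^sub>R e) e \<le> c"
 shows "\<rho> (x + b *\<^sub>R e) - \<rho> (x + a *\<^sub>R e) \<le> c * (b - a)"
proof (cases "a = b")
 case False
 with ab have "a < b" by simp
 from MVT2[OF this, of "\<lambda>t. \<rho> (x + t *\<^sub>R e)" "\<lambda>t. der \<rho> (x + t *\<^sub>R e) e"]
 obtain \<xi> where \<xi>: "a < \<xi>" "\<xi> < b" "\<rho> (x + b *\<^sub>R e) - \<rho> (x + a *\<^sub>R e) = (b - a) * der \<rho> (x + \<xi> *\<^sub>R e) e"
  using line_derivative[OF smooth_rho] by (auto simp: has_real_derivative_iff_has_vector_derivative)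
 have "der \<rho> (x + \<xi> *\<^sub>R e) e * (b - a) \<le> c * (b - a)"
  using \<xi> ab by (intro mult_right_mono sl) auto
 then show ?thesis using \<xi>(3) by (simp add: mult.commute)
qed simp

text \<open>From a point \<open>z\<close> near the boundary a straight line in a direction transversal to the boundary
reaches the zero set of \<open>\<rho>\<close> after time \<open>O(\<bar>\<rho> z\<bar>)\<close>. There
\<open>F\<close> vanishes, and along the line it changes at bounded speed.\<close>

lemma vanishing_local_bound:
 fixes F :: "'a => 'b::real_normed_vector"
 assumes F: "smooth F" and F0: "\<And>q. q \<in> frontier \<Omega> ==> F q = 0" and p: "p \<in> frontier \<Omega>"
 shows "\<exists>\<delta>>0. \<exists>C\<ge>0. \<forall>z\<in>ball p \<delta>. norm (F z) \<le> C * \<bar>\<rho> z\<bar>"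
proof -
 let ?d = "\<lambda>x v. der \<rho> x v"
 obtain v where v: "?d p v \<noteq> 0" using nondegenerate[OF p] by (auto simp: fun_eq_iff)
 define e where "e = (if ?d p v > 0 then v else - v)"
 have lin: "linear (?d p)" using linear_frechet_derivative[OF smooth_on_differentiable[OF smooth_on_rho UNIV_I]] .
 have e: "?d p e > 0" using v linear_neg[OF lin, of v] by (auto simp: e_def)
 then have e0: "norm e > 0" using linear_0[OF lin] by auto
 define c where "c = ?d p e / 2"
 have c: "c > 0" using e by (simp add: c_def)
 define L where "L = norm (der F p e) + 1"
 have L: "L > 0" by (simp add: L_def add_nonneg_pos)
 have ic: "isCont (\<lambda>x. ?d x e) p" "isCont (\<lambda>x. der F x e) p"
  using continuous_derivative[OF smooth_rho, of UNIV e] continuous_derivative[OF F, of UNIV e]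
  by (simp_all add: continuous_on_eq_continuous_at)
 obtain d1 where d1: "d1 > 0" "\<And>x. dist x p < d1 ==> dist (?d x e) (?d p e) < c"
  using isCont_dist[OF ic(1) c] by blast
 obtain d2 where d2: "d2 > 0" "\<And>x. dist x p < d2 ==> dist (der F x e) (der F p e) < 1"
  using isCont_dist[OF ic(2) zero_less_one] by blast
 note d12 = d1 d2
 define \<delta>1 where "\<delta>1 = min d1 d2"
 have \<delta>1: "\<delta>1 > 0" using d12 by (simp add: \<delta>1_def)
 have slope: "c \<le> ?d x e" if "dist x p < \<delta>1" for x
 proof -
  have "\<bar>?d x e - ?d p e\<bar> < c" using d12(2)[of x] that by (simp add: \<delta>1_def dist_real_def)
  then show ?thesis unfolding abs_less_iff c_def by linarith
 qed
 have FL: "norm (der F x e) \<le> L" if "dist x p < \<delta>1" for x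
 proof -
  have "norm (der F x e - der F p e) < 1"
   using d12(4)[of x] that by (simp add: \<delta>1_def dist_norm)
  then show ?thesis
   using norm_triangle_sub[of "der F x e" "der F p e"] by (simp add: L_def)
 qed
 define \<tau>0 where "\<tau>0 = \<delta>1 / (4 * norm e)"
 have \<tau>0: "\<tau>0 > 0" "\<tau>0 * norm e = \<delta>1 / 4" using \<delta>1 e0 by (simp_all add: \<tau>0_def)
 have icr: "isCont \<rho> p" using continuous_rho[of UNIV] by (simp add: continuous_on_eq_continuous_at)
 obtain d3 where d3: "d3 > 0" "\<And>x. dist x p < d3 ==> dist (\<rho> x) (\<rho> p) < c * \<tau>0"
  using isCont_dist[OF icr mult_pos_pos[OF c \<tau>0(1)]] by blast
 define \<delta> where "\<delta> = min d3 (\<delta>1 / 2)"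
 have \<delta>: "\<delta> > 0" using d3 \<delta>1 by (simp add: \<delta>_def)
 have "norm (F z) \<le> (L / c) * \<bar>\<rho> z\<bar>" if z: "z \<in> ball p \<delta>" for z
 proof -
  have zp: "dist z p < \<delta>1 / 2" "\<bar>\<rho> z\<bar> < c * \<tau>0"
   using z d3(2)[of z] frontier_zero[OF p] by (auto simp: \<delta>_def dist_commute dist_real_def)
  \<comment> \<open>At slope at least \<open>c\<close> this time suffices to reach the zero set.\<close>
  define \<tau> where "\<tau> = \<bar>\<rho> z\<bar> / c"
  have \<tau>: "0 \<le> \<tau>" "\<tau> < \<tau>0" using zp c by (simp_all add: \<tau>_def pos_divide_less_eq mult.commute)
  have line: "dist (z + t *\<^sub>R e) p < \<delta>1" if "\<bar>t\<bar> \<le> \<tau>0" for t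
  proof -
   have "\<bar>t\<bar> * norm e \<le> \<delta>1 / 4" using mult_right_mono[OF that norm_ge_zero[of e]] \<tau>0(2) by simp
   then have "dist (z + t *\<^sub>R e) z \<le> \<delta>1 / 4" by (simp add: dist_norm)
   then show ?thesis using dist_triangle[of "z + t *\<^sub>R e" p z] zp(1) \<delta>1 by simp
  qed
  have up: "c * (b - a) \<le> \<rho> (z + b *\<^sub>R e) - \<rho> (z + a *\<^sub>R e)" if "- \<tau>0 \<le> a" "a \<le> b" "b \<le> \<tau>0" for a b
   by (rule slope_bound[OF that(2)]) (rule slope[OF line], use that in auto)
  have contl: "continuous_on {a..b} (\<lambda>t. \<rho> (z + t *\<^sub>R e))" for a b
   by (rule continuous_on_compose2[OF continuous_rho[of UNIV]]) (auto intro!: continuous_intros)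
  have "\<exists>t. \<bar>t\<bar> \<le> \<tau> \<and> \<rho> (z + t *\<^sub>R e) = 0"
  proof (cases "\<rho> z \<ge> 0")
   case True
   have "\<rho> (z + (-\<tau>) *\<^sub>R e) \<le> 0" using up[of "-\<tau>" 0] \<tau> True c by (simp add: \<tau>_def)
   moreover have "0 \<le> \<rho> (z + 0 *\<^sub>R e)" using True by simp
   ultimately obtain t where "-\<tau> \<le> t" "t \<le> 0" "\<rho> (z + t *\<^sub>R e) = 0"
    using IVT'[of "\<lambda>t. \<rho> (z + t *\<^sub>R e)" "-\<tau>" 0 0] contl \<tau> by auto
   then show ?thesis by (intro exI[of _ t]) auto
  next
   case False
   have "0 \<le> \<rho> (z + \<tau> *\<^sub>R e)" using up[of 0 \<tau>] \<tau> False c by (simp add: \<tau>_def)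
   moreover have "\<rho> (z + 0 *\<^sub>R e) \<le> 0" using False by simp
   ultimately obtain t where "0 \<le> t" "t \<le> \<tau>" "\<rho> (z + t *\<^sub>R e) = 0"
    using IVT'[of "\<lambda>t. \<rho> (z + t *\<^sub>R e)" 0 0 \<tau>] contl \<tau> by auto
   then show ?thesis by (intro exI[of _ t]) auto
  qed
  then obtain t where t: "\<bar>t\<bar> \<le> \<tau>" "\<rho> (z + t *\<^sub>R e) = 0" by blast
  let ?x = "z + t *\<^sub>R e"
  have "?x \<in> closure \<Omega>"
   unfolding closure_approachable
  proof (intro allI impI)
   fix \<epsilon> :: real assume \<epsilon>: "\<epsilon> > 0"
   define s where "s = min (\<epsilon> / (2 * norm e)) (\<tau>0 - \<tau>)"
   have s: "s > 0" "s \<le> \<tau>0 - \<tau>" "s \<le> \<epsilon> / (2 * norm e)" using \<epsilon> e0 \<tau> by (simp_all add: s_def)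
   have "c * (t - (t - s)) \<le> \<rho> ?x - \<rho> (z + (t - s) *\<^sub>R e)"
    by (rule up) (use s t(1) \<tau> in auto)
   then have "\<rho> (z + (t - s) *\<^sub>R e) < 0" using mult_pos_pos[OF c s(1)] t(2) by simp
   moreover have "dist (z + (t - s) *\<^sub>R e) ?x < \<epsilon>"
   proof -
    have "dist (z + (t - s) *\<^sub>R e) ?x = s * norm e" using s by (simp add: dist_norm algebra_simps)
    also have "\<dots> \<le> \<epsilon> / (2 * norm e) * norm e" using s e0 by (intro mult_right_mono) auto
    also have "\<dots> < \<epsilon>" using e0 \<epsilon> by simp
    finally show ?thesis .
   qed
   ultimately show "\<exists>y\<in>\<Omega>. dist y ?x < \<epsilon>" using domain_eq by blast
  qed
  moreover have "?x \<notin> \<Omega>" using t(2) domain_eq by simp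
  ultimately have "?x \<in> frontier \<Omega>" using closure_cases by blast
  then have "norm (F z) = norm (F (z + 0 *\<^sub>R e) - F (z + t *\<^sub>R e))" using F0 by simp
  also have "\<dots> \<le> L * norm (0 - t)"
  proof (rule differentiable_bound[where S="{-\<tau>0..\<tau>0}" and f="\<lambda>t. F (z + t *\<^sub>R e)" and f'="\<lambda>t h. h *\<^sub>R der F (z + t *\<^sub>R e) e"])
   show "((\<lambda>t. F (z + t *\<^sub>R e)) has_derivative (\<lambda>h. h *\<^sub>R der F (z + t *\<^sub>R e) e)) (at t within {-\<tau>0..\<tau>0})" for t
    using line_derivative[OF F] by (auto simp: has_vector_derivative_def intro: has_derivative_at_withinI)
   show "onorm (\<lambda>h. h *\<^sub>R der F (z + t *\<^sub>R e) e) \<le> L" if "t \<in> {-\<tau>0..\<tau>0}" for t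
   proof (rule onorm_bound)
    have *: "norm (der F (z + t *\<^sub>R e) e) \<le> L" by (rule FL[OF line]) (use that in auto)
    show "norm (h *\<^sub>R der F (z + t *\<^sub>R e) e) \<le> L * norm h" for h
     using mult_right_mono[OF *, of "\<bar>h\<bar>"] by (simp add: mult.commute)
   qed (use L in simp)
  qed (use t(1) \<tau> in auto)
  also have "\<dots> \<le> L * \<tau>" using t(1) L by simp
  finally show ?thesis by (simp add: \<tau>_def)
 qed
 then show ?thesis using \<delta> L c by (intro exI[of _ \<delta>] conjI exI[of _ "L / c"]) auto
qed

text \<open>Along a line tangent to the boundary \<open>\<rho>\<close> is \<open>o(t)\<close>, hence so is
\<open>F\<close> by the preceding bound. Applied to a second defining function this shows that all defining
functions have the same tangent spaces.\<close>

lemma vanishing_derivative_tangent: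
 fixes F :: "'a => 'b::real_normed_vector"
 assumes F: "smooth F" and F0: "\<And>q. q \<in> frontier \<Omega> ==> F q = 0" and p: "p \<in> frontier \<Omega>"
  and x: "der \<rho> p x = 0"
 shows "der F p x = 0"
proof -
 obtain \<delta> C where \<delta>: "\<delta> > 0" "C \<ge> 0" "\<And>z. z \<in> ball p \<delta> ==> norm (F z) \<le> C * \<bar>\<rho> z\<bar>"
  using vanishing_local_bound[OF F F0 p] by blast
 have "((\<lambda>t. \<rho> (p + t *\<^sub>R x)) has_vector_derivative 0) (at 0)"
  using line_derivative[OF smooth_rho, of p x 0] x by simp
 then have "((\<lambda>h. \<rho> (p + h *\<^sub>R x) /\<^sub>R h) \<longlongrightarrow> 0) (at 0)"
  using frontier_zero[OF p] by (simp add: has_vector_derivative_iff_quotient)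
 then have lim: "((\<lambda>h. C * \<bar>\<rho> (p + h *\<^sub>R x) /\<^sub>R h\<bar>) \<longlongrightarrow> 0) (at 0)"
  by (intro tendsto_mult_right_zero tendsto_rabs_zero)
 have "((\<lambda>h. p + h *\<^sub>R x) \<longlongrightarrow> p + 0 *\<^sub>R x) (at 0)" by (intro tendsto_intros)
 then have "\<forall>\<^sub>F h in at 0. dist (p + h *\<^sub>R x) p < \<delta>" using \<delta>(1) by (auto dest: tendstoD)
 then have "\<forall>\<^sub>F h in at 0. norm (F (p + h *\<^sub>R x) /\<^sub>R h) \<le> C * \<bar>\<rho> (p + h *\<^sub>R x) /\<^sub>R h\<bar>"
 proof eventually_elim
  case (elim h)
  then have "norm (F (p + h *\<^sub>R x)) \<le> C * \<bar>\<rho> (p + h *\<^sub>R x)\<bar>" by (intro \<delta>(3)) (simp add: dist_commute)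
  from mult_left_mono[OF this, of "\<bar>inverse h\<bar>"] show ?case by (simp add: abs_mult mult_ac)
 qed
 from Lim_null_comparison[OF this lim] have "((\<lambda>h. F (p + h *\<^sub>R x) /\<^sub>R h) \<longlongrightarrow> 0) (at 0)" .
 moreover have "((\<lambda>h. F (p + h *\<^sub>R x) /\<^sub>R h) \<longlongrightarrow> der F p x) (at 0)"
  using line_derivative[OF F, of p x 0] F0[OF p] by (simp add: has_vector_derivative_iff_quotient)
 ultimately show ?thesis using tendsto_unique[OF at_neq_bot] by blast
qed

lemma vanishing_bound:
 fixes F :: "'a => 'b::real_normed_vector"
 assumes F: "smooth F" and F0: "\<And>q. q \<in> frontier \<Omega> ==> F q = 0"
 shows "\<exists>C\<ge>0. \<forall>z\<in>\<Omega>. norm (F z) \<le> C * r z"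
proof -
 have "\<exists>C. \<forall>z\<in>closure \<Omega>. z \<in> \<Omega> --> norm (F z) \<le> C * r z"
 proof (rule compact_uniform_bound[OF compact_closure_domain])
  fix p assume "p \<in> closure \<Omega>"
  then consider "p \<in> \<Omega>" | "p \<in> frontier \<Omega>" using closure_cases by blast
  then show "\<exists>e>0. \<exists>C. \<forall>z\<in>ball p e. z \<in> \<Omega> --> norm (F z) \<le> C * r z"
  proof cases
   case 1
   have ic: "isCont (\<lambda>z. norm (F z) / r z) p"
    using F smooth_on_continuous_on[of UNIV F] continuous_rho[of UNIV] r_pos[OF 1]
    by (intro continuous_intros) (auto simp: smooth_iff continuous_on_eq_continuous_at)
   obtain e where e: "e > 0" "\<And>z. dist z p < e ==> dist (norm (F z) / r z) (norm (F p) / r p) < 1"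
    using isCont_dist[OF ic zero_less_one] by blast
   have "norm (F z) \<le> (norm (F p) / r p + 1) * r z" if "z \<in> ball p e" "z \<in> \<Omega>" for z
   proof -
    have "norm (F z) / r z \<le> norm (F p) / r p + 1"
    proof -
     have "dist z p < e" using that by (simp add: dist_commute)
     from e(2)[OF this] show ?thesis unfolding dist_real_def abs_less_iff by linarith
    qed
    from mult_right_mono[OF this less_imp_le[OF r_pos[OF that(2)]]] show ?thesis
     using r_pos[OF that(2)] by (simp only: times_divide_eq_left nonzero_mult_div_cancel_right[OF less_imp_neq[symmetric]])
   qed
   then show ?thesis using e(1) by blast
  next
   case 2
   obtain \<delta> C where "\<delta> > 0" "\<And>z. z \<in> ball p \<delta> ==> norm (F z) \<le> C * \<bar>\<rho> z\<bar>"
    using vanishing_local_bound[OF F F0 2] by blast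
   moreover from this(2) have "\<forall>z\<in>ball p \<delta>. z \<in> \<Omega> --> norm (F z) \<le> C * r z"
    by (fastforce simp: domain_eq)
   ultimately show ?thesis by blast
  qed
 next
  fix C C' z assume "z \<in> \<Omega> --> norm (F z) \<le> C * r z" "C \<le> C'"
  then show "z \<in> \<Omega> --> norm (F z) \<le> C' * r z"
   using r_pos mult_right_mono[of C C' "r z"] by fastforce
 qed
 then obtain C where C: "\<And>z. z \<in> \<Omega> ==> norm (F z) \<le> C * r z" using closure_subset by blast
 have "norm (F z) \<le> max C 0 * r z" if "z \<in> \<Omega>" for z
 proof -
  have "C * r z \<le> max C 0 * r z" using r_pos[OF that] by (intro mult_right_mono) auto
  then show ?thesis using C[OF that] by linarith
 qed
 then show ?thesis by (intro exI[of _ "max C 0"]) simp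
qed

text \<open>Compactness of the boundary makes the strict inequality uniform, also for base points \<open>x\<close>
slightly different from the point \<open>z\<close> at which the field is evaluated.\<close>

lemma inward_slope:
 assumes w: "smooth w" and inward: "\<And>p. p \<in> frontier \<Omega> ==> der \<rho> p (w p) < 0"
 shows "\<exists>c>0. \<forall>z\<in>\<Omega>. r z < c --> (\<forall>x. dist x z < c --> der \<rho> x (w z) \<le> - c)"
proof -
 let ?d = "\<lambda>x z. der \<rho> x (w z)"
 have cont: "continuous_on UNIV (\<lambda>p. ?d (fst p) (snd p))"
 proof -
  have "continuous_on UNIV (\<lambda>p. \<Sum>b\<in>Basis. (w (snd p) \<bullet> b) *\<^sub>R der \<rho> (fst p) b)"
   by (intro continuous_intros continuous_on_compose2[OF continuous_derivative[OF smooth_rho, of UNIV]]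
      continuous_on_compose2[OF smooth_on_continuous_on[of UNIV w]])
    (use w in \<open>auto simp: smooth_iff\<close>)
  then show ?thesis
   by (simp add: frechet_derivative_eq_sum_Basis[OF smooth_on_differentiable[OF smooth_on_rho UNIV_I], where v="w _"])
 qed
 let ?P = "\<lambda>C z. 0 < C \<and> (z \<in> \<Omega> \<and> r z < 1 / C --> (\<forall>x. dist x z < 1 / C --> ?d x z \<le> - (1 / C)))"
 have "\<exists>C. \<forall>z\<in>closure \<Omega>. ?P C z"
 proof (rule compact_uniform_bound[OF compact_closure_domain])
  fix p assume "p \<in> closure \<Omega>"
  then consider "p \<in> \<Omega>" | "p \<in> frontier \<Omega>" using closure_cases by blast
  then show "\<exists>e>0. \<exists>C. \<forall>z\<in>ball p e. ?P C z"
  proof cases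
   case 1
   then have rp: "r p / 2 > 0" using r_pos by simp
   have icr: "isCont \<rho> p" using continuous_rho[of UNIV] by (simp add: continuous_on_eq_continuous_at)
   obtain e where e: "e > 0" "\<And>z. dist z p < e ==> dist (\<rho> z) (\<rho> p) < r p / 2"
    using isCont_dist[OF icr rp] by blast
   have "?P (2 / r p) z" if "z \<in> ball p e" for z
    using e(2)[of z] that rp by (auto simp: dist_commute dist_real_def)
   then show ?thesis using e(1) by blast
  next
   case 2
   define k where "k = - ?d p p / 2"
   have k: "k > 0" using inward[OF 2] by (simp add: k_def)
   have ic: "isCont (\<lambda>q. ?d (fst q) (snd q)) (p, p)" using cont by (simp add: continuous_on_eq_continuous_at)
   obtain e where e: "e > 0" "\<And>q. dist q (p, p) < e ==> dist (?d (fst q) (snd q)) (?d p p) < k"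
    using isCont_dist[OF ic k] by auto
   define C where "C = max (4 / e) (1 / k)"
   have C: "C > 0" "1 / C \<le> e / 4" "1 / C \<le> k"
   proof -
    show C0: "C > 0" using k by (simp add: C_def less_max_iff_disj)
    have "4 / e \<le> C" "1 / k \<le> C" by (simp_all add: C_def)
    then show "1 / C \<le> e / 4" "1 / C \<le> k" using e(1) k C0 by (simp_all add: field_simps)
   qed
   have "?P C z" if z: "z \<in> ball p (e/4)" for z
   proof (intro conjI impI allI)
    fix x assume "dist x z < 1 / C"
    then have "dist x p < e / 2" using dist_triangle[of x p z] z C(2) by (simp add: dist_commute)
    moreover have "dist z p < e / 2" using z e(1) by (simp add: dist_commute)
    ultimately have "dist (x, z) (p, p) < e"
     using dist_Pair_Pair[of x z p p] sqrt_sum_squares_le_sum[of "dist x p" "dist z p"] by simp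
    from e(2)[OF this] have "?d x z < - k" by (simp add: k_def dist_real_def abs_less_iff)
    then show "?d x z \<le> - (1 / C)" using C(3) by simp
   qed (rule C)
   then show ?thesis using e(1) by (intro exI[of _ "e/4"] conjI exI[of _ C]) auto
  qed
 next
  fix C C' z assume P: "?P C z" and le: "C \<le> C'"
  then have i: "1 / C' \<le> 1 / C" "0 < C'" by (auto simp: frac_le)
  show "?P C' z"
  proof (intro conjI impI allI)
   fix x assume a: "z \<in> \<Omega> \<and> r z < 1 / C'" "dist x z < 1 / C'"
   then have "r z < 1 / C" "dist x z < 1 / C" using i by linarith+
   then have "?d x z \<le> - (1 / C)" using P a(1) by blast
   then show "?d x z \<le> - (1 / C')" using i by linarith
  qed (rule i)
 qed
 then obtain C where C: "\<And>z. z \<in> closure \<Omega> ==> ?P C z" by blast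
 show ?thesis
 proof (cases "\<Omega> = {}")
  case False
  then have "C > 0" using C closure_subset by blast
  moreover have "\<forall>z\<in>\<Omega>. r z < 1 / C --> (\<forall>x. dist x z < 1 / C --> ?d x z \<le> - (1 / C))"
   using C closure_subset by blast
  ultimately show ?thesis by (intro exI[of _ "1 / C"]) simp
 qed (intro exI[of _ 1], simp)
qed

lemma rho_lipschitz:
 "\<exists>L\<ge>1. (\<forall>z\<in>\<Omega>. r z \<le> L) \<and> (\<forall>x\<in>\<Omega>. \<forall>y. dist x y \<le> 1 --> \<bar>\<rho> x - \<rho> y\<bar> \<le> L * dist x y)"
proof -
 obtain R where R: "\<And>x. x \<in> \<Omega> ==> norm x \<le> R" using bounded_domain unfolding bounded_iff by blast
 let ?K = "cball (0::'a) (R + 1)"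
 have "\<exists>M. \<forall>x\<in>?K. norm (der \<rho> x b) \<le> M" for b
  using compact_imp_bounded[OF compact_continuous_image[OF continuous_derivative[OF smooth_rho] compact_cball], of b 0 "R + 1"]
  unfolding bounded_iff by blast
 then obtain M where M: "\<And>b x. x \<in> ?K ==> norm (der \<rho> x b) \<le> M b" by metis
 obtain M' where M': "\<And>x. x \<in> ?K ==> norm (\<rho> x) \<le> M'"
  using compact_imp_bounded[OF compact_continuous_image[OF continuous_rho compact_cball], of 0 "R + 1"]
  unfolding bounded_iff by blast
 define L where "L = max 1 (max M' (\<Sum>b\<in>Basis. \<bar>M b\<bar>))"
 have on: "onorm (der \<rho> x) \<le> L" if "x \<in> ?K" for x
 proof (rule onorm_bound)
  fix v
  have "norm (der \<rho> x v) = norm (\<Sum>b\<in>Basis. (v \<bullet> b) *\<^sub>R der \<rho> x b)"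
   using frechet_derivative_eq_sum_Basis[OF smooth_on_differentiable[OF smooth_on_rho UNIV_I], of x v] by simp
  also have "\<dots> \<le> (\<Sum>b\<in>Basis. norm v * \<bar>M b\<bar>)"
  proof (rule sum_norm_le)
   fix b :: 'a assume b: "b \<in> Basis"
   have "\<bar>v \<bullet> b\<bar> * norm (der \<rho> x b) \<le> norm v * \<bar>M b\<bar>"
    by (intro mult_mono Basis_le_norm[OF b] order_trans[OF M[OF that]]) auto
   then show "norm ((v \<bullet> b) *\<^sub>R der \<rho> x b) \<le> norm v * \<bar>M b\<bar>" by (simp only: norm_scaleR)
  qed
  also have "\<dots> = (\<Sum>b\<in>Basis. \<bar>M b\<bar>) * norm v" by (simp add: sum_distrib_left mult.commute)
  also have "\<dots> \<le> L * norm v" by (intro mult_right_mono) (simp_all add: L_def)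
  finally show "norm (der \<rho> x v) \<le> L * norm v" .
 qed (simp add: L_def)
 have "\<bar>\<rho> x - \<rho> y\<bar> \<le> L * dist x y" if "x \<in> \<Omega>" "dist x y \<le> 1" for x y
 proof -
  have y: "x \<in> ?K" "y \<in> ?K" using R[OF that(1)] that(2) norm_triangle_sub[of y x] by (auto simp: dist_norm norm_minus_commute)
  have "norm (\<rho> x - \<rho> y) \<le> L * norm (x - y)"
   by (rule differentiable_bound[where S="?K" and f'="\<lambda>x. der \<rho> x"])
    (use y on smooth_on_has_derivative[OF smooth_on_rho UNIV_I] in \<open>auto intro: has_derivative_at_withinI\<close>)
  then show ?thesis by (simp add: dist_norm)
 qed
 moreover have "r z \<le> L" if "z \<in> \<Omega>" for z
  using M'[of z] R[OF that] by (auto simp: L_def)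
 moreover have "L \<ge> 1" by (simp add: L_def)
 ultimately show ?thesis by blast
qed

end

section \<open>A collar of the boundary and its inward flow\<close>

text \<open>The set \<open>{g > 0}\<close> may be much smaller than the interval, but from its infimum on \<open>g\<close>
grows at least linearly, and \<open>1 / sqrt t\<close> is integrable at \<open>0\<close>.\<close>

lemma nn_integral_inverse_sqrt_slope:
 fixes g :: "real => real"
 assumes c: "c > 0" and sl: "\<And>a b. 0 \<le> a ==> a \<le> b ==> b \<le> R ==> c * (b - a) \<le> g b - g a" and R: "0 \<le> R"
 shows "(\<integral>\<^sup>+t. ennreal (1 / sqrt (g t)) * indicator {t. 0 \<le> t \<and> t \<le> R \<and> g t > 0} t \<partial>lborel) \<le> ennreal (2 * sqrt (R / c))"
proof -
 define S where "S = {t. 0 \<le> t \<and> t \<le> R \<and> g t > 0}"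
 show ?thesis
 proof (cases "S = {}")
  case True
  then have "(\<lambda>t. ennreal (1 / sqrt (g t)) * indicator {t. 0 \<le> t \<and> t \<le> R \<and> g t > 0} t) = (\<lambda>t. 0)"
   by (auto simp: S_def indicator_def fun_eq_iff)
  then show ?thesis by (simp only: nn_integral_const) simp
 next
  case False
  define t0 where "t0 = Inf S"
  have bdd: "bdd_below S" by (rule bdd_belowI[of _ 0]) (auto simp: S_def)
  have t0: "0 \<le> t0" unfolding t0_def by (rule cInf_greatest[OF False]) (auto simp: S_def)
  have t0le: "t0 \<le> t" if "t \<in> S" for t unfolding t0_def by (rule cInf_lower[OF that bdd])
  have t0R: "t0 \<le> R" using False t0le by (force simp: S_def)
  have gt: "c * (t - t0) \<le> g t" if t: "t \<in> S" for t
  proof -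
   have "t - g t / c \<le> t0"
    unfolding t0_def
   proof (rule cInf_greatest[OF False])
    fix s assume s: "s \<in> S"
    show "t - g t / c \<le> s"
    proof (cases "s \<le> t")
     case True
     then have "c * (t - s) \<le> g t - g s" using s t by (intro sl) (auto simp: S_def)
     then have "c * (t - s) \<le> g t" using s by (simp add: S_def)
     then show ?thesis using c by (simp add: field_simps)
    next
     case False
     have "0 \<le> g t / c" using t c by (simp add: S_def)
     then show ?thesis using False by linarith
    qed
   qed
   then show ?thesis using c by (simp add: field_simps)
  qed
  have "(\<integral>\<^sup>+t. ennreal (1 / sqrt (g t)) * indicator S t \<partial>lborel) \<le> (\<integral>\<^sup>+t. ennreal (1 / sqrt (c * (t - t0))) * indicator {t0..R} t \<partial>lborel)"
  proof (rule nn_integral_mono_AE)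
   have "AE t in lborel. t \<noteq> t0" by (rule AE_lborel_singleton)
   then show "AE t in lborel. ennreal (1 / sqrt (g t)) * indicator S t \<le> ennreal (1 / sqrt (c * (t - t0))) * indicator {t0..R} t"
   proof eventually_elim
    case (elim t)
    show ?case
    proof (cases "t \<in> S")
     case True
     then have "t0 < t" using t0le[OF True] elim by simp
     then have "0 < c * (t - t0)" using c by simp
     then have "1 / sqrt (g t) \<le> 1 / sqrt (c * (t - t0))"
      using gt[OF True] by (intro frac_le) auto
     then show ?thesis using True t0le[OF True] by (auto simp: S_def intro: ennreal_leI)
    qed simp
   qed
  qed
  also have "\<dots> = ennreal (2 * sqrt (c * (R - t0)) / c - 2 * sqrt (c * (t0 - t0)) / c)"
  proof (rule nn_integral_has_integral_lebesgue')
   show "0 \<le> 1 / sqrt (c * (t - t0))" if "t \<in> {t0..R}" for t using that c by simp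
   show "((\<lambda>t. 1 / sqrt (c * (t - t0))) has_integral 2 * sqrt (c * (R - t0)) / c - 2 * sqrt (c * (t0 - t0)) / c) {t0..R}"
   proof (rule fundamental_theorem_of_calculus_interior[OF t0R])
    show "continuous_on {t0..R} (\<lambda>t. 2 * sqrt (c * (t - t0)) / c)" using c by (intro continuous_intros) auto
    fix t assume "t \<in> {t0<..<R}"
    then have p: "c * (t - t0) > 0" using c by simp
    have "((\<lambda>t. 2 * sqrt (c * (t - t0)) / c) has_real_derivative 1 / sqrt (c * (t - t0))) (at t)"
     using p c by (auto intro!: derivative_eq_intros simp: field_simps)
    then show "((\<lambda>t. 2 * sqrt (c * (t - t0)) / c) has_vector_derivative 1 / sqrt (c * (t - t0))) (at t)"
     by (simp add: has_real_derivative_iff_has_vector_derivative)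
   qed
  qed
  also have "\<dots> \<le> ennreal (2 * sqrt (R / c))"
  proof (rule ennreal_leI)
   have "sqrt (c * (R - t0)) / c = sqrt ((R - t0) / c)"
   proof -
    have "sqrt (c * (R - t0)) / c = (sqrt c * sqrt (R - t0)) / (sqrt c * sqrt c)"
     using c by (simp add: real_sqrt_mult)
    also have "\<dots> = sqrt (R - t0) / sqrt c" by (rule mult_divide_mult_cancel_left) (use c in simp)
    finally show ?thesis by (simp add: real_sqrt_divide)
   qed
   also have "\<dots> \<le> sqrt (R / c)" using t0 c by (simp add: divide_right_mono)
   finally show "2 * sqrt (c * (R - t0)) / c - 2 * sqrt (c * (t0 - t0)) / c \<le> 2 * sqrt (R / c)" by simp
  qed
  finally show ?thesis by (simp add: S_def)
 qed
qed

context smooth_domain begin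

text \<open>Although \<open>1 / sqrt r\<close> blows up at the boundary, its integral over a ball of radius
\<open>R\<close> is at most of the order \<open>R\<^sup>d / sqrt R\<close>, \<open>d\<close> the dimension, as
if \<open>r\<close> were of size \<open>R\<close> there. Average over the lines in the inward direction
\<open>e\<close>, on which \<open>r\<close> increases linearly.\<close>

lemma thin_shell:
 assumes c: "c > 0" and R: "R > 0" and e: "norm e \<le> B"
  and sl: "\<And>x. dist x y \<le> R * (1 + 2 * B) ==> der \<rho> x e \<le> - c"
 shows "(\<integral>\<^sup>+z. ennreal (1 / sqrt (r z)) * indicator {z\<in>\<Omega>. dist z y \<le> R} z \<partial>lborel)
  \<le> ennreal (2 * measure lborel (ball (0::'a) 1) * (1 + B) ^ DIM('a) / sqrt c * (R ^ DIM('a) / sqrt R))"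
proof -
 have B: "0 \<le> B" using e norm_ge_zero order_trans by blast
 define \<phi> where "\<phi> z = ennreal (1 / sqrt (r z)) * indicator {z\<in>\<Omega>. dist z y \<le> R} z" for z
 have \<phi>m [measurable]: "\<phi> \<in> borel_measurable borel"
 proof -
  have [measurable]: "\<rho> \<in> borel_measurable borel" by (rule borel_measurable_continuous_onI[OF continuous_rho])
  have [measurable]: "{z\<in>\<Omega>. dist z y \<le> R} \<in> sets borel"
  proof -
   have "{z\<in>\<Omega>. dist z y \<le> R} = \<Omega> \<inter> cball y R" by (auto simp: dist_commute)
   then show ?thesis using open_domain by simp
  qed
  show ?thesis unfolding \<phi>_def by measurable
 qed
 let ?D = "cball y (R * (1 + B))"
 have inner: "(\<integral>\<^sup>+t. \<phi> (z + t *\<^sub>R e) * indicator {0..R} t \<partial>lborel) \<le> ennreal (2 * sqrt (R / c)) * indicator ?D z" for z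
 proof (cases "z \<in> ?D")
  case False
  have "\<phi> (z + t *\<^sub>R e) * indicator {0..R} t = 0" for t
  proof (cases "t \<in> {0..R}")
   case True
   have "\<bar>t\<bar> * norm e \<le> R * B" using True e B by (intro mult_mono) auto
   then have "dist z (z + t *\<^sub>R e) \<le> R * B" by (simp add: dist_norm)
   then have "\<not> dist (z + t *\<^sub>R e) y \<le> R"
    using False dist_triangle[of z y "z + t *\<^sub>R e"] by (simp add: dist_commute algebra_simps)
   then show ?thesis by (simp add: \<phi>_def)
  qed simp
  then have "(\<integral>\<^sup>+t. \<phi> (z + t *\<^sub>R e) * indicator {0..R} t \<partial>lborel) = (\<integral>\<^sup>+t. 0 \<partial>(lborel :: real measure))"
   by (intro nn_integral_cong)
  then show ?thesis by simp
 next
  case True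
  have sl': "c * (b - a) \<le> r (z + b *\<^sub>R e) - r (z + a *\<^sub>R e)" if "0 \<le> a" "a \<le> b" "b \<le> R" for a b
  proof -
   have "\<rho> (z + b *\<^sub>R e) - \<rho> (z + a *\<^sub>R e) \<le> (- c) * (b - a)"
   proof (rule slope_bound_upper[OF that(2)], rule sl)
    fix t assume t: "a \<le> t" "t \<le> b"
    have "\<bar>t\<bar> * norm e \<le> R * B" using t that e B by (intro mult_mono) auto
    then have "dist z (z + t *\<^sub>R e) \<le> R * B" by (simp add: dist_norm)
    then show "dist (z + t *\<^sub>R e) y \<le> R * (1 + 2 * B)"
     using True dist_triangle[of "z + t *\<^sub>R e" y z] by (simp add: dist_commute algebra_simps)
   qed
   then show ?thesis by simp
  qed
  have "(\<integral>\<^sup>+t. \<phi> (z + t *\<^sub>R e) * indicator {0..R} t \<partial>lborel)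
    \<le> (\<integral>\<^sup>+t. ennreal (1 / sqrt (r (z + t *\<^sub>R e))) * indicator {t. 0 \<le> t \<and> t \<le> R \<and> r (z + t *\<^sub>R e) > 0} t \<partial>lborel)"
   by (intro nn_integral_mono) (auto simp: \<phi>_def indicator_def domain_eq)
  also have "\<dots> \<le> ennreal (2 * sqrt (R / c))"
   by (rule nn_integral_inverse_sqrt_slope[OF c sl']) (use R in auto)
  finally show ?thesis using True by simp
 qed
 have joint: "(\<lambda>(z, t). \<phi> (z + t *\<^sub>R e) * indicator {0..R} t) \<in> borel_measurable (lborel \<Otimes>\<^sub>M lborel)"
  by measurable
 have V: "emeasure lborel ?D = ennreal ((R * (1 + B)) ^ DIM('a) * measure lborel (ball (0::'a) 1))"
 proof -
  have "emeasure lborel ?D = ennreal (measure lborel ?D)"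
   using emeasure_lborel_cball_finite[of y "R * (1 + B)"] by (simp add: emeasure_eq_ennreal_measure)
  also have "measure lborel ?D = (R * (1 + B)) ^ DIM('a) * measure lborel (ball (0::'a) 1)"
   using R B content_cball_conv_ball[of y "R * (1 + B)"] content_ball_conv_unit_ball[of "R * (1 + B)" y] by simp
  finally show ?thesis .
 qed
 have "ennreal R * (\<integral>\<^sup>+z. \<phi> z \<partial>lborel) = (\<integral>\<^sup>+t. (\<integral>\<^sup>+z. \<phi> z \<partial>lborel) * indicator {0..R} t \<partial>lborel)"
  using R by (subst nn_integral_cmult_indicator) (simp_all add: mult.commute)
 also have "\<dots> = (\<integral>\<^sup>+t. (\<integral>\<^sup>+z. \<phi> (z + t *\<^sub>R e) * indicator {0..R} t \<partial>lborel) \<partial>lborel)"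
 proof (rule nn_integral_cong)
  fix t :: real
  have "(\<integral>\<^sup>+z. \<phi> (z + t *\<^sub>R e) * indicator {0..R} t \<partial>lborel) = (\<integral>\<^sup>+z. \<phi> (z + t *\<^sub>R e) \<partial>lborel) * indicator {0..R} t"
   by (rule nn_integral_multc) measurable
  also have "(\<integral>\<^sup>+z. \<phi> (z + t *\<^sub>R e) \<partial>lborel) = (\<integral>\<^sup>+z. \<phi> z \<partial>lborel)"
   using nn_integral_lborel_translate(1)[OF \<phi>m, of "t *\<^sub>R e"] by (simp add: add.commute)
  finally show "(\<integral>\<^sup>+z. \<phi> z \<partial>lborel) * indicator {0..R} t = (\<integral>\<^sup>+z. \<phi> (z + t *\<^sub>R e) * indicator {0..R} t \<partial>lborel)" by simp
 qed
 also have "\<dots> = (\<integral>\<^sup>+z. (\<integral>\<^sup>+t. \<phi> (z + t *\<^sub>R e) * indicator {0..R} t \<partial>lborel) \<partial>lborel)"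
  by (rule lborel_pair.Fubini'[OF joint])
 also have "\<dots> \<le> (\<integral>\<^sup>+z. ennreal (2 * sqrt (R / c)) * indicator ?D z \<partial>lborel)"
  by (intro nn_integral_mono inner)
 also have "\<dots> = ennreal (2 * sqrt (R / c) * ((R * (1 + B)) ^ DIM('a) * measure lborel (ball (0::'a) 1)))"
  using R B c by (subst nn_integral_cmult_indicator) (simp_all add: V ennreal_mult)
 finally have "ennreal (1 / R) * (ennreal R * (\<integral>\<^sup>+z. \<phi> z \<partial>lborel)) \<le> ennreal (1 / R) * \<dots>"
  by (rule mult_left_mono) simp
 also have "ennreal (1 / R) * (ennreal R * (\<integral>\<^sup>+z. \<phi> z \<partial>lborel)) = (\<integral>\<^sup>+z. \<phi> z \<partial>lborel)"
  using R by (simp add: mult.assoc[symmetric] ennreal_mult[symmetric])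
 also have "ennreal (1 / R) * ennreal (2 * sqrt (R / c) * ((R * (1 + B)) ^ DIM('a) * measure lborel (ball (0::'a) 1)))
   = ennreal (2 * measure lborel (ball (0::'a) 1) * (1 + B) ^ DIM('a) / sqrt c * (R ^ DIM('a) / sqrt R))"
 proof -
  have "1 / R * sqrt R = 1 / sqrt R" using R real_sqrt_mult_self[of R] by (simp add: field_simps)
  have "1 / R * (2 * sqrt (R / c) * ((R * (1 + B)) ^ DIM('a) * measure lborel (ball (0::'a) 1)))
   = (1 / R * sqrt R) * (2 * ((R * (1 + B)) ^ DIM('a) * measure lborel (ball (0::'a) 1)) / sqrt c)"
   by (simp add: real_sqrt_divide)
  also have "\<dots> = 2 * measure lborel (ball (0::'a) 1) * (1 + B) ^ DIM('a) / sqrt c * (R ^ DIM('a) / sqrt R)"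
   unfolding \<open>1 / R * sqrt R = 1 / sqrt R\<close> by (simp add: power_mult_distrib mult_ac)
  finally show ?thesis using R B c by (simp add: ennreal_mult[symmetric])
 qed
 finally show ?thesis by (simp add: \<phi>_def)
qed

end

text \<open>Quantitative data of a collar that the segments \<open>z + s w(z)\<close> sweep out. The condition
\<open>flow\<close> says that \<open>r\<close> along the segment is comparable to \<open>s + r z\<close>,
\<open>whitney\<close> that \<open>r\<close> is nearly constant on balls of radius comparable to
\<open>r\<close>, and \<open>thin\<close> is the integral bound of \<open>thin_shell\<close> on balls whose
radius is adapted to the displacement by the flow.\<close>

locale collar = smooth_domain \<Omega> \<rho> for \<Omega> :: "'a::euclidean_space set" and \<rho> +
 fixes w :: "'a => 'a" and c L B \<delta> \<eta> K :: real
 assumes smooth_w: "smooth w"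
  and pos: "0 < c" "1 \<le> L" "0 \<le> B" "0 < \<delta>" "0 < \<eta>" "0 \<le> K"
  and w_bound: "\<And>z. z \<in> \<Omega> ==> norm (w z) \<le> B"
  and whitney: "\<And>x y. x \<in> \<Omega> ==> dist x y < r x / L ==> y \<in> \<Omega> \<and> r x \<le> 2 * r y \<and> r y \<le> 2 * r x"
  and flow: "\<And>z s. z \<in> \<Omega> ==> r z < 2 * \<eta> ==> 0 \<le> s ==> s \<le> 2 * \<delta> ==>
    z + s *\<^sub>R w z \<in> \<Omega> \<and> c * (s + r z) \<le> r (z + s *\<^sub>R w z) \<and> r (z + s *\<^sub>R w z) \<le> L * (s + r z)"
  and thin: "\<And>y. y \<in> \<Omega> ==> r y \<le> 4 * L * (\<delta> + \<eta>) ==>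
    (\<integral>\<^sup>+z. ennreal (1 / sqrt (r z)) * indicator {z\<in>\<Omega>. dist z y \<le> 2 * (1 / L + B / c) * r y} z \<partial>lborel)
    \<le> ennreal (K * (r y ^ DIM('a) / sqrt (r y)))"

lemma (in smooth_domain) collar_exists:
 assumes w: "smooth w" and inward: "\<And>p. p \<in> frontier \<Omega> ==> der \<rho> p (w p) < 0"
 shows "\<exists>c L B \<delta> \<eta> K. collar \<Omega> \<rho> w c L B \<delta> \<eta> K"
proof -
 obtain c0 where c0: "c0 > 0" "\<And>z x. z \<in> \<Omega> ==> r z < c0 ==> dist x z < c0 ==> der \<rho> x (w z) \<le> - c0"
  using inward_slope[OF w inward] by blast
 obtain L0 where L0: "L0 \<ge> 1" "\<And>z. z \<in> \<Omega> ==> r z \<le> L0" "\<And>x y. x \<in> \<Omega> ==> dist x y \<le> 1 ==> \<bar>\<rho> x - \<rho> y\<bar> \<le> L0 * dist x y"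
  using rho_lipschitz by blast
 have "continuous_on (closure \<Omega>) w"
  using w smooth_on_continuous_on[of UNIV w] continuous_on_subset by (auto simp: smooth_iff)
 then have "bounded (w ` closure \<Omega>)"
  by (intro compact_imp_bounded compact_continuous_image compact_closure_domain)
 then obtain B0 where B0: "\<And>z. z \<in> closure \<Omega> ==> norm (w z) \<le> B0" unfolding bounded_iff by blast
 define B where "B = max B0 0"
 have B: "0 \<le> B" "\<And>z. z \<in> \<Omega> ==> norm (w z) \<le> B"
  using B0 closure_subset by (auto simp: B_def intro: max.coboundedI1)
 define c where "c = min 1 c0"
 define L where "L = 2 * L0 * (1 + B)"
 define A where "A = 2 * (1 / L + B / c)"
 define m where "m = min 1 c0"
 \<comment> \<open>One constant serves as length of the flow and as width of the collar; it is small enough for all displacements below to stay where the slope bound holds.\<close>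
 define \<kappa> where "\<kappa> = m / (16 * L * (1 + A) * (1 + 2 * B))"
 define K where "K = 2 * measure lborel (ball (0::'a) 1) * (1 + B) ^ DIM('a) / sqrt c0 * (A ^ DIM('a) / sqrt A)"
 have c: "0 < c" "c \<le> 1" "c \<le> c0" using c0 by (auto simp: c_def)
 have L: "1 \<le> L" "2 * L0 \<le> L" "L0 * B \<le> L"
 proof -
  have "2 * L0 * 1 \<le> 2 * L0 * (1 + B)" using L0 B by (intro mult_left_mono) auto
  then show "2 * L0 \<le> L" by (simp add: L_def)
  then show "1 \<le> L" using L0 by simp
  have "0 \<le> L0 * B" using L0 B by simp
  then show "L0 * B \<le> L" using L0 by (simp add: L_def algebra_simps)
 qed
 have A: "0 < A" using L c B by (simp add: A_def add_pos_nonneg)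
 have m: "0 < m" "m \<le> 1" "m \<le> c0" using c0 by (auto simp: m_def)
 define P where "P = L * (1 + A) * (1 + 2 * B)"
 have ge1: "1 \<le> x * y" if "1 \<le> x" "1 \<le> y" for x y :: real using mult_mono[OF that] that by simp
 have P: "1 \<le> P" "1 + 2 * B \<le> P" "L * (A * (1 + 2 * B)) \<le> P" "L \<le> P"
 proof -
  have LA: "1 \<le> L * (1 + A)" using ge1[of L "1 + A"] L A by simp
  show "1 \<le> P" unfolding P_def using ge1[OF LA, of "1 + 2 * B"] B by simp
  show "1 + 2 * B \<le> P" unfolding P_def using mult_right_mono[OF LA, of "1 + 2 * B"] B by simp
  have "L * A * (1 + 2 * B) \<le> L * (1 + A) * (1 + 2 * B)" using L A B by (intro mult_right_mono mult_left_mono) auto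
  then show "L * (A * (1 + 2 * B)) \<le> P" by (simp add: P_def mult.assoc)
  have "1 \<le> (1 + A) * (1 + 2 * B)" using ge1[of "1 + A" "1 + 2 * B"] A B by simp
  from mult_left_mono[OF this, of L] L show "L \<le> P" by (simp add: P_def mult.assoc)
 qed
 have \<kappa>: "\<kappa> > 0" "16 * P * \<kappa> = m" using m P(1) by (simp_all add: \<kappa>_def P_def[symmetric] mult.assoc)
   (simp_all add: P_def[symmetric] mult.assoc[symmetric])
 have \<kappa>le: "x * \<kappa> \<le> m / 16" if "x \<le> P" for x
  using mult_right_mono[OF that less_imp_le[OF \<kappa>(1)]] \<kappa>(2) by simp
 have near: "2 * \<kappa> < c0" "2 * \<kappa> * B < c0" "2 * \<kappa> * B \<le> 1"
 proof -
  show "2 * \<kappa> < c0" using \<kappa>le[OF P(1)] m by simp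
  have "B * \<kappa> \<le> m / 16" by (rule \<kappa>le) (use P(2) B in simp)
  then show "2 * \<kappa> * B < c0" "2 * \<kappa> * B \<le> 1" using m by (simp_all add: mult.commute)
 qed
 have "collar \<Omega> \<rho> w c L B \<kappa> \<kappa> K"
 proof unfold_locales
  show "smooth w" by (rule w)
  show "0 < c" "1 \<le> L" "0 \<le> B" "0 < \<kappa>" using c L B \<kappa> by simp_all
  show "0 \<le> K" using c0 A B by (simp add: K_def)
  show "norm (w z) \<le> B" if "z \<in> \<Omega>" for z using B(2)[OF that] .
  show "y \<in> \<Omega> \<and> r x \<le> 2 * r y \<and> r y \<le> 2 * r x" if "x \<in> \<Omega>" "dist x y < r x / L" for x y
  proof -
   have rx: "0 < r x" "r x \<le> L0" using r_pos[OF that(1)] L0(2)[OF that(1)] by simp_all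
   have "r x / L \<le> r x / (2 * L0)" using rx L L0 by (intro divide_left_mono) auto
   then have d: "dist x y < r x / (2 * L0)" using that(2) by linarith
   moreover have "r x / (2 * L0) \<le> 1" using rx L0 by (simp add: divide_simps)
   ultimately have "\<bar>\<rho> x - \<rho> y\<bar> \<le> L0 * dist x y" using that(1) by (intro L0(3)) auto
   also have "\<dots> \<le> L0 * (r x / (2 * L0))" using d L0 by (intro mult_left_mono) auto
   also have "\<dots> = r x / 2" using L0 by simp
   finally show ?thesis using rx domain_eq by auto
  qed
  show "z + s *\<^sub>R w z \<in> \<Omega> \<and> c * (s + r z) \<le> r (z + s *\<^sub>R w z) \<and> r (z + s *\<^sub>R w z) \<le> L * (s + r z)"
   if z: "z \<in> \<Omega>" "r z < 2 * \<kappa>" and s: "0 \<le> s" "s \<le> 2 * \<kappa>" for z s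
  proof -
   have sw: "t * norm (w z) \<le> 2 * \<kappa> * B" if "0 \<le> t" "t \<le> s" for t
    using that s B(2)[OF z(1)] \<kappa> by (intro mult_mono) auto
   have "\<rho> (z + s *\<^sub>R w z) - \<rho> (z + 0 *\<^sub>R w z) \<le> (- c0) * (s - 0)"
   proof (rule slope_bound_upper[OF s(1)], rule c0(2)[OF z(1)])
    show "r z < c0" using z near by simp
    fix t assume "0 \<le> t" "t \<le> s"
    then show "dist (z + t *\<^sub>R w z) z < c0" using sw[of t] near by (simp add: dist_norm)
   qed
   then have low: "r z + c0 * s \<le> r (z + s *\<^sub>R w z)" by simp
   have "c * (s + r z) \<le> c0 * s + 1 * r z"
    unfolding distrib_left using c s r_pos[OF z(1)] by (intro add_mono mult_right_mono) auto
   then have 1: "c * (s + r z) \<le> r (z + s *\<^sub>R w z)" using low by simp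
   have "0 < c * (s + r z)" using c s r_pos[OF z(1)] by simp
   then have 2: "z + s *\<^sub>R w z \<in> \<Omega>" using 1 domain_eq by simp
   have "\<bar>\<rho> z - \<rho> (z + s *\<^sub>R w z)\<bar> \<le> L0 * dist z (z + s *\<^sub>R w z)"
    by (rule L0(3)[OF z(1)]) (use sw[OF s(1) order_refl] near s in \<open>simp add: dist_norm\<close>)
   also have "\<dots> \<le> L0 * (s * B)" using L0 s B(2)[OF z(1)] by (intro mult_left_mono) (auto simp: dist_norm mult_left_mono)
   also have "\<dots> \<le> L * s" using mult_right_mono[OF L(3) s(1)] by (simp add: mult_ac)
   finally have "r (z + s *\<^sub>R w z) \<le> L * s + 1 * r z" by linarith
   also have "\<dots> \<le> L * (s + r z)" unfolding distrib_left using L r_pos[OF z(1)] s by (intro add_mono mult_right_mono) auto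
   finally show ?thesis using 1 2 by blast
  qed
  show "(\<integral>\<^sup>+z. ennreal (1 / sqrt (r z)) * indicator {z\<in>\<Omega>. dist z y \<le> 2 * (1 / L + B / c) * r y} z \<partial>lborel)
    \<le> ennreal (K * (r y ^ DIM('a) / sqrt (r y)))" if y: "y \<in> \<Omega>" "r y \<le> 4 * L * (\<kappa> + \<kappa>)" for y
  proof -
   have ry: "0 < r y" using r_pos[OF y(1)] .
   have "r y \<le> 8 * (L * \<kappa>)" using y(2) by simp
   then have ry1: "r y < c0" using \<kappa>le[OF P(4)] m by simp
   have "A * (1 + 2 * B) * r y \<le> A * (1 + 2 * B) * (8 * (L * \<kappa>))"
    using \<open>r y \<le> 8 * (L * \<kappa>)\<close> A B by (intro mult_left_mono) auto
   also have "\<dots> = 8 * ((L * (A * (1 + 2 * B))) * \<kappa>)" by (simp add: mult_ac)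
   also have "\<dots> < c0" using \<kappa>le[OF P(3)] m by simp
   finally have ARB: "A * r y * (1 + 2 * B) < c0" by (simp add: mult_ac)
   have "(\<integral>\<^sup>+z. ennreal (1 / sqrt (r z)) * indicator {z\<in>\<Omega>. dist z y \<le> A * r y} z \<partial>lborel)
    \<le> ennreal (2 * measure lborel (ball (0::'a) 1) * (1 + B) ^ DIM('a) / sqrt c0 * ((A * r y) ^ DIM('a) / sqrt (A * r y)))"
   proof (rule thin_shell[OF c0(1) mult_pos_pos[OF A ry] B(2)[OF y(1)]])
    show "der \<rho> x (w y) \<le> - c0" if "dist x y \<le> A * r y * (1 + 2 * B)" for x
     by (rule c0(2)[OF y(1) ry1 le_less_trans[OF that ARB]])
   qed
   also have "2 * measure lborel (ball (0::'a) 1) * (1 + B) ^ DIM('a) / sqrt c0 * ((A * r y) ^ DIM('a) / sqrt (A * r y))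
    = K * (r y ^ DIM('a) / sqrt (r y))"
   proof -
    have "2 * measure lborel (ball (0::'a) 1) * (1 + B) ^ DIM('a) / sqrt c0 * ((A * t) ^ DIM('a) / sqrt (A * t))
     = K * (t ^ DIM('a) / sqrt t)" for t
     by (simp add: K_def power_mult_distrib real_sqrt_mult)
    then show ?thesis .
   qed
   finally show ?thesis by (simp add: A_def)
  qed
 qed
 then show ?thesis by blast
qed

section \<open>Weighted norms of holomorphic functions\<close>

lemma double_power_square: "((2 * a) ^ q)^2 * b^2 = 4 ^ q * (a ^ q * b)^2" for a b :: real
proof -
 have "(2 ^ q)^2 = ((2::real)^2) ^ q" by (simp only: power_mult[symmetric] mult.commute)
 then show ?thesis by (simp add: power_mult_distrib)
qed

lemma ennreal_mult_assoc_real: "0 \<le> a ==> ennreal a * (ennreal b * X) = ennreal (a * b) * X"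
 by (simp add: ennreal_mult' mult.assoc)

lemma ennreal_times_top: "0 < a ==> ennreal a * top = top"
 by (simp add: ennreal_mult_eq_top_iff)

lemma divide_power_le_double:
 fixes a b C :: real
 assumes "0 < a" "0 < b" "b \<le> 2 * a" "0 \<le> C"
 shows "C / a ^ d \<le> C * 2 ^ d / b ^ d"
proof -
 have "b ^ d \<le> (2 * a) ^ d" using assms by (intro power_mono) auto
 then have "C * b ^ d \<le> C * 2 ^ d * a ^ d"
  using assms(4) by (simp add: power_mult_distrib mult.assoc mult_left_mono)
 then show ?thesis using assms(1,2) by (simp add: frac_le_eq divide_simps)
qed

locale ccollar = collar \<Omega> \<rho> w c L B \<delta> \<eta> K
 for \<Omega> :: "(complex^'n) set" and \<rho> w c L B \<delta> \<eta> K
begin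

abbreviation holo :: "(complex^'n => complex) => bool" where "holo H \<equiv> holomorphic_fun_on H \<Omega>"

text \<open>\<open>wmass q H\<close> is \<open>\<parallel>r\<^sup>q H\<parallel>^2\<close>; with values in
\<open>ennreal\<close> it makes sense before finiteness is known, and \<open>wn q H\<close> below is its
square root.\<close>

definition wt :: "nat => (complex^'n => complex) => complex^'n => ennreal" where
 "wt q H y = ennreal ((r y ^ q * cmod (H y))^2) * indicator \<Omega> y"

definition wmass :: "nat => (complex^'n => complex) => ennreal" where
 "wmass q H = (\<integral>\<^sup>+y. wt q H y \<partial>lborel)"

abbreviation flw :: "real => complex^'n => complex^'n" where "flw s z \<equiv> z + s *\<^sub>R w z"
abbreviation near :: "(complex^'n) set" where "near \<equiv> {z\<in>\<Omega>. r z \<le> \<eta>}"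
abbreviation hardy_density :: "nat => (complex^'n => complex) => real => complex^'n => ennreal" where
 "hardy_density n H s z \<equiv> ennreal ((s ^ n)^2 * ((s + r z) * sqrt (s + r z)) / sqrt (r z) * (cmod (H (flw s z)))^2) * indicator near z"

lemma unit_ball_pos: "0 < measure lborel (ball (0::complex^'n) 1)" by (simp add: content_ball_pos)

lemma measurable_rho [measurable]: "\<rho> \<in> borel_measurable borel"
 by (rule borel_measurable_continuous_onI[OF continuous_rho])

lemma measurable_domain [measurable]: "\<Omega> \<in> sets borel" using open_domain by simp

lemma measurable_near [measurable]: "near \<in> sets borel"
proof -
 have "near = \<Omega> \<inter> {z. r z \<le> \<eta>}" by auto
 moreover have "closed {z. r z \<le> \<eta>}"
  by (rule closed_Collect_le) (auto intro!: continuous_intros continuous_rho)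
 ultimately show ?thesis by simp
qed

lemma continuous_w: "continuous_on A w"
 using smooth_w smooth_on_continuous_on[of UNIV w] continuous_on_subset by (auto simp: smooth_iff)

lemma measurable_w [measurable]: "w \<in> borel_measurable borel"
 by (rule borel_measurable_continuous_onI[OF continuous_w])

lemma measurable_holo:
 assumes "holo H"
 shows "(\<lambda>y. indicator \<Omega> y *\<^sub>R H y) \<in> borel_measurable borel"
 using holo_continuous_on[OF assms] open_domain by (simp add: borel_measurable_continuous_on_indicator)

lemma measurable_wt [measurable]:
 assumes "holo H"
 shows "wt q H \<in> borel_measurable borel"
proof -
 have [measurable]: "(\<lambda>y. indicator \<Omega> y *\<^sub>R H y) \<in> borel_measurable borel" by (rule measurable_holo[OF assms])
 have m: "(\<lambda>y. ennreal ((r y ^ q * cmod (indicator \<Omega> y *\<^sub>R H y))^2)) \<in> borel_measurable borel" by measurable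
 have "(\<lambda>y. ennreal ((r y ^ q * cmod (indicator \<Omega> y *\<^sub>R H y))^2)) = wt q H" by (auto simp: wt_def indicator_def fun_eq_iff)
 from m[unfolded this] show ?thesis .
qed

lemma emeasure_ball_lborel: "0 \<le> R ==> emeasure lborel (ball (z::complex^'n) R) = ennreal (R ^ DIM(complex^'n) * measure lborel (ball (0::complex^'n) 1))"
 and emeasure_cball_lborel: "0 \<le> R ==> emeasure lborel (cball (z::complex^'n) R) = ennreal (R ^ DIM(complex^'n) * measure lborel (ball (0::complex^'n) 1))"
 using content_ball_conv_unit_ball[of R z] content_cball_conv_ball[of z R]
  emeasure_lborel_ball_finite[of z R] emeasure_lborel_cball_finite[of z R]
 by (simp_all add: emeasure_eq_ennreal_measure)

text \<open>On a ball of radius comparable to \<open>r\<close> the weight is comparable to a constant, so the mean value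
inequality survives the weight.\<close>

lemma whitney_mean:
 assumes H: "holo H" and x: "x \<in> \<Omega>" and R: "0 < R" and sub: "ball y R \<subseteq> ball x (r x / L)"
 shows "ennreal ((r x ^ q * cmod (H y))^2) \<le> ennreal (4 ^ q / (R ^ DIM(complex^'n) * measure lborel (ball (0::complex^'n) 1))) * (\<integral>\<^sup>+v. wt q H v * indicator {v. dist x v < r x / L} v \<partial>lborel)"
proof -
 have sub\<Omega>: "ball y R \<subseteq> \<Omega>" using sub whitney[OF x] by (auto simp: subset_eq)
 have rx: "0 < r x" using r_pos[OF x] .
 have m: "R ^ DIM(complex^'n) * measure lborel (ball (0::complex^'n) 1) > 0" using R unit_ball_pos by simp
 have "ennreal ((cmod (H y))^2) * ennreal (R ^ DIM(complex^'n) * measure lborel (ball (0::complex^'n) 1)) \<le> (\<integral>\<^sup>+v. ennreal ((cmod (H v))^2) * indicator (ball y R) v \<partial>lborel)"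
  using holo_mean_value[OF open_domain H sub\<Omega>] R by (simp add: emeasure_ball_lborel)
 then have "ennreal ((r x ^ q)^2) * (ennreal ((cmod (H y))^2) * ennreal (R ^ DIM(complex^'n) * measure lborel (ball (0::complex^'n) 1))) \<le> ennreal ((r x ^ q)^2) * \<dots>"
  by (rule mult_left_mono) simp
 also have "\<dots> = (\<integral>\<^sup>+v. ennreal ((r x ^ q)^2) * (ennreal ((cmod (H v))^2) * indicator (ball y R) v) \<partial>lborel)"
 proof (rule nn_integral_cmult[symmetric])
  have [measurable]: "(\<lambda>y. indicator \<Omega> y *\<^sub>R H y) \<in> borel_measurable borel" by (rule measurable_holo[OF H])
  have [measurable]: "ball y R \<in> sets borel" by simp
  have m: "(\<lambda>v. ennreal ((cmod (indicator \<Omega> v *\<^sub>R H v))^2) * indicator (ball y R) v) \<in> borel_measurable borel" by measurable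
  have "(\<lambda>v. ennreal ((cmod (indicator \<Omega> v *\<^sub>R H v))^2) * indicator (ball y R) v) = (\<lambda>v. ennreal ((cmod (H v))^2) * indicator (ball y R) v)"
   using sub\<Omega> by (auto simp: indicator_def fun_eq_iff)
  from m[unfolded this] show "(\<lambda>v. ennreal ((cmod (H v))^2) * indicator (ball y R) v) \<in> borel_measurable lborel" by simp
 qed
 also have "\<dots> \<le> (\<integral>\<^sup>+v. ennreal (4 ^ q) * (wt q H v * indicator {v. dist x v < r x / L} v) \<partial>lborel)"
 proof (rule nn_integral_mono)
  fix v
  show "ennreal ((r x ^ q)^2) * (ennreal ((cmod (H v))^2) * indicator (ball y R) v) \<le> ennreal (4 ^ q) * (wt q H v * indicator {v. dist x v < r x / L} v)"
  proof (cases "v \<in> ball y R")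
   case True
   then have d: "dist x v < r x / L" using sub by auto
   then have w: "v \<in> \<Omega>" "r x \<le> 2 * r v" using whitney[OF x d] by auto
   have "(r x ^ q)^2 * (cmod (H v))^2 \<le> ((2 * r v) ^ q)^2 * (cmod (H v))^2"
    using w rx by (intro mult_right_mono power_mono) auto
   also have "\<dots> = 4 ^ q * (r v ^ q * cmod (H v))^2"
    by (rule double_power_square)
   finally show ?thesis using True d w by (simp add: wt_def ennreal_mult[symmetric])
  qed simp
 qed
 also have "\<dots> = ennreal (4 ^ q) * (\<integral>\<^sup>+v. wt q H v * indicator {v. dist x v < r x / L} v \<partial>lborel)"
 proof -
  note [measurable] = measurable_wt[OF H]
  show ?thesis by (rule nn_integral_cmult) measurable
 qed
 finally have "ennreal (1 / (R ^ DIM(complex^'n) * measure lborel (ball (0::complex^'n) 1))) * (ennreal ((r x ^ q)^2) * (ennreal ((cmod (H y))^2) * ennreal (R ^ DIM(complex^'n) * measure lborel (ball (0::complex^'n) 1)))) \<le> ennreal (1 / (R ^ DIM(complex^'n) * measure lborel (ball (0::complex^'n) 1))) * \<dots>"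
  by (rule mult_left_mono) simp
 also have "ennreal (1 / (R ^ DIM(complex^'n) * measure lborel (ball (0::complex^'n) 1))) * (ennreal ((r x ^ q)^2) * (ennreal ((cmod (H y))^2) * ennreal (R ^ DIM(complex^'n) * measure lborel (ball (0::complex^'n) 1)))) = ennreal ((r x ^ q * cmod (H y))^2)"
  using m R by (simp add: ennreal_mult[symmetric] power_mult_distrib)
 finally show ?thesis using m by (simp add: mult.assoc[symmetric] ennreal_mult[symmetric])
qed

text \<open>Integrating mean value bounds over the points \<open>X z\<close> costs only a constant: the \<open>z\<close>
for which the ball around \<open>X z\<close> contains a given \<open>v\<close> lie in a ball around
\<open>v\<close> of comparable radius.\<close>

lemma whitney_schur:
 assumes H: "holo H" and A[measurable]: "A \<in> sets borel" and X[measurable]: "X \<in> borel_measurable borel"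
  and XA: "\<And>z. z \<in> A ==> X z \<in> \<Omega> \<and> dist (X z) z \<le> b * r (X z)" and b: "0 \<le> b" and C: "0 \<le> C"
  and f: "\<And>z. z \<in> A ==> f z \<le> ennreal (C / r (X z) ^ DIM(complex^'n)) * (\<integral>\<^sup>+v. wt q H v * indicator {v. dist (X z) v < r (X z) / L} v \<partial>lborel)"
 shows "(\<integral>\<^sup>+z. f z * indicator A z \<partial>lborel) \<le> ennreal (C * (4 * (b + 1 / L)) ^ DIM(complex^'n) * measure lborel (ball (0::complex^'n) 1)) * wmass q H"
proof -
 note [measurable] = measurable_wt[OF H]
 define k where "k z v = ennreal (C / r (X z) ^ DIM(complex^'n)) * indicator A z * indicator {p. dist (X (fst p)) (snd p) < r (X (fst p)) / L} (z, v)" for z v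
 have km: "(\<lambda>(z, v). wt q H v * k z v) \<in> borel_measurable (lborel \<Otimes>\<^sub>M lborel)"
  unfolding k_def by measurable
 have "(\<integral>\<^sup>+z. f z * indicator A z \<partial>lborel) \<le> (\<integral>\<^sup>+z. (\<integral>\<^sup>+v. wt q H v * k z v \<partial>lborel) \<partial>lborel)"
 proof (rule nn_integral_mono)
  fix z show "f z * indicator A z \<le> (\<integral>\<^sup>+v. wt q H v * k z v \<partial>lborel)"
  proof (cases "z \<in> A")
   case True
   have "(\<integral>\<^sup>+v. wt q H v * k z v \<partial>lborel) = (\<integral>\<^sup>+v. ennreal (C / r (X z) ^ DIM(complex^'n)) * (wt q H v * indicator {v. dist (X z) v < r (X z) / L} v) \<partial>lborel)"
    using True by (intro nn_integral_cong) (auto simp: k_def indicator_def mult_ac)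
   also have "\<dots> = ennreal (C / r (X z) ^ DIM(complex^'n)) * (\<integral>\<^sup>+v. wt q H v * indicator {v. dist (X z) v < r (X z) / L} v \<partial>lborel)"
    by (rule nn_integral_cmult) measurable
   finally show ?thesis using f[OF True] True by simp
  qed simp
 qed
 also have "\<dots> = (\<integral>\<^sup>+v. (\<integral>\<^sup>+z. wt q H v * k z v \<partial>lborel) \<partial>lborel)"
  by (rule lborel_pair.Fubini'[OF km, symmetric])
 also have "\<dots> \<le> (\<integral>\<^sup>+v. ennreal (C * (4 * (b + 1 / L)) ^ DIM(complex^'n) * measure lborel (ball (0::complex^'n) 1)) * wt q H v \<partial>lborel)"
 proof (rule nn_integral_mono)
  fix v
  show "(\<integral>\<^sup>+z. wt q H v * k z v \<partial>lborel) \<le> ennreal (C * (4 * (b + 1 / L)) ^ DIM(complex^'n) * measure lborel (ball (0::complex^'n) 1)) * wt q H v"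
  proof (cases "v \<in> \<Omega>")
   case True
   then have rv: "0 < r v" by (rule r_pos)
   have "k z v \<le> ennreal (C * 2 ^ DIM(complex^'n) / r v ^ DIM(complex^'n)) * indicator (cball v (2 * (b + 1 / L) * r v)) z" for z
   proof (cases "z \<in> A \<and> dist (X z) v < r (X z) / L")
    case t: True
    then have X\<Omega>: "X z \<in> \<Omega>" "dist (X z) z \<le> b * r (X z)" using XA by auto
    then have w: "r (X z) \<le> 2 * r v" "r v \<le> 2 * r (X z)" using whitney[OF X\<Omega>(1)] t by blast+
    have rX: "0 < r (X z)" using r_pos[OF X\<Omega>(1)] .
    have "dist v z \<le> dist (X z) v + dist (X z) z" by (rule dist_triangle3)
    also have "\<dots> \<le> r (X z) / L + b * r (X z)" using t X\<Omega>(2) by simp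
    also have "\<dots> = (b + 1 / L) * r (X z)" by (simp add: algebra_simps)
    also have "\<dots> \<le> (b + 1 / L) * (2 * r v)" using w b pos(2) by (intro mult_left_mono) auto
    finally have "z \<in> cball v (2 * (b + 1 / L) * r v)" by (simp add: mult_ac)
    moreover have "C / r (X z) ^ DIM(complex^'n) \<le> C * 2 ^ DIM(complex^'n) / r v ^ DIM(complex^'n)"
     by (rule divide_power_le_double[OF rX rv w(2) C])
    ultimately show ?thesis using t by (simp add: k_def ennreal_leI)
   qed (auto simp: k_def indicator_def)
   then have "(\<integral>\<^sup>+z. k z v \<partial>lborel) \<le> (\<integral>\<^sup>+z. ennreal (C * 2 ^ DIM(complex^'n) / r v ^ DIM(complex^'n)) * indicator (cball v (2 * (b + 1 / L) * r v)) z \<partial>lborel)"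
    by (intro nn_integral_mono)
   also have "\<dots> = ennreal (C * 2 ^ DIM(complex^'n) / r v ^ DIM(complex^'n)) * ennreal ((2 * (b + 1 / L) * r v) ^ DIM(complex^'n) * measure lborel (ball (0::complex^'n) 1))"
   proof -
    have R: "0 \<le> 2 * (b + 1 / L) * r v" using b pos(2) rv by (intro mult_nonneg_nonneg) auto
    show ?thesis by (subst nn_integral_cmult_indicator) (simp, simp only: emeasure_cball_lborel[OF R])
   qed
   also have "\<dots> = ennreal (C * (4 * (b + 1 / L)) ^ DIM(complex^'n) * measure lborel (ball (0::complex^'n) 1))"
   proof -
    have "C * 2 ^ DIM(complex^'n) / r v ^ DIM(complex^'n) * ((2 * (b + 1 / L) * r v) ^ DIM(complex^'n) * measure lborel (ball (0::complex^'n) 1)) = C * (2 ^ DIM(complex^'n) * (2 * (b + 1 / L)) ^ DIM(complex^'n)) * measure lborel (ball (0::complex^'n) 1)"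
     using rv by (simp add: power_mult_distrib)
    also have "2 ^ DIM(complex^'n) * (2 * (b + 1 / L)) ^ DIM(complex^'n) = (4 * (b + 1 / L)) ^ DIM(complex^'n)"
     unfolding power_mult_distrib[symmetric] by simp
    finally have E: "C * 2 ^ DIM(complex^'n) / r v ^ DIM(complex^'n) * ((2 * (b + 1 / L) * r v) ^ DIM(complex^'n) * measure lborel (ball (0::complex^'n) 1))
     = C * (4 * (b + 1 / L)) ^ DIM(complex^'n) * measure lborel (ball (0::complex^'n) 1)" .
    have "0 \<le> C * 2 ^ DIM(complex^'n) / r v ^ DIM(complex^'n)"
     using C rv by (intro divide_nonneg_nonneg mult_nonneg_nonneg zero_le_power) auto
    from ennreal_mult'[OF this] show ?thesis unfolding E[symmetric] by simp
   qed
   finally have "wt q H v * (\<integral>\<^sup>+z. k z v \<partial>lborel) \<le> wt q H v * ennreal (C * (4 * (b + 1 / L)) ^ DIM(complex^'n) * measure lborel (ball (0::complex^'n) 1))"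
    by (rule mult_left_mono) simp
   moreover have "(\<integral>\<^sup>+z. wt q H v * k z v \<partial>lborel) = wt q H v * (\<integral>\<^sup>+z. k z v \<partial>lborel)"
    unfolding k_def by (rule nn_integral_cmult) measurable
   ultimately show ?thesis by (simp add: mult.commute)
  qed (simp add: wt_def)
 qed
 also have "\<dots> = ennreal (C * (4 * (b + 1 / L)) ^ DIM(complex^'n) * measure lborel (ball (0::complex^'n) 1)) * wmass q H"
  unfolding wmass_def by (rule nn_integral_cmult) measurable
 finally show ?thesis .
qed

lemma flow_bounds:
 assumes "z \<in> near" "0 \<le> s" "s \<le> 2 * \<delta>"
 shows "flw s z \<in> \<Omega>" "c * (s + r z) \<le> r (flw s z)" "r (flw s z) \<le> L * (s + r z)"
  "dist (flw s z) z \<le> B / c * r (flw s z)" "0 < r z" "0 < r (flw s z)"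
proof -
 have z: "z \<in> \<Omega>" "r z < 2 * \<eta>" using assms pos by auto
 show 1: "flw s z \<in> \<Omega>" "c * (s + r z) \<le> r (flw s z)" "r (flw s z) \<le> L * (s + r z)"
  using flow[OF z assms(2,3)] by auto
 show rz: "0 < r z" "0 < r (flw s z)" using r_pos[OF z(1)] r_pos[OF 1(1)] .
 have "dist (flw s z) z = s * norm (w z)" using assms by (simp add: dist_norm)
 also have "\<dots> \<le> s * B" using w_bound[OF z(1)] assms by (intro mult_left_mono) auto
 also have "\<dots> = B / c * (c * s)" using pos by simp
 also have "\<dots> \<le> B / c * r (flw s z)"
 proof (rule mult_left_mono)
  have "c * s \<le> c * (s + r z)" using rz pos by simp
  then show "c * s \<le> r (flw s z)" using 1 by linarith
 qed (use pos in simp)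
 finally show "dist (flw s z) z \<le> B / c * r (flw s z)" .
qed

lemma flow_mean:
 assumes H: "holo H" and x: "x \<in> \<Omega>"
 shows "ennreal ((r x ^ q * cmod (H x))^2) \<le> ennreal (4 ^ q * L ^ DIM(complex^'n) / measure lborel (ball (0::complex^'n) 1) / r x ^ DIM(complex^'n)) * (\<integral>\<^sup>+v. wt q H v * indicator {v. dist x v < r x / L} v \<partial>lborel)"
proof -
 have eq: "4 ^ q / ((a / L) ^ DIM(complex^'n) * V) = 4 ^ q * L ^ DIM(complex^'n) / V / a ^ DIM(complex^'n)" for a V :: real
  by (simp add: power_divide)
 have "0 < r x / L" using r_pos[OF x] pos(2) by (intro divide_pos_pos) auto
 from whitney_mean[OF H x this subset_refl, of q] show ?thesis unfolding eq .
qed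

text \<open>On a shifted point \<open>s\<close> is bounded by a multiple of \<open>r\<close>, so the shift can be absorbed
by Whitney balls without a change of variables.\<close>

lemma flow_L2:
 "\<exists>C\<ge>0. \<forall>H s. holo H --> 0 \<le> s --> s \<le> 2 * \<delta> -->
   (\<integral>\<^sup>+z. ennreal ((s ^ q * cmod (H (flw s z)))^2) * indicator near z \<partial>lborel) \<le> ennreal C * wmass q H"
proof (intro exI conjI allI impI)
 let ?C0 = "4 ^ q * L ^ DIM(complex^'n) / measure lborel (ball (0::complex^'n) 1)"
 let ?C1 = "(1 / c ^ q)^2 * ?C0"
 have C0: "0 \<le> ?C0" "0 \<le> ?C1" using pos unit_ball_pos by simp_all
 show "0 \<le> ?C1 * (4 * (B / c + 1 / L)) ^ DIM(complex^'n) * measure lborel (ball (0::complex^'n) 1)" using C0 pos unit_ball_pos by simp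
 fix H s assume H: "holo H" and s: "0 \<le> s" "s \<le> 2 * \<delta>"
 show "(\<integral>\<^sup>+z. ennreal ((s ^ q * cmod (H (flw s z)))^2) * indicator near z \<partial>lborel) \<le> ennreal (?C1 * (4 * (B / c + 1 / L)) ^ DIM(complex^'n) * measure lborel (ball (0::complex^'n) 1)) * wmass q H"
 proof (rule whitney_schur[OF H measurable_near, of "flw s"])
  show "flw s \<in> borel_measurable borel" by measurable
  show "flw s z \<in> \<Omega> \<and> dist (flw s z) z \<le> B / c * r (flw s z)" if "z \<in> near" for z
   using flow_bounds[OF that s] by blast
  show "0 \<le> B / c" "0 \<le> ?C1" using pos C0 by simp_all
  fix z assume z: "z \<in> near"
  note fb = flow_bounds[OF z s]
  have "(c * s) ^ q \<le> r (flw s z) ^ q"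
  proof (rule power_mono)
   have "c * s \<le> c * (s + r z)" using fb pos by simp
   then show "c * s \<le> r (flw s z)" using fb by linarith
  qed (use pos s in simp)
  then have "s ^ q \<le> 1 / c ^ q * r (flw s z) ^ q" using pos by (simp add: power_mult_distrib field_simps)
  then have "s ^ q * cmod (H (flw s z)) \<le> 1 / c ^ q * r (flw s z) ^ q * cmod (H (flw s z))" by (rule mult_right_mono) simp
  then have "(s ^ q * cmod (H (flw s z)))^2 \<le> (1 / c ^ q * r (flw s z) ^ q * cmod (H (flw s z)))^2"
   using s by (intro power_mono) auto
  also have "\<dots> = (1 / c ^ q)^2 * (r (flw s z) ^ q * cmod (H (flw s z)))^2"
   by (simp only: power_mult_distrib mult.assoc)
  finally have "ennreal ((s ^ q * cmod (H (flw s z)))^2) \<le> ennreal ((1 / c ^ q)^2) * ennreal ((r (flw s z) ^ q * cmod (H (flw s z)))^2)"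
   by (simp add: ennreal_mult[symmetric] ennreal_leI)
  also have "\<dots> \<le> ennreal ((1 / c ^ q)^2) * (ennreal (?C0 / r (flw s z) ^ DIM(complex^'n)) * (\<integral>\<^sup>+v. wt q H v * indicator {v. dist (flw s z) v < r (flw s z) / L} v \<partial>lborel))"
   by (intro mult_left_mono flow_mean H fb) simp
  also have "\<dots> = ennreal (?C1 / r (flw s z) ^ DIM(complex^'n)) * (\<integral>\<^sup>+v. wt q H v * indicator {v. dist (flw s z) v < r (flw s z) / L} v \<partial>lborel)"
   by (simp only: ennreal_mult_assoc_real[OF zero_le_power2] times_divide_eq_right)
  finally show "ennreal ((s ^ q * cmod (H (flw s z)))^2) \<le> \<dots>" .
 qed
qed

text \<open>Cauchy's estimate on a ball of radius comparable to \<open>r\<close>, followed by the mean value inequality.\<close>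

lemma derivative_wmass:
 "\<exists>C\<ge>0. \<forall>H. holo H --> wmass (Suc q) (\<lambda>z. der H z v) \<le> ennreal C * wmass q H"
proof (intro exI conjI allI impI)
 let ?C0 = "(norm v * (4 * L))^2 * (4 ^ q * (4 * L) ^ DIM(complex^'n) / measure lborel (ball (0::complex^'n) 1))"
 have C0: "0 \<le> ?C0" using pos unit_ball_pos by simp
 show "0 \<le> ?C0 * (4 * (0 + 1 / L)) ^ DIM(complex^'n) * measure lborel (ball (0::complex^'n) 1)" using C0 pos unit_ball_pos by simp
 fix H assume H: "holo H"
 let ?D = "\<lambda>z. der H z v"
 have "(\<integral>\<^sup>+z. ennreal ((r z ^ Suc q * cmod (?D z))^2) * indicator \<Omega> z \<partial>lborel) \<le> ennreal (?C0 * (4 * (0 + 1 / L)) ^ DIM(complex^'n) * measure lborel (ball (0::complex^'n) 1)) * wmass q H"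
 proof (rule whitney_schur[OF H measurable_domain, of "\<lambda>z. z"])
  show "0 \<le> ?C0" by (rule C0)
  fix x assume x: "x \<in> \<Omega>"
  have rx: "0 < r x" by (rule r_pos[OF x])
  define \<epsilon> where "\<epsilon> = r x / (4 * L)"
  have \<epsilon>: "\<epsilon> > 0" unfolding \<epsilon>_def using rx pos by (intro divide_pos_pos) auto
  have e4: "4 * \<epsilon> = r x / L" by (simp add: \<epsilon>_def)
  define I where "I = (\<integral>\<^sup>+v. wt q H v * indicator {v. dist x v < r x / L} v \<partial>lborel)"
  define C2 where "C2 = 4 ^ q / (\<epsilon> ^ DIM(complex^'n) * measure lborel (ball (0::complex^'n) 1))"
  have C2: "0 < C2" using \<epsilon> unit_ball_pos by (simp add: C2_def)
  have eqC: "?C0 / r x ^ DIM(complex^'n) = (norm v * (4 * L))^2 * C2"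
   using rx pos by (simp add: C2_def \<epsilon>_def power_divide)
  have bound: "ennreal ((r x ^ q * cmod (H y))^2) \<le> ennreal C2 * I" if "y \<in> cball x \<epsilon>" for y
  proof -
   have "ball y \<epsilon> \<subseteq> ball x (r x / L)"
   proof
    fix u assume "u \<in> ball y \<epsilon>"
    then show "u \<in> ball x (r x / L)" using that dist_triangle[of x u y] \<epsilon> e4 by simp
   qed
   from whitney_mean[OF H x \<epsilon> this] show ?thesis by (simp add: C2_def I_def)
  qed
  show "ennreal ((r x ^ Suc q * cmod (?D x))^2) \<le> ennreal (?C0 / r x ^ DIM(complex^'n)) * (\<integral>\<^sup>+v. wt q H v * indicator {v. dist x v < r x / L} v \<partial>lborel)"
  proof (cases "I = \<infinity>")
   case True
   show ?thesis
   proof (cases "v = 0")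
    case True
    then have "?D x = 0" using linear_0[OF has_derivative_linear[OF holo_has_derivative(1)[OF H x]]] by simp
    then show ?thesis by simp
   next
    case False
    then have "?C0 / r x ^ DIM(complex^'n) > 0" unfolding eqC using C2 pos by simp
    from ennreal_times_top[OF this] True show ?thesis unfolding I_def[symmetric] by (simp only: infinity_ennreal_def) simp
   qed
  next
   case False
   then obtain i where i: "I = ennreal i" "0 \<le> i" by (cases I) auto
   define M where "M = sqrt (C2 * i) / r x ^ q"
   have "cmod (H y) \<le> M" if "y \<in> cball x \<epsilon>" for y
   proof -
    have "(r x ^ q * cmod (H y))^2 \<le> C2 * i"
     using bound[OF that] C2 i by (simp add: ennreal_mult[symmetric])
    then have "r x ^ q * cmod (H y) \<le> sqrt (C2 * i)" by (rule real_le_rsqrt)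
    then show ?thesis using rx by (simp add: M_def field_simps)
   qed
   moreover have "cball x \<epsilon> \<subseteq> \<Omega>"
    using whitney[OF x] e4 \<epsilon> by (auto simp: subset_eq)
   ultimately have "cmod (?D x) \<le> M / \<epsilon> * norm v" by (intro deriv_bound_on_ball[OF H \<epsilon>])
   then have "r x ^ Suc q * cmod (?D x) \<le> r x ^ Suc q * (M / \<epsilon> * norm v)"
    by (intro mult_left_mono zero_le_power less_imp_le[OF rx])
   also have "\<dots> = norm v * (4 * L) * sqrt (C2 * i)" using rx pos by (simp add: M_def \<epsilon>_def)
   finally have "(r x ^ Suc q * cmod (?D x))^2 \<le> (norm v * (4 * L) * sqrt (C2 * i))^2"
    by (rule power_mono) (intro mult_nonneg_nonneg zero_le_power less_imp_le[OF rx] norm_ge_zero)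
   also have "\<dots> = (norm v * (4 * L))^2 * C2 * i" using C2 i by (simp add: power_mult_distrib)
   finally show ?thesis unfolding I_def[symmetric] eqC i(1) using C2 i
    by (simp add: ennreal_mult[symmetric] ennreal_leI)
  qed
 qed auto
 then show "wmass (Suc q) ?D \<le> ennreal (?C0 * (4 * (0 + 1 / L)) ^ DIM(complex^'n) * measure lborel (ball (0::complex^'n) 1)) * wmass q H"
  by (simp add: wmass_def wt_def)
qed

end

section \<open>A Hardy inequality along the flow\<close>

lemma nn_integral_hardy_weight:
 assumes a: "0 < a" and d: "0 \<le> d"
 shows "(\<integral>\<^sup>+s. ennreal (sqrt a / ((s + a) * sqrt (s + a))) * indicator {0..d} s \<partial>lborel) \<le> 2"
proof -
 have "(\<integral>\<^sup>+s. ennreal (sqrt a / ((s + a) * sqrt (s + a))) * indicator {0..d} s \<partial>lborel)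
  = ennreal ((- 2 * sqrt a / sqrt (d + a)) - (- 2 * sqrt a / sqrt (0 + a)))"
 proof (rule nn_integral_has_integral_lebesgue')
  show "0 \<le> sqrt a / ((s + a) * sqrt (s + a))" if "s \<in> {0..d}" for s using that a by simp
  show "((\<lambda>s. sqrt a / ((s + a) * sqrt (s + a))) has_integral (- 2 * sqrt a / sqrt (d + a)) - (- 2 * sqrt a / sqrt (0 + a))) {0..d}"
  proof (rule fundamental_theorem_of_calculus[OF d])
   fix s assume "s \<in> {0..d}"
   then have p: "s + a > 0" using a by simp
   have "((\<lambda>s. - 2 * sqrt a / sqrt (s + a)) has_real_derivative sqrt a / ((s + a) * sqrt (s + a))) (at s within {0..d})"
    using p by (auto intro!: derivative_eq_intros simp: field_simps)
   then show "((\<lambda>s. - 2 * sqrt a / sqrt (s + a)) has_vector_derivative sqrt a / ((s + a) * sqrt (s + a))) (at s within {0..d})"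
    by (simp add: has_real_derivative_iff_has_vector_derivative)
  qed
 qed
 also have "\<dots> \<le> ennreal 2"
 proof (rule ennreal_leI)
  have "0 \<le> 2 * sqrt a / sqrt (d + a)" using a d by simp
  then show "(- 2 * sqrt a / sqrt (d + a)) - (- 2 * sqrt a / sqrt (0 + a)) \<le> 2" using a by simp
 qed
 finally show ?thesis by simp
qed

lemma hardy_pointwise:
 fixes s a x c :: real
 assumes c: "0 < c" and s: "0 \<le> s" and a: "0 < a" and x: "c * (s + a) \<le> x"
 shows "(s ^ n)^2 * ((s + a) * sqrt (s + a)) \<le> (1 / c ^ Suc n)^2 * sqrt c * ((x ^ Suc n)^2 / sqrt x)"
proof -
 define t where "t = x / c"
 have "s + a \<le> t" using x c by (simp add: t_def pos_le_divide_eq mult.commute)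
 then have t: "s \<le> t" "s + a \<le> t" "0 < t" using s a by simp_all
 have "(s ^ n)^2 * ((s + a) * sqrt (s + a)) \<le> (t ^ n)^2 * (t * sqrt t)"
  using t s a by (intro mult_mono power_mono) auto
 also have "t * sqrt t = t * t / sqrt t"
  by (simp only: times_divide_eq_right[symmetric] real_div_sqrt[OF less_imp_le[OF t(3)]])
 also have "(t ^ n)^2 * (t * t / sqrt t) = (t ^ Suc n)^2 / sqrt t" by (simp add: power2_eq_square mult_ac)
 also have "\<dots> = (1 / c ^ Suc n)^2 * sqrt c * ((x ^ Suc n)^2 / sqrt x)"
  unfolding t_def by (simp add: power_divide real_sqrt_divide)
 finally show ?thesis .
qed

lemma inverse_sqrt_power_le_double:
 fixes x v :: real
 assumes "0 < x" "0 < v" "v \<le> 2 * x"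
 shows "1 / (sqrt x * x ^ d) \<le> 2 * 2 ^ d / (sqrt v * v ^ d)"
proof -
 have "sqrt v \<le> sqrt (4 * x)" using assms by (intro real_sqrt_le_mono) simp
 then have "sqrt v \<le> 2 * sqrt x" by (simp add: real_sqrt_mult)
 moreover have "v ^ d \<le> 2 ^ d * x ^ d" using power_mono[of v "2 * x" d] assms by (simp add: power_mult_distrib)
 ultimately have "sqrt v * v ^ d \<le> (2 * sqrt x) * (2 ^ d * x ^ d)" using assms by (intro mult_mono) auto
 then show ?thesis using assms by (simp add: frac_le_eq divide_simps mult_ac)
qed

context ccollar begin

text \<open>The factor with \<open>H\<close> that the Cauchy-Schwarz inequality produces in the proof of
\<open>hardy_inequality\<close>. A mean value bound at \<open>z + s w(z)\<close> replaces \<open>H\<close>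
there by its mass at nearby points \<open>v\<close>. For fixed \<open>v\<close> the integral over
\<open>z\<close> is a thin shell integral of \<open>1 / sqrt r\<close>, and the factor \<open>1 / r v\<close>
that it leaves is integrated over \<open>s \<le> 2 r v / c\<close>.\<close>

lemma hardy_flow_factor:
 assumes p: "p = Suc n"
 shows "\<exists>C\<ge>0. \<forall>H. holo H -->
   (\<integral>\<^sup>+s. (\<integral>\<^sup>+z. hardy_density n H s z \<partial>lborel) * indicator {0..\<delta>} s \<partial>lborel)
   \<le> ennreal C * wmass p H"
proof (intro exI conjI allI impI)
 let ?d = "DIM(complex^'n)"
 define C0 where "C0 = 4 ^ p * L ^ ?d / measure lborel (ball (0::complex^'n) 1)"
 define C1 where "C1 = (1 / c ^ p)^2 * sqrt c"
 have C: "0 \<le> C0" "0 \<le> C1" using pos unit_ball_pos by (simp_all add: C0_def C1_def)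
 define A where "A = 2 * (1 / L + B / c)"
 define E where "E v = C1 * C0 * (2 * 2 ^ ?d / (sqrt (r v) * r v ^ ?d))" for v
 define C2 where "C2 = C1 * C0 * 2 * 2 ^ ?d * K"
 have C2: "0 \<le> C2" using C pos by (simp add: C2_def)
 show "0 \<le> C2 * (2 / c)" using C2 pos by simp
 fix H assume H: "holo H"
 note [measurable] = measurable_wt[OF H]
 define S where "S = {q. 0 \<le> fst q \<and> c * fst q \<le> 2 * r (snd q)}"
 have S[measurable]: "S \<in> sets (borel \<Otimes>\<^sub>M borel)"
 proof -
  have "S = {q \<in> space (borel \<Otimes>\<^sub>M borel). 0 \<le> fst q \<and> c * fst q \<le> 2 * r (snd q)}" by (simp add: S_def space_pair_measure)
  also have "\<dots> \<in> sets (borel \<Otimes>\<^sub>M borel)" by measurable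
  finally show ?thesis .
 qed
 define T where "T z v = ennreal (1 / sqrt (r z)) * indicator {q. fst q \<in> \<Omega> \<and> dist (fst q) (snd q) \<le> A * r (snd q)} (z, v)" for z v
 define U where "U = {v. v \<in> \<Omega> \<and> r v \<le> 4 * L * (\<delta> + \<eta>)}"
 have U[measurable]: "U \<in> sets borel"
 proof -
  have "U = {v \<in> space borel. v \<in> \<Omega> \<and> r v \<le> 4 * L * (\<delta> + \<eta>)}" by (simp add: U_def)
  also have "\<dots> \<in> sets borel" by measurable
  finally show ?thesis .
 qed
 have inner: "(\<integral>\<^sup>+z. hardy_density n H s z \<partial>lborel)
   \<le> (\<integral>\<^sup>+v. wt p H v * ennreal (C2 / r v) * indicator S (s, v) \<partial>lborel)" if s: "s \<in> {0..\<delta>}" for s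
 proof -
  have s2: "0 \<le> s" "s \<le> 2 * \<delta>" using s pos by auto
  \<comment> \<open>The kernel that dominates the mean value bound; it factors into functions of \<open>v\<close> and the thin shell integrand \<open>T z v\<close>.\<close>
  define k where "k z v = ennreal (E v) * indicator U v * T z v * indicator S (s, v)" for z v
  have [measurable]: "E \<in> borel_measurable borel" unfolding E_def by measurable
  have Tm[measurable]: "(\<lambda>(z, v). T z v) \<in> borel_measurable (borel \<Otimes>\<^sub>M borel)" unfolding T_def by measurable
  have km: "(\<lambda>(z, v). wt p H v * k z v) \<in> borel_measurable (lborel \<Otimes>\<^sub>M lborel)"
   unfolding k_def T_def by measurable
  have "(\<integral>\<^sup>+z. hardy_density n H s z \<partial>lborel)
    \<le> (\<integral>\<^sup>+z. (\<integral>\<^sup>+v. wt p H v * k z v \<partial>lborel) \<partial>lborel)"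
  proof (rule nn_integral_mono)
   fix z
   show "hardy_density n H s z \<le> (\<integral>\<^sup>+v. wt p H v * k z v \<partial>lborel)"
   proof (cases "z \<in> near")
    case True
    note fb = flow_bounds[OF True s2]
    define x where "x = r (flw s z)"
    define a where "a = r z"
    have xa: "0 < x" "0 < a" "c * (s + a) \<le> x" using fb by (simp_all add: x_def a_def)
    have "(s ^ n)^2 * ((s + a) * sqrt (s + a)) / sqrt a * (cmod (H (flw s z)))^2
     \<le> (C1 * ((x ^ p)^2 / sqrt x)) / sqrt a * (cmod (H (flw s z)))^2"
     using hardy_pointwise[OF pos(1) s2(1) xa(2,3), of n] xa unfolding p C1_def
     by (intro mult_right_mono divide_right_mono) auto
    also have "\<dots> = C1 / (sqrt x * sqrt a) * (x ^ p * cmod (H (flw s z)))^2" by (simp add: power_mult_distrib)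
    finally have "ennreal ((s ^ n)^2 * ((s + a) * sqrt (s + a)) / sqrt a * (cmod (H (flw s z)))^2)
     \<le> ennreal (C1 / (sqrt x * sqrt a)) * ennreal ((x ^ p * cmod (H (flw s z)))^2)"
     using C xa by (simp add: ennreal_mult[symmetric] ennreal_leI)
    also have "\<dots> \<le> ennreal (C1 / (sqrt x * sqrt a)) * (ennreal (C0 / x ^ ?d) * (\<integral>\<^sup>+v. wt p H v * indicator {v. dist (flw s z) v < x / L} v \<partial>lborel))"
     unfolding x_def C0_def by (intro mult_left_mono flow_mean H fb) simp
    also have "\<dots> = ennreal (C1 / (sqrt x * sqrt a) * (C0 / x ^ ?d)) * (\<integral>\<^sup>+v. wt p H v * indicator {v. dist (flw s z) v < x / L} v \<partial>lborel)"
     using C xa by (intro ennreal_mult_assoc_real) simp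
    also have "\<dots> = (\<integral>\<^sup>+v. ennreal (C1 / (sqrt x * sqrt a) * (C0 / x ^ ?d)) * (wt p H v * indicator {v. dist (flw s z) v < x / L} v) \<partial>lborel)"
     by (rule nn_integral_cmult[symmetric]) measurable
    also have "\<dots> \<le> (\<integral>\<^sup>+v. wt p H v * k z v \<partial>lborel)"
    proof (rule nn_integral_mono)
     fix v
     show "ennreal (C1 / (sqrt x * sqrt a) * (C0 / x ^ ?d)) * (wt p H v * indicator {v. dist (flw s z) v < x / L} v) \<le> wt p H v * k z v"
     proof (cases "dist (flw s z) v < x / L")
      case t: True
      then have wh: "v \<in> \<Omega>" "x \<le> 2 * r v" "r v \<le> 2 * x" using whitney[OF fb(1)] by (auto simp: x_def)
      define y where "y = r v"
      have y: "0 < y" using r_pos[OF wh(1)] by (simp add: y_def)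
      have "dist z v \<le> dist (flw s z) z + dist (flw s z) v" by (rule dist_triangle3)
      also have "\<dots> \<le> B / c * x + x / L" using fb(4) t by (simp add: x_def)
      also have "\<dots> = (1 / L + B / c) * x" by (simp add: algebra_simps)
      also have "\<dots> \<le> (1 / L + B / c) * (2 * y)" using wh pos by (intro mult_left_mono) (auto simp: y_def)
      also have "\<dots> = A * y" by (simp add: A_def)
      finally have dA: "dist z v \<le> A * r v" by (simp add: y_def)
      have "c * s \<le> c * (s + a)" using pos xa by simp
      then have inS: "(s, v) \<in> S" using xa(3) wh s2 by (simp add: S_def)
      have "y \<le> 2 * (L * (s + a))" using wh(3) fb(3) unfolding y_def x_def a_def by linarith
      also have "\<dots> \<le> 2 * (L * (\<delta> + \<eta>))" using s True pos by (intro mult_left_mono add_mono) (auto simp: a_def)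
      also have "\<dots> \<le> 4 * L * (\<delta> + \<eta>)" using pos by simp
      finally have inU: "v \<in> U" using wh(1) by (simp add: U_def y_def)
      have inT: "T z v = ennreal (1 / sqrt a)" using True dA by (simp add: T_def a_def)
      have "C1 / (sqrt x * sqrt a) * (C0 / x ^ ?d) = (C1 * C0 * (1 / (sqrt x * x ^ ?d))) * (1 / sqrt a)" by simp
      also have "\<dots> \<le> (C1 * C0 * (2 * 2 ^ ?d / (sqrt y * y ^ ?d))) * (1 / sqrt a)"
       using inverse_sqrt_power_le_double[OF xa(1) y, of ?d] wh(3) C xa by (intro mult_right_mono mult_left_mono) (auto simp: y_def)
      also have "\<dots> = E v * (1 / sqrt a)" by (simp add: E_def y_def)
      finally have "ennreal (C1 / (sqrt x * sqrt a) * (C0 / x ^ ?d)) \<le> ennreal (E v) * ennreal (1 / sqrt a)"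
       using C xa by (simp add: ennreal_mult'[symmetric] ennreal_mult''[symmetric] ennreal_leI)
      then show ?thesis using t inS inU by (simp add: k_def inT mult.commute mult_left_mono)
     qed simp
    qed
    finally show ?thesis using True by (simp add: a_def)
   qed simp
  qed
  also have "\<dots> = (\<integral>\<^sup>+v. (\<integral>\<^sup>+z. wt p H v * k z v \<partial>lborel) \<partial>lborel)"
   by (rule lborel_pair.Fubini'[OF km, symmetric])
  also have "\<dots> \<le> (\<integral>\<^sup>+v. wt p H v * ennreal (C2 / r v) * indicator S (s, v) \<partial>lborel)"
  proof (rule nn_integral_mono)
   fix v
   show "(\<integral>\<^sup>+z. wt p H v * k z v \<partial>lborel) \<le> wt p H v * ennreal (C2 / r v) * indicator S (s, v)"
   proof (cases "v \<in> U")
    case True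
    define y where "y = r v"
    have y: "0 < y" using True r_pos by (simp add: U_def y_def)
    have "(\<integral>\<^sup>+z. wt p H v * k z v \<partial>lborel) = (\<integral>\<^sup>+z. (wt p H v * ennreal (E v) * indicator S (s, v)) * T z v \<partial>lborel)"
     using True by (intro nn_integral_cong) (simp add: k_def mult_ac)
    also have "\<dots> = (wt p H v * ennreal (E v) * indicator S (s, v)) * (\<integral>\<^sup>+z. T z v \<partial>lborel)"
    proof (rule nn_integral_cmult)
     have "(\<lambda>z. (\<lambda>(z, v). T z v) (z, v)) \<in> borel_measurable lborel"
      by (rule measurable_compose[OF _ Tm]) measurable
     then show "(\<lambda>z. T z v) \<in> borel_measurable lborel" by simp
    qed
    also have "(\<integral>\<^sup>+z. T z v \<partial>lborel) \<le> ennreal (K * (y ^ ?d / sqrt y))"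
     using thin[of v] True by (simp add: U_def T_def A_def y_def indicator_def cong: nn_integral_cong)
    also have "(wt p H v * ennreal (E v) * indicator S (s, v)) * ennreal (K * (y ^ ?d / sqrt y))
     = wt p H v * (ennreal (E v) * ennreal (K * (y ^ ?d / sqrt y))) * indicator S (s, v)" by (simp add: mult_ac)
    also have "ennreal (E v) * ennreal (K * (y ^ ?d / sqrt y)) = ennreal (C2 / y)"
    proof -
     have "E v * (K * (y ^ ?d / sqrt y)) = C2 / (sqrt y * sqrt y)"
      using y by (simp add: E_def C2_def y_def[symmetric] del: real_sqrt_mult_self)
     also have "sqrt y * sqrt y = y" using y by simp
     finally show ?thesis using C y pos by (simp add: ennreal_mult''[symmetric])
    qed
    finally show ?thesis by (simp add: y_def mult_left_mono)
   qed (simp add: k_def)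
  qed
  finally show ?thesis .
 qed
 have m: "(\<lambda>(s, v). wt p H v * ennreal (C2 / r v) * indicator S (s, v)) \<in> borel_measurable (lborel \<Otimes>\<^sub>M lborel)"
  by measurable
 have "(\<integral>\<^sup>+s. (\<integral>\<^sup>+z. hardy_density n H s z \<partial>lborel) * indicator {0..\<delta>} s \<partial>lborel)
  \<le> (\<integral>\<^sup>+s. (\<integral>\<^sup>+v. wt p H v * ennreal (C2 / r v) * indicator S (s, v) \<partial>lborel) \<partial>lborel)"
 proof (rule nn_integral_mono)
  fix s :: real
  show "(\<integral>\<^sup>+z. hardy_density n H s z \<partial>lborel) * indicator {0..\<delta>} s
   \<le> (\<integral>\<^sup>+v. wt p H v * ennreal (C2 / r v) * indicator S (s, v) \<partial>lborel)"
  proof (cases "s \<in> {0..\<delta>}")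
   case True
   then show ?thesis using inner[OF True] by (simp only: indicator_simps mult_1_right)
  next
   case False
   then have "indicator {0..\<delta>} s = (0::ennreal)" by (rule indicator_simps(2))
   then show ?thesis by (simp only: mult_zero_right zero_le)
  qed
 qed
 also have "\<dots> = (\<integral>\<^sup>+v. (\<integral>\<^sup>+s. wt p H v * ennreal (C2 / r v) * indicator S (s, v) \<partial>lborel) \<partial>lborel)"
  by (rule lborel_pair.Fubini'[OF m, symmetric])
 also have "\<dots> \<le> (\<integral>\<^sup>+v. ennreal (C2 * (2 / c)) * wt p H v \<partial>lborel)"
 proof (rule nn_integral_mono)
  fix v
  show "(\<integral>\<^sup>+s. wt p H v * ennreal (C2 / r v) * indicator S (s, v) \<partial>lborel) \<le> ennreal (C2 * (2 / c)) * wt p H v"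
  proof (cases "v \<in> \<Omega>")
   case True
   define y where "y = r v"
   have y: "0 < y" using r_pos[OF True] by (simp add: y_def)
   have "(\<lambda>s. indicator S (s, v) :: ennreal) = indicator {0..2 * y / c}"
    using pos(1) by (auto simp: S_def y_def indicator_def fun_eq_iff field_simps)
   then have "(\<integral>\<^sup>+s. wt p H v * ennreal (C2 / r v) * indicator S (s, v) \<partial>lborel) = (\<integral>\<^sup>+s. wt p H v * ennreal (C2 / r v) * indicator {0..2 * y / c} s \<partial>lborel)"
    by (metis (no_types, lifting))
   also have "\<dots> = wt p H v * (ennreal (C2 / y) * ennreal (2 * y / c))"
    using y pos by (subst nn_integral_cmult_indicator) (simp_all add: y_def[symmetric] mult.assoc)
   also have "ennreal (C2 / y) * ennreal (2 * y / c) = ennreal (C2 * (2 / c))"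
    using y pos C2 by (simp add: ennreal_mult[symmetric])
   finally show ?thesis by (simp add: mult.commute)
  qed (simp add: wt_def)
 qed
 also have "\<dots> = ennreal (C2 * (2 / c)) * wmass p H"
  unfolding wmass_def by (rule nn_integral_cmult) measurable
 finally show "(\<integral>\<^sup>+s. (\<integral>\<^sup>+z. hardy_density n H s z \<partial>lborel) * indicator {0..\<delta>} s \<partial>lborel) \<le> ennreal (C2 * (2 / c)) * wmass p H" .
qed

lemma measurable_lebesgue_on_ident: "(\<lambda>z. z) \<in> \<mu> \<rightarrow>\<^sub>M borel"
 by (rule measurable_restrict_space1, rule measurable_completion) simp

text \<open>A Hardy inequality: although \<open>s\<^sup>n H(z + s w(z))\<close> alone has one power of the distance less
than needed, integration in \<open>s\<close> supplies it. This is Schur's test.\<close>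

lemma hardy_inequality:
 assumes p: "p = Suc n"
 shows "\<exists>C\<ge>0. \<forall>H G. holo H --> G \<in> borel_measurable \<mu> -->
   (\<integral>\<^sup>+s. (\<integral>\<^sup>+z. ennreal (s ^ n * (cmod (G z) * cmod (H (flw s z)))) * indicator near z \<partial>\<mu>) * indicator {0..\<delta>} s \<partial>lborel)^2
   \<le> ennreal C * ((\<integral>\<^sup>+z. ennreal ((cmod (G z))^2) \<partial>\<mu>) * wmass p H)"
proof -
 obtain C where C: "C \<ge> 0" "\<And>H. holo H ==>
   (\<integral>\<^sup>+s. (\<integral>\<^sup>+z. hardy_density n H s z \<partial>lborel) * indicator {0..\<delta>} s \<partial>lborel)
   \<le> ennreal C * wmass p H"
  using hardy_flow_factor[OF p] by blast
 let ?M = "\<mu>"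
 interpret M: finite_measure ?M
  by (rule finite_measure_lebesgue_on[OF lmeasurable_open[OF bounded_domain open_domain]])
 interpret P: pair_sigma_finite lborel ?M
  by (intro pair_sigma_finite.intro sigma_finite_lborel M.sigma_finite_measure_axioms)
 show ?thesis
 proof (intro exI conjI allI impI)
  show "0 \<le> 2 * C" using C by simp
  fix H G :: "complex^'n => complex" assume H: "holo H" and G[measurable]: "G \<in> borel_measurable ?M"
  have idm[measurable]: "(\<lambda>z. z) \<in> ?M \<rightarrow>\<^sub>M borel" by (rule measurable_lebesgue_on_ident)
  define Hx where "Hx x = indicator \<Omega> x *\<^sub>R H x" for x
  have Hxm[measurable]: "Hx \<in> borel_measurable borel" unfolding Hx_def by (rule measurable_holo[OF H])
  \<comment> \<open>The weight of the Schur test. It is homogeneous of degree \<open>- 1\<close> in \<open>(s, r)\<close> and integrable in \<open>s\<close> uniformly in \<open>r\<close>.\<close>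
  define \<phi> where "\<phi> s z = sqrt (r z) / ((s + r z) * sqrt (s + r z))" for s z
  have sndm[measurable]: "(\<lambda>q. snd q) \<in> lborel \<Otimes>\<^sub>M ?M \<rightarrow>\<^sub>M borel"
   using measurable_compose[OF measurable_snd idm] by simp
  have fstm[measurable]: "(\<lambda>q. fst q) \<in> lborel \<Otimes>\<^sub>M ?M \<rightarrow>\<^sub>M borel" by measurable
  have Gm[measurable]: "(\<lambda>q. G (snd q)) \<in> borel_measurable (lborel \<Otimes>\<^sub>M ?M)"
   by (rule measurable_compose[OF measurable_snd G])
  define I where "I q = (indicator {0..\<delta>} (fst q) * indicator near (snd q) :: ennreal)" for q
  have Im[measurable]: "I \<in> borel_measurable (lborel \<Otimes>\<^sub>M ?M)"
   unfolding I_def using measurable_compose[OF sndm borel_measurable_indicator[OF measurable_near]]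
    measurable_compose[OF fstm borel_measurable_indicator[of "{0..\<delta>}"]] by measurable
  have I2: "I q * I q = I q" for q by (auto simp: I_def indicator_def)
  have rm[measurable]: "(\<lambda>q. \<rho> (snd q)) \<in> borel_measurable (lborel \<Otimes>\<^sub>M ?M)"
   by (rule measurable_compose[OF sndm measurable_rho])
  have wm[measurable]: "(\<lambda>q. w (snd q)) \<in> borel_measurable (lborel \<Otimes>\<^sub>M ?M)"
   by (rule measurable_compose[OF sndm measurable_w])
  have \<phi>m[measurable]: "(\<lambda>q. \<phi> (fst q) (snd q)) \<in> borel_measurable (lborel \<Otimes>\<^sub>M ?M)"
   unfolding \<phi>_def by measurable
  have Hm[measurable]: "(\<lambda>q. Hx (flw (fst q) (snd q))) \<in> borel_measurable (lborel \<Otimes>\<^sub>M ?M)"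
   by (rule measurable_compose[OF _ Hxm]) measurable
  define f where "f q = ennreal (cmod (G (snd q)) * sqrt (\<phi> (fst q) (snd q))) * I q" for q
  define g where "g q = ennreal (fst q ^ n * cmod (Hx (flw (fst q) (snd q))) / sqrt (\<phi> (fst q) (snd q))) * I q" for q
  have fm[measurable]: "f \<in> borel_measurable (lborel \<Otimes>\<^sub>M ?M)" unfolding f_def by measurable
  have gm[measurable]: "g \<in> borel_measurable (lborel \<Otimes>\<^sub>M ?M)" unfolding g_def by measurable
  have \<phi>pos: "0 < \<phi> s z" if "s \<in> {0..\<delta>}" "z \<in> near" for s z
  proof -
   have "0 < r z" using that r_pos by simp
   then show ?thesis using that by (auto simp: \<phi>_def intro!: divide_pos_pos mult_pos_pos add_nonneg_pos)
  qed
  have HxH: "Hx (flw s z) = H (flw s z)" if "s \<in> {0..\<delta>}" "z \<in> near" for s z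
   using flow_bounds(1)[OF that(2), of s] that(1) pos by (simp add: Hx_def)
  have fg: "f (s, z) * g (s, z) = ennreal (s ^ n * (cmod (G z) * cmod (H (flw s z)))) * indicator near z * indicator {0..\<delta>} s" for s z
  proof (cases "s \<in> {0..\<delta>} \<and> z \<in> near")
   case True
   then have "0 < sqrt (\<phi> s z)" using \<phi>pos by simp
   then show ?thesis using True HxH[of s z] by (simp add: f_def g_def I_def ennreal_mult[symmetric] mult_ac)
  qed (auto simp: f_def g_def I_def)
  have "(\<integral>\<^sup>+s. (\<integral>\<^sup>+z. ennreal (s ^ n * (cmod (G z) * cmod (H (flw s z)))) * indicator near z \<partial>?M) * indicator {0..\<delta>} s \<partial>lborel)
   = (\<integral>\<^sup>+s. (\<integral>\<^sup>+z. f (s, z) * g (s, z) \<partial>?M) \<partial>lborel)"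
  proof (rule nn_integral_cong)
   fix s :: real
   show "(\<integral>\<^sup>+z. ennreal (s ^ n * (cmod (G z) * cmod (H (flw s z)))) * indicator near z \<partial>?M) * indicator {0..\<delta>} s = (\<integral>\<^sup>+z. f (s, z) * g (s, z) \<partial>?M)"
    unfolding fg by (cases "s \<in> {0..\<delta>}") simp_all
  qed
  also have "\<dots> = (\<integral>\<^sup>+q. f q * g q \<partial>(lborel \<Otimes>\<^sub>M ?M))"
   by (rule M.nn_integral_fst) measurable
  finally have "(\<integral>\<^sup>+s. (\<integral>\<^sup>+z. ennreal (s ^ n * (cmod (G z) * cmod (H (flw s z)))) * indicator near z \<partial>?M) * indicator {0..\<delta>} s \<partial>lborel)^2
   = (\<integral>\<^sup>+q. f q * g q \<partial>(lborel \<Otimes>\<^sub>M ?M))^2" by simp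
  also have "\<dots> \<le> (\<integral>\<^sup>+q. f q ^ 2 \<partial>(lborel \<Otimes>\<^sub>M ?M)) * (\<integral>\<^sup>+q. g q ^ 2 \<partial>(lborel \<Otimes>\<^sub>M ?M))"
   by (rule Cauchy_Schwarz_nn_integral[OF fm gm])
  also have "\<dots> \<le> (2 * (\<integral>\<^sup>+z. ennreal ((cmod (G z))^2) \<partial>?M)) * (ennreal C * wmass p H)"
  proof (rule mult_mono)
   have "(\<integral>\<^sup>+q. f q ^ 2 \<partial>(lborel \<Otimes>\<^sub>M ?M)) = (\<integral>\<^sup>+z. (\<integral>\<^sup>+s. f (s, z) ^ 2 \<partial>lborel) \<partial>?M)"
    by (rule P.nn_integral_snd[symmetric]) measurable
   also have "\<dots> \<le> (\<integral>\<^sup>+z. 2 * ennreal ((cmod (G z))^2) \<partial>?M)"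
   proof (rule nn_integral_mono)
    fix z
    show "(\<integral>\<^sup>+s. f (s, z) ^ 2 \<partial>lborel) \<le> 2 * ennreal ((cmod (G z))^2)"
    proof (cases "z \<in> near")
     case True
     have rz: "0 < r z" using True r_pos by simp
     have "(\<integral>\<^sup>+s. f (s, z) ^ 2 \<partial>lborel) = (\<integral>\<^sup>+s. ennreal ((cmod (G z))^2) * (ennreal (\<phi> s z) * indicator {0..\<delta>} s) \<partial>lborel)"
     proof (rule nn_integral_cong)
      fix s :: real
      show "f (s, z) ^ 2 = ennreal ((cmod (G z))^2) * (ennreal (\<phi> s z) * indicator {0..\<delta>} s)"
       using True \<phi>pos[of s z] by (auto simp: f_def I_def indicator_def ennreal_power ennreal_mult[symmetric] power_mult_distrib)
     qed
     also have "\<dots> = ennreal ((cmod (G z))^2) * (\<integral>\<^sup>+s. ennreal (\<phi> s z) * indicator {0..\<delta>} s \<partial>lborel)"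
      unfolding \<phi>_def by (rule nn_integral_cmult) measurable
     also have "\<dots> \<le> ennreal ((cmod (G z))^2) * 2"
      unfolding \<phi>_def using rz pos by (intro mult_left_mono nn_integral_hardy_weight) auto
     finally show ?thesis by (simp add: mult.commute)
    qed (simp add: f_def I_def)
   qed
   also have "\<dots> = 2 * (\<integral>\<^sup>+z. ennreal ((cmod (G z))^2) \<partial>?M)" by (rule nn_integral_cmult) measurable
   finally show "(\<integral>\<^sup>+q. f q ^ 2 \<partial>(lborel \<Otimes>\<^sub>M ?M)) \<le> 2 * (\<integral>\<^sup>+z. ennreal ((cmod (G z))^2) \<partial>?M)" .
   have "(\<integral>\<^sup>+q. g q ^ 2 \<partial>(lborel \<Otimes>\<^sub>M ?M)) = (\<integral>\<^sup>+s. (\<integral>\<^sup>+z. g (s, z) ^ 2 \<partial>?M) \<partial>lborel)"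
    by (rule M.nn_integral_fst[symmetric]) measurable
   also have "\<dots> = (\<integral>\<^sup>+s. (\<integral>\<^sup>+z. hardy_density n H s z \<partial>lborel) * indicator {0..\<delta>} s \<partial>lborel)"
   proof (rule nn_integral_cong)
    fix s :: real
    have "(\<integral>\<^sup>+z. g (s, z) ^ 2 \<partial>?M) = (\<integral>\<^sup>+z. g (s, z) ^ 2 * indicator \<Omega> z \<partial>lborel)"
     by (rule nn_integral_lebesgue_on_lborel) (use open_domain in simp)
    also have "\<dots> = (\<integral>\<^sup>+z. hardy_density n H s z * indicator {0..\<delta>} s \<partial>lborel)"
    proof (rule nn_integral_cong)
     fix z
     show "g (s, z) ^ 2 * indicator \<Omega> z = hardy_density n H s z * indicator {0..\<delta>} s"
     proof (cases "s \<in> {0..\<delta>} \<and> z \<in> near")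
      case True
      then have ph: "0 < \<phi> s z" using \<phi>pos by blast
      have gen: "(X * Y / sqrt (u / v))^2 = X^2 * v / u * Y^2" if "0 < u / v" for X Y u v :: real
       using that by (simp add: power_divide power_mult_distrib)
      have "(s ^ n * cmod (H (flw s z)) / sqrt (\<phi> s z))^2 = (s ^ n)^2 * ((s + r z) * sqrt (s + r z)) / sqrt (r z) * (cmod (H (flw s z)))^2"
       using ph unfolding \<phi>_def by (rule gen)
      moreover have "g (s, z) ^ 2 = ennreal ((s ^ n * cmod (H (flw s z)) / sqrt (\<phi> s z))^2)"
       using True ph HxH[of s z] by (simp add: g_def I_def ennreal_power)
      ultimately show ?thesis using True by simp
     qed (auto simp: g_def I_def)
    qed
    also have "\<dots> = (\<integral>\<^sup>+z. hardy_density n H s z \<partial>lborel) * indicator {0..\<delta>} s"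
     by (cases "s \<in> {0..\<delta>}") simp_all
    finally show "(\<integral>\<^sup>+z. g (s, z) ^ 2 \<partial>?M) = \<dots>" .
   qed
   also have "\<dots> \<le> ennreal C * wmass p H" by (rule C(2)[OF H])
   finally show "(\<integral>\<^sup>+q. g q ^ 2 \<partial>(lborel \<Otimes>\<^sub>M ?M)) \<le> ennreal C * wmass p H" .
  qed simp_all
  also have "\<dots> = ennreal (2 * C) * ((\<integral>\<^sup>+z. ennreal ((cmod (G z))^2) \<partial>?M) * wmass p H)"
   using C(1) by (simp add: ennreal_mult mult_ac)
  finally show "(\<integral>\<^sup>+s. (\<integral>\<^sup>+z. ennreal (s ^ n * (cmod (G z) * cmod (H (flw s z)))) * indicator near z \<partial>?M) * indicator {0..\<delta>} s \<partial>lborel)^2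
   \<le> ennreal (2 * C) * ((\<integral>\<^sup>+z. ennreal ((cmod (G z))^2) \<partial>?M) * wmass p H)" .
 qed
qed

end

section \<open>Complex vector fields and their transposes\<close>

text \<open>The value of the complexified vector \<open>t\<close> on a real-linear functional \<open>L\<close>, by the
usual formulas for \<open>\<partial>/\<partial>z\<^sub>j\<close> and
\<open>\<partial>/\<partial>z\<^sub>j\<^sup>-\<close>.\<close>

definition cvector_apply :: "'n::finite cvector => (complex^'n => complex) => complex" where
 "cvector_apply t L = (\<Sum>j\<in>UNIV. fst t $ j * ((L (axis j 1) - \<i> * L (axis j \<i>)) / 2) + snd t $ j * ((L (axis j 1) + \<i> * L (axis j \<i>)) / 2))"

definition field_deriv :: "(complex^'n => 'n::finite cvector) => (complex^'n => complex) => complex^'n => complex" where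
 "field_deriv T f z = cvector_apply (T z) (der f z)"

definition field_div :: "(complex^'n => 'n::finite cvector) => complex^'n => complex" where
 "field_div T z = (\<Sum>j\<in>UNIV. wirtinger j (\<lambda>w. fst (T w) $ j) z + wirtinger_bar j (\<lambda>w. snd (T w) $ j) z)"

lemma cvector_apply_add: "cvector_apply t (\<lambda>v. L v + M v) = cvector_apply t L + cvector_apply t M"
 unfolding cvector_apply_def sum.distrib[symmetric]
 by (rule sum.cong[OF refl]) (simp add: algebra_simps add_divide_distrib diff_divide_distrib)

lemma cvector_apply_scale: "cvector_apply t (\<lambda>v. a * L v) = a * cvector_apply t L"
 unfolding cvector_apply_def sum_distrib_left
 by (rule sum.cong[OF refl]) (simp add: algebra_simps add_divide_distrib diff_divide_distrib)

lemma cvector_apply_zero: "cvector_apply t (\<lambda>v. 0) = 0"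
 by (simp add: cvector_apply_def)

lemma cvector_apply_sum: "cvector_apply t (\<lambda>v. \<Sum>l\<in>I. L l v) = (\<Sum>l\<in>I. cvector_apply t (L l))"
 by (induction I rule: infinite_finite_induct) (simp_all add: cvector_apply_zero cvector_apply_add)

lemma cvector_apply_cnj_component: "cvector_apply t (\<lambda>v. cnj (v $ l)) = snd t $ l"
proof -
 have "cvector_apply t (\<lambda>v. cnj (v $ l)) = (\<Sum>j\<in>UNIV. if j = l then snd t $ j else 0)"
  unfolding cvector_apply_def by (rule sum.cong[OF refl]) (simp add: axis_def)
 then show ?thesis by simp
qed

lemma field_deriv_mult:
 assumes "f differentiable at z" "g differentiable at z"
 shows "field_deriv T (\<lambda>x. f x * g x) z = f z * field_deriv T g z + g z * field_deriv T f z"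
proof -
 have "((\<lambda>x. f x * g x) has_derivative (\<lambda>v. f z * der g z v + der f z v * g z)) (at z)"
  using assms by (intro has_derivative_mult) (simp_all add: frechet_derivative_works[symmetric])
 from frechet_derivative_at[OF this]
 have "der (\<lambda>x. f x * g x) z = (\<lambda>v. f z * der g z v + g z * der f z v)"
  by (simp add: mult.commute)
 then show ?thesis by (simp add: field_deriv_def cvector_apply_add cvector_apply_scale)
qed

lemma wirtinger_mult:
 assumes "f differentiable at z" "g differentiable at z"
 shows "wirtinger j (\<lambda>x. f x * g x) z = f z * wirtinger j g z + g z * wirtinger j f z"
  and "wirtinger_bar j (\<lambda>x. f x * g x) z = f z * wirtinger_bar j g z + g z * wirtinger_bar j f z"
proof -
 have "((\<lambda>x. f x * g x) has_derivative (\<lambda>v. f z * der g z v + der f z v * g z)) (at z)"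
  using assms by (intro has_derivative_mult) (simp_all add: frechet_derivative_works[symmetric])
 from frechet_derivative_at[OF this]
 have "der (\<lambda>x. f x * g x) z = (\<lambda>v. f z * der g z v + g z * der f z v)"
  by (simp add: mult.commute)
 then show "wirtinger j (\<lambda>x. f x * g x) z = f z * wirtinger j g z + g z * wirtinger j f z"
  and "wirtinger_bar j (\<lambda>x. f x * g x) z = f z * wirtinger_bar j g z + g z * wirtinger_bar j f z"
  by (simp_all add: wirtinger_def wirtinger_bar_def algebra_simps add_divide_distrib diff_divide_distrib)
qed

lemma smooth_on_field_components:
 fixes T :: "complex^'n => 'n::finite cvector"
 assumes "open S" "smooth_on S T"
 shows "smooth_on S (\<lambda>z. fst (T z) $ j)" "smooth_on S (\<lambda>z. snd (T z) $ j)"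
proof -
 have b: "bounded_linear (\<lambda>t::'n cvector. fst t $ j)" "bounded_linear (\<lambda>t::'n cvector. snd t $ j)"
  using bounded_linear_compose[OF bounded_linear_vec_nth bounded_linear_fst]
   bounded_linear_compose[OF bounded_linear_vec_nth bounded_linear_snd] by blast+
 show "smooth_on S (\<lambda>z. fst (T z) $ j)" by (rule smooth_on_linear[OF b(1) assms])
 show "smooth_on S (\<lambda>z. snd (T z) $ j)" by (rule smooth_on_linear[OF b(2) assms])
qed

lemma transpose_field_eq:
 fixes T :: "complex^'n => 'n::finite cvector"
 assumes "open S" "smooth_on S T" "z \<in> S" "\<phi> differentiable at z"
 shows "transpose_field T \<phi> z = - (field_deriv T \<phi> z + field_div T z * \<phi> z)"
proof -
 have d: "(\<lambda>z. fst (T z) $ j) differentiable at z" "(\<lambda>z. snd (T z) $ j) differentiable at z" for j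
  using smooth_on_field_components[OF assms(1,2)] smooth_on_differentiable assms(3) by blast+
 have "(\<Sum>j\<in>UNIV. wirtinger j (\<lambda>w. fst (T w) $ j * \<phi> w) z + wirtinger_bar j (\<lambda>w. snd (T w) $ j * \<phi> w) z)
  = (\<Sum>j\<in>UNIV. (fst (T z) $ j * wirtinger j \<phi> z + snd (T z) $ j * wirtinger_bar j \<phi> z)
    + (wirtinger j (\<lambda>w. fst (T w) $ j) z + wirtinger_bar j (\<lambda>w. snd (T w) $ j) z) * \<phi> z)"
  by (rule sum.cong[OF refl])
   (simp only: wirtinger_mult(1)[OF d(1) assms(4)] wirtinger_mult(2)[OF d(2) assms(4)], simp add: algebra_simps)
 also have "\<dots> = field_deriv T \<phi> z + field_div T z * \<phi> z"
  by (subst sum.distrib) (simp add: sum_distrib_right[symmetric] field_deriv_def field_div_def cvector_apply_def wirtinger_def wirtinger_bar_def)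
 finally show ?thesis by (simp add: transpose_field_def)
qed

lemma smooth_on_wirtinger:
 assumes "open S" "smooth_on S f"
 shows "smooth_on S (wirtinger j f)" "smooth_on S (wirtinger_bar j f)"
proof -
 have d: "smooth_on S (\<lambda>z. der f z v)" for v by (rule smooth_on_deriv[OF assms]) simp
 have "wirtinger j f = (\<lambda>z. (der f z (axis j 1) - \<i> * der f z (axis j \<i>)) * (1/2))"
   "wirtinger_bar j f = (\<lambda>z. (der f z (axis j 1) + \<i> * der f z (axis j \<i>)) * (1/2))"
  by (simp_all add: wirtinger_def wirtinger_bar_def fun_eq_iff)
 then show "smooth_on S (wirtinger j f)" "smooth_on S (wirtinger_bar j f)"
  by (simp_all only:) (intro smooth_on_mult smooth_on_add smooth_on_diff smooth_on_const d assms)+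
qed

lemma smooth_on_field_deriv:
 assumes "open S" "smooth_on S T" "smooth_on S f"
 shows "smooth_on S (field_deriv T f)"
proof -
 have "field_deriv T f = (\<lambda>z. \<Sum>j\<in>UNIV. fst (T z) $ j * wirtinger j f z + snd (T z) $ j * wirtinger_bar j f z)"
  by (simp add: field_deriv_def cvector_apply_def wirtinger_def wirtinger_bar_def fun_eq_iff)
 then show ?thesis
  by (simp only:) (intro smooth_on_sum smooth_on_add smooth_on_mult smooth_on_wirtinger smooth_on_field_components assms)
qed

lemma smooth_on_field_div:
 assumes "open S" "smooth_on S T"
 shows "smooth_on S (field_div T)"
proof -
 have "smooth_on S (\<lambda>z. field_div T z)" unfolding field_div_def
  by (intro smooth_on_sum smooth_on_add smooth_on_wirtinger smooth_on_field_components assms)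
 then show ?thesis by simp
qed

lemma field_deriv_cong_open:
 "open S ==> z \<in> S ==> (\<And>x. x \<in> S ==> f x = g x) ==> field_deriv T f z = field_deriv T g z"
 unfolding field_deriv_def using frechet_derivative_cong_open[of S z f g] by simp

lemma test_function_transpose:
 assumes T: "smooth T" and \<phi>: "test_function \<Omega> \<phi>"
 shows "test_function \<Omega> (transpose_field T \<phi>)"
proof -
 from \<phi> obtain S where S: "smooth \<phi>" "compact S" "S \<subseteq> \<Omega>" "\<And>x. x \<notin> S ==> \<phi> x = 0"
  unfolding test_function_def by blast
 have s: "smooth_on UNIV T" "smooth_on UNIV \<phi>" using T S by (simp_all add: smooth_iff)
 have "transpose_field T \<phi> = (\<lambda>z. - (field_deriv T \<phi> z + field_div T z * \<phi> z))"
  using transpose_field_eq[OF open_UNIV s(1) UNIV_I smooth_on_differentiable[OF s(2) UNIV_I]] by (simp add: fun_eq_iff)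
 moreover have "smooth_on UNIV (\<lambda>z. - (field_deriv T \<phi> z + field_div T z * \<phi> z))"
  using smooth_on_minus[OF open_UNIV smooth_on_add[OF open_UNIV smooth_on_field_deriv[OF open_UNIV s] smooth_on_mult[OF open_UNIV smooth_on_field_div[OF open_UNIV s(1)] s(2)]]] .
 moreover have "field_deriv T \<phi> z = 0" if "z \<notin> S" for z
  using frechet_derivative_zero_outside[of S \<phi> z] S that by (simp add: compact_imp_closed field_deriv_def cvector_apply_zero)
 ultimately show ?thesis unfolding test_function_def using S by (auto simp: smooth_iff)
qed

text \<open>The interplay of \<open>T\<close> with the collar: \<open>w_eq\<close> makes the inward flow and the field
\<open>T\<close> interchangeable on antiholomorphic functions, and \<open>tangential_bound\<close> is
tangency, extended to the inside of \<open>\<Omega>\<close>.\<close>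

locale tfield = ccollar \<Omega> \<rho> w c L B \<delta> \<eta> K
 for \<Omega> :: "(complex^'n) set" and \<rho> w c L B \<delta> \<eta> K +
 fixes T :: "complex^'n => 'n cvector" and \<gamma> :: "complex^'n => complex" and \<theta> :: real
 assumes smooth_T: "smooth T" and smooth_gamma: "smooth \<gamma>"
  and w_eq: "\<And>z j. w z $ j = cnj (\<gamma> z * snd (T z) $ j)"
  and tangential_bound: "\<And>z. z \<in> \<Omega> ==> cmod (field_deriv T (\<lambda>z. of_real (\<rho> z)) z) \<le> \<theta> * r z"
begin

lemma smooth_bounded:
 fixes b :: "complex^'n => complex"
 assumes "smooth b" shows "\<exists>M\<ge>0. \<forall>z\<in>\<Omega>. cmod (b z) \<le> M"
proof -
 have "bounded (b ` closure \<Omega>)"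
  using assms smooth_on_continuous_on[of UNIV b] continuous_on_subset
  by (intro compact_imp_bounded compact_continuous_image compact_closure_domain) (auto simp: smooth_iff)
 then obtain M where M: "\<And>z. z \<in> closure \<Omega> ==> cmod (b z) \<le> M" unfolding bounded_iff by blast
 have "cmod (b z) \<le> max M 0" if "z \<in> \<Omega>" for z using M[of z] closure_subset that by (auto intro: max.coboundedI1)
 then show ?thesis by (intro exI[of _ "max M 0"]) auto
qed

text \<open>Coefficients supported where the flow is defined; they form the class that is stable under the repeated
integration by parts.\<close>

definition coef :: "(complex^'n => complex) => bool" where
 "coef b \<longleftrightarrow> smooth b \<and> (\<forall>z\<in>\<Omega>. r z > \<eta> --> b z = 0)"

lemma open_inner: "open {z\<in>\<Omega>. r z > a}"
proof -
 have "open {z. a < r z}" by (rule open_Collect_less) (auto intro!: continuous_intros continuous_rho)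
 moreover have "{z\<in>\<Omega>. r z > a} = \<Omega> \<inter> {z. a < r z}" by auto
 ultimately show ?thesis using open_domain by auto
qed

lemma open_collar: "open {z\<in>\<Omega>. r z < a}"
proof -
 have "open {z. r z < a}" by (rule open_Collect_less) (auto intro!: continuous_intros continuous_rho)
 moreover have "{z\<in>\<Omega>. r z < a} = \<Omega> \<inter> {z. r z < a}" by auto
 ultimately show ?thesis using open_domain by auto
qed

lemma coef_mult: "coef b ==> smooth a ==> coef (\<lambda>z. b z * a z)"
 unfolding coef_def smooth_iff by (auto intro: smooth_on_mult)

lemma coef_add: "coef b ==> coef a ==> coef (\<lambda>z. b z + a z)"
 unfolding coef_def smooth_iff by (auto intro: smooth_on_add)

lemma smooth_field_deriv: "smooth b ==> smooth (field_deriv T b)"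
 using smooth_on_field_deriv[OF open_UNIV] smooth_T by (simp add: smooth_iff)

lemma smooth_field_div: "smooth (field_div T)"
 using smooth_on_field_div[OF open_UNIV] smooth_T by (simp add: smooth_iff)

lemma coef_field_deriv:
 assumes "coef b" shows "coef (field_deriv T b)"
 unfolding coef_def
proof (intro conjI ballI impI)
 show "smooth (field_deriv T b)" using assms smooth_field_deriv by (simp add: coef_def)
 fix z assume z: "z \<in> \<Omega>" "r z > \<eta>"
 have "field_deriv T b z = field_deriv T (\<lambda>z. 0) z"
  by (rule field_deriv_cong_open[OF open_inner[of \<eta>]]) (use z assms in \<open>auto simp: coef_def\<close>)
 then show "field_deriv T b z = 0" by (simp add: field_deriv_def cvector_apply_zero)
qed

lemma coef_bounded: "coef b ==> \<exists>M\<ge>0. \<forall>z\<in>\<Omega>. cmod (b z) \<le> M"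
 by (rule smooth_bounded) (simp add: coef_def)

lemma coef_zero: "coef b ==> z \<in> \<Omega> ==> z \<notin> near ==> b z = 0"
 unfolding coef_def by auto

lemma measurable_coef: "coef b ==> b \<in> borel_measurable \<mu>"
 using smooth_on_continuous_on[of UNIV b] continuous_on_subset
 by (intro continuous_on_measurable_lebesgue_on[OF open_domain]) (auto simp: coef_def smooth_iff)

lemma compact_sublevel: "a > 0 ==> compact {z. a \<le> r z}"
 and sublevel_subset: "a > 0 ==> {z. a \<le> r z} \<subseteq> \<Omega>"
proof -
 assume a: "a > 0"
 show s: "{z. a \<le> r z} \<subseteq> \<Omega>" using a domain_eq by auto
 have "closed {z. a \<le> r z}" by (rule closed_Collect_le) (auto intro!: continuous_intros continuous_rho)
 moreover have "bounded {z. a \<le> r z}" using s bounded_domain bounded_subset by blast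
 ultimately show "compact {z. a \<le> r z}" by (simp add: compact_eq_bounded_closed)
qed

text \<open>Compactly supported in \<open>\<Omega>\<close> and tending to \<open>1\<close>. Because \<open>T r =
O(r)\<close>, their derivatives along \<open>T\<close> stay bounded and tend to \<open>0\<close>, by tangency
of \<open>T\<close>.\<close>

definition cut :: "nat => complex^'n => complex" where
 "cut m z = of_real (flat (real (Suc m) * r z - 1))"

lemma smooth_cut: "smooth (cut m)"
proof -
 have "smooth_on UNIV (\<lambda>z. real (Suc m) * r z - 1)"
  by (intro smooth_on_diff smooth_on_mult smooth_on_const smooth_on_minus smooth_on_rho open_UNIV)
 then have "smooth_on UNIV (\<lambda>z. flat (real (Suc m) * r z - 1))"
  by (rule smooth_on_compose[OF open_UNIV subset_UNIV smooth_flat[unfolded smooth_iff]])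
 then show ?thesis unfolding smooth_iff cut_def by (intro smooth_on_of_real open_UNIV)
qed

lemma cut_test_function:
 assumes "smooth_on \<Omega> \<psi>" shows "test_function \<Omega> (\<lambda>z. \<psi> z * cut m z)"
proof (rule test_function_mult[OF open_domain assms])
 have "cut m z = 0" if "z \<notin> {z. 1 / real (Suc m) \<le> r z}" for z
 proof -
  have "real (Suc m) * r z - 1 \<le> 0" using that by (simp add: field_simps)
  then show ?thesis by (simp add: cut_def flat_zero)
 qed
 then show "test_function \<Omega> (cut m)"
  unfolding test_function_def using smooth_cut compact_sublevel[of "1 / real (Suc m)"] sublevel_subset[of "1 / real (Suc m)"]
  by (intro conjI exI[of _ "{z. 1 / real (Suc m) \<le> r z}"]) auto
qed

lemma norm_cut_le_1: "cmod (cut m z) \<le> 1"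
 by (simp add: cut_def flat_nonneg flat_le_1)

lemma scale_at_top: "0 < a ==> filterlim (\<lambda>m. real (Suc m) * a - 1) at_top sequentially"
proof -
 assume a: "0 < a"
 have "filterlim (\<lambda>m. a * real (Suc m)) at_top sequentially"
  using filterlim_compose[OF filterlim_real_sequentially filterlim_Suc] a
  by (intro filterlim_tendsto_pos_mult_at_top[OF tendsto_const]) auto
 from filterlim_tendsto_add_at_top[OF tendsto_const[of "-1"] this]
 show ?thesis by (simp add: mult.commute)
qed

lemma cut_tendsto: "z \<in> \<Omega> ==> (\<lambda>m. cut m z) \<longlonglongrightarrow> 1"
 using tendsto_of_real[OF filterlim_compose[OF flat_tendsto_1 scale_at_top[OF r_pos]], where 'a=complex]
 unfolding cut_def by simp

lemma field_deriv_cut: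
 "field_deriv T (cut m) z = - of_real (real (Suc m) * flat' (real (Suc m) * r z - 1)) * field_deriv T (\<lambda>z. of_real (\<rho> z)) z"
proof -
 let ?k = "real (Suc m)"
 have hr: "(\<rho> has_derivative der \<rho> z) (at z)"
  by (rule smooth_on_has_derivative[OF smooth_on_rho UNIV_I])
 from has_derivative_diff[OF has_derivative_mult_right[OF has_derivative_minus[OF hr], of ?k] has_derivative_const[of 1]]
 have "((\<lambda>z. ?k * r z - 1) has_derivative (\<lambda>v. ?k * (- der \<rho> z v))) (at z)" by simp
 from diff_chain_at[OF this flat_has_derivative[unfolded has_field_derivative_def]]
 have "((\<lambda>z. flat (?k * r z - 1)) has_derivative (\<lambda>v. flat' (?k * r z - 1) * (?k * (- der \<rho> z v)))) (at z)"
  by (simp add: o_def)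
 from bounded_linear.has_derivative[OF bounded_linear_of_real this]
 have "(cut m has_derivative (\<lambda>v. of_real (flat' (?k * r z - 1) * (?k * (- der \<rho> z v))))) (at z)"
  unfolding cut_def by simp
 from frechet_derivative_at[OF this]
 have 1: "der (cut m) z = (\<lambda>v. (- of_real (?k * flat' (?k * r z - 1))) * of_real (der \<rho> z v))"
  by (simp add: fun_eq_iff mult_ac)
 have "der (\<lambda>z. complex_of_real (\<rho> z)) z = (\<lambda>v. of_real (der \<rho> z v))"
  by (rule frechet_derivative_at[OF bounded_linear.has_derivative[OF bounded_linear_of_real hr], symmetric])
 then show ?thesis unfolding field_deriv_def 1 by (simp only: cvector_apply_scale)
qed

lemma theta_nonneg: "z \<in> \<Omega> ==> 0 \<le> \<theta>"
proof -
 assume z: "z \<in> \<Omega>"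
 have "0 \<le> \<theta> * r z" using order_trans[OF norm_ge_zero tangential_bound[OF z]] .
 then show "0 \<le> \<theta>" using mult_neg_pos[OF _ r_pos[OF z], of \<theta>] by linarith
qed

lemma field_deriv_cut_bound:
 assumes z: "z \<in> \<Omega>"
 shows "cmod (field_deriv T (cut m) z) \<le> \<theta> * ((real (Suc m) * r z - 1 + 1) * flat' (real (Suc m) * r z - 1))"
proof -
 have "cmod (field_deriv T (cut m) z) = real (Suc m) * flat' (real (Suc m) * r z - 1) * cmod (field_deriv T (\<lambda>z. of_real (\<rho> z)) z)"
  unfolding field_deriv_cut norm_mult norm_minus_cancel norm_of_real using flat'_nonneg by simp
 also have "\<dots> \<le> real (Suc m) * flat' (real (Suc m) * r z - 1) * (\<theta> * r z)"
  by (intro mult_left_mono tangential_bound z mult_nonneg_nonneg flat'_nonneg) simp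
 also have "\<dots> = \<theta> * ((real (Suc m) * r z - 1 + 1) * flat' (real (Suc m) * r z - 1))" by (simp add: mult_ac)
 finally show ?thesis .
qed

lemma field_deriv_cut_tendsto:
 assumes z: "z \<in> \<Omega>" shows "(\<lambda>m. field_deriv T (cut m) z) \<longlonglongrightarrow> 0"
proof (rule Lim_null_comparison)
 let ?t = "\<lambda>m. real (Suc m) * r z - 1"
 have top: "filterlim ?t at_top sequentially" by (rule scale_at_top[OF r_pos[OF z]])
 have "(\<lambda>m. inverse (?t m)) \<longlonglongrightarrow> 0" by (rule filterlim_compose[OF tendsto_inverse_0_at_top[OF filterlim_ident] top])
 then have "(\<lambda>m. \<theta> * (inverse (?t m) + (inverse (?t m))^2)) \<longlonglongrightarrow> \<theta> * (0 + 0^2)" by (intro tendsto_intros)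
 then show "(\<lambda>m. \<theta> * (1 / ?t m + (1 / ?t m)^2)) \<longlonglongrightarrow> 0" by (simp add: inverse_eq_divide)
 have "\<forall>\<^sub>F m in sequentially. ?t m > 0" by (rule eventually_compose_filterlim[OF eventually_gt_at_top top])
 then show "\<forall>\<^sub>F m in sequentially. cmod (field_deriv T (cut m) z) \<le> \<theta> * (1 / ?t m + (1 / ?t m)^2)"
 proof eventually_elim
  case (elim m)
  have "\<theta> * ((?t m + 1) * flat' (?t m)) \<le> \<theta> * (1 / ?t m + (1 / ?t m)^2)"
   by (intro mult_left_mono flat'_bound2 theta_nonneg[OF z] elim)
  then show ?case using field_deriv_cut_bound[OF z, of m] by linarith
 qed
qed

text \<open>Integration by parts along \<open>T\<close> produces no boundary term, even against functions that do not
vanish at the boundary: cut off and let the cut-offs exhaust \<open>\<Omega>\<close>.\<close>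

lemma transpose_bounded:
 assumes g: "g \<in> L2 \<Omega>" "g' \<in> L2 \<Omega>"
  and weak: "\<And>\<phi>. test_function \<Omega> \<phi> ==> (\<integral>x. g' x * \<phi> x \<partial>\<mu>) = (\<integral>x. g x * transpose_field T \<phi> x \<partial>\<mu>)"
  and \<psi>: "smooth_on \<Omega> \<psi>" and M: "\<And>z. z \<in> \<Omega> ==> cmod (\<psi> z) \<le> M" "\<And>z. z \<in> \<Omega> ==> cmod (transpose_field T \<psi> z) \<le> M"
 shows "(\<integral>x. g' x * \<psi> x \<partial>\<mu>) = (\<integral>x. g x * transpose_field T \<psi> x \<partial>\<mu>)"
proof -
 have gi: "integrable \<mu> (\<lambda>x. cmod (g x))" "integrable \<mu> (\<lambda>x. cmod (g' x))"
  using L2_integrable[OF open_domain bounded_domain] g by simp_all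
 have sT: "smooth_on \<Omega> T" using smooth_T smooth_imp_smooth_on by blast
 have tr: "transpose_field T f z = - (field_deriv T f z + field_div T z * f z)" if "z \<in> \<Omega>" "smooth_on \<Omega> f" for f z
  by (rule transpose_field_eq[OF open_domain sT that(1) smooth_on_differentiable[OF that(2,1)]])
 have scut: "smooth_on \<Omega> (cut m)" for m using smooth_cut smooth_imp_smooth_on by blast
 have prod: "transpose_field T (\<lambda>x. \<psi> x * cut m x) z = cut m z * transpose_field T \<psi> z - \<psi> z * field_deriv T (cut m) z"
  if z: "z \<in> \<Omega>" for m z
  unfolding tr[OF z \<psi>] tr[OF z smooth_on_mult[OF open_domain \<psi> scut]]
   field_deriv_mult[OF smooth_on_differentiable[OF \<psi> z] smooth_on_differentiable[OF scut z], of T]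
  by (simp add: algebra_simps)
 have m1: "\<psi> \<in> borel_measurable \<mu>"
  by (rule continuous_on_measurable_lebesgue_on[OF open_domain smooth_on_continuous_on[OF \<psi>]])
 have mcut: "cut m \<in> borel_measurable \<mu>" for m
  by (rule continuous_on_measurable_lebesgue_on[OF open_domain smooth_on_continuous_on[OF scut]])
 have str: "smooth_on \<Omega> (transpose_field T f)" if "smooth_on \<Omega> f" for f
 proof (rule smooth_on_cong[OF open_domain])
  show "smooth_on \<Omega> (\<lambda>z. - (field_deriv T f z + field_div T z * f z))"
   using smooth_on_minus[OF open_domain smooth_on_add[OF open_domain smooth_on_field_deriv[OF open_domain sT that] smooth_on_mult[OF open_domain smooth_on_field_div[OF open_domain sT] that]]] .
 qed (use tr that in simp)
 have mt: "transpose_field T f \<in> borel_measurable \<mu>" if "smooth_on \<Omega> f" for f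
  by (rule continuous_on_measurable_lebesgue_on[OF open_domain smooth_on_continuous_on[OF str[OF that]]])
 have l1: "(\<lambda>m. \<integral>x. g' x * (\<psi> x * cut m x) \<partial>\<mu>) \<longlonglongrightarrow> (\<integral>x. g' x * \<psi> x \<partial>\<mu>)"
 proof (rule integral_dominated_convergence[where w="\<lambda>x. M * cmod (g' x)"])
  show "(\<lambda>x. g' x * \<psi> x) \<in> borel_measurable \<mu>" "(\<lambda>x. g' x * (\<psi> x * cut m x)) \<in> borel_measurable \<mu>" for m
   using L2_measurable[OF g(2)] m1 mcut by measurable
  show "integrable \<mu> (\<lambda>x. M * cmod (g' x))" using gi by simp
  show "AE x in \<mu>. (\<lambda>m. g' x * (\<psi> x * cut m x)) \<longlonglongrightarrow> g' x * \<psi> x"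
  proof (rule AE_I2)
   fix x assume "x \<in> space \<mu>"
   then have "(\<lambda>m. g' x * (\<psi> x * cut m x)) \<longlonglongrightarrow> g' x * (\<psi> x * 1)"
    by (intro tendsto_intros cut_tendsto) (simp add: space_restrict_space)
   then show "(\<lambda>m. g' x * (\<psi> x * cut m x)) \<longlonglongrightarrow> g' x * \<psi> x" by simp
  qed
  show "AE x in \<mu>. norm (g' x * (\<psi> x * cut m x)) \<le> M * cmod (g' x)" for m
  proof (rule AE_I2)
   fix x assume "x \<in> space \<mu>"
   then have "cmod (\<psi> x) * cmod (cut m x) \<le> M * 1"
    using M(1)[of x] norm_cut_le_1[of m x] order_trans[OF norm_ge_zero M(1)[of x]] by (intro mult_mono) (auto simp: space_restrict_space)
   from mult_left_mono[OF this norm_ge_zero[of "g' x"]]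
   show "norm (g' x * (\<psi> x * cut m x)) \<le> M * cmod (g' x)" by (simp add: norm_mult mult.commute)
  qed
 qed
 have l2: "(\<lambda>m. \<integral>x. g x * transpose_field T (\<lambda>x. \<psi> x * cut m x) x \<partial>\<mu>) \<longlonglongrightarrow> (\<integral>x. g x * transpose_field T \<psi> x \<partial>\<mu>)"
 proof (rule integral_dominated_convergence[where w="\<lambda>x. (M + M * (2 * \<theta>)) * cmod (g x)"])
  show "(\<lambda>x. g x * transpose_field T \<psi> x) \<in> borel_measurable \<mu>"
   using L2_measurable[OF g(1)] mt[OF \<psi>] by measurable
  show "(\<lambda>x. g x * transpose_field T (\<lambda>x. \<psi> x * cut m x) x) \<in> borel_measurable \<mu>" for m
   using L2_measurable[OF g(1)] mt[OF smooth_on_mult[OF open_domain \<psi> scut]] by measurable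
  show "integrable \<mu> (\<lambda>x. (M + M * (2 * \<theta>)) * cmod (g x))" using gi by simp
  show "AE x in \<mu>. (\<lambda>m. g x * transpose_field T (\<lambda>x. \<psi> x * cut m x) x) \<longlonglongrightarrow> g x * transpose_field T \<psi> x"
  proof (rule AE_domainI)
   fix x assume x: "x \<in> \<Omega>"
   have "(\<lambda>m. g x * (cut m x * transpose_field T \<psi> x - \<psi> x * field_deriv T (cut m) x)) \<longlonglongrightarrow> g x * (1 * transpose_field T \<psi> x - \<psi> x * 0)"
    by (intro tendsto_intros cut_tendsto field_deriv_cut_tendsto x)
   then show "(\<lambda>m. g x * transpose_field T (\<lambda>x. \<psi> x * cut m x) x) \<longlonglongrightarrow> g x * transpose_field T \<psi> x"
    by (simp add: prod[OF x])
  qed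
  show "AE x in \<mu>. norm (g x * transpose_field T (\<lambda>x. \<psi> x * cut m x) x) \<le> (M + M * (2 * \<theta>)) * cmod (g x)" for m
  proof (rule AE_domainI)
   fix x assume x: "x \<in> \<Omega>"
   have M0: "0 \<le> M" using order_trans[OF norm_ge_zero M(1)[OF x]] .
   have "cmod (field_deriv T (cut m) x) \<le> \<theta> * 2"
    by (rule order_trans[OF field_deriv_cut_bound[OF x]]) (intro mult_left_mono flat'_bound theta_nonneg[OF x])
   then have "cmod (\<psi> x) * cmod (field_deriv T (cut m) x) \<le> M * (2 * \<theta>)"
    using M(1)[OF x] M0 by (intro mult_mono) auto
   moreover have "cmod (cut m x) * cmod (transpose_field T \<psi> x) \<le> 1 * M"
    using M(2)[OF x] norm_cut_le_1 M0 by (intro mult_mono) auto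
   ultimately have "cmod (transpose_field T (\<lambda>x. \<psi> x * cut m x) x) \<le> M + M * (2 * \<theta>)"
    unfolding prod[OF x] using norm_triangle_ineq4[of "cut m x * transpose_field T \<psi> x" "\<psi> x * field_deriv T (cut m) x"]
    by (simp add: norm_mult)
   from mult_left_mono[OF this norm_ge_zero[of "g x"]]
   show "norm (g x * transpose_field T (\<lambda>x. \<psi> x * cut m x) x) \<le> (M + M * (2 * \<theta>)) * cmod (g x)" by (simp add: norm_mult mult.commute)
  qed
 qed
 have "(\<lambda>m. \<integral>x. g' x * (\<psi> x * cut m x) \<partial>\<mu>) = (\<lambda>m. \<integral>x. g x * transpose_field T (\<lambda>x. \<psi> x * cut m x) x \<partial>\<mu>)"
  using weak[OF cut_test_function[OF \<psi>]] by simp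
 then show ?thesis using LIMSEQ_unique[OF l1] l2 by simp
qed

end

section \<open>Pairing with a shifted holomorphic function\<close>

lemma ennreal_square_le:
 assumes "(X::ennreal)^2 \<le> ennreal (Y^2)" "0 \<le> Y" shows "X \<le> ennreal Y"
proof (cases X)
 case (real x)
 then have "x^2 \<le> Y^2" using assms by (simp add: ennreal_power)
 then show ?thesis using real assms power2_le_imp_le[of x Y] by (simp add: ennreal_leI)
next
 case top
 then show ?thesis using assms by (simp add: power2_eq_square ennreal_mult_top top_unique)
qed

context tfield begin

text \<open>The quantity that is differentiated in \<open>s\<close>: \<open>g\<close> against the conjugate of the shifted
function.\<close>

definition pairing :: "(complex^'n => complex) => (complex^'n => complex) => (complex^'n => complex) => real => complex" where
 "pairing g b H s = (\<integral>z. g z * (b z * cnj (H (flw s z))) \<partial>\<mu>)"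

definition wn :: "nat => (complex^'n => complex) => real" where
 "wn q H = sqrt (enn2real (wmass q H))"

abbreviation pd :: "'n => (complex^'n => complex) => complex^'n => complex" where
 "pd l H \<equiv> (\<lambda>x. der H x (axis l 1))"

lemma wn_nonneg: "0 \<le> wn q H" by (simp add: wn_def)

lemma wmass_eq: "wmass q H < \<infinity> ==> wmass q H = ennreal ((wn q H)^2)"
 by (simp add: wn_def)

lemma wn_le:
 assumes "wmass q H \<le> ennreal C * wmass p G" "wmass p G < \<infinity>" "0 \<le> C"
 shows "wmass q H < \<infinity>" "wn q H \<le> sqrt C * wn p G"
proof -
 have e: "wmass q H \<le> ennreal (C * (wn p G)^2)"
  using assms(1,3) wmass_eq[OF assms(2)] by (simp add: ennreal_mult)
 then show f: "wmass q H < \<infinity>" by (simp add: le_less_trans)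
 have "(wn q H)^2 \<le> C * (wn p G)^2" using e wmass_eq[OF f] assms(3) by simp
 then have "wn q H \<le> sqrt (C * (wn p G)^2)" by (rule real_le_rsqrt)
 then show "wn q H \<le> sqrt C * wn p G" using wn_nonneg by (simp add: real_sqrt_mult)
qed

lemma holo_pd: "holo H ==> holo (pd l H)"
 by (rule holo_deriv[OF open_domain])

lemma wn_pd: "\<exists>C\<ge>0. \<forall>H. holo H --> wmass q H < \<infinity> --> wmass (Suc q) (pd l H) < \<infinity> \<and> wn (Suc q) (pd l H) \<le> C * wn q H"
proof -
 obtain C where C: "C \<ge> 0" "\<And>H. holo H ==> wmass (Suc q) (pd l H) \<le> ennreal C * wmass q H"
  using derivative_wmass[of q "axis l 1"] by blast
 show ?thesis
  by (intro exI[of _ "sqrt C"]) (use C wn_le[OF C(2)] in simp)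
qed

lemma wmass_add_finite:
 assumes H: "holo H" and fin: "wmass q H < \<infinity>" shows "wmass (q + n) H < \<infinity>"
proof -
 obtain M where M: "M \<ge> 0" "\<And>z. z \<in> \<Omega> ==> cmod (of_real (\<rho> z)) \<le> M"
 proof -
  have "smooth (\<lambda>z. complex_of_real (\<rho> z))" unfolding smooth_iff by (rule smooth_on_of_real[OF open_UNIV smooth_on_rho])
  then show ?thesis using smooth_bounded that by blast
 qed
 have "wmass (q + n) H \<le> (\<integral>\<^sup>+y. ennreal ((M ^ n)^2) * wt q H y \<partial>lborel)"
  unfolding wmass_def
 proof (rule nn_integral_mono)
  fix y show "wt (q + n) H y \<le> ennreal ((M ^ n)^2) * wt q H y"
  proof (cases "y \<in> \<Omega>")
   case True
   have ry: "0 \<le> r y" "r y \<le> M" using r_pos[OF True] M(2)[OF True] by simp_all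
   have "r y ^ (q + n) * cmod (H y) = r y ^ n * (r y ^ q * cmod (H y))" by (simp add: power_add mult_ac)
   also have "\<dots> \<le> M ^ n * (r y ^ q * cmod (H y))"
    by (intro mult_right_mono power_mono ry mult_nonneg_nonneg zero_le_power norm_ge_zero)
   finally have "(r y ^ (q + n) * cmod (H y))^2 \<le> (M ^ n * (r y ^ q * cmod (H y)))^2"
    by (rule power_mono) (intro mult_nonneg_nonneg zero_le_power norm_ge_zero ry)
   also have "\<dots> = (M ^ n)^2 * (r y ^ q * cmod (H y))^2" by (simp only: power_mult_distrib)
   finally show ?thesis using True by (simp add: wt_def ennreal_mult[symmetric] ennreal_leI)
  qed (simp add: wt_def)
 qed
 also have "\<dots> = ennreal ((M ^ n)^2) * wmass q H"
  unfolding wmass_def using measurable_wt[OF H] by (intro nn_integral_cmult) simp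
 finally show ?thesis using wmass_eq[OF fin] by (simp add: ennreal_mult[symmetric] le_less_trans)
qed

lemma flw_smooth: "smooth (flw s)"
 unfolding smooth_iff using smooth_w smooth_on_add[OF open_UNIV smooth_on_id smooth_on_scaleR[OF open_UNIV smooth_on_const]]
 by (simp add: smooth_iff)

lemma shifted_smooth:
 assumes b: "coef b" and H: "holo H" and s: "0 \<le> s" "s \<le> 2 * \<delta>"
 shows "smooth_on \<Omega> (\<lambda>z. b z * cnj (H (flw s z)))"
proof -
 let ?U1 = "{z\<in>\<Omega>. r z < 2 * \<eta>}" and ?U2 = "{z\<in>\<Omega>. r z > \<eta>}"
 have fl: "flw s ` ?U1 \<subseteq> \<Omega>" using flow s by auto
 have "smooth_on ?U1 (\<lambda>z. H (flw s z))"
  by (rule smooth_on_compose[OF open_collar fl holo_smooth_on[OF open_domain H] smooth_imp_smooth_on[OF flw_smooth]])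
 then have 1: "smooth_on ?U1 (\<lambda>z. b z * cnj (H (flw s z)))"
  using b by (intro smooth_on_mult[OF open_collar] smooth_on_cnj[OF open_collar]) (auto simp: coef_def intro: smooth_imp_smooth_on)
 have 2: "smooth_on ?U2 (\<lambda>z. b z * cnj (H (flw s z)))"
  by (rule smooth_on_cong[OF open_inner smooth_on_const[of _ 0]]) (use b in \<open>auto simp: coef_def\<close>)
 have "\<Omega> = ?U1 \<union> ?U2" using pos by auto
 then show ?thesis using smooth_on_Un[OF 1 2] by simp
qed

lemma shifted_measurable:
 "coef b ==> holo H ==> 0 \<le> s ==> s \<le> 2 * \<delta> ==> (\<lambda>z. b z * cnj (H (flw s z))) \<in> borel_measurable \<mu>"
 by (rule continuous_on_measurable_lebesgue_on[OF open_domain smooth_on_continuous_on[OF shifted_smooth]])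

lemma sublevel_bound:
 assumes "continuous_on \<Omega> (f :: complex^'n => complex)" "a > 0"
 shows "\<exists>M\<ge>0. \<forall>x. a \<le> r x --> cmod (f x) \<le> M"
proof -
 have "bounded (f ` {x. a \<le> r x})"
  by (intro compact_imp_bounded compact_continuous_image continuous_on_subset[OF assms(1)] sublevel_subset compact_sublevel assms)
 then obtain M where M: "\<And>x. a \<le> r x ==> cmod (f x) \<le> M" unfolding bounded_iff by blast
 have "cmod (f x) \<le> max M 0" if "a \<le> r x" for x using M[OF that] by simp
 then show ?thesis by (intro exI[of _ "max M 0"]) auto
qed

text \<open>For \<open>s > 0\<close> the shifted points stay in a compact part of \<open>\<Omega>\<close>.\<close>

lemma holo_flow_bound:
 assumes H: "holo H" and a: "a > 0"
 shows "\<exists>M\<ge>0. \<forall>z\<in>near. \<forall>s. a \<le> s + r z --> 0 \<le> s --> s \<le> 2 * \<delta> --> cmod (H (flw s z)) \<le> M"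
proof -
 have "c * a > 0" using pos a by simp
 then obtain M where M: "M \<ge> 0" "\<And>x. c * a \<le> r x ==> cmod (H x) \<le> M"
  using sublevel_bound[OF holo_continuous_on[OF H]] by blast
 have "cmod (H (flw s z)) \<le> M" if "z \<in> near" "a \<le> s + r z" "0 \<le> s" "s \<le> 2 * \<delta>" for z s
 proof (rule M(2))
  have "c * a \<le> c * (s + r z)" using that pos by (intro mult_left_mono) auto
  then show "c * a \<le> r (flw s z)" using flow_bounds(2)[OF that(1,3,4)] by linarith
 qed
 then show ?thesis using M(1) by blast
qed

lemma shifted_bounded:
 assumes b: "coef b" and H: "holo H" and s: "0 < s" "s \<le> 2 * \<delta>"
 shows "\<exists>M\<ge>0. \<forall>z\<in>\<Omega>. cmod (b z * cnj (H (flw s z))) \<le> M"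
proof -
 obtain M where M: "M \<ge> 0" "\<forall>z\<in>near. \<forall>t. s \<le> t + r z --> 0 \<le> t --> t \<le> 2 * \<delta> --> cmod (H (flw t z)) \<le> M"
  using holo_flow_bound[OF H s(1)] by blast
 obtain Mb where Mb: "Mb \<ge> 0" "\<forall>z\<in>\<Omega>. cmod (b z) \<le> Mb" using coef_bounded[OF b] by blast
 have "cmod (b z * cnj (H (flw s z))) \<le> Mb * M" if z: "z \<in> \<Omega>" for z
 proof (cases "z \<in> near")
  case True
  have "cmod (H (flw s z)) \<le> M" using M(2) True s r_pos[OF z] by auto
  then show ?thesis using Mb z M(1) by (simp add: norm_mult mult_mono)
 next
  case False
  then show ?thesis using coef_zero[OF b z] Mb M by simp
 qed
 then show ?thesis using Mb M by (intro exI[of _ "Mb * M"]) auto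
qed

lemma L2_times_bounded_integrable:
 assumes g: "g \<in> L2 \<Omega>" and m: "f \<in> borel_measurable \<mu>" and M: "\<And>z. z \<in> \<Omega> ==> cmod (f z) \<le> M"
 shows "integrable \<mu> (\<lambda>z. g z * f z)"
 using L2_integrable[OF open_domain bounded_domain L2_bounded_mult[OF g m M]] by (simp add: mult.commute)

lemma shifted_integrable:
 assumes "g \<in> L2 \<Omega>" "coef b" "holo H" "0 < s" "s \<le> 2 * \<delta>"
 shows "integrable \<mu> (\<lambda>z. g z * (b z * cnj (H (flw s z))))"
proof -
 obtain M where M: "\<forall>z\<in>\<Omega>. cmod (b z * cnj (H (flw s z))) \<le> M" using shifted_bounded[OF assms(2-5)] by blast
 show ?thesis by (rule L2_times_bounded_integrable[OF assms(1) shifted_measurable[OF assms(2,3)], where M=M]) (use assms M in auto)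
qed

lemma shifted_L2:
 assumes b: "coef b"
 shows "\<exists>C\<ge>0. \<forall>H s. holo H --> wmass q H < \<infinity> --> 0 \<le> s --> s \<le> 2 * \<delta> -->
  (\<lambda>z. of_real (s ^ q) * (b z * cnj (H (flw s z)))) \<in> L2 \<Omega> \<and> L2_norm \<Omega> (\<lambda>z. of_real (s ^ q) * (b z * cnj (H (flw s z)))) \<le> C * wn q H"
proof -
 obtain C where C: "C \<ge> 0" "\<And>H s. holo H ==> 0 \<le> s ==> s \<le> 2 * \<delta> ==>
   (\<integral>\<^sup>+z. ennreal ((s ^ q * cmod (H (flw s z)))^2) * indicator near z \<partial>lborel) \<le> ennreal C * wmass q H"
  using flow_L2[of q] by blast
 obtain Mb where Mb: "Mb \<ge> 0" "\<And>z. z \<in> \<Omega> ==> cmod (b z) \<le> Mb" using coef_bounded[OF b] by blast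
 show ?thesis
 proof (intro exI conjI allI impI)
  show "0 \<le> Mb * sqrt C" using Mb C by simp
  fix H s assume H: "holo H" and fin: "wmass q H < \<infinity>" and s: "0 \<le> s" "s \<le> 2 * \<delta>"
  let ?f = "\<lambda>z. of_real (s ^ q) * (b z * cnj (H (flw s z)))"
  have m: "?f \<in> borel_measurable \<mu>" using shifted_measurable[OF b H s] by measurable
  have "(\<integral>\<^sup>+z. ennreal ((cmod (?f z))^2) \<partial>\<mu>) = (\<integral>\<^sup>+z. ennreal ((cmod (?f z))^2) * indicator \<Omega> z \<partial>lborel)"
   by (rule nn_integral_lebesgue_on_lborel) (use open_domain in simp)
  also have "\<dots> \<le> (\<integral>\<^sup>+z. ennreal (Mb^2) * (ennreal ((s ^ q * cmod (H (flw s z)))^2) * indicator near z) \<partial>lborel)"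
  proof (rule nn_integral_mono)
   fix z show "ennreal ((cmod (?f z))^2) * indicator \<Omega> z \<le> ennreal (Mb^2) * (ennreal ((s ^ q * cmod (H (flw s z)))^2) * indicator near z)"
   proof (cases "z \<in> near")
    case True
    then have z: "z \<in> \<Omega>" by simp
    have "cmod (?f z) = cmod (b z) * (s ^ q * cmod (H (flw s z)))" using s by (simp add: norm_mult norm_power)
    also have "\<dots> \<le> Mb * (s ^ q * cmod (H (flw s z)))" using Mb(2)[OF z] s by (intro mult_right_mono) auto
    finally have "(cmod (?f z))^2 \<le> (Mb * (s ^ q * cmod (H (flw s z))))^2" by (intro power_mono) auto
    also have "\<dots> = Mb^2 * (s ^ q * cmod (H (flw s z)))^2" by (simp only: power_mult_distrib)
    finally show ?thesis using True by (simp add: ennreal_mult[symmetric] ennreal_leI)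
   next
    case False
    then show ?thesis using coef_zero[OF b, of z] by (cases "z \<in> \<Omega>") auto
   qed
  qed
  also have "\<dots> = ennreal (Mb^2) * (\<integral>\<^sup>+z. ennreal ((s ^ q * cmod (H (flw s z)))^2) * indicator near z \<partial>lborel)"
  proof (rule nn_integral_cmult)
   have [measurable]: "(\<lambda>y. indicator \<Omega> y *\<^sub>R H y) \<in> borel_measurable borel" by (rule measurable_holo[OF H])
   have "(\<lambda>z. indicator \<Omega> (flw s z) *\<^sub>R H (flw s z)) \<in> borel_measurable borel"
    by (rule measurable_compose[where f="flw s" and g="\<lambda>y. indicator \<Omega> y *\<^sub>R H y"]) measurable
   then have "(\<lambda>z. ennreal ((s ^ q * cmod (indicator \<Omega> (flw s z) *\<^sub>R H (flw s z)))^2) * indicator near z) \<in> borel_measurable lborel"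
    using borel_measurable_indicator[OF measurable_near] by measurable
   moreover have "(\<lambda>z. ennreal ((s ^ q * cmod (indicator \<Omega> (flw s z) *\<^sub>R H (flw s z)))^2) * indicator near z)
     = (\<lambda>z. ennreal ((s ^ q * cmod (H (flw s z)))^2) * indicator near z)"
   proof
    fix z show "ennreal ((s ^ q * cmod (indicator \<Omega> (flw s z) *\<^sub>R H (flw s z)))^2) * indicator near z = ennreal ((s ^ q * cmod (H (flw s z)))^2) * indicator near z"
     using flow_bounds(1)[OF _ s, of z] by (cases "z \<in> near") auto
   qed
   ultimately show "(\<lambda>z. ennreal ((s ^ q * cmod (H (flw s z)))^2) * indicator near z) \<in> borel_measurable lborel" by simp
  qed
  also have "\<dots> \<le> ennreal (Mb^2) * (ennreal C * wmass q H)" by (intro mult_left_mono C H s) simp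
  also have "\<dots> = ennreal ((Mb * sqrt C * wn q H)^2)"
   using C(1) by (simp add: wmass_eq[OF fin] ennreal_mult[symmetric] power_mult_distrib mult.assoc)
  finally have "(\<integral>\<^sup>+z. ennreal ((cmod (?f z))^2) \<partial>\<mu>) \<le> \<dots>" .
  from L2_from_nn_integral[OF m this] show "?f \<in> L2 \<Omega>" "L2_norm \<Omega> ?f \<le> Mb * sqrt C * wn q H"
   using Mb C wn_nonneg[of q H] by simp_all
 qed
qed

lemma pairing_scale:
 "of_real a * pairing g b H s = (\<integral>z. g z * (of_real a * (b z * cnj (H (flw s z)))) \<partial>\<mu>)"
proof -
 have "(\<lambda>z. g z * (of_real a * (b z * cnj (H (flw s z))))) = (\<lambda>z. of_real a * (g z * (b z * cnj (H (flw s z)))))"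
  by (simp add: fun_eq_iff mult_ac)
 then show ?thesis by (simp add: pairing_def)
qed

lemma pairing_bound:
 assumes b: "coef b"
 shows "\<exists>C\<ge>0. \<forall>g H s. g \<in> L2 \<Omega> --> holo H --> wmass q H < \<infinity> --> 0 \<le> s --> s \<le> 2 * \<delta> -->
  cmod (of_real (s ^ q) * pairing g b H s) \<le> L2_norm \<Omega> g * (C * wn q H)"
proof -
 obtain C where C: "C \<ge> 0" "\<And>H s. holo H ==> wmass q H < \<infinity> ==> 0 \<le> s ==> s \<le> 2 * \<delta> ==>
  (\<lambda>z. of_real (s ^ q) * (b z * cnj (H (flw s z)))) \<in> L2 \<Omega> \<and> L2_norm \<Omega> (\<lambda>z. of_real (s ^ q) * (b z * cnj (H (flw s z)))) \<le> C * wn q H"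
  using shifted_L2[OF b, of q] by blast
 show ?thesis
 proof (intro exI conjI allI impI)
  show "0 \<le> C" by (rule C)
  fix g H s assume a: "g \<in> L2 \<Omega>" "holo H" "wmass q H < \<infinity>" "0 \<le> s" "s \<le> 2 * \<delta>"
  note f = C(2)[OF a(2-5)]
  show "cmod (of_real (s ^ q) * pairing g b H s) \<le> L2_norm \<Omega> g * (C * wn q H)"
   unfolding pairing_scale
   by (rule order_trans[OF L2_Cauchy_Schwarz[OF a(1) conjunct1[OF f]]]) (intro mult_left_mono conjunct2[OF f] L2_norm_nonneg)
 qed
qed

text \<open>Up to \<open>s = 0\<close>, where the integrand is no longer bounded: replacing \<open>g\<close> by its
restriction to \<open>{r \<ge> 1 / (m + 1)}\<close> changes the function by an amount that is small uniformly
in \<open>s\<close>, and makes continuity a matter of dominated convergence.\<close>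

lemma pairing_continuous:
 assumes g: "g \<in> L2 \<Omega>" and b: "coef b" and H: "holo H" and fin: "wmass q H < \<infinity>"
 shows "continuous_on {0..2 * \<delta>} (\<lambda>s. of_real (s ^ q) * pairing g b H s)"
proof -
 define \<psi> where "\<psi> s z = of_real (s ^ q) * (b z * cnj (H (flw s z)))" for s z
 obtain C where C: "C \<ge> 0" "\<And>s. 0 \<le> s ==> s \<le> 2 * \<delta> ==> \<psi> s \<in> L2 \<Omega> \<and> L2_norm \<Omega> (\<psi> s) \<le> C * wn q H"
  using shifted_L2[OF b, of q] H fin unfolding \<psi>_def by blast
 define Km where "Km m = {z. 1 / real (Suc m) \<le> r z}" for m
 have Kms: "Km m \<subseteq> \<Omega>" for m unfolding Km_def by (rule sublevel_subset) simp
 have Kmi: "(\<lambda>z. indicator (Km m) z :: real) \<in> borel_measurable \<mu>" for m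
 proof -
  have "closed (Km m)" unfolding Km_def using compact_sublevel by (intro compact_imp_closed) auto
  then have "indicat_real (Km m) \<in> borel_measurable lborel" by (intro borel_measurable_indicator) simp
  then show ?thesis by (intro measurable_restrict_space1 measurable_completion)
 qed
 define gi where "gi m z = of_real (indicator (Km m) z) * g z" for m z
 define go where "go m z = of_real (1 - indicator (Km m) z) * g z" for m z
 have gim: "(\<lambda>z. complex_of_real (indicator (Km m) z)) \<in> borel_measurable \<mu>"
  "(\<lambda>z. complex_of_real (1 - indicator (Km m) z)) \<in> borel_measurable \<mu>" for m
  using Kmi[of m] by measurable
 have gL: "gi m \<in> L2 \<Omega>" "go m \<in> L2 \<Omega>" for m
  unfolding gi_def go_def by (rule L2_bounded_mult[OF g gim(1), where M=1], simp add: indicator_def)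
   (rule L2_bounded_mult[OF g gim(2), where M=1], simp add: indicator_def)
 have "(\<lambda>m. \<integral>z. (cmod (go m z))^2 \<partial>\<mu>) \<longlonglongrightarrow> (\<integral>z. 0 \<partial>\<mu>)"
 proof (rule integral_dominated_convergence[where w="\<lambda>z. (cmod (g z))^2"])
  show "(\<lambda>z. (cmod (go m z))^2) \<in> borel_measurable \<mu>" for m using L2_measurable[OF gL(2)[of m]] by measurable
  show "integrable \<mu> (\<lambda>z. (cmod (g z))^2)" by (rule L2_integrable_sq[OF g])
  show "AE z in \<mu>. (\<lambda>m. (cmod (go m z))^2) \<longlonglongrightarrow> 0"
  proof (rule AE_I2)
   fix z assume "z \<in> space \<mu>"
   then have rz: "0 < r z" using r_pos by (simp add: space_restrict_space)
   have "\<forall>\<^sub>F m in sequentially. inverse (real (Suc m)) < r z"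
    using order_tendstoD(2)[OF LIMSEQ_inverse_real_of_nat rz] .
   then have "\<forall>\<^sub>F m in sequentially. (cmod (go m z))^2 = 0"
    by eventually_elim (simp add: go_def Km_def inverse_eq_divide)
   then show "(\<lambda>m. (cmod (go m z))^2) \<longlonglongrightarrow> 0" by (rule tendsto_eventually)
  qed
  show "AE z in \<mu>. norm ((cmod (go m z))^2) \<le> (cmod (g z))^2" for m
   by (rule AE_I2) (simp add: go_def indicator_def norm_mult)
 qed simp
 then have "(\<lambda>m. (L2_norm \<Omega> (go m))^2) \<longlonglongrightarrow> 0" by (simp add: L2_norm_sq)
 from tendsto_real_sqrt[OF this] have go0: "(\<lambda>m. L2_norm \<Omega> (go m)) \<longlonglongrightarrow> 0" by simp
 define A where "A s = of_real (s ^ q) * pairing g b H s" for s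
 define a where "a m s = (\<integral>z. gi m z * \<psi> s z \<partial>\<mu>)" for m s
 have Aeq: "A s = (\<integral>z. g z * \<psi> s z \<partial>\<mu>)" for s unfolding A_def pairing_scale \<psi>_def ..
 \<comment> \<open>The discarded part is paired with a function whose norm is bounded independently of \<open>s\<close>.\<close>
 have diff: "cmod (A s - a m s) \<le> L2_norm \<Omega> (go m) * (C * wn q H)" if s: "s \<in> {0..2 * \<delta>}" for m s
 proof -
  have P: "\<psi> s \<in> L2 \<Omega>" "L2_norm \<Omega> (\<psi> s) \<le> C * wn q H" using C(2)[of s] s by auto
  have "A s - a m s = (\<integral>z. g z * \<psi> s z - gi m z * \<psi> s z \<partial>\<mu>)"
   unfolding Aeq a_def by (rule Bochner_Integration.integral_diff[symmetric]) (intro L2_mult_integrable g gL P)+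
  also have "\<dots> = (\<integral>z. go m z * \<psi> s z \<partial>\<mu>)" by (simp add: gi_def go_def algebra_simps)
  finally show ?thesis
   using L2_Cauchy_Schwarz[OF gL(2)[of m] P(1)] mult_left_mono[OF P(2) L2_norm_nonneg[of \<Omega> "go m"]] by simp
 qed
 have cont: "continuous_on {0..2 * \<delta>} (a m)" for m
  unfolding continuous_on_sequentially
 proof (intro allI ballI impI, elim conjE)
  fix x s assume s: "s \<in> {0..2 * \<delta>}" and xs: "\<forall>n. x n \<in> {0..2 * \<delta>}" and lim: "x \<longlonglongrightarrow> s"
  have "1 / real (Suc m) > 0" by simp
  from holo_flow_bound[OF H this] obtain M where M: "M \<ge> 0" "\<And>z s. z \<in> near ==> 1 / real (Suc m) \<le> s + r z ==> 0 \<le> s ==> s \<le> 2 * \<delta> ==> cmod (H (flw s z)) \<le> M"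
   by blast
  obtain Mb where Mb: "Mb \<ge> 0" "\<And>z. z \<in> \<Omega> ==> cmod (b z) \<le> Mb" using coef_bounded[OF b] by blast
  show "(a m \<circ> x) \<longlonglongrightarrow> a m s"
   unfolding a_def o_def
  proof (rule integral_dominated_convergence[where w="\<lambda>z. ((2 * \<delta>) ^ q * (Mb * M)) * cmod (g z)"])
   show "(\<lambda>z. gi m z * \<psi> s z) \<in> borel_measurable \<mu>"
    using L2_measurable[OF gL(1)[of m]] L2_measurable[of "\<psi> s" \<Omega>] C(2)[of s] s by (auto intro!: borel_measurable_times)
   show "(\<lambda>z. gi m z * \<psi> (x n) z) \<in> borel_measurable \<mu>" for n
    using L2_measurable[OF gL(1)[of m]] L2_measurable[of "\<psi> (x n)" \<Omega>] C(2)[of "x n"] xs by (auto intro!: borel_measurable_times)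
   show "integrable \<mu> (\<lambda>z. ((2 * \<delta>) ^ q * (Mb * M)) * cmod (g z))"
    using L2_integrable[OF open_domain bounded_domain g] by simp
   show "AE z in \<mu>. (\<lambda>n. gi m z * \<psi> (x n) z) \<longlonglongrightarrow> gi m z * \<psi> s z"
   proof (rule AE_domainI)
    fix z assume z: "z \<in> \<Omega>"
    show "(\<lambda>n. gi m z * \<psi> (x n) z) \<longlonglongrightarrow> gi m z * \<psi> s z"
    proof (cases "z \<in> near")
     case True
     have "flw s z \<in> \<Omega>" using flow_bounds(1)[OF True, of s] s by simp
     then have "isCont H (flw s z)"
      using holo_continuous_on[OF H] open_domain by (simp add: continuous_on_eq_continuous_at)
     moreover have "(\<lambda>n. flw (x n) z) \<longlonglongrightarrow> flw s z" by (intro tendsto_intros lim)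
     ultimately have "(\<lambda>n. H (flw (x n) z)) \<longlonglongrightarrow> H (flw s z)" by (rule isCont_tendsto_compose)
     then show ?thesis unfolding \<psi>_def by (intro tendsto_intros lim)
    next
     case False
     then show ?thesis using coef_zero[OF b z] by (simp add: \<psi>_def)
    qed
   qed
   show "AE z in \<mu>. norm (gi m z * \<psi> (x n) z) \<le> ((2 * \<delta>) ^ q * (Mb * M)) * cmod (g z)" for n
   proof (rule AE_domainI)
    fix z assume z: "z \<in> \<Omega>"
    have xn: "0 \<le> x n" "x n \<le> 2 * \<delta>" using xs by auto
    show "norm (gi m z * \<psi> (x n) z) \<le> ((2 * \<delta>) ^ q * (Mb * M)) * cmod (g z)"
    proof (cases "z \<in> near \<and> z \<in> Km m")
     case True
     have "cmod (H (flw (x n) z)) \<le> M" by (rule M(2)) (use True xn in \<open>auto simp: Km_def\<close>)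
     then have "cmod (\<psi> (x n) z) \<le> (2 * \<delta>) ^ q * (Mb * M)"
      unfolding \<psi>_def norm_mult using power_mono[OF xn(2,1), of q] xn Mb(2)[OF z] Mb(1) M(1) zero_le_power[of "2 * \<delta>" q] pos
      by (intro mult_mono) (auto simp: norm_power simp del: power_mult_distrib power_mult_numeral)
     from mult_left_mono[OF this norm_ge_zero[of "g z"]] True show ?thesis by (simp add: gi_def norm_mult mult.commute)
    next
     case False
     then have e: "gi m z * \<psi> (x n) z = 0" using coef_zero[OF b z] by (auto simp: gi_def \<psi>_def)
     show ?thesis unfolding e norm_zero
      by (intro mult_nonneg_nonneg zero_le_power norm_ge_zero Mb(1) M(1)) (use pos in simp_all)
    qed
   qed
  qed
 qed
 have "uniform_limit {0..2 * \<delta>} a A sequentially"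
  unfolding uniform_limit_iff
 proof (intro allI impI)
  fix e :: real assume e: "e > 0"
  have "(\<lambda>m. L2_norm \<Omega> (go m) * (C * wn q H)) \<longlonglongrightarrow> 0 * (C * wn q H)" by (intro tendsto_intros go0)
  then have "\<forall>\<^sub>F m in sequentially. L2_norm \<Omega> (go m) * (C * wn q H) < e" using e by (intro order_tendstoD(2)) auto
  then show "\<forall>\<^sub>F m in sequentially. \<forall>s\<in>{0..2 * \<delta>}. dist (a m s) (A s) < e"
  proof eventually_elim
   case (elim m)
   show ?case
   proof
    fix s assume "s \<in> {0..2 * \<delta>}"
    from le_less_trans[OF diff[OF this] elim] show "dist (a m s) (A s) < e" by (simp only: dist_norm norm_minus_commute)
   qed
  qed
 qed
 then have "continuous_on {0..2 * \<delta>} A"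
  by (rule uniform_limit_theorem[rotated]) (simp_all only: cont always_eventually simp_thms trivial_limit_sequentially not_False_eq_True)
 then show ?thesis by (simp add: A_def[abs_def])
qed

end

section \<open>The derivative of the pairing is a derivative along the field\<close>

lemma holo_deriv_components:
 assumes "holomorphic_fun_on H \<Omega>" "x \<in> \<Omega>"
 shows "der H x v = (\<Sum>l\<in>UNIV. v $ l * der H x (axis l 1))"
proof -
 interpret l: bounded_linear "der H x"
  by (rule has_derivative_bounded_linear[OF holo_has_derivative(1)[OF assms]])
 have "der H x v = der H x (\<Sum>l\<in>UNIV. v $ l *s axis l 1)"
  by (simp only: basis_expansion)
 also have "\<dots> = (\<Sum>l\<in>UNIV. v $ l * der H x (axis l 1))"
  by (simp only: l.sum holo_has_derivative(2)[OF assms])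
 finally show ?thesis .
qed

context tfield begin

lemma coef_product: "coef b ==> coef (\<lambda>z. b z * (\<gamma> z * snd (T z) $ l))"
proof (rule coef_mult)
 have "smooth_on UNIV T" using smooth_T by (simp add: smooth_iff)
 from smooth_on_mult[OF open_UNIV smooth_gamma[unfolded smooth_iff] smooth_on_field_components(2)[OF open_UNIV this]]
 show "smooth (\<lambda>z. \<gamma> z * snd (T z) $ l)" by (simp add: smooth_iff)
qed

lemma cnj_w: "cnj (w z $ l) = \<gamma> z * snd (T z) $ l"
 by (simp add: w_eq)

lemma shifted_has_derivative:
 assumes H: "holo H" and z: "z \<in> near" and s: "0 \<le> s" "s \<le> 2 * \<delta>"
 shows "((\<lambda>s. b z * cnj (H (flw s z))) has_vector_derivative
  (\<Sum>l\<in>UNIV. b z * (\<gamma> z * snd (T z) $ l) * cnj (pd l H (flw s z)))) (at s)"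
proof -
 have fl: "flw s z \<in> \<Omega>" using flow_bounds(1)[OF z s] .
 have "((\<lambda>s. H (flw s z)) has_vector_derivative der H (flw s z) (w z)) (at s)"
  by (rule smooth_has_vector_derivative_line[OF holo_smooth_on[OF open_domain H] fl])
 from has_vector_derivative_mult_right[OF bounded_linear.has_vector_derivative[OF bounded_linear_cnj this], of "b z"]
 show ?thesis
  unfolding holo_deriv_components[OF H fl, of "w z"] cnj_sum complex_cnj_mult cnj_w sum_distrib_left mult.assoc .
qed

text \<open>Differentiation under the integral sign; for \<open>s > 0\<close> the integrand has bounded
\<open>s\<close>-derivative.\<close>

lemma pairing_derivative:
 assumes g: "g \<in> L2 \<Omega>" and b: "coef b" and H: "holo H" and s: "0 < s" "s < 2 * \<delta>"
 shows "(pairing g b H has_vector_derivative (\<Sum>l\<in>UNIV. pairing g (\<lambda>z. b z * (\<gamma> z * snd (T z) $ l)) (pd l H) s)) (at s)"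
proof -
 define \<psi> where "\<psi> s z = b z * cnj (H (flw s z))" for s z
 define D where "D s z = (\<Sum>l\<in>UNIV. b z * (\<gamma> z * snd (T z) $ l) * cnj (pd l H (flw s z)))" for s z
 let ?S = "{- (s/2)<..<2 * \<delta> - s}"
 have Sin: "s/2 \<le> s + h \<and> s + h \<le> 2 * \<delta> \<and> 0 < s + h" if "h \<in> ?S" for h using that s by auto
 have "\<forall>l. \<exists>M\<ge>0. \<forall>z\<in>near. \<forall>t. s/2 \<le> t + r z --> 0 \<le> t --> t \<le> 2 * \<delta> --> cmod (pd l H (flw t z)) \<le> M"
  by (rule allI, rule holo_flow_bound[OF holo_pd[OF H]]) (use s in simp)
 from choice[OF this] obtain M where M': "\<forall>l. M l \<ge> 0 \<and> (\<forall>z\<in>near. \<forall>t. s/2 \<le> t + r z --> 0 \<le> t --> t \<le> 2 * \<delta> --> cmod (pd l H (flw t z)) \<le> M l)"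
  by (elim exE)
 have M: "M l \<ge> 0" "z \<in> near ==> s/2 \<le> t + r z ==> 0 \<le> t ==> t \<le> 2 * \<delta> ==> cmod (pd l H (flw t z)) \<le> M l" for l z t
  by (rule conjunct1[OF spec[OF M']], rule conjunct2[OF spec[OF M'], rule_format])
 have "\<forall>l. \<exists>M\<ge>0. \<forall>z\<in>\<Omega>. cmod (b z * (\<gamma> z * snd (T z) $ l)) \<le> M" by (rule allI, rule coef_bounded[OF coef_product[OF b]])
 from choice[OF this] obtain Mb where Mb': "\<forall>l. Mb l \<ge> 0 \<and> (\<forall>z\<in>\<Omega>. cmod (b z * (\<gamma> z * snd (T z) $ l)) \<le> Mb l)" by (elim exE)
 have Mb: "Mb l \<ge> 0" "z \<in> \<Omega> ==> cmod (b z * (\<gamma> z * snd (T z) $ l)) \<le> Mb l" for l z by (rule conjunct1[OF spec[OF Mb']], rule conjunct2[OF spec[OF Mb'], rule_format])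
 define K where "K = (\<Sum>l\<in>UNIV. Mb l * M l)"
 have K: "K \<ge> 0" unfolding K_def by (intro sum_nonneg mult_nonneg_nonneg Mb M)
 have D: "cmod (D t z) \<le> K" if z: "z \<in> near" and t: "s/2 \<le> t" "t \<le> 2 * \<delta>" for t z
  unfolding D_def K_def
 proof (rule sum_norm_le)
  fix l
  have "cmod (pd l H (flw t z)) \<le> M l" by (rule M(2)[OF z]) (use t s z r_pos[of z] in auto)
  then show "cmod (b z * (\<gamma> z * snd (T z) $ l) * cnj (pd l H (flw t z))) \<le> Mb l * M l"
   unfolding norm_mult[of _ "cnj _"] complex_mod_cnj using Mb z by (intro mult_mono) auto
 qed
 have quot: "cmod ((\<psi> (s + h) z - \<psi> s z) /\<^sub>R h) \<le> K" if h: "h \<in> ?S" "h \<noteq> 0" and z: "z \<in> \<Omega>" for h z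
 proof (cases "z \<in> near")
  case True
  have "norm (\<psi> (s + h) z - \<psi> s z) \<le> K * norm (s + h - s)"
  proof (rule differentiable_bound[where S="{s/2..2 * \<delta>}" and f="\<lambda>t. \<psi> t z" and f'="\<lambda>t h. h *\<^sub>R D t z"])
   fix t assume t: "t \<in> {s/2..2 * \<delta>}"
   then have "((\<lambda>t. \<psi> t z) has_vector_derivative D t z) (at t)"
    unfolding \<psi>_def D_def using s by (intro shifted_has_derivative[OF H True]) auto
   then show "((\<lambda>t. \<psi> t z) has_derivative (\<lambda>h. h *\<^sub>R D t z)) (at t within {s/2..2 * \<delta>})"
    unfolding has_vector_derivative_def by (rule has_derivative_at_withinI)
   show "onorm (\<lambda>h. h *\<^sub>R D t z) \<le> K"
   proof (rule onorm_le)
    fix x :: real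
    have "cmod (D t z) \<le> K" by (rule D[OF True]) (use t in auto)
    from mult_right_mono[OF this abs_ge_zero[of x]] show "norm (x *\<^sub>R D t z) \<le> K * norm x" by (simp add: mult.commute)
   qed
  qed (use Sin[OF h(1)] s in auto)
  then have "cmod (\<psi> (s + h) z - \<psi> s z) / \<bar>h\<bar> \<le> K" using h by (simp add: pos_divide_le_eq)
  then show ?thesis by (simp only: norm_scaleR abs_inverse divide_inverse mult.commute real_norm_def)
 next
  case False
  then show ?thesis using coef_zero[OF b z] K by (simp add: \<psi>_def)
 qed
 have pm: "\<psi> t \<in> borel_measurable \<mu>" if "0 \<le> t" "t \<le> 2 * \<delta>" for t
  unfolding \<psi>_def by (rule shifted_measurable[OF b H that])
 have pint: "integrable \<mu> (\<lambda>z. g z * \<psi> t z)" if "0 < t" "t \<le> 2 * \<delta>" for t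
  unfolding \<psi>_def by (rule shifted_integrable[OF g b H that])
 have Dm: "D s \<in> borel_measurable \<mu>"
  unfolding D_def[abs_def]
  by (rule borel_measurable_sum, rule shifted_measurable[OF coef_product[OF b] holo_pd[OF H]]) (use s in simp_all)
 have lim: "((\<lambda>h. (pairing g b H (s + h) - pairing g b H s) /\<^sub>R h) \<longlongrightarrow> (\<integral>z. g z * D s z \<partial>\<mu>)) (at 0 within ?S)"
  unfolding tendsto_at_iff_sequentially o_def
 proof (intro allI impI)
  fix h assume h: "\<forall>i. h i \<in> ?S - {0}" and h0: "h \<longlonglongrightarrow> (0::real)"
  have hi: "h i \<in> ?S" "h i \<noteq> 0" for i using h by auto
  have eq: "(pairing g b H (s + h i) - pairing g b H s) /\<^sub>R h i = (\<integral>z. g z * ((\<psi> (s + h i) z - \<psi> s z) /\<^sub>R h i) \<partial>\<mu>)" for i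
  proof -
   have "pairing g b H (s + h i) - pairing g b H s = (\<integral>z. g z * \<psi> (s + h i) z - g z * \<psi> s z \<partial>\<mu>)"
    unfolding pairing_def \<psi>_def[symmetric]
    by (rule Bochner_Integration.integral_diff[symmetric]; rule pint) (use Sin[OF hi(1)[of i]] s in auto)
   moreover have "g z * ((\<psi> (s + h i) z - \<psi> s z) /\<^sub>R h i) = (g z * \<psi> (s + h i) z - g z * \<psi> s z) /\<^sub>R h i" for z
    by (simp only: mult_scaleR_right right_diff_distrib)
   ultimately show ?thesis by (simp only: integral_scaleR_right)
  qed
  show "(\<lambda>i. (pairing g b H (s + h i) - pairing g b H s) /\<^sub>R h i) \<longlonglongrightarrow> (\<integral>z. g z * D s z \<partial>\<mu>)"
   unfolding eq
  proof (rule integral_dominated_convergence[where w="\<lambda>z. K * cmod (g z)"])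
   show "(\<lambda>z. g z * D s z) \<in> borel_measurable \<mu>" using Dm L2_measurable[OF g] by measurable
   show "(\<lambda>z. g z * ((\<psi> (s + h i) z - \<psi> s z) /\<^sub>R h i)) \<in> borel_measurable \<mu>" for i
   proof -
    have [measurable]: "\<psi> (s + h i) \<in> borel_measurable \<mu>" "\<psi> s \<in> borel_measurable \<mu>"
     by (rule pm; use Sin[OF hi(1)[of i]] s in auto)+
    show ?thesis using L2_measurable[OF g] by measurable
   qed
   show "integrable \<mu> (\<lambda>z. K * cmod (g z))" using L2_integrable[OF open_domain bounded_domain g] by simp
   show "AE z in \<mu>. (\<lambda>i. g z * ((\<psi> (s + h i) z - \<psi> s z) /\<^sub>R h i)) \<longlonglongrightarrow> g z * D s z"
   proof (rule AE_domainI)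
    fix z assume z: "z \<in> \<Omega>"
    show "(\<lambda>i. g z * ((\<psi> (s + h i) z - \<psi> s z) /\<^sub>R h i)) \<longlonglongrightarrow> g z * D s z"
    proof (cases "z \<in> near")
     case True
     have "((\<lambda>t. \<psi> t z) has_vector_derivative D s z) (at s)"
      unfolding \<psi>_def D_def using s by (intro shifted_has_derivative[OF H True]) auto
     then have "((\<lambda>h. (\<psi> (s + h) z - \<psi> s z) /\<^sub>R h) \<longlongrightarrow> D s z) (at 0)"
      by (simp only: has_vector_derivative_iff_quotient)
     moreover have "filterlim h (at 0) sequentially" using h0 hi(2) by (simp only: filterlim_at always_eventually simp_thms UNIV_I)
     ultimately have "(\<lambda>i. (\<psi> (s + h i) z - \<psi> s z) /\<^sub>R h i) \<longlonglongrightarrow> D s z" by (rule filterlim_compose)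
     then show ?thesis by (rule tendsto_mult_left)
    next
     case False
     then show ?thesis using coef_zero[OF b z] by (simp add: \<psi>_def D_def)
    qed
   qed
   show "AE z in \<mu>. norm (g z * ((\<psi> (s + h i) z - \<psi> s z) /\<^sub>R h i)) \<le> K * cmod (g z)" for i
   proof (rule AE_domainI)
    fix z assume z: "z \<in> \<Omega>"
    show "norm (g z * ((\<psi> (s + h i) z - \<psi> s z) /\<^sub>R h i)) \<le> K * cmod (g z)"
     unfolding norm_mult[of "g z"] using mult_right_mono[OF quot[OF hi z] norm_ge_zero[of "g z"]] by (simp only: mult.commute)
   qed
  qed
 qed
 have "at (0::real) within ?S = at 0" using s by (intro at_within_open) auto
 moreover have "(\<integral>z. g z * D s z \<partial>\<mu>) = (\<Sum>l\<in>UNIV. pairing g (\<lambda>z. b z * (\<gamma> z * snd (T z) $ l)) (pd l H) s)"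
  unfolding D_def sum_distrib_left pairing_def
  by (rule Bochner_Integration.integral_sum) (rule shifted_integrable[OF g coef_product[OF b] holo_pd[OF H] s(1)], use s in simp)
 ultimately show ?thesis unfolding has_vector_derivative_iff_quotient using lim by (simp only:)
qed

text \<open>The function \<open>cnj \<circ> H\<close> is antiholomorphic, so \<open>T\<close> enters only through
\<open>T(cnj (z + s w(z))\<^sub>l) = v\<^sub>l + s T(cnj w\<^sub>l)\<close>.\<close>

lemma field_deriv_flow:
 assumes H: "holo H" and z: "flw s z \<in> \<Omega>"
 shows "field_deriv T (\<lambda>z. cnj (H (flw s z))) z
  = (\<Sum>l\<in>UNIV. (snd (T z) $ l + of_real s * field_deriv T (\<lambda>z. cnj (w z $ l)) z) * cnj (pd l H (flw s z)))"
proof -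
 let ?dw = "der w z" and ?P = "\<lambda>l. cnj (pd l H (flw s z))"
 have hw: "(w has_derivative ?dw) (at z)"
  using smooth_w by (intro smooth_on_has_derivative[of UNIV]) (auto simp: smooth_iff)
 have 1: "(flw s has_derivative (\<lambda>v. v + s *\<^sub>R ?dw v)) (at z)"
  by (intro has_derivative_add has_derivative_ident has_derivative_scaleR_right hw)
 have "((\<lambda>z. cnj (H (flw s z))) has_derivative (\<lambda>v. cnj (der H (flw s z) (v + s *\<^sub>R ?dw v)))) (at z)"
  using bounded_linear.has_derivative[OF bounded_linear_cnj diff_chain_at[OF 1 holo_has_derivative(1)[OF H z]]] by (simp add: o_def)
 then have d: "der (\<lambda>z. cnj (H (flw s z))) z = (\<lambda>v. cnj (der H (flw s z) (v + s *\<^sub>R ?dw v)))"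
  by (rule frechet_derivative_at[symmetric])
 have e: "cnj (der H (flw s z) (v + s *\<^sub>R ?dw v))
   = (\<Sum>l\<in>UNIV. ?P l * cnj (v $ l) + (?P l * of_real s) * cnj (?dw v $ l))" for v
  unfolding holo_deriv_components[OF H z, of "v + s *\<^sub>R ?dw v"]
   vector_add_component vector_scaleR_component cnj_sum complex_cnj_mult complex_cnj_add
   scaleR_conv_of_real[where 'a=complex] complex_cnj_complex_of_real
  by (simp add: algebra_simps)
 have "bounded_linear (\<lambda>v::complex^'n. cnj (v $ l))" for l
  using bounded_linear_compose[OF bounded_linear_cnj bounded_linear_vec_nth] .
 from frechet_derivative_at[OF bounded_linear.has_derivative[OF this hw]]
 have f: "der (\<lambda>z. cnj (w z $ l)) z = (\<lambda>v. cnj (?dw v $ l))" for l by simp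
 show ?thesis
  unfolding field_deriv_def d e f cvector_apply_sum cvector_apply_add cvector_apply_scale cvector_apply_cnj_component
  by (simp add: algebra_simps)
qed

definition \<tau> :: "'n => complex^'n => complex" where
 "\<tau> l = field_deriv T (\<lambda>z. cnj (w z $ l))"

text \<open>The divergence of \<open>b T\<close>, that is the zeroth-order term of its transpose up to sign.\<close>

definition div_coef :: "(complex^'n => complex) => complex^'n => complex" where
 "div_coef b z = field_deriv T b z + b z * field_div T z"

lemma smooth_tau: "smooth (\<tau> l)"
proof -
 have "smooth_on UNIV (\<lambda>z. cnj (w z $ l))"
  by (intro smooth_on_cnj open_UNIV smooth_on_linear[OF bounded_linear_vec_nth open_UNIV smooth_w[unfolded smooth_iff]])
 then show ?thesis unfolding \<tau>_def by (intro smooth_field_deriv) (simp add: smooth_iff)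
qed

lemma coef_div: "coef b ==> coef (div_coef b)"
 using coef_add[OF coef_field_deriv coef_mult[OF _ smooth_field_div]] unfolding div_coef_def[abs_def] by blast

text \<open>Since \<open>\<gamma> v\<^sub>l = cnj w\<^sub>l\<close>, the first sum is the \<open>s\<close>-derivative of
the integrand of the pairing.\<close>

lemma transpose_psi:
 assumes b: "coef b" and H: "holo H" and s: "0 \<le> s" "s \<le> 2 * \<delta>" and z: "z \<in> \<Omega>"
 shows "transpose_field T (\<lambda>z. b z * \<gamma> z * cnj (H (flw s z))) z
  = - ((\<Sum>l\<in>UNIV. b z * (\<gamma> z * snd (T z) $ l) * cnj (pd l H (flw s z)))
    + of_real s * (\<Sum>l\<in>UNIV. b z * \<gamma> z * \<tau> l z * cnj (pd l H (flw s z)))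
    + div_coef (\<lambda>z. b z * \<gamma> z) z * cnj (H (flw s z)))"
proof -
 let ?b = "\<lambda>z. b z * \<gamma> z" and ?F = "\<lambda>z. cnj (H (flw s z))"
 have b': "coef ?b" by (rule coef_mult[OF b smooth_gamma])
 have d: "(\<lambda>z. ?b z * ?F z) differentiable at z"
  by (rule smooth_on_differentiable[OF shifted_smooth[OF b' H s] z])
 have tr: "transpose_field T (\<lambda>z. ?b z * ?F z) z = - (field_deriv T (\<lambda>z. ?b z * ?F z) z + field_div T z * (?b z * ?F z))"
  by (rule transpose_field_eq[OF open_UNIV smooth_T[unfolded smooth_iff] UNIV_I d])
 show ?thesis
 proof (cases "r z > \<eta>")
  case True
  have "field_deriv T (\<lambda>z. ?b z * ?F z) z = field_deriv T (\<lambda>z. 0) z"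
   by (rule field_deriv_cong_open[OF open_inner[of \<eta>]]) (use z True b in \<open>auto simp: coef_def\<close>)
  then show ?thesis
   unfolding tr using z True b coef_div[OF b'] by (simp add: coef_def field_deriv_def cvector_apply_zero)
 next
  case False
  then have fl: "flw s z \<in> \<Omega>" using flow_bounds(1)[OF _ s, of z] z by simp
  have db: "?b differentiable at z" using b' by (intro smooth_on_differentiable[of UNIV]) (auto simp: coef_def smooth_iff)
  have hw: "(flw s has_derivative der (flw s) z) (at z)"
   using flw_smooth by (intro smooth_on_has_derivative[of UNIV]) (auto simp: smooth_iff)
  have dF: "?F differentiable at z"
   using bounded_linear.has_derivative[OF bounded_linear_cnj diff_chain_at[OF hw holo_has_derivative(1)[OF H fl]]]
   by (auto simp: o_def differentiable_def)
  show ?thesis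
   unfolding tr field_deriv_mult[OF db dF] field_deriv_flow[OF H fl] \<tau>_def[symmetric] div_coef_def
   by (simp add: algebra_simps sum.distrib sum_distrib_left)
 qed
qed

text \<open>The derivative in \<open>s\<close> is traded for a derivative of \<open>g\<close> along \<open>T\<close>.\<close>

lemma pairing_by_parts:
 assumes g: "g \<in> L2 \<Omega>" "g' \<in> L2 \<Omega>"
  and weak: "\<And>\<phi>. test_function \<Omega> \<phi> ==> (\<integral>x. g' x * \<phi> x \<partial>\<mu>) = (\<integral>x. g x * transpose_field T \<phi> x \<partial>\<mu>)"
  and b: "coef b" and H: "holo H" and s: "0 < s" "s < 2 * \<delta>"
 shows "(pairing g b H has_vector_derivative
  - (pairing g' (\<lambda>z. b z * \<gamma> z) H s + pairing g (div_coef (\<lambda>z. b z * \<gamma> z)) H s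
    + of_real s * (\<Sum>l\<in>UNIV. pairing g (\<lambda>z. b z * \<gamma> z * \<tau> l z) (pd l H) s))) (at s)"
proof -
 let ?b = "\<lambda>z. b z * \<gamma> z"
 let ?\<psi> = "\<lambda>z. ?b z * cnj (H (flw s z))"
 let ?A = "\<lambda>l z. b z * (\<gamma> z * snd (T z) $ l) * cnj (pd l H (flw s z))"
 let ?B = "\<lambda>l z. b z * \<gamma> z * \<tau> l z * cnj (pd l H (flw s z))"
 let ?E = "\<lambda>z. div_coef ?b z * cnj (H (flw s z))"
 have s': "0 \<le> s" "s \<le> 2 * \<delta>" using s by auto
 have b': "coef ?b" by (rule coef_mult[OF b smooth_gamma])
 have cB: "coef (\<lambda>z. b z * \<gamma> z * \<tau> l z)" for l by (rule coef_mult[OF b' smooth_tau])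
 note bnd = shifted_bounded[OF _ _ s(1) s'(2)]
 obtain M0 where M0: "M0 \<ge> 0" "\<And>z. z \<in> \<Omega> ==> cmod (?\<psi> z) \<le> M0" using bnd[OF b' H] by blast
 have "\<forall>l. \<exists>M\<ge>0. \<forall>z\<in>\<Omega>. cmod (?A l z) \<le> M" by (rule allI, rule bnd[OF coef_product[OF b] holo_pd[OF H]])
 from choice[OF this] obtain M1 where M1': "\<forall>l. M1 l \<ge> 0 \<and> (\<forall>z\<in>\<Omega>. cmod (?A l z) \<le> M1 l)" by (elim exE)
 have M1: "M1 l \<ge> 0" "z \<in> \<Omega> ==> cmod (?A l z) \<le> M1 l" for l z by (rule conjunct1[OF spec[OF M1']], rule conjunct2[OF spec[OF M1'], rule_format])
 have "\<forall>l. \<exists>M\<ge>0. \<forall>z\<in>\<Omega>. cmod (?B l z) \<le> M" by (rule allI, rule bnd[OF cB holo_pd[OF H]])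
 from choice[OF this] obtain M2 where M2': "\<forall>l. M2 l \<ge> 0 \<and> (\<forall>z\<in>\<Omega>. cmod (?B l z) \<le> M2 l)" by (elim exE)
 have M2: "M2 l \<ge> 0" "z \<in> \<Omega> ==> cmod (?B l z) \<le> M2 l" for l z by (rule conjunct1[OF spec[OF M2']], rule conjunct2[OF spec[OF M2'], rule_format])
 obtain M3 where M3: "M3 \<ge> 0" "\<And>z. z \<in> \<Omega> ==> cmod (?E z) \<le> M3" using bnd[OF coef_div[OF b'] H] by blast
 define K where "K = sum M1 UNIV + s * sum M2 UNIV + M3"
 have K: "0 \<le> K" unfolding K_def using s' M1(1) M2(1) M3(1) by (intro add_nonneg_nonneg mult_nonneg_nonneg sum_nonneg) auto
 note int = shifted_integrable[OF g(1) _ _ s(1) s'(2)]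
 have iA: "integrable \<mu> (\<lambda>z. g z * ?A l z)" for l by (rule int[OF coef_product[OF b] holo_pd[OF H]])
 have iB: "integrable \<mu> (\<lambda>z. g z * ?B l z)" for l by (rule int[OF cB holo_pd[OF H]])
 have iE: "integrable \<mu> (\<lambda>z. g z * ?E z)" by (rule int[OF coef_div[OF b'] H])
 have "pairing g' ?b H s = (\<integral>z. g z * transpose_field T ?\<psi> z \<partial>\<mu>)"
  unfolding pairing_def
 proof (rule transpose_bounded[OF g weak shifted_smooth[OF b' H s'], where M="M0 + K"])
  fix z assume z: "z \<in> \<Omega>"
  show "cmod (?\<psi> z) \<le> M0 + K" using M0(2)[OF z] K by linarith
  have "cmod (transpose_field T ?\<psi> z) \<le> K"
   unfolding transpose_psi[OF b H s' z] norm_minus_cancel K_def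
  proof (intro norm_triangle_mono)
   show "cmod (\<Sum>l\<in>UNIV. ?A l z) \<le> sum M1 UNIV" by (rule sum_norm_le) (rule M1(2)[OF z])
   have "cmod (\<Sum>l\<in>UNIV. ?B l z) \<le> sum M2 UNIV" by (rule sum_norm_le) (rule M2(2)[OF z])
   then show "cmod (of_real s * (\<Sum>l\<in>UNIV. ?B l z)) \<le> s * sum M2 UNIV"
    using s' by (simp add: norm_mult mult_left_mono)
   show "cmod (?E z) \<le> M3" by (rule M3(2)[OF z])
  qed
  then show "cmod (transpose_field T ?\<psi> z) \<le> M0 + K" using M0(1) by linarith
 qed
 also have "\<dots> = (\<integral>z. - ((\<Sum>l\<in>UNIV. g z * ?A l z) + of_real s * (\<Sum>l\<in>UNIV. g z * ?B l z) + g z * ?E z) \<partial>\<mu>)"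
 proof (rule Bochner_Integration.integral_cong[OF refl])
  fix z assume "z \<in> space \<mu>"
  then have z: "z \<in> \<Omega>" by (simp add: space_restrict_space)
  have alg: "x * (- (a + t * d + e)) = - (x * a + t * (x * d) + x * e)" for x a t d e :: complex by (simp add: algebra_simps)
  show "g z * transpose_field T ?\<psi> z = - ((\<Sum>l\<in>UNIV. g z * ?A l z) + of_real s * (\<Sum>l\<in>UNIV. g z * ?B l z) + g z * ?E z)"
   unfolding transpose_psi[OF b H s' z] alg sum_distrib_left[where r="g z"] ..
 qed
 also have "\<dots> = - ((\<Sum>l\<in>UNIV. \<integral>z. g z * ?A l z \<partial>\<mu>) + of_real s * (\<Sum>l\<in>UNIV. \<integral>z. g z * ?B l z \<partial>\<mu>)
   + (\<integral>z. g z * ?E z \<partial>\<mu>))"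
  using iA iB iE by (simp add: Bochner_Integration.integral_sum Bochner_Integration.integral_add Bochner_Integration.integrable_add Bochner_Integration.integrable_sum)
 finally have eq0: "pairing g' ?b H s = \<dots>" unfolding pairing_def .
 have solve: "p = - (a + t + e) ==> a = - (p + e + t)" for a p t e :: complex by (simp add: algebra_simps)
 have eq: "(\<Sum>l\<in>UNIV. pairing g (\<lambda>z. b z * (\<gamma> z * snd (T z) $ l)) (pd l H) s)
  = - (pairing g' ?b H s + pairing g (div_coef ?b) H s + of_real s * (\<Sum>l\<in>UNIV. pairing g (\<lambda>z. b z * \<gamma> z * \<tau> l z) (pd l H) s))"
  using solve[OF eq0] unfolding pairing_def .
 show ?thesis using pairing_derivative[OF g(1) b H s] unfolding eq .
qed

end

section \<open>Repeated integration by parts\<close>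

lemma norm_integral_le_nn_integral: "ennreal (norm (integral\<^sup>L M f)) \<le> (\<integral>\<^sup>+x. ennreal (norm (f x)) \<partial>M)"
 for f :: "'a => 'b::{banach, second_countable_topology}"
 by (cases "integrable M f") (simp_all add: integral_norm_bound_ennreal not_integrable_integral_eq)

context tfield begin

text \<open>The functions \<open>g i\<close> are successive weak derivatives along \<open>T\<close> of \<open>g 0\<close>.\<close>

definition weak_system :: "nat => (nat => complex^'n => complex) => real => bool" where
 "weak_system k g N \<longleftrightarrow> (\<forall>i\<le>k. g i \<in> L2 \<Omega> \<and> L2_norm \<Omega> (g i) \<le> N) \<and>
  (\<forall>i<k. \<forall>\<phi>. test_function \<Omega> \<phi> -->
   (\<integral>x. g (Suc i) x * \<phi> x \<partial>\<mu>) = (\<integral>x. g i x * transpose_field T \<phi> x \<partial>\<mu>))"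

definition moment :: "nat => (complex^'n => complex) => (complex^'n => complex) => (complex^'n => complex) => complex" where
 "moment j g b H = integral {0..\<delta>} (\<lambda>s. of_real (s ^ j) * pairing g b H s)"

text \<open>The constant is uniform in \<open>g\<close> and \<open>H\<close>. The order \<open>\<beta>\<close> is the
number of derivatives that have already fallen on \<open>H\<close>; for such \<open>H\<close> only
\<open>r\<^sup>\<beta> H\<close> is known to be square integrable.\<close>

definition moment_bounded :: "nat => nat => nat => nat => (complex^'n => complex) => bool" where
 "moment_bounded k \<beta> i j b \<longleftrightarrow> (\<exists>C\<ge>0. \<forall>g N H. weak_system k g N --> holo H --> wmass \<beta> H < \<infinity> -->
   cmod (moment j (g i) b H) \<le> C * N * wn (k + \<beta>) H)"

lemma weak_systemD:
 assumes "weak_system k g N" "i \<le> k" shows "g i \<in> L2 \<Omega>" "L2_norm \<Omega> (g i) \<le> N" "0 \<le> N"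
proof -
 show "g i \<in> L2 \<Omega>" and N: "L2_norm \<Omega> (g i) \<le> N" using assms by (auto simp: weak_system_def)
 show "0 \<le> N" by (rule order_trans[OF L2_norm_nonneg N])
qed

lemma wmass_finite_mono: "holo H ==> wmass q H < \<infinity> ==> q \<le> p ==> wmass p H < \<infinity>"
 using wmass_add_finite[of H q "p - q"] by simp

lemma moment_continuous:
 assumes "g \<in> L2 \<Omega>" "coef b" "holo H" "wmass q H < \<infinity>" "q \<le> j"
 shows "continuous_on {0..\<delta>} (\<lambda>s. of_real (s ^ j) * pairing g b H s)"
 by (rule continuous_on_subset[OF pairing_continuous[OF assms(1-3) wmass_finite_mono[OF assms(3-5)]]]) (use pos in auto)

lemma moment_has_integral:
 assumes "g \<in> L2 \<Omega>" "coef b" "holo H" "wmass q H < \<infinity>" "q \<le> j"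
 shows "((\<lambda>s. of_real (s ^ j) * pairing g b H s) has_integral moment j g b H) {0..\<delta>}"
 unfolding moment_def by (rule integrable_integral[OF integrable_continuous_real[OF moment_continuous[OF assms]]])

lemma coef_gamma: "coef b ==> coef (\<lambda>z. b z * \<gamma> z)"
 by (rule coef_mult[OF _ smooth_gamma])

lemma coef_tau: "coef b ==> coef (\<lambda>z. b z * \<gamma> z * \<tau> l z)"
 by (rule coef_mult[OF coef_gamma smooth_tau])

text \<open>The fundamental theorem of calculus for \<open>s\<^sup>n\<close> times the pairing. The function on the left
need not be continuous at \<open>0\<close>; its integrability is part of the conclusion.\<close>

lemma moment_by_parts:
 assumes g: "g \<in> L2 \<Omega>" "g' \<in> L2 \<Omega>"
  and weak: "\<And>\<phi>. test_function \<Omega> \<phi> ==> (\<integral>x. g' x * \<phi> x \<partial>\<mu>) = (\<integral>x. g x * transpose_field T \<phi> x \<partial>\<mu>)"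
  and b: "coef b" and H: "holo H" and fin: "wmass q H < \<infinity>" "q \<le> n"
 shows "((\<lambda>s. of_real (real n * s ^ (n - 1)) * pairing g b H s) has_integral
  (of_real (\<delta> ^ n) * pairing g b H \<delta> - of_real (0 ^ n) * pairing g b H 0
   + (moment n g' (\<lambda>z. b z * \<gamma> z) H + moment n g (div_coef (\<lambda>z. b z * \<gamma> z)) H
    + (\<Sum>l\<in>UNIV. moment (Suc n) g (\<lambda>z. b z * \<gamma> z * \<tau> l z) (pd l H))))) {0..\<delta>}"
proof -
 let ?p = "\<lambda>s. pairing g b H s"
 let ?p1 = "\<lambda>s. pairing g' (\<lambda>z. b z * \<gamma> z) H s" and ?p2 = "\<lambda>s. pairing g (div_coef (\<lambda>z. b z * \<gamma> z)) H s"
 let ?p3 = "\<lambda>l s. pairing g (\<lambda>z. b z * \<gamma> z * \<tau> l z) (pd l H) s"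
 let ?Q = "\<lambda>s. of_real (s ^ n) * ?p1 s + of_real (s ^ n) * ?p2 s + (\<Sum>l\<in>UNIV. of_real (s ^ Suc n) * ?p3 l s)"
 let ?f = "\<lambda>s. complex_of_real (s ^ n) * - (?p1 s + ?p2 s + of_real s * (\<Sum>l\<in>UNIV. ?p3 l s)) + of_real (real n * s ^ (n - 1)) * ?p s"
 have "(?f has_integral (of_real (\<delta> ^ n) * ?p \<delta> - of_real (0 ^ n) * ?p 0)) {0..\<delta>}"
 proof (rule fundamental_theorem_of_calculus_interior)
  show "0 \<le> \<delta>" using pos by simp
  show "continuous_on {0..\<delta>} (\<lambda>s. of_real (s ^ n) * ?p s)" by (rule moment_continuous[OF g(1) b H fin])
  fix s assume s: "s \<in> {0<..<\<delta>}"
  have 1: "((\<lambda>s. complex_of_real (s ^ n)) has_vector_derivative of_real (real n * s ^ (n - 1))) (at s)"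
   by (rule has_vector_derivative_of_real) (auto intro!: derivative_eq_intros)
  show "((\<lambda>s. of_real (s ^ n) * ?p s) has_vector_derivative ?f s) (at s)"
   by (rule has_vector_derivative_mult[OF 1 pairing_by_parts[OF g weak b H]]) (use s in auto)
 qed
 moreover have "(?Q has_integral (moment n g' (\<lambda>z. b z * \<gamma> z) H + moment n g (div_coef (\<lambda>z. b z * \<gamma> z)) H
    + (\<Sum>l\<in>UNIV. moment (Suc n) g (\<lambda>z. b z * \<gamma> z * \<tau> l z) (pd l H)))) {0..\<delta>}"
 proof (rule has_integral_add[OF has_integral_add])
  show "((\<lambda>s. of_real (s ^ n) * ?p1 s) has_integral moment n g' (\<lambda>z. b z * \<gamma> z) H) {0..\<delta>}"
   by (rule moment_has_integral[OF g(2) coef_gamma[OF b] H fin])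
  show "((\<lambda>s. of_real (s ^ n) * ?p2 s) has_integral moment n g (div_coef (\<lambda>z. b z * \<gamma> z)) H) {0..\<delta>}"
   by (rule moment_has_integral[OF g(1) coef_div[OF coef_gamma[OF b]] H fin])
  show "((\<lambda>s. \<Sum>l\<in>UNIV. of_real (s ^ Suc n) * ?p3 l s) has_integral (\<Sum>l\<in>UNIV. moment (Suc n) g (\<lambda>z. b z * \<gamma> z * \<tau> l z) (pd l H))) {0..\<delta>}"
  proof (rule has_integral_sum[OF finite_class.finite_UNIV])
   fix l
   have "wmass (Suc q) (pd l H) < \<infinity>" using wn_pd[of q l] H fin by blast
   then show "((\<lambda>s. of_real (s ^ Suc n) * ?p3 l s) has_integral moment (Suc n) g (\<lambda>z. b z * \<gamma> z * \<tau> l z) (pd l H)) {0..\<delta>}"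
    by (rule moment_has_integral[OF g(1) coef_tau[OF b] holo_pd[OF H]]) (use fin in simp)
  qed
 qed
 ultimately have "((\<lambda>s. ?f s + ?Q s) has_integral (of_real (\<delta> ^ n) * ?p \<delta> - of_real (0 ^ n) * ?p 0
   + (moment n g' (\<lambda>z. b z * \<gamma> z) H + moment n g (div_coef (\<lambda>z. b z * \<gamma> z)) H
    + (\<Sum>l\<in>UNIV. moment (Suc n) g (\<lambda>z. b z * \<gamma> z * \<tau> l z) (pd l H))))) {0..\<delta>}"
  by (rule has_integral_add)
 moreover have "?f s + ?Q s = of_real (real n * s ^ (n - 1)) * ?p s" for s
 proof -
  have "x * - (a + c + y * d) + e + (x * a + x * c + (y * x) * d) = e" for x a c y d e :: complex by (simp add: algebra_simps)
  then show ?thesis unfolding power_Suc of_real_mult sum_distrib_left[where r="of_real s * of_real (s ^ n)", symmetric] .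
 qed
 ultimately show ?thesis by (simp only:)
qed

text \<open>The common step of the induction and of its last stage: for \<open>n > 0\<close> the second summand vanishes,
for \<open>n = 0\<close> the first one does and the value of the pairing at \<open>s = 0\<close> remains.\<close>

lemma parts_bound:
 assumes b: "coef b" and i: "i < k" and n: "\<beta> \<le> n"
  and m1: "moment_bounded k \<beta> (Suc i) n (\<lambda>z. b z * \<gamma> z)"
  and m2: "moment_bounded k \<beta> i n (div_coef (\<lambda>z. b z * \<gamma> z))"
  and m3: "\<And>l. moment_bounded k (Suc \<beta>) i (Suc n) (\<lambda>z. b z * \<gamma> z * \<tau> l z)"
 shows "\<exists>C\<ge>0. \<forall>g N H. weak_system k g N --> holo H --> wmass \<beta> H < \<infinity> -->
   cmod (integral {0..\<delta>} (\<lambda>s. of_real (real n * s ^ (n - 1)) * pairing (g i) b H s) + of_real (0 ^ n) * pairing (g i) b H 0)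
   \<le> C * N * wn (k + \<beta>) H"
proof -
 obtain C1 where C1: "C1 \<ge> 0" "\<And>g N H. weak_system k g N ==> holo H ==> wmass \<beta> H < \<infinity> ==>
   cmod (moment n (g (Suc i)) (\<lambda>z. b z * \<gamma> z) H) \<le> C1 * N * wn (k + \<beta>) H"
  using m1 unfolding moment_bounded_def by blast
 obtain C2 where C2: "C2 \<ge> 0" "\<And>g N H. weak_system k g N ==> holo H ==> wmass \<beta> H < \<infinity> ==>
   cmod (moment n (g i) (div_coef (\<lambda>z. b z * \<gamma> z)) H) \<le> C2 * N * wn (k + \<beta>) H"
  using m2 unfolding moment_bounded_def by blast
 from choice[OF allI[OF m3[unfolded moment_bounded_def]]]
 obtain C3 where C3': "\<forall>l. C3 l \<ge> 0 \<and> (\<forall>g N H. weak_system k g N --> holo H --> wmass (Suc \<beta>) H < \<infinity> -->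
   cmod (moment (Suc n) (g i) (\<lambda>z. b z * \<gamma> z * \<tau> l z) H) \<le> C3 l * N * wn (k + Suc \<beta>) H)" by (rule exE)
 have C3: "C3 l \<ge> 0" "weak_system k g N ==> holo H ==> wmass (Suc \<beta>) H < \<infinity> ==>
   cmod (moment (Suc n) (g i) (\<lambda>z. b z * \<gamma> z * \<tau> l z) H) \<le> C3 l * N * wn (k + Suc \<beta>) H" for l g N H
  by (rule conjunct1[OF spec[OF C3']], rule conjunct2[OF spec[OF C3'], rule_format])
 from choice[OF allI[OF wn_pd[of "k + \<beta>"]]]
 obtain D where D': "\<forall>l. D l \<ge> 0 \<and> (\<forall>H. holo H --> wmass (k + \<beta>) H < \<infinity> -->
   wmass (Suc (k + \<beta>)) (pd l H) < \<infinity> \<and> wn (Suc (k + \<beta>)) (pd l H) \<le> D l * wn (k + \<beta>) H)" by (rule exE)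
 have D: "D l \<ge> 0" "holo H ==> wmass (k + \<beta>) H < \<infinity> ==> wn (Suc (k + \<beta>)) (pd l H) \<le> D l * wn (k + \<beta>) H" for l H
  by (rule conjunct1[OF spec[OF D']], rule conjunct2[OF conjunct2[OF spec[OF D'], rule_format]])
 obtain Cb where Cb: "Cb \<ge> 0" "\<And>g H s. g \<in> L2 \<Omega> ==> holo H ==> wmass (k + \<beta>) H < \<infinity> ==> 0 \<le> s ==> s \<le> 2 * \<delta> ==>
  cmod (of_real (s ^ (k + \<beta>)) * pairing g b H s) \<le> L2_norm \<Omega> g * (Cb * wn (k + \<beta>) H)"
  using pairing_bound[OF b, of "k + \<beta>"] by blast
 have dl: "0 < \<delta>" by (rule pos)
 define E where "E = \<delta> ^ n / \<delta> ^ (k + \<beta>)"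
 have E: "0 \<le> E" "E * \<delta> ^ (k + \<beta>) = \<delta> ^ n" using dl by (simp_all add: E_def)
 show ?thesis
 proof (intro exI conjI allI impI)
  show "0 \<le> E * Cb + (C1 + C2 + (\<Sum>l\<in>UNIV. C3 l * D l))"
   by (intro add_nonneg_nonneg mult_nonneg_nonneg sum_nonneg E C1(1) C2(1) C3(1) D(1) Cb(1))
  fix g N H assume ws: "weak_system k g N" and H: "holo H" and fin: "wmass \<beta> H < \<infinity>"
  let ?W = "wn (k + \<beta>) H"
  have fk: "wmass (k + \<beta>) H < \<infinity>" by (rule wmass_finite_mono[OF H fin]) simp
  have gi: "g i \<in> L2 \<Omega>" "L2_norm \<Omega> (g i) \<le> N" "0 \<le> N" and gi': "g (Suc i) \<in> L2 \<Omega>"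
   using weak_systemD(1,2)[OF ws] weak_systemD(3)[OF ws, of 0] i by simp_all
  have weak: "(\<integral>x. g (Suc i) x * \<phi> x \<partial>\<mu>) = (\<integral>x. g i x * transpose_field T \<phi> x \<partial>\<mu>)"
   if "test_function \<Omega> \<phi>" for \<phi> using ws i that by (simp add: weak_system_def)
  have eq: "integral {0..\<delta>} (\<lambda>s. of_real (real n * s ^ (n - 1)) * pairing (g i) b H s) + of_real (0 ^ n) * pairing (g i) b H 0
   = of_real (\<delta> ^ n) * pairing (g i) b H \<delta> + (moment n (g (Suc i)) (\<lambda>z. b z * \<gamma> z) H + moment n (g i) (div_coef (\<lambda>z. b z * \<gamma> z)) H
    + (\<Sum>l\<in>UNIV. moment (Suc n) (g i) (\<lambda>z. b z * \<gamma> z * \<tau> l z) (pd l H)))"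
  proof -
   have cancel: "x = u - v + t ==> x + v = u + t" for x u v t :: complex by simp
   show ?thesis by (rule cancel, rule integral_unique, rule moment_by_parts[OF gi(1) gi' weak b H fin n])
  qed
  show "cmod (integral {0..\<delta>} (\<lambda>s. of_real (real n * s ^ (n - 1)) * pairing (g i) b H s) + of_real (0 ^ n) * pairing (g i) b H 0)
   \<le> (E * Cb + (C1 + C2 + (\<Sum>l\<in>UNIV. C3 l * D l))) * N * ?W"
   unfolding eq distrib_right
  proof (intro norm_triangle_mono)
   have "cmod (of_real (\<delta> ^ n) * pairing (g i) b H \<delta>) = E * cmod (of_real (\<delta> ^ (k + \<beta>)) * pairing (g i) b H \<delta>)"
    unfolding norm_mult norm_of_real E(2)[symmetric] using E(1) by (simp add: abs_mult)
   also have "\<dots> \<le> E * (L2_norm \<Omega> (g i) * (Cb * ?W))"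
    using dl by (intro mult_left_mono Cb(2) gi H fk E) auto
   also have "\<dots> \<le> E * (N * (Cb * ?W))"
    by (intro mult_left_mono mult_right_mono gi E mult_nonneg_nonneg Cb wn_nonneg)
   finally show "cmod (of_real (\<delta> ^ n) * pairing (g i) b H \<delta>) \<le> E * Cb * N * ?W" by (simp only: mult_ac)
   show "cmod (moment n (g (Suc i)) (\<lambda>z. b z * \<gamma> z) H) \<le> C1 * N * ?W" by (rule C1(2)[OF ws H fin])
   show "cmod (moment n (g i) (div_coef (\<lambda>z. b z * \<gamma> z)) H) \<le> C2 * N * ?W" by (rule C2(2)[OF ws H fin])
   show "cmod (\<Sum>l\<in>UNIV. moment (Suc n) (g i) (\<lambda>z. b z * \<gamma> z * \<tau> l z) (pd l H)) \<le> (\<Sum>l\<in>UNIV. C3 l * D l) * N * ?W"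
    unfolding sum_distrib_right
   proof (rule sum_norm_le)
    fix l
    have "wmass (Suc \<beta>) (pd l H) < \<infinity>" using wn_pd[of \<beta> l] H fin by blast
    from C3(2)[OF ws holo_pd[OF H] this]
    have "cmod (moment (Suc n) (g i) (\<lambda>z. b z * \<gamma> z * \<tau> l z) (pd l H)) \<le> C3 l * N * wn (Suc (k + \<beta>)) (pd l H)" by simp
    also have "\<dots> \<le> C3 l * N * (D l * ?W)" by (intro mult_left_mono D(2) H fk mult_nonneg_nonneg C3(1) gi)
    finally show "cmod (moment (Suc n) (g i) (\<lambda>z. b z * \<gamma> z * \<tau> l z) (pd l H)) \<le> C3 l * D l * N * ?W" by (simp only: mult_ac)
   qed
  qed
 qed
qed

text \<open>The base case, in which the power of \<open>s\<close> is just large enough for the Hardy inequality.\<close>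

lemma moment_hardy:
 assumes b: "coef b" and i: "i \<le> k" and j: "Suc j = k + \<beta>" and k: "1 \<le> k"
 shows "moment_bounded k \<beta> i j b"
proof -
 obtain C where C: "C \<ge> 0" "\<And>H G. holo H ==> G \<in> borel_measurable \<mu> ==>
   (\<integral>\<^sup>+s. (\<integral>\<^sup>+z. ennreal (s ^ j * (cmod (G z) * cmod (H (flw s z)))) * indicator near z \<partial>\<mu>) * indicator {0..\<delta>} s \<partial>lborel)^2
   \<le> ennreal C * ((\<integral>\<^sup>+z. ennreal ((cmod (G z))^2) \<partial>\<mu>) * wmass (k + \<beta>) H)"
  using hardy_inequality[OF j[symmetric]] by blast
 obtain Mb where Mb: "Mb \<ge> 0" "\<And>z. z \<in> \<Omega> ==> cmod (b z) \<le> Mb" using coef_bounded[OF b] by blast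
 show ?thesis unfolding moment_bounded_def
 proof (intro exI conjI allI impI)
  show "0 \<le> sqrt C * Mb" using C Mb by simp
  fix g N H assume ws: "weak_system k g N" and H: "holo H" and fin: "wmass \<beta> H < \<infinity>"
  have gi: "g i \<in> L2 \<Omega>" "L2_norm \<Omega> (g i) \<le> N" "0 \<le> N" using weak_systemD[OF ws i] by simp_all
  have fk: "wmass (k + \<beta>) H < \<infinity>" by (rule wmass_finite_mono[OF H fin]) simp
  \<comment> \<open>Absorbing the bound of the coefficient into \<open>g\<close> avoids pulling it out of an iterated integral.\<close>
  define G where "G z = of_real Mb * g i z" for z
  have GL: "G \<in> L2 \<Omega>" unfolding G_def[abs_def] by (rule L2_scale[OF gi(1)])
  have "L2_norm \<Omega> G \<le> Mb * L2_norm \<Omega> (g i)"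
   by (rule L2_norm_mono(2)[OF gi(1) L2_measurable[OF GL] _ Mb(1)]) (use Mb(1) in \<open>simp add: G_def norm_mult\<close>)
  also have "\<dots> \<le> Mb * N" by (intro mult_left_mono gi Mb)
  finally have Gn: "L2_norm \<Omega> G \<le> Mb * N" .
  let ?f = "\<lambda>s. of_real (s ^ j) * pairing (g i) b H s"
  have si: "set_integrable lborel {0..\<delta>} ?f"
   by (rule borel_integrable_atLeastAtMost'[OF moment_continuous[OF gi(1) b H fin]]) (use j k in simp)
  have "moment j (g i) b H = (\<integral>s. indicator {0..\<delta>} s *\<^sub>R ?f s \<partial>lborel)"
   unfolding moment_def set_borel_integral_eq_integral(2)[OF si, symmetric] set_lebesgue_integral_def ..
  then have "ennreal (cmod (moment j (g i) b H)) \<le> (\<integral>\<^sup>+s. ennreal (cmod (indicator {0..\<delta>} s *\<^sub>R ?f s)) \<partial>lborel)"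
   by (simp only: norm_integral_le_nn_integral)
  also have "\<dots> \<le> (\<integral>\<^sup>+s. (\<integral>\<^sup>+z. ennreal (s ^ j * (cmod (G z) * cmod (H (flw s z)))) * indicator near z \<partial>\<mu>) * indicator {0..\<delta>} s \<partial>lborel)"
  proof (rule nn_integral_mono)
   fix s
   show "ennreal (cmod (indicator {0..\<delta>} s *\<^sub>R ?f s)) \<le> (\<integral>\<^sup>+z. ennreal (s ^ j * (cmod (G z) * cmod (H (flw s z)))) * indicator near z \<partial>\<mu>) * indicator {0..\<delta>} s"
   proof (cases "s \<in> {0..\<delta>}")
    case True
    have "ennreal (cmod (?f s)) \<le> (\<integral>\<^sup>+z. ennreal (cmod (g i z * (of_real (s ^ j) * (b z * cnj (H (flw s z)))))) \<partial>\<mu>)"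
     unfolding pairing_scale by (rule norm_integral_le_nn_integral)
    also have "\<dots> \<le> (\<integral>\<^sup>+z. ennreal (s ^ j * (cmod (G z) * cmod (H (flw s z)))) * indicator near z \<partial>\<mu>)"
    proof (rule nn_integral_domain_mono)
     fix z assume z: "z \<in> \<Omega>"
     show "ennreal (cmod (g i z * (of_real (s ^ j) * (b z * cnj (H (flw s z)))))) \<le> ennreal (s ^ j * (cmod (G z) * cmod (H (flw s z)))) * indicator near z"
     proof (cases "z \<in> near")
      case near: True
      have "cmod (g i z * (of_real (s ^ j) * (b z * cnj (H (flw s z))))) = s ^ j * ((cmod (b z) * cmod (g i z)) * cmod (H (flw s z)))"
       using True by (simp add: norm_mult norm_power mult_ac)
      also have "\<dots> \<le> s ^ j * ((Mb * cmod (g i z)) * cmod (H (flw s z)))"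
       using True by (intro mult_left_mono mult_right_mono Mb(2) z) auto
      also have "\<dots> = s ^ j * (cmod (G z) * cmod (H (flw s z)))" using Mb(1) by (simp add: G_def norm_mult)
      finally show ?thesis using near by (simp add: ennreal_leI)
     next
      case False
      then show ?thesis using coef_zero[OF b z] by simp
     qed
    qed
    finally show ?thesis using True by simp
   qed simp
  qed
  also have "\<dots> \<le> ennreal (sqrt C * Mb * N * wn (k + \<beta>) H)"
  proof (rule ennreal_square_le)
   have "ennreal C * ((\<integral>\<^sup>+z. ennreal ((cmod (G z))^2) \<partial>\<mu>) * wmass (k + \<beta>) H)
     = ennreal (C * ((L2_norm \<Omega> G)^2 * (wn (k + \<beta>) H)^2))"
    unfolding L2_nn_integral[OF GL] wmass_eq[OF fk] using C(1) by (simp add: ennreal_mult)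
   also have "\<dots> \<le> ennreal (C * ((Mb * N)^2 * (wn (k + \<beta>) H)^2))"
    by (intro ennreal_leI mult_left_mono mult_right_mono power_mono Gn C(1)) auto
   also have "C * ((Mb * N)^2 * (wn (k + \<beta>) H)^2) = (sqrt C * Mb * N * wn (k + \<beta>) H)^2"
    using C(1) by (simp add: power_mult_distrib)
   finally show "(\<integral>\<^sup>+s. (\<integral>\<^sup>+z. ennreal (s ^ j * (cmod (G z) * cmod (H (flw s z)))) * indicator near z \<partial>\<mu>) * indicator {0..\<delta>} s \<partial>lborel)^2
    \<le> ennreal ((sqrt C * Mb * N * wn (k + \<beta>) H)^2)"
    using order_trans[OF C(2)[OF H L2_measurable[OF GL]]] by blast
   show "0 \<le> sqrt C * Mb * N * wn (k + \<beta>) H" using C Mb gi wn_nonneg[of "k + \<beta>" H] by simp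
  qed
  finally show "cmod (moment j (g i) b H) \<le> sqrt C * Mb * N * wn (k + \<beta>) H"
   using C Mb gi wn_nonneg[of "k + \<beta>" H] by (simp add: ennreal_le_iff)
 qed
qed

text \<open>Here \<open>m\<close> counts the integrations by parts that are still available. Each step raises the power of
\<open>s\<close> relative to the order of \<open>H\<close> by one, and applies \<open>T\<close> at most once
more to \<open>g\<close>.\<close>

lemma moment_estimate:
 assumes k: "1 \<le> k"
 shows "coef b ==> m < k ==> i + m \<le> k ==> Suc j + m = k + \<beta> ==> moment_bounded k \<beta> i j b"
proof (induction m arbitrary: b i j \<beta>)
 case 0
 then show ?case using moment_hardy[OF 0(1) _ _ k] by simp
next
 case (Suc m)
 note IH = Suc.IH
 have b: "coef b" by (rule Suc.prems)
 have "\<exists>C\<ge>0. \<forall>g N H. weak_system k g N --> holo H --> wmass \<beta> H < \<infinity> -->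
   cmod (integral {0..\<delta>} (\<lambda>s. of_real (real (Suc j) * s ^ (Suc j - 1)) * pairing (g i) b H s) + of_real (0 ^ Suc j) * pairing (g i) b H 0)
   \<le> C * N * wn (k + \<beta>) H"
 proof (rule parts_bound[OF b])
  show "i < k" "\<beta> \<le> Suc j" using Suc.prems by simp_all
  show "moment_bounded k \<beta> (Suc i) (Suc j) (\<lambda>z. b z * \<gamma> z)" by (rule IH[OF coef_gamma[OF b]]) (use Suc.prems in simp_all)
  show "moment_bounded k \<beta> i (Suc j) (div_coef (\<lambda>z. b z * \<gamma> z))" by (rule IH[OF coef_div[OF coef_gamma[OF b]]]) (use Suc.prems in simp_all)
  show "moment_bounded k (Suc \<beta>) i (Suc (Suc j)) (\<lambda>z. b z * \<gamma> z * \<tau> l z)" for l by (rule IH[OF coef_tau[OF b]]) (use Suc.prems in simp_all)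
 qed
 then obtain C where C: "C \<ge> 0" "\<And>g N H. weak_system k g N ==> holo H ==> wmass \<beta> H < \<infinity> ==>
   cmod (integral {0..\<delta>} (\<lambda>s. of_real (real (Suc j) * s ^ (Suc j - 1)) * pairing (g i) b H s) + of_real (0 ^ Suc j) * pairing (g i) b H 0)
   \<le> C * N * wn (k + \<beta>) H" by blast
 have eq: "integral {0..\<delta>} (\<lambda>s. of_real (real (Suc j) * s ^ (Suc j - 1)) * pairing g b H s) + of_real (0 ^ Suc j) * pairing g b H 0
  = of_real (real (Suc j)) * moment j g b H" for g H
  unfolding moment_def integral_mult_right[symmetric] by (simp only: diff_Suc_1 of_real_mult mult.assoc power_Suc of_real_0 mult_zero_left add_0_right)
 show ?case unfolding moment_bounded_def
 proof (intro exI conjI allI impI)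
  show "0 \<le> C" by (rule C)
  fix g N H assume a: "weak_system k g N" "holo H" "wmass \<beta> H < \<infinity>"
  have "cmod (moment j (g i) b H) \<le> real (Suc j) * cmod (moment j (g i) b H)"
   using mult_right_mono[of 1 "real (Suc j)" "cmod (moment j (g i) b H)"] by simp
  also have "\<dots> = cmod (of_real (real (Suc j)) * moment j (g i) b H)" by (simp only: norm_mult norm_of_real abs_of_nat)
  also have "\<dots> \<le> C * N * wn (k + \<beta>) H" using C(2)[OF a] unfolding eq .
  finally show "cmod (moment j (g i) b H) \<le> C * N * wn (k + \<beta>) H" .
 qed
qed

lemma boundary_pairing_estimate:
 assumes k: "1 \<le> k" and b: "coef b"
 shows "\<exists>C\<ge>0. \<forall>g N H. weak_system k g N --> holo H --> wmass 0 H < \<infinity> -->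
   cmod (pairing (g 0) b H 0) \<le> C * N * wn k H"
proof -
 have "\<exists>C\<ge>0. \<forall>g N H. weak_system k g N --> holo H --> wmass 0 H < \<infinity> -->
   cmod (integral {0..\<delta>} (\<lambda>s. of_real (real 0 * s ^ (0 - 1)) * pairing (g 0) b H s) + of_real (0 ^ 0) * pairing (g 0) b H 0)
   \<le> C * N * wn (k + 0) H"
 proof (rule parts_bound[OF b])
  show "0 < k" "0 \<le> (0::nat)" using k by simp_all
  note est = moment_estimate[OF k, where m="k - 1"]
  show "moment_bounded k 0 (Suc 0) 0 (\<lambda>z. b z * \<gamma> z)" by (rule est[OF coef_gamma[OF b]]) (use k in simp_all)
  show "moment_bounded k 0 0 0 (div_coef (\<lambda>z. b z * \<gamma> z))" by (rule est[OF coef_div[OF coef_gamma[OF b]]]) (use k in simp_all)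
  show "moment_bounded k (Suc 0) 0 (Suc 0) (\<lambda>z. b z * \<gamma> z * \<tau> l z)" for l by (rule est[OF coef_tau[OF b]]) (use k in simp_all)
 qed
 then show ?thesis by simp
qed

text \<open>Equal to \<open>1\<close> up to order \<open>k\<close> at the boundary, so that the part of \<open>(g,
H)\<close> away from the collar is bounded by \<open>\<parallel>g\<parallel> \<parallel>r\<^sup>k
H\<parallel>\<close> directly.\<close>

lemma collar_cutoff:
 "\<exists>\<zeta> M. coef \<zeta> \<and> 0 \<le> M \<and> (\<forall>z\<in>\<Omega>. cmod (1 - \<zeta> z) \<le> M * r z ^ k)"
proof (intro exI conjI ballI)
 have f: "0 < flat \<eta>" using pos by (simp add: flat_pos)
 let ?x = "\<lambda>z. 1 - flat (\<eta> - r z) / flat \<eta>"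
 let ?z = "\<lambda>z. 1 - complex_of_real (?x z ^ k)"
 have "smooth_on UNIV (\<lambda>z. \<eta> - r z)" by (intro smooth_on_diff smooth_on_const smooth_on_minus smooth_on_rho open_UNIV)
 then have 1: "smooth_on UNIV (\<lambda>z. flat (\<eta> - r z))"
  by (rule smooth_on_compose[OF open_UNIV subset_UNIV smooth_flat[unfolded smooth_iff]])
 have "smooth_on UNIV (\<lambda>z. 1 - flat (\<eta> - r z) * inverse (flat \<eta>))"
  by (intro smooth_on_diff smooth_on_mult smooth_on_const 1 open_UNIV)
 from smooth_on_diff[OF open_UNIV smooth_on_const smooth_on_of_real[OF open_UNIV smooth_on_power[OF open_UNIV this]]]
 have "smooth ?z" by (simp only: smooth_iff divide_inverse)
 then show "coef ?z" unfolding coef_def by (simp add: flat_zero)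
 show "0 \<le> (2 / flat \<eta>) ^ k" using f by simp
 fix z assume z: "z \<in> \<Omega>"
 have x0: "0 \<le> ?x z" using flat_mono[of "\<eta> - r z" \<eta>] r_pos[OF z] f by simp
 have "?x z = (flat \<eta> - flat (\<eta> - r z)) / flat \<eta>" using f by (simp add: diff_divide_distrib)
 also have "\<dots> \<le> (2 * r z) / flat \<eta>"
  using flat_lipschitz[of "\<eta> - r z" \<eta>] r_pos[OF z] f by (intro divide_right_mono) auto
 finally have x2: "?x z \<le> (2 / flat \<eta>) * r z" by simp
 have "cmod (1 - ?z z) = ?x z ^ k" using zero_le_power[OF x0, of k] by (simp only: diff_diff_eq2 add_diff_cancel_left' norm_of_real abs_of_nonneg)
 also have "\<dots> \<le> ((2 / flat \<eta>) * r z) ^ k" by (rule power_mono[OF x2 x0])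
 also have "\<dots> = (2 / flat \<eta>) ^ k * r z ^ k" by (rule power_mult_distrib)
 finally show "cmod (1 - ?z z) \<le> (2 / flat \<eta>) ^ k * r z ^ k" .
qed

lemma wmass_lebesgue_on: "wmass q H = (\<integral>\<^sup>+z. ennreal ((r z ^ q * cmod (H z))^2) \<partial>\<mu>)"
 unfolding wmass_def wt_def using open_domain by (simp add: nn_integral_lebesgue_on_lborel)

lemma bergman_wmass: "H \<in> bergman_space \<Omega> ==> wmass 0 H < \<infinity>"
 by (simp add: wmass_lebesgue_on L2_nn_integral[OF bergman_spaceD(1)])

lemma L2_of_weighted_bound:
 assumes f: "f \<in> borel_measurable \<mu>" and H: "holo H" and fin: "wmass q H < \<infinity>"
  and M: "0 \<le> M" "\<And>z. z \<in> \<Omega> ==> cmod (f z) \<le> M * (r z ^ q * cmod (H z))"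
 shows "f \<in> L2 \<Omega>" "L2_norm \<Omega> f \<le> M * wn q H"
proof -
 have "(\<integral>\<^sup>+z. ennreal ((cmod (f z))^2) \<partial>\<mu>) \<le> (\<integral>\<^sup>+z. ennreal (M^2) * ennreal ((r z ^ q * cmod (H z))^2) \<partial>\<mu>)"
 proof (rule nn_integral_mono)
  fix x assume "x \<in> space \<mu>"
  then have "cmod (f x) \<le> M * (r x ^ q * cmod (H x))" by (intro M(2)) (simp add: space_restrict_space)
  then have "(cmod (f x))^2 \<le> (M * (r x ^ q * cmod (H x)))^2" by (intro power_mono) auto
  then show "ennreal ((cmod (f x))^2) \<le> ennreal (M^2) * ennreal ((r x ^ q * cmod (H x))^2)"
   by (subst ennreal_mult[symmetric]) (simp_all add: power_mult_distrib[of M] ennreal_leI)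
 qed
 also have "\<dots> = ennreal (M^2) * wmass q H"
  unfolding wmass_lebesgue_on
 proof (rule nn_integral_cmult)
  have "(\<lambda>z. r z ^ q * cmod (H z)) \<in> borel_measurable \<mu>"
   by (rule continuous_on_measurable_lebesgue_on[OF open_domain])
    (intro continuous_intros continuous_rho holo_continuous_on[OF H])
  then show "(\<lambda>z. ennreal ((r z ^ q * cmod (H z))^2)) \<in> borel_measurable \<mu>" by measurable
 qed
 also have "\<dots> = ennreal ((M * wn q H)^2)"
  unfolding wmass_eq[OF fin] by (simp add: ennreal_mult[symmetric] power_mult_distrib)
 finally show "f \<in> L2 \<Omega>" "L2_norm \<Omega> f \<le> M * wn q H"
  using L2_from_nn_integral[OF f] M(1) wn_nonneg[of q H] by simp_all
qed

text \<open>The cut-off splits the inner product into a part that sees \<open>r\<^sup>k H\<close> only, and the pairing at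
\<open>s = 0\<close>.\<close>

lemma key_estimate:
 assumes k: "1 \<le> k"
 shows "\<exists>C\<ge>0. \<forall>g N H. weak_system k g N --> H \<in> bergman_space \<Omega> --> cmod (L2_inner \<Omega> (g 0) H) \<le> C * N * wn k H"
proof -
 obtain \<zeta> M where z: "coef \<zeta>" "0 \<le> M" "\<And>z. z \<in> \<Omega> ==> cmod (1 - \<zeta> z) \<le> M * r z ^ k"
  using collar_cutoff[of k] by blast
 obtain C where C: "C \<ge> 0" "\<And>g N H. weak_system k g N ==> holo H ==> wmass 0 H < \<infinity> ==>
   cmod (pairing (g 0) \<zeta> H 0) \<le> C * N * wn k H"
  using boundary_pairing_estimate[OF k z(1)] by blast
 show ?thesis
 proof (intro exI conjI allI impI)
  show "0 \<le> M + C" using z C by simp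
  fix g N H assume ws: "weak_system k g N" and HB: "H \<in> bergman_space \<Omega>"
  note H = bergman_spaceD[OF HB] and f0 = bergman_wmass[OF HB]
  have fk: "wmass k H < \<infinity>" by (rule wmass_finite_mono[OF H(2) f0]) simp
  have g: "g 0 \<in> L2 \<Omega>" "L2_norm \<Omega> (g 0) \<le> N" "0 \<le> N" using weak_systemD[OF ws, of 0] by simp_all
  let ?R = "\<lambda>z. (1 - \<zeta> z) * cnj (H z)" and ?S = "\<lambda>z. \<zeta> z * cnj (H z)"
  have zm: "\<zeta> \<in> borel_measurable \<mu>" by (rule measurable_coef[OF z(1)])
  obtain Mz where Mz: "\<And>z. z \<in> \<Omega> ==> cmod (\<zeta> z) \<le> Mz" using coef_bounded[OF z(1)] by blast
  have SL: "?S \<in> L2 \<Omega>" by (rule L2_bounded_mult[OF L2_cnj[OF H(1)] zm Mz])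
  have Rm: "?R \<in> borel_measurable \<mu>" using zm L2_measurable[OF L2_cnj[OF H(1)]] by measurable
  have "cmod (?R x) \<le> M * (r x ^ k * cmod (H x))" if x: "x \<in> \<Omega>" for x
   unfolding norm_mult complex_mod_cnj mult.assoc[symmetric] by (intro mult_right_mono z(3) x) simp
  note RL = L2_of_weighted_bound[OF Rm H(2) fk z(2) this]
  have "L2_inner \<Omega> (g 0) H = (\<integral>z. g 0 z * ?R z + g 0 z * ?S z \<partial>\<mu>)"
   unfolding L2_inner_def by (simp add: algebra_simps)
  also have "\<dots> = (\<integral>z. g 0 z * ?R z \<partial>\<mu>) + pairing (g 0) \<zeta> H 0"
   unfolding pairing_def using L2_mult_integrable[OF g(1) RL(1)] L2_mult_integrable[OF g(1) SL] by simp
  finally have "cmod (L2_inner \<Omega> (g 0) H) \<le> cmod (\<integral>z. g 0 z * ?R z \<partial>\<mu>) + cmod (pairing (g 0) \<zeta> H 0)"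
   by (simp only: norm_triangle_ineq)
  also have "\<dots> \<le> N * (M * wn k H) + C * N * wn k H"
   by (intro add_mono C(2)[OF ws H(2) f0] order_trans[OF L2_Cauchy_Schwarz[OF g(1) RL(1)]] mult_mono g RL L2_norm_nonneg)
  also have "\<dots> = (M + C) * N * wn k H" by (simp add: algebra_simps)
  finally show "cmod (L2_inner \<Omega> (g 0) H) \<le> (M + C) * N * wn k H" .
 qed
qed

end

section \<open>Sobolev norms of weighted holomorphic functions\<close>

lemma partials_add:
 assumes S: "open S" and f: "smooth_on S f" and g: "smooth_on S g" and bs: "set bs \<subseteq> Basis" and x: "x \<in> S"
 shows "partials bs (\<lambda>x. f x + g x) x = partials bs f x + partials bs g x"
 using bs x
proof (induction bs arbitrary: x)
 case (Cons b bs)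
 then have bs: "set bs \<subseteq> Basis" by simp
 have "der (partials bs (\<lambda>x. f x + g x)) x = der (\<lambda>x. partials bs f x + partials bs g x) x"
  by (rule frechet_derivative_cong_open[OF S Cons.prems(2)]) (rule Cons.IH[OF bs])
 also have "\<dots> = (\<lambda>v. der (partials bs f) x v + der (partials bs g) x v)"
  by (rule frechet_derivative_at[symmetric], rule has_derivative_add;
    rule smooth_on_has_derivative[OF smooth_on_partials[OF _ bs] Cons.prems(2)]) (fact f g)+
 finally show ?case by simp
qed simp

lemma L2_norm_add_le:
 assumes "f \<in> L2 \<Omega>" "g \<in> L2 \<Omega>"
 shows "L2_norm \<Omega> (\<lambda>x. f x + g x) \<le> 2 * (L2_norm \<Omega> f + L2_norm \<Omega> g)"
proof (rule power2_le_imp_le)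
 have "(L2_norm \<Omega> (\<lambda>x. f x + g x))^2 \<le> (\<integral>x. 2 * (cmod (f x))^2 + 2 * (cmod (g x))^2 \<partial>lebesgue_on \<Omega>)"
  unfolding L2_norm_sq
 proof (rule integral_mono)
  show "integrable (lebesgue_on \<Omega>) (\<lambda>x. (cmod (f x + g x))^2)" by (rule L2_integrable_sq[OF L2_add[OF assms]])
  show "integrable (lebesgue_on \<Omega>) (\<lambda>x. 2 * (cmod (f x))^2 + 2 * (cmod (g x))^2)" using assms[THEN L2_integrable_sq] by simp
  fix x
  have "(cmod (f x + g x))^2 \<le> (cmod (f x) + cmod (g x))^2" by (rule power_mono[OF norm_triangle_ineq norm_ge_zero])
  also have "\<dots> \<le> 2 * (cmod (f x))^2 + 2 * (cmod (g x))^2"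
   using sum_squares_bound[of "cmod (f x)" "cmod (g x)"] by (simp add: power2_sum)
  finally show "(cmod (f x + g x))^2 \<le> 2 * (cmod (f x))^2 + 2 * (cmod (g x))^2" .
 qed
 also have "\<dots> = 2 * (L2_norm \<Omega> f)^2 + 2 * (L2_norm \<Omega> g)^2" using assms[THEN L2_integrable_sq] by (simp add: L2_norm_sq)
 also have "\<dots> \<le> (2 * (L2_norm \<Omega> f + L2_norm \<Omega> g))^2"
  using L2_norm_nonneg[of \<Omega> f] L2_norm_nonneg[of \<Omega> g] by (simp add: power_mult_distrib power2_sum)
 finally show "(L2_norm \<Omega> (\<lambda>x. f x + g x))^2 \<le> (2 * (L2_norm \<Omega> f + L2_norm \<Omega> g))^2" .
qed (use L2_norm_nonneg[of \<Omega> f] L2_norm_nonneg[of \<Omega> g] in simp)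

lemma L2_norm_cong: "(\<And>x. x \<in> \<Omega> ==> f x = g x) ==> L2_norm \<Omega> f = L2_norm \<Omega> g"
 unfolding L2_norm_def by (intro arg_cong[where f=sqrt] Bochner_Integration.integral_cong) (auto simp: space_restrict_space)

lemma L2_cong: "g \<in> L2 \<Omega> ==> (\<And>x. x \<in> \<Omega> ==> f x = g x) ==> f \<in> L2 \<Omega>"
 by (rule L2_norm_mono(1)[of g \<Omega> f 1]) (auto intro: measurable_cong[THEN iffD1, OF _ L2_measurable[of g \<Omega>]] simp: space_restrict_space)

context tfield begin

definition wprod :: "nat => (complex^'n => complex) => (complex^'n => complex) => complex^'n => complex" where
 "wprod p a H z = a z * of_real (- \<rho> z) ^ p * H z"

lemma smooth_wprod:
 assumes "smooth a" "holo H" shows "smooth_on \<Omega> (wprod p a H)"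
 unfolding wprod_def[abs_def]
 by (intro smooth_on_mult smooth_on_power smooth_on_of_real smooth_on_minus smooth_on_subset[OF smooth_on_rho] open_domain
   smooth_imp_smooth_on[OF assms(1)] holo_smooth_on[OF open_domain assms(2)] subset_UNIV)

lemma wprod_derivative:
 assumes a: "smooth a" and H: "holo H" and z: "z \<in> \<Omega>"
 shows "der (wprod p a H) z v = wprod p (\<lambda>z. der a z v) H z
  + (wprod (p - 1) (\<lambda>z. - of_nat p * (a z * of_real (der \<rho> z v))) H z + wprod p a (\<lambda>z. der H z v) z)"
proof -
 have da: "(a has_derivative der a z) (at z)"
  using a by (intro smooth_on_has_derivative[of UNIV]) (auto simp: smooth_iff)
 have dr: "((\<lambda>z. complex_of_real (- \<rho> z)) has_derivative (\<lambda>v. of_real (- der \<rho> z v))) (at z)"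
  by (intro bounded_linear.has_derivative[OF bounded_linear_of_real] has_derivative_minus smooth_on_has_derivative[OF smooth_on_rho UNIV_I])
 have "der (wprod p a H) z = (\<lambda>v. a z * of_real (- \<rho> z) ^ p * der H z v
   + (a z * (of_nat p * of_real (- der \<rho> z v) * of_real (- \<rho> z) ^ (p - 1)) + der a z v * of_real (- \<rho> z) ^ p) * H z)"
  unfolding wprod_def[abs_def]
  by (rule frechet_derivative_at[symmetric]) (intro has_derivative_mult da has_derivative_power dr holo_has_derivative(1)[OF H z])
 then show ?thesis by (simp add: wprod_def algebra_simps)
qed

text \<open>Each derivative falls either on the coefficient, or on the power of \<open>r\<close> and lowers it by one, or
on \<open>H\<close>, where it costs one power of \<open>r\<close> in the weight. In each case \<open>q +
length bs \<le> p\<close> is preserved.\<close>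

lemma wprod_partials:
 assumes "set bs \<subseteq> Basis"
 shows "smooth a ==> q + length bs \<le> p ==> \<exists>C\<ge>0. \<forall>H. holo H --> wmass q H < \<infinity> -->
  partials bs (wprod p a H) \<in> L2 \<Omega> \<and> L2_norm \<Omega> (partials bs (wprod p a H)) \<le> C * wn q H"
 using assms
proof (induction bs arbitrary: a p q rule: rev_induct)
 case Nil
 obtain Ma where Ma: "Ma \<ge> 0" "\<And>z. z \<in> \<Omega> ==> cmod (a z) \<le> Ma" using smooth_bounded[OF Nil(1)] by blast
 have "smooth (\<lambda>z. complex_of_real (\<rho> z))" unfolding smooth_iff by (rule smooth_on_of_real[OF open_UNIV smooth_on_rho])
 then obtain M where M: "M \<ge> 0" "\<And>z. z \<in> \<Omega> ==> cmod (of_real (\<rho> z)) \<le> M" using smooth_bounded by blast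
 show ?case
 proof (intro exI conjI allI impI)
  show MM: "0 \<le> Ma * M ^ (p - q)" using Ma M by simp
  fix H assume H: "holo H" and fin: "wmass q H < \<infinity>"
  have m: "wprod p a H \<in> borel_measurable \<mu>"
   by (rule continuous_on_measurable_lebesgue_on[OF open_domain smooth_on_continuous_on[OF smooth_wprod[OF Nil(1) H]]])
  have b: "cmod (wprod p a H z) \<le> Ma * M ^ (p - q) * (r z ^ q * cmod (H z))" if z: "z \<in> \<Omega>" for z
  proof -
   have rz: "0 \<le> r z" "r z \<le> M" using r_pos[OF z] M(2)[OF z] by simp_all
   have "p = (p - q) + q" using Nil(2) by simp
   then have "r z ^ p = r z ^ (p - q) * r z ^ q" by (metis power_add)
   then have "cmod (wprod p a H z) = (cmod (a z) * r z ^ (p - q)) * (r z ^ q * cmod (H z))"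
    unfolding wprod_def norm_mult norm_power norm_of_real using rz by (simp add: abs_of_nonneg del: abs_minus_cancel abs_minus)
   also have "\<dots> \<le> (Ma * M ^ (p - q)) * (r z ^ q * cmod (H z))"
    by (intro mult_right_mono mult_mono power_mono Ma rz zero_le_power mult_nonneg_nonneg norm_ge_zero z)
   finally show ?thesis .
  qed
  show "partials [] (wprod p a H) \<in> L2 \<Omega>" "L2_norm \<Omega> (partials [] (wprod p a H)) \<le> Ma * M ^ (p - q) * wn q H"
   using L2_of_weighted_bound[OF m H fin MM b] by simp_all
 qed
next
 case (snoc v bs)
 then have bs: "set bs \<subseteq> Basis" and len: "q + Suc (length bs) \<le> p" by simp_all
 let ?a1 = "\<lambda>z. der a z v"
 let ?a2 = "\<lambda>z. - of_nat p * (a z * complex_of_real (der \<rho> z v))"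
 have sa: "smooth_on UNIV a" using snoc.prems by (simp add: smooth_iff)
 have s1: "smooth ?a1" unfolding smooth_iff by (rule smooth_on_deriv[OF open_UNIV sa smooth_on_const])
 have s2: "smooth ?a2" unfolding smooth_iff
  by (intro smooth_on_mult smooth_on_const smooth_on_of_real open_UNIV sa smooth_on_deriv smooth_on_rho)
 obtain C1 where C1: "C1 \<ge> 0" "\<And>H. holo H ==> wmass q H < \<infinity> ==>
  partials bs (wprod p ?a1 H) \<in> L2 \<Omega> \<and> L2_norm \<Omega> (partials bs (wprod p ?a1 H)) \<le> C1 * wn q H"
  using snoc.IH[OF s1 _ bs, of q p] len by force
 obtain C2 where C2: "C2 \<ge> 0" "\<And>H. holo H ==> wmass q H < \<infinity> ==>
  partials bs (wprod (p - 1) ?a2 H) \<in> L2 \<Omega> \<and> L2_norm \<Omega> (partials bs (wprod (p - 1) ?a2 H)) \<le> C2 * wn q H"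
 proof -
  have "q + length bs \<le> p - 1" using len by simp
  from snoc.IH[OF s2 this bs] show ?thesis using that by blast
 qed
 obtain C3 where C3: "C3 \<ge> 0" "\<And>H. holo H ==> wmass (Suc q) H < \<infinity> ==>
  partials bs (wprod p a H) \<in> L2 \<Omega> \<and> L2_norm \<Omega> (partials bs (wprod p a H)) \<le> C3 * wn (Suc q) H"
  using snoc.IH[OF snoc.prems(1) _ bs, of "Suc q" p] len by force
 obtain D where D: "D \<ge> 0" "\<And>H. holo H ==> wmass (Suc q) (\<lambda>z. der H z v) \<le> ennreal D * wmass q H"
  using derivative_wmass[of q v] by blast
 show ?case
 proof (intro exI conjI allI impI)
  show "0 \<le> 2 * (C1 + 2 * (C2 + C3 * sqrt D))" using C1 C2 C3 D by simp
  fix H assume H: "holo H" and fin: "wmass q H < \<infinity>"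
  let ?H = "\<lambda>z. der H z v"
  have H': "holo ?H" by (rule holo_deriv[OF open_domain H])
  note wH = wn_le[OF D(2)[OF H] fin D(1)]
  let ?X1 = "wprod p ?a1 H" and ?X2 = "wprod (p - 1) ?a2 H" and ?X3 = "wprod p a ?H"
  have sm: "smooth_on \<Omega> ?X1" "smooth_on \<Omega> ?X2" "smooth_on \<Omega> ?X3"
   by (rule smooth_wprod[OF s1 H], rule smooth_wprod[OF s2 H], rule smooth_wprod[OF snoc.prems(1) H'])
  \<comment> \<open>Differentiating in direction \<open>v\<close> first keeps the three terms in the form required by the induction hypothesis.\<close>
  have eq: "partials (bs @ [v]) (wprod p a H) z = partials bs ?X1 z + (partials bs ?X2 z + partials bs ?X3 z)" if z: "z \<in> \<Omega>" for z
  proof -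
   have "partials (bs @ [v]) (wprod p a H) z = partials bs (\<lambda>z. der (wprod p a H) z v) z"
    by (simp add: partials_append)
   also have "\<dots> = partials bs (\<lambda>z. ?X1 z + (?X2 z + ?X3 z)) z"
    by (rule partials_cong[OF open_domain _ z]) (rule wprod_derivative[OF snoc.prems(1) H])
   also have "\<dots> = partials bs ?X1 z + (partials bs ?X2 z + partials bs ?X3 z)"
    using partials_add[OF open_domain sm(1) smooth_on_add[OF open_domain sm(2,3)] bs z] partials_add[OF open_domain sm(2,3) bs z] by simp
   finally show ?thesis .
  qed
  note L1 = C1(2)[OF H fin] and L2 = C2(2)[OF H fin] and L3 = C3(2)[OF H' wH(1)]
  have L23: "(\<lambda>z. partials bs ?X2 z + partials bs ?X3 z) \<in> L2 \<Omega>" using L2 L3 L2_add by blast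
  have L: "(\<lambda>z. partials bs ?X1 z + (partials bs ?X2 z + partials bs ?X3 z)) \<in> L2 \<Omega>" using L1 L23 L2_add by blast
  show "partials (bs @ [v]) (wprod p a H) \<in> L2 \<Omega>" by (rule L2_cong[OF L eq])
  have "L2_norm \<Omega> (partials (bs @ [v]) (wprod p a H)) = L2_norm \<Omega> (\<lambda>z. partials bs ?X1 z + (partials bs ?X2 z + partials bs ?X3 z))"
   by (rule L2_norm_cong[OF eq])
  also have "\<dots> \<le> 2 * (L2_norm \<Omega> (partials bs ?X1) + 2 * (L2_norm \<Omega> (partials bs ?X2) + L2_norm \<Omega> (partials bs ?X3)))"
   using L2_norm_add_le[OF conjunct1[OF L1] L23] L2_norm_add_le[OF conjunct1[OF L2] conjunct1[OF L3]] by simp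
  also have "\<dots> \<le> 2 * (C1 * wn q H + 2 * (C2 * wn q H + C3 * (sqrt D * wn q H)))"
   using conjunct2[OF L1] conjunct2[OF L2] order_trans[OF conjunct2[OF L3] mult_left_mono[OF wH(2) C3(1)]] by simp
  also have "\<dots> = 2 * (C1 + 2 * (C2 + C3 * sqrt D)) * wn q H" by (simp add: algebra_simps)
  finally show "L2_norm \<Omega> (partials (bs @ [v]) (wprod p a H)) \<le> 2 * (C1 + 2 * (C2 + C3 * sqrt D)) * wn q H" .
 qed
qed

text \<open>With \<open>2 k\<close> powers of \<open>r\<close>, half of them pay for \<open>k\<close> derivatives and the
other half remain in the weight.\<close>

lemma weighted_sobolev:
 "\<exists>C\<ge>0. \<forall>H. holo H --> wmass k H < \<infinity> -->
  wprod (2 * k) (\<lambda>z. 1) H \<in> sobolev \<Omega> k \<and> sobolev_norm \<Omega> k (wprod (2 * k) (\<lambda>z. 1) H) \<le> C * wn k H"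
proof -
 let ?P = "\<lambda>H. wprod (2 * k) (\<lambda>z. 1) H"
 let ?S = "{bs :: (complex^'n) list. set bs \<subseteq> Basis \<and> length bs \<le> k}"
 have fS: "finite ?S" using finite_lists_length_le[OF finite_Basis] .
 have s1: "smooth (\<lambda>z::complex^'n. 1::complex)" by (simp add: smooth_iff)
 have "\<forall>bs\<in>?S. \<exists>C\<ge>0. \<forall>H. holo H --> wmass k H < \<infinity> -->
  partials bs (?P H) \<in> L2 \<Omega> \<and> L2_norm \<Omega> (partials bs (?P H)) \<le> C * wn k H"
  using wprod_partials[OF _ s1, of _ k "2 * k"] by auto
 from bchoice[OF this] obtain C where C': "\<forall>bs\<in>?S. C bs \<ge> 0 \<and> (\<forall>H. holo H --> wmass k H < \<infinity> -->
  partials bs (?P H) \<in> L2 \<Omega> \<and> L2_norm \<Omega> (partials bs (?P H)) \<le> C bs * wn k H)" by (rule exE)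
 let ?c = "sqrt (card (multi_indices k :: (complex^'n) multiset set))"
 have C0: "0 \<le> sum C ?S" using C' by (intro sum_nonneg) blast
 show ?thesis
 proof (intro exI conjI allI impI)
  show "0 \<le> ?c * sum C ?S" using C0 by simp
  fix H assume H: "holo H" and fin: "wmass k H < \<infinity>"
  have D: "partials bs (?P H) \<in> L2 \<Omega> \<and> L2_norm \<Omega> (partials bs (?P H)) \<le> sum C ?S * wn k H"
   if "set bs \<subseteq> Basis" "length bs \<le> k" for bs
  proof -
   have b: "bs \<in> ?S" using that by simp
   have "C bs \<le> sum C ?S" by (rule member_le_sum[OF b _ fS]) (use C' in blast)
   from mult_right_mono[OF this wn_nonneg[of k H]] C' b H fin show ?thesis by force
  qed
  from sobolev_smoothI[OF open_domain bounded_domain smooth_wprod[OF s1 H] D]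
  show "?P H \<in> sobolev \<Omega> k" "sobolev_norm \<Omega> k (?P H) \<le> ?c * sum C ?S * wn k H" by (simp_all add: mult.assoc)
 qed
qed

lemma wn_sq_inner:
 assumes H: "H \<in> bergman_space \<Omega>"
 shows "wprod (2 * k) (\<lambda>z. 1) H \<in> L2 \<Omega>" "L2_inner \<Omega> H (wprod (2 * k) (\<lambda>z. 1) H) = of_real ((wn k H)^2)"
proof -
 note h = bergman_spaceD(2)[OF H] and f0 = bergman_wmass[OF H]
 have s1: "smooth (\<lambda>z::complex^'n. 1::complex)" by (simp add: smooth_iff)
 show "wprod (2 * k) (\<lambda>z. 1) H \<in> L2 \<Omega>" using wprod_partials[of "[]" "\<lambda>z. 1" 0 "2 * k"] s1 h f0 by auto
 have fk: "wmass k H < \<infinity>" by (rule wmass_finite_mono[OF h f0]) simp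
 have L: "wprod k (\<lambda>z. 1) H \<in> L2 \<Omega>" using wprod_partials[of "[]" "\<lambda>z. 1" 0 k] s1 h f0 by auto
 have "ennreal ((L2_norm \<Omega> (wprod k (\<lambda>z. 1) H))^2) = wmass k H"
  unfolding L2_nn_integral[OF L, symmetric] wmass_lebesgue_on
  by (rule nn_integral_cong) (simp add: wprod_def norm_mult norm_power power_mult_distrib power_even_abs flip: power_mult)
 then have n: "(wn k H)^2 = (L2_norm \<Omega> (wprod k (\<lambda>z. 1) H))^2" unfolding wmass_eq[OF fk] by simp
 have "L2_inner \<Omega> H (wprod (2 * k) (\<lambda>z. 1) H) = L2_inner \<Omega> (wprod k (\<lambda>z. 1) H) (wprod k (\<lambda>z. 1) H)"
 proof -
  have e: "cnj (complex_of_real x ^ (2 * k)) = of_real x ^ k * cnj (of_real x ^ k)" for x by (simp add: mult_2 power_add)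
  show ?thesis unfolding L2_inner_def wprod_def complex_cnj_mult e by (simp only: complex_cnj_one mult_1_left mult_ac)
 qed
 then show "L2_inner \<Omega> H (wprod (2 * k) (\<lambda>z. 1) H) = of_real ((wn k H)^2)" unfolding n L2_inner_self .
qed

end

section \<open>Duality\<close>

context tfield begin

text \<open>Test the functional on \<open>cnj h\<close> times a cut-off and let the cut-off tend to \<open>1\<close>.\<close>

lemma L2_from_test_functions:
 assumes h: "smooth_on \<Omega> h" and A: "0 \<le> A"
  and le: "\<And>\<phi>. test_function \<Omega> \<phi> ==> cmod (\<integral>x. h x * \<phi> x \<partial>\<mu>) \<le> A * L2_norm \<Omega> \<phi>"
 shows "h \<in> L2 \<Omega>" "L2_norm \<Omega> h \<le> A"
proof -
 have hm: "h \<in> borel_measurable \<mu>"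
  by (rule continuous_on_measurable_lebesgue_on[OF open_domain smooth_on_continuous_on[OF h]])
 let ?\<phi> = "\<lambda>m z. cnj (h z) * cut m z"
 define F where "F m z = Re (cut m z) * (cmod (h z))^2" for m z
 have t: "test_function \<Omega> (?\<phi> m)" for m by (rule cut_test_function[OF smooth_on_cnj[OF open_domain h]])
 have cr: "cut m z = of_real (Re (cut m z))" "0 \<le> Re (cut m z)" "Re (cut m z) \<le> 1" for m z
  by (simp_all add: cut_def flat_nonneg flat_le_1)
 have prod: "h z * ?\<phi> m z = of_real (F m z)" for m z
 proof -
  have "h z * ?\<phi> m z = (h z * cnj (h z)) * of_real (Re (cut m z))" using cr(1)[of m z] by simp
  then show ?thesis unfolding complex_norm_square[symmetric] F_def by simp
 qed
 have Fi: "integrable \<mu> (F m)" for m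
 proof -
  have "test_function \<Omega> (\<lambda>z. h z * ?\<phi> m z)" by (rule test_function_mult[OF open_domain h t])
  from integrable_Re[OF test_function_integrable(1)[OF this open_domain]] show ?thesis unfolding prod by simp
 qed
 have F0: "0 \<le> F m z" for m z unfolding F_def using cr(2) by simp
 have I: "(\<integral>z. F m z \<partial>\<mu>) \<le> A^2" for m
 proof -
  let ?I = "\<integral>z. F m z \<partial>\<mu>"
  have I0: "0 \<le> ?I" using F0 by simp
  have "(L2_norm \<Omega> (?\<phi> m))^2 \<le> ?I"
   unfolding L2_norm_sq
  proof (rule integral_mono[OF L2_integrable_sq[OF test_function_L2[OF open_domain t]] Fi])
   fix z
   have "(cmod (?\<phi> m z))^2 = (Re (cut m z))^2 * (cmod (h z))^2"
    unfolding norm_mult power_mult_distrib complex_mod_cnj by (subst cr(1)) (simp only: norm_of_real power2_abs mult.commute)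
   also have "\<dots> \<le> F m z"
    unfolding F_def using mult_right_mono[OF cr(3)[of m z] cr(2)[of m z]] cr(2)[of m z] by (intro mult_right_mono) (simp_all add: power2_eq_square)
   finally show "(cmod (?\<phi> m z))^2 \<le> F m z" .
  qed
  then have 1: "L2_norm \<Omega> (?\<phi> m) \<le> sqrt ?I" by (rule real_le_rsqrt)
  have "?I = cmod (\<integral>x. h x * ?\<phi> m x \<partial>\<mu>)" unfolding prod using I0 by simp
  also have "\<dots> \<le> A * L2_norm \<Omega> (?\<phi> m)" by (rule le[OF t])
  also have "\<dots> \<le> A * sqrt ?I" by (rule mult_left_mono[OF 1 A])
  finally have 2: "?I \<le> A * sqrt ?I" .
  show ?thesis
  proof (cases "?I = 0")
   case False
   then have s: "0 < sqrt ?I" using I0 by simp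
   have "sqrt ?I * sqrt ?I \<le> A * sqrt ?I" using 2 I0 by simp
   then have "sqrt ?I \<le> A" by (rule mult_right_le_imp_le[OF _ s])
   from power_mono[OF this, of 2] show ?thesis using I0 by simp
  qed simp
 qed
 have "(\<integral>\<^sup>+z. ennreal ((cmod (h z))^2) \<partial>\<mu>) = (\<integral>\<^sup>+z. liminf (\<lambda>m. ennreal (F m z)) \<partial>\<mu>)"
 proof (rule nn_integral_cong)
  fix z assume "z \<in> space \<mu>"
  then have z: "z \<in> \<Omega>" by (simp add: space_restrict_space)
  have "(\<lambda>m. Re (cut m z)) \<longlonglongrightarrow> Re 1" by (rule tendsto_Re[OF cut_tendsto[OF z]])
  from tendsto_mult_right[OF this] have "(\<lambda>m. F m z) \<longlonglongrightarrow> (cmod (h z))^2" unfolding F_def by simp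
  from lim_imp_Liminf[OF _ tendsto_ennrealI[OF this]] show "ennreal ((cmod (h z))^2) = liminf (\<lambda>m. ennreal (F m z))" by simp
 qed
 also have "\<dots> \<le> liminf (\<lambda>m. \<integral>\<^sup>+z. ennreal (F m z) \<partial>\<mu>)"
  by (rule nn_integral_liminf) (use Fi in \<open>auto dest: borel_measurable_integrable\<close>)
 also have "\<dots> \<le> liminf (\<lambda>m. ennreal (A^2))"
  by (rule Liminf_mono, rule always_eventually) (use I F0 Fi in \<open>auto simp: nn_integral_eq_integral intro!: ennreal_leI\<close>)
 also have "\<dots> = ennreal (A^2)" by (simp add: Liminf_const)
 finally show "h \<in> L2 \<Omega>" "L2_norm \<Omega> h \<le> A" by (rule L2_from_nn_integral[OF hm _ A])+
qed

text \<open>The duality argument in which the assumed regularity of the projection is used: \<open>\<parallel>r\<^sup>k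
H\<parallel>^2\<close> is an inner product of \<open>H = B \<Phi>\<close> with \<open>r\<^sup>2\<^sup>k
H\<close>, and the projection moves to the other side.\<close>

lemma projection_of_test_derivative:
 assumes C1: "\<And>f. f \<in> sobolev \<Omega> k ==> bergman_projection \<Omega> f \<in> sobolev \<Omega> k2 \<and>
      sobolev_norm \<Omega> k2 (bergman_projection \<Omega> f) \<le> C1 * sobolev_norm \<Omega> k f" and C1_pos: "0 < C1"
 shows "\<exists>C\<ge>0. \<forall>bs \<phi>. set bs \<subseteq> Basis --> length bs \<le> k2 --> test_function \<Omega> \<phi> -->
  wn k (bergman_projection \<Omega> (\<lambda>z. cnj (partials bs \<phi> z))) \<le> C * L2_norm \<Omega> \<phi>"
proof -
 obtain C where C: "C \<ge> 0" "\<And>H. holo H ==> wmass k H < \<infinity> ==>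
  wprod (2 * k) (\<lambda>z. 1) H \<in> sobolev \<Omega> k \<and> sobolev_norm \<Omega> k (wprod (2 * k) (\<lambda>z. 1) H) \<le> C * wn k H"
  using weighted_sobolev[of k] by blast
 show ?thesis
 proof (intro exI conjI allI impI)
  show "0 \<le> C1 * C" using C C1_pos by simp
  fix bs \<phi> assume bs: "set bs \<subseteq> (Basis :: (complex^'n) set)" "length bs \<le> k2" and \<phi>: "test_function \<Omega> \<phi>"
  let ?\<Phi> = "\<lambda>z. cnj (partials bs \<phi> z)"
  define H where "H = bergman_projection \<Omega> ?\<Phi>"
  have tp: "partials bs \<phi> \<in> L2 \<Omega>" by (rule test_function_L2[OF open_domain test_function_partials[OF \<phi>]])
  have \<Phi>: "?\<Phi> \<in> L2 \<Omega>" by (rule L2_cnj[OF tp])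
  have HB: "H \<in> bergman_space \<Omega>" unfolding H_def by (rule bergman_projection_props(1)[OF open_domain \<Phi>])
  have fk: "wmass k H < \<infinity>" by (rule wmass_finite_mono[OF bergman_spaceD(2)[OF HB] bergman_wmass[OF HB]]) simp
  let ?P = "wprod (2 * k) (\<lambda>z. 1) H"
  have PL: "?P \<in> L2 \<Omega>" by (rule wn_sq_inner(1)[OF HB])
  note PS = C(2)[OF bergman_spaceD(2)[OF HB] fk]
  let ?Q = "bergman_projection \<Omega> ?P"
  note QS = C1[OF conjunct1[OF PS]]
  have QL: "?Q \<in> L2 \<Omega>" by (rule bergman_spaceD(1)[OF bergman_projection_props(1)[OF open_domain PL]])
  have mi: "mset bs \<in> multi_indices k2" using bs by (simp add: multi_indices_def)
  then obtain g where g: "g \<in> L2 \<Omega>" "is_weak_derivative \<Omega> (mset bs) ?Q g" using QS unfolding sobolev_def by blast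
  let ?D = "weak_derivative \<Omega> (mset bs) ?Q"
  note D = weak_derivative_props[OF g]
  have "of_real ((wn k H)^2) = L2_inner \<Omega> ?\<Phi> ?Q"
   unfolding wn_sq_inner(2)[OF HB, symmetric] unfolding H_def by (rule bergman_projection_selfadjoint[OF open_domain \<Phi> PL[unfolded H_def]])
  also have "\<dots> = cnj (\<integral>z. ?Q z * partials bs \<phi> z \<partial>\<mu>)"
   unfolding L2_inner_simps(2)[OF QL \<Phi> \<Phi>, symmetric] unfolding L2_inner_def complex_cnj_cnj ..
  finally have e: "complex_of_real ((wn k H)^2) = \<dots>" .
  have "(wn k H)^2 = cmod (complex_of_real ((wn k H)^2))" unfolding norm_of_real by simp
  also have "\<dots> = cmod (\<integral>z. ?Q z * partials bs \<phi> z \<partial>\<mu>)" unfolding e complex_mod_cnj ..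
  also have "\<dots> = cmod (\<integral>z. ?D z * \<phi> z \<partial>\<mu>)"
  proof -
   have "(\<integral>z. ?D z * \<phi> z \<partial>\<mu>) = (- 1) ^ size (mset bs) * (\<integral>z. ?Q z * partials bs \<phi> z \<partial>\<mu>)"
    using D(2) \<phi> unfolding is_weak_derivative_def by blast
   then show ?thesis by (simp add: norm_mult norm_power)
  qed
  also have "\<dots> \<le> L2_norm \<Omega> ?D * L2_norm \<Omega> \<phi>"
   by (rule L2_Cauchy_Schwarz[OF D(1) test_function_L2[OF open_domain \<phi>]])
  also have "\<dots> \<le> (C1 * (C * wn k H)) * L2_norm \<Omega> \<phi>"
   by (intro mult_right_mono L2_norm_nonneg order_trans[OF weak_derivative_le_sobolev_norm[OF mi]] order_trans[OF conjunct2[OF QS]] mult_left_mono conjunct2[OF PS])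
    (use C1_pos in simp)
  finally have "wn k H * wn k H \<le> (C1 * C * L2_norm \<Omega> \<phi>) * wn k H" by (simp add: power2_eq_square mult_ac)
  then have "wn k H \<le> C1 * C * L2_norm \<Omega> \<phi>"
   using wn_nonneg[of k H] C C1_pos L2_norm_nonneg[of \<Omega> \<phi>] by (cases "wn k H = 0") simp_all
  then show "wn k (bergman_projection \<Omega> ?\<Phi>) \<le> C1 * C * L2_norm \<Omega> \<phi>" unfolding H_def .
 qed
qed

text \<open>Only the inner products of \<open>f\<close> with holomorphic functions matter, hence \<open>f\<close> may be
replaced by the representative \<open>g 0\<close>.\<close>

lemma projection_estimate:
 assumes k: "1 \<le> k"
  and C1: "\<And>f. f \<in> sobolev \<Omega> k ==> bergman_projection \<Omega> f \<in> sobolev \<Omega> k2 \<and>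
      sobolev_norm \<Omega> k2 (bergman_projection \<Omega> f) \<le> C1 * sobolev_norm \<Omega> k f" and C1_pos: "0 < C1"
 shows "\<exists>C\<ge>0. \<forall>g N f. weak_system k g N --> f \<in> L2 \<Omega> --> (AE z in \<mu>. f z - g 0 z = 0) -->
  bergman_projection \<Omega> f \<in> sobolev \<Omega> k2 \<and> sobolev_norm \<Omega> k2 (bergman_projection \<Omega> f) \<le> C * N"
proof -
 obtain K where K: "K \<ge> 0" "\<And>g N H. weak_system k g N ==> H \<in> bergman_space \<Omega> ==> cmod (L2_inner \<Omega> (g 0) H) \<le> K * N * wn k H"
  using key_estimate[OF k] by blast
 obtain C where C: "C \<ge> 0" "\<And>bs \<phi>. set bs \<subseteq> Basis ==> length bs \<le> k2 ==> test_function \<Omega> \<phi> ==>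
  wn k (bergman_projection \<Omega> (\<lambda>z. cnj (partials bs \<phi> z))) \<le> C * L2_norm \<Omega> \<phi>"
  using projection_of_test_derivative[OF C1 C1_pos] by blast
 let ?c = "sqrt (card (multi_indices k2 :: (complex^'n) multiset set))"
 show ?thesis
 proof (intro exI conjI allI impI)
  show "0 \<le> ?c * (K * C)" using K C by simp
  fix g N f assume ws: "weak_system k g N" and f: "f \<in> L2 \<Omega>" and ae: "AE z in \<mu>. f z - g 0 z = 0"
  have g0: "g 0 \<in> L2 \<Omega>" "0 \<le> N" using weak_systemD[OF ws, of 0] by simp_all
  let ?h = "bergman_projection \<Omega> f"
  note hB = bergman_projection_props(1)[OF open_domain f]
  have hs: "smooth_on \<Omega> ?h" by (rule holo_smooth_on[OF open_domain bergman_spaceD(2)[OF hB]])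
  have D: "partials bs ?h \<in> L2 \<Omega> \<and> L2_norm \<Omega> (partials bs ?h) \<le> K * C * N"
   if bs: "set bs \<subseteq> Basis" "length bs \<le> k2" for bs
  proof -
   have A: "0 \<le> K * C * N" using K C g0 by simp
   have le: "cmod (\<integral>x. partials bs ?h x * \<phi> x \<partial>\<mu>) \<le> K * C * N * L2_norm \<Omega> \<phi>" if \<phi>: "test_function \<Omega> \<phi>" for \<phi>
   proof -
    let ?\<Phi> = "\<lambda>z. cnj (partials (rev bs) \<phi> z)"
    have tp: "partials (rev bs) \<phi> \<in> L2 \<Omega>" by (rule test_function_L2[OF open_domain test_function_partials[OF \<phi>]])
    have \<Phi>: "?\<Phi> \<in> L2 \<Omega>" by (rule L2_cnj[OF tp])
    let ?H = "bergman_projection \<Omega> ?\<Phi>"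
    have HB: "?H \<in> bergman_space \<Omega>" by (rule bergman_projection_props(1)[OF open_domain \<Phi>])
    have "cmod (\<integral>x. partials bs ?h x * \<phi> x \<partial>\<mu>) = cmod (L2_inner \<Omega> ?h ?\<Phi>)"
     unfolding integration_by_parts_partials[OF open_domain hs \<phi> bs(1)] by (simp add: norm_mult norm_power L2_inner_def)
    also have "\<dots> = cmod (L2_inner \<Omega> f ?H)" by (simp only: bergman_projection_selfadjoint[OF open_domain f \<Phi>])
    also have "L2_inner \<Omega> f ?H = L2_inner \<Omega> (g 0) ?H"
     unfolding L2_inner_def
    proof (rule integral_cong_AE)
     have "?H \<in> L2 \<Omega>" by (rule bergman_spaceD(1)[OF HB])
     note m = L2_measurable[OF L2_cnj[OF this]] L2_measurable[OF f] L2_measurable[OF g0(1)]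
     show "(\<lambda>x. f x * cnj (?H x)) \<in> borel_measurable \<mu>" "(\<lambda>x. g 0 x * cnj (?H x)) \<in> borel_measurable \<mu>"
      using m by (auto intro: borel_measurable_times)
     show "AE x in \<mu>. f x * cnj (?H x) = g 0 x * cnj (?H x)" using ae by eventually_elim simp
    qed
    also have "cmod (L2_inner \<Omega> (g 0) ?H) \<le> K * N * wn k ?H" by (rule K(2)[OF ws HB])
    also have "\<dots> \<le> K * N * (C * L2_norm \<Omega> \<phi>)"
     using bs K g0 by (intro mult_left_mono C(2) \<phi>) auto
    finally show ?thesis by (simp add: mult_ac)
   qed
   show ?thesis using L2_from_test_functions[OF smooth_on_partials[OF hs bs(1)] A le] by blast
  qed
  from sobolev_smoothI[OF open_domain bounded_domain hs D]
  show "?h \<in> sobolev \<Omega> k2" "sobolev_norm \<Omega> k2 ?h \<le> ?c * (K * C) * N" by (simp_all add: mult.assoc)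
 qed
qed

end

section \<open>Complex transversality and the main estimate\<close>

lemma cvector_apply_plus_left: "cvector_apply (s + t) L = cvector_apply s L + cvector_apply t L"
 unfolding cvector_apply_def sum.distrib[symmetric]
 by (rule sum.cong[OF refl]) (simp add: algebra_simps add_divide_distrib diff_divide_distrib)

lemma cvector_apply_cscale: "cvector_apply (cscale c t) L = c * cvector_apply t L"
 unfolding cvector_apply_def sum_distrib_left by (rule sum.cong[OF refl]) (simp add: cscale_def algebra_simps)

lemma real_linear_expansion:
 fixes L :: "complex^'n => real"
 assumes "linear L"
 shows "L x = (\<Sum>j\<in>UNIV. Re (x $ j) * L (axis j 1) + Im (x $ j) * L (axis j \<i>))"
proof -
 interpret linear L by fact
 have "x $ j *s axis j 1 = Re (x $ j) *\<^sub>R axis j 1 + Im (x $ j) *\<^sub>R axis j \<i>" for j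
  by (simp add: vec_eq_iff axis_def complex_eq_iff)
 then have "x = (\<Sum>j\<in>UNIV. Re (x $ j) *\<^sub>R axis j 1 + Im (x $ j) *\<^sub>R axis j \<i>)"
  using basis_expansion[of x] by simp
 then have "L x = L (\<Sum>j\<in>UNIV. Re (x $ j) *\<^sub>R axis j 1 + Im (x $ j) *\<^sub>R axis j \<i>)" by (rule arg_cong)
 then show ?thesis by (simp only: sum add scale real_scaleR_def)
qed

lemma cvector_apply_of_real_vector:
 fixes L :: "complex^'n => real"
 assumes "linear L"
 shows "cvector_apply (of_real_vector x) (\<lambda>v. of_real (L v)) = of_real (L x)"
 unfolding cvector_apply_def real_linear_expansion[OF assms, of x] of_real_sum
 by (rule sum.cong[OF refl]) (simp add: of_real_vector_def complex_eq_iff field_simps)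

lemma real_linear_cvector_apply:
 fixes L :: "complex^'n => real"
 assumes "linear L"
 shows "L x = 2 * Re (cvector_apply (0, \<chi> j. cnj (x $ j)) (\<lambda>v. of_real (L v)))"
 unfolding cvector_apply_def real_linear_expansion[OF assms, of x] Re_sum sum_distrib_left
 by (rule sum.cong[OF refl]) simp

lemma transpose_field_cong_open:
 assumes "open S" "z \<in> S" "\<And>x. x \<in> S ==> T x = T' x" "\<And>x. x \<in> S ==> \<phi> x = \<psi> x"
 shows "transpose_field T \<phi> z = transpose_field T' \<psi> z"
proof -
 have "der (\<lambda>w. fst (T w) $ j * \<phi> w) z = der (\<lambda>w. fst (T' w) $ j * \<psi> w) z"
  "der (\<lambda>w. snd (T w) $ j * \<phi> w) z = der (\<lambda>w. snd (T' w) $ j * \<psi> w) z" for j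
  by (rule frechet_derivative_cong_open[OF assms(1,2)]; simp only: assms(3,4))+
 then show ?thesis unfolding transpose_field_def wirtinger_def wirtinger_bar_def by simp
qed

lemma transpose_field_power_cong:
 assumes "open S" "\<And>x. x \<in> S ==> T x = T' x" "z \<in> S"
 shows "(transpose_field T ^^ m) \<phi> z = (transpose_field T' ^^ m) \<phi> z"
 using assms(3)
proof (induction m arbitrary: z)
 case (Suc m)
 then show ?case using transpose_field_cong_open[OF assms(1) Suc.prems assms(2) Suc.IH] by simp
qed simp

text \<open>The formal transpose is a local operator, so only the values of the field inside \<open>\<Omega>\<close>
matter. This allows a field that is smooth up to the boundary to be replaced by a smooth extension.\<close>

lemma is_weak_field_power_cong:
 assumes "open \<Omega>" "\<And>x. x \<in> \<Omega> ==> T x = T' x"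
 shows "is_weak_field_power \<Omega> T m f g = is_weak_field_power \<Omega> T' m f g"
proof -
 have "(\<integral>x. f x * (transpose_field T ^^ m) \<phi> x \<partial>lebesgue_on \<Omega>) = (\<integral>x. f x * (transpose_field T' ^^ m) \<phi> x \<partial>lebesgue_on \<Omega>)" for \<phi>
  by (rule Bochner_Integration.integral_cong[OF refl]) (simp add: space_restrict_space transpose_field_power_cong[OF assms])
 then show ?thesis by (simp add: is_weak_field_power_def)
qed

lemma boundary_tangent_eq:
 assumes "smooth_domain \<Omega> \<rho>" and p: "p \<in> frontier \<Omega>"
 shows "boundary_tangent \<Omega> p = {v. der \<rho> p v = 0}"
proof (intro set_eqI iffI CollectI)
 interpret smooth_domain \<Omega> \<rho> by fact
 fix v assume v: "v \<in> boundary_tangent \<Omega> p"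
 have "defining_function \<Omega> \<rho>" unfolding defining_function_def using smooth_rho domain_eq nondegenerate by blast
 then show "der \<rho> p v = 0" using v by (simp add: boundary_tangent_def)
next
 interpret smooth_domain \<Omega> \<rho> by fact
 fix v assume v: "v \<in> {v. der \<rho> p v = 0}"
 show "v \<in> boundary_tangent \<Omega> p" unfolding boundary_tangent_def
 proof (intro CollectI allI impI)
  fix \<rho>' assume d: "defining_function \<Omega> \<rho>'"
  interpret R: smooth_domain \<Omega> \<rho>'
   using d bounded_domain by (intro smooth_domain.intro) (auto simp: defining_function_def)
  show "frechet_derivative \<rho>' (at p) v = 0"
   by (rule vanishing_derivative_tangent[OF R.smooth_rho R.frontier_zero p]) (use v in simp_all)
 qed
qed

text \<open>A vector of type \<open>(1,0)\<close> is \<open>x + i y\<close> with real vectors \<open>x = u / 2\<close> and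
\<open>y = - i u / 2\<close>; applying it to \<open>\<rho>\<close> gives \<open>d\<rho>(x) + i
d\<rho>(y)\<close>, which vanishes only if both \<open>x\<close> and \<open>y\<close> are tangent. The type
\<open>(0,1)\<close> is similar.\<close>

lemma T10_T01_boundaryI:
 assumes "smooth_domain \<Omega> \<rho>" and p: "p \<in> frontier \<Omega>"
 shows "cvector_apply (u, 0) (\<lambda>v. of_real (der \<rho> p v)) = 0 ==> (u, 0) \<in> T10_boundary \<Omega> p"
  and "cvector_apply (0, v) (\<lambda>v. of_real (der \<rho> p v)) = 0 ==> (0, v) \<in> T01_boundary \<Omega> p"
proof -
 interpret smooth_domain \<Omega> \<rho> by fact
 let ?L = "der \<rho> p"
 have lin: "linear ?L" by (rule has_derivative_linear[OF smooth_on_has_derivative[OF smooth_on_rho UNIV_I]])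
 have mem: "t \<in> complexified_boundary_tangent \<Omega> p"
  if t: "t = of_real_vector x + cscale \<i> (of_real_vector y)" and 0: "cvector_apply t (\<lambda>v. of_real (?L v)) = 0" for t x y
 proof -
  have "complex_of_real (?L x) + \<i> * of_real (?L y) = 0"
   using 0 unfolding t cvector_apply_plus_left cvector_apply_cscale cvector_apply_of_real_vector[OF lin] .
  then have "?L x = 0" "?L y = 0" by (simp_all add: complex_eq_iff)
  then show ?thesis unfolding complexified_boundary_tangent_def boundary_tangent_eq[OF assms] using t by blast
 qed
 have 1: "(u, 0) = of_real_vector (\<chi> j. u $ j / 2) + cscale \<i> (of_real_vector (\<chi> j. - \<i> * u $ j / 2))"
  by (simp add: of_real_vector_def cscale_def vec_eq_iff)
 show "(u, 0) \<in> T10_boundary \<Omega> p" if "cvector_apply (u, 0) (\<lambda>v. of_real (?L v)) = 0"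
  unfolding T10_boundary_def using mem[OF 1 that] by simp
 have 2: "(0, v) = of_real_vector (\<chi> j. cnj (v $ j) / 2) + cscale \<i> (of_real_vector (\<chi> j. \<i> * cnj (v $ j) / 2))"
  by (simp add: of_real_vector_def cscale_def vec_eq_iff)
 show "(0, v) \<in> T01_boundary \<Omega> p" if "cvector_apply (0, v) (\<lambda>v. of_real (?L v)) = 0"
  unfolding T01_boundary_def using mem[OF 2 that] by simp
qed

text \<open>If \<open>\<kappa>\<close> vanished at a boundary point, the two parts of \<open>T\<close> would be tangential
one by one, against complex transversality. The choice \<open>\<gamma> = - cnj \<kappa>\<close> then makes
\<open>w\<close> point inwards.\<close>

lemma tfield_exists:
 fixes T :: "complex^'n => 'n::finite cvector"
 assumes dom: "smoothly_bounded_domain \<Omega>" and T: "smooth T" and tan: "tangential \<Omega> T" and tr: "complex_transversal \<Omega> T"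
 shows "\<exists>\<rho> w c L B \<delta> \<eta> K \<gamma> \<theta>. tfield \<Omega> \<rho> w c L B \<delta> \<eta> K T \<gamma> \<theta>"
proof -
 obtain \<rho> where d: "bounded \<Omega>" "defining_function \<Omega> \<rho>" using dom unfolding smoothly_bounded_domain_def by blast
 have sd: "smooth_domain \<Omega> \<rho>" using d by (intro smooth_domain.intro) (auto simp: defining_function_def)
 interpret smooth_domain \<Omega> \<rho> by (rule sd)
 let ?R = "\<lambda>z. complex_of_real (\<rho> z)"
 let ?L = "\<lambda>z. der \<rho> z"
 have lin: "linear (?L z)" for z by (rule has_derivative_linear[OF smooth_on_has_derivative[OF smooth_on_rho UNIV_I]])
 have dR: "der ?R z = (\<lambda>v. of_real (?L z v))" for z
  by (rule frechet_derivative_at[OF bounded_linear.has_derivative[OF bounded_linear_of_real smooth_on_has_derivative[OF smooth_on_rho UNIV_I]], symmetric])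
 have sR: "smooth_on UNIV ?R" by (rule smooth_on_of_real[OF open_UNIV smooth_on_rho])
 have sT: "smooth_on UNIV T" using T by (simp add: smooth_iff)
 have fd0: "field_deriv T ?R p = 0" if p: "p \<in> frontier \<Omega>" for p
 proof -
  obtain x y where xy: "T p = of_real_vector x + cscale \<i> (of_real_vector y)" "?L p x = 0" "?L p y = 0"
   using bspec[OF tan[unfolded tangential_def] p] unfolding complexified_boundary_tangent_def boundary_tangent_eq[OF sd p] by blast
  show ?thesis
   unfolding field_deriv_def dR xy(1) cvector_apply_plus_left cvector_apply_cscale cvector_apply_of_real_vector[OF lin] xy(2,3) by simp
 qed
 have "smooth (field_deriv T ?R)" unfolding smooth_iff by (rule smooth_on_field_deriv[OF open_UNIV sT sR])
 from vanishing_bound[OF this fd0]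
 obtain \<theta> where \<theta>: "\<And>z. z \<in> \<Omega> ==> norm (field_deriv T ?R z) \<le> \<theta> * r z" by blast
 define \<kappa> where "\<kappa> = field_deriv (\<lambda>z. (0, snd (T z))) ?R"
 have "bounded_linear (\<lambda>t::'n cvector. (0 :: complex^'n, snd t))"
  by (intro bounded_linear_Pair bounded_linear_zero bounded_linear_snd)
 from smooth_on_field_deriv[OF open_UNIV smooth_on_linear[OF this open_UNIV sT] sR]
 have s\<kappa>: "smooth_on UNIV \<kappa>" unfolding \<kappa>_def .
 have \<kappa>: "\<kappa> p \<noteq> 0" if p: "p \<in> frontier \<Omega>" for p
 proof
  assume 0: "\<kappa> p = 0"
  have sp: "T p = (fst (T p), 0) + (0, snd (T p))" by simp
  have v0: "cvector_apply (0, snd (T p)) (\<lambda>v. of_real (?L p v)) = 0" using 0 unfolding \<kappa>_def field_deriv_def dR .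
  have "cvector_apply (fst (T p), 0) (\<lambda>v. of_real (?L p v)) + cvector_apply (0, snd (T p)) (\<lambda>v. of_real (?L p v)) = 0"
   using fd0[OF p] unfolding field_deriv_def dR cvector_apply_plus_left[symmetric] by simp
  then have u0: "cvector_apply (fst (T p), 0) (\<lambda>v. of_real (?L p v)) = 0" unfolding v0 by simp
  have "T p \<in> {\<sigma> + \<tau> | \<sigma> \<tau>. \<sigma> \<in> T10_boundary \<Omega> p \<and> \<tau> \<in> T01_boundary \<Omega> p}"
   using sp T10_T01_boundaryI[OF sd p] u0 v0 by blast
  with bspec[OF tr[unfolded complex_transversal_def] p] show False by contradiction
 qed
 define \<gamma> where "\<gamma> z = - cnj (\<kappa> z)" for z
 have s\<gamma>: "smooth_on UNIV \<gamma>" unfolding \<gamma>_def[abs_def] by (intro smooth_on_minus smooth_on_cnj open_UNIV s\<kappa>)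
 define w where "w z = (\<Sum>j\<in>UNIV. axis j (cnj (\<gamma> z * snd (T z) $ j)))" for z
 have wj: "w z $ j = cnj (\<gamma> z * snd (T z) $ j)" for z j
  unfolding w_def by (simp add: axis_def if_distrib cong: if_cong)
 have ax: "bounded_linear (axis j :: complex => complex^'n)" for j
  by (intro linear_conv_bounded_linear[THEN iffD1] linearI) (simp_all add: vec_eq_iff axis_def)
 have sv: "smooth_on UNIV (\<lambda>z. cnj (\<gamma> z * snd (T z) $ j))" for j
  by (rule smooth_on_cnj[OF open_UNIV smooth_on_mult[OF open_UNIV s\<gamma> smooth_on_field_components(2)[OF open_UNIV sT]]])
 have sw: "smooth w" unfolding smooth_iff w_def[abs_def]
  by (rule smooth_on_sum[OF open_UNIV smooth_on_linear[OF ax open_UNIV sv]])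
 have inward: "der \<rho> p (w p) < 0" if p: "p \<in> frontier \<Omega>" for p
 proof -
  have e: "(0, \<chi> j. cnj (w p $ j)) = cscale (\<gamma> p) (0, snd (T p))"
   by (simp add: cscale_def wj vec_eq_iff)
  have "?L p (w p) = 2 * Re (\<gamma> p * \<kappa> p)"
   unfolding real_linear_cvector_apply[OF lin, of p "w p"] e cvector_apply_cscale \<kappa>_def field_deriv_def dR ..
  also have "\<gamma> p * \<kappa> p = - of_real ((cmod (\<kappa> p))^2)"
   unfolding \<gamma>_def complex_norm_square by simp
  finally show ?thesis using \<kappa>[OF p] by simp
 qed
 obtain c L B \<delta> \<eta> K where "collar \<Omega> \<rho> w c L B \<delta> \<eta> K" using collar_exists[OF sw inward] by blast
 then have "tfield \<Omega> \<rho> w c L B \<delta> \<eta> K T \<gamma> \<theta>"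
  by (rule tfield.intro[OF ccollar.intro tfield_axioms.intro[OF T s\<gamma>[folded smooth_iff] wj \<theta>]])
 then show ?thesis by blast
qed

text \<open>The space \<open>H\<^sup>k\<^sub>T\<close> requires each power of \<open>T\<close> separately; by testing with
\<open>T\<^sup>t \<phi>\<close> consecutive powers are derivatives of each other.\<close>

lemma (in tfield) sobolev_field_weak_system:
 assumes f: "f \<in> sobolev_field \<Omega> T' k" and eq: "\<And>x. x \<in> \<Omega> ==> T' x = T x"
 shows "weak_system k (\<lambda>i. weak_field_power \<Omega> T' i f) (sobolev_field_norm \<Omega> T' k f)"
  and "AE z in lebesgue_on \<Omega>. f z - weak_field_power \<Omega> T' 0 f z = 0"
proof -
 have fL: "f \<in> L2 \<Omega>" using f by (simp add: sobolev_field_def)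
 let ?g = "\<lambda>i. weak_field_power \<Omega> T' i f"
 have g: "?g i \<in> L2 \<Omega>" "is_weak_field_power \<Omega> T' i f (?g i)" if i: "i \<le> k" for i
 proof -
  have "\<exists>g. g \<in> L2 \<Omega> \<and> is_weak_field_power \<Omega> T' i f g"
  proof (cases "i = 0")
   case True
   then show ?thesis using fL by (auto simp: is_weak_field_power_def)
  next
   case False
   then have "i \<in> {1..k}" using i by simp
   then show ?thesis using f unfolding sobolev_field_def by blast
  qed
  from someI_ex[OF this] show "?g i \<in> L2 \<Omega>" "is_weak_field_power \<Omega> T' i f (?g i)"
   unfolding weak_field_power_def by blast+
 qed
 have w: "(\<integral>x. ?g i x * \<phi> x \<partial>lebesgue_on \<Omega>) = (\<integral>x. f x * (transpose_field T ^^ i) \<phi> x \<partial>lebesgue_on \<Omega>)"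
  if "i \<le> k" "test_function \<Omega> \<phi>" for i \<phi>
 proof -
  have "is_weak_field_power \<Omega> T i f (?g i)"
   by (rule iffD1[OF is_weak_field_power_cong[where T=T' and T'=T, OF open_domain eq] g(2)[OF that(1)]])
  then show ?thesis using that(2) unfolding is_weak_field_power_def by blast
 qed
 have n: "L2_norm \<Omega> (?g i) \<le> sobolev_field_norm \<Omega> T' k f" if i: "i \<le> k" for i
  unfolding sobolev_field_norm_def
 proof (rule real_le_rsqrt)
  show "(L2_norm \<Omega> (?g i))^2 \<le> (\<Sum>m=0..k. (L2_norm \<Omega> (weak_field_power \<Omega> T' m f))^2)"
   by (rule member_le_sum[where f="\<lambda>i. (L2_norm \<Omega> (?g i))^2"]) (use i in auto)
 qed
 have s: "(\<integral>x. ?g (Suc i) x * \<phi> x \<partial>lebesgue_on \<Omega>) = (\<integral>x. ?g i x * transpose_field T \<phi> x \<partial>lebesgue_on \<Omega>)"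
  if i: "i < k" and \<phi>: "test_function \<Omega> \<phi>" for i \<phi>
  using w[of "Suc i" \<phi>] w[of i "transpose_field T \<phi>"] test_function_transpose[OF smooth_T \<phi>] i \<phi>
  by (simp add: funpow_swap1)
 show "weak_system k ?g (sobolev_field_norm \<Omega> T' k f)" unfolding weak_system_def
  by (intro conjI allI impI) (rule g(1) n s; assumption)+
 show "AE z in lebesgue_on \<Omega>. f z - ?g 0 z = 0"
 proof (rule fundamental_lemma[OF open_domain])
  show "integrable (lebesgue_on \<Omega>) (\<lambda>z. f z - ?g 0 z)"
   by (rule L2_integrable[OF open_domain bounded_domain L2_diff[OF fL g(1)]]) simp
  fix \<phi> assume \<phi>: "test_function \<Omega> \<phi>"
  have "\<phi> \<in> L2 \<Omega>" by (rule test_function_L2[OF open_domain \<phi>])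
  then show "(\<integral>x. (f x - ?g 0 x) * \<phi> x \<partial>lebesgue_on \<Omega>) = 0"
   using w[of 0 \<phi>] \<phi> L2_mult_integrable[OF fL] L2_mult_integrable[OF g(1)[of 0]] by (simp add: left_diff_distrib)
 qed
qed

theorem theorem1p1:
  fixes \<Omega> :: "(complex ^ 'n) set"
    and T :: "complex ^ 'n \<Rightarrow> (complex ^ 'n) \<times> (complex ^ 'n)"
    and k\<^sub>1 k\<^sub>2 :: nat and C\<^sub>1 :: real
  assumes "smoothly_bounded_domain \<Omega>"
    and "smooth_up_to_boundary \<Omega> T"
    and "tangential \<Omega> T"
    and "complex_transversal \<Omega> T"
    and "k\<^sub>1 \<ge> 1" and "k\<^sub>2 \<ge> 1" and "C\<^sub>1 > 0"
    and "\<forall>f\<in>sobolev \<Omega> k\<^sub>1. bergman_projection \<Omega> f \<in> sobolev \<Omega> k\<^sub>2 \<and>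
           sobolev_norm \<Omega> k\<^sub>2 (bergman_projection \<Omega> f) \<le> C\<^sub>1 * sobolev_norm \<Omega> k\<^sub>1 f"
  shows "\<exists>C\<^sub>2>0. \<forall>f\<in>sobolev_field \<Omega> T k\<^sub>1. bergman_projection \<Omega> f \<in> sobolev \<Omega> k\<^sub>2 \<and>
           sobolev_norm \<Omega> k\<^sub>2 (bergman_projection \<Omega> f) \<le> C\<^sub>2 * sobolev_field_norm \<Omega> T k\<^sub>1 f"
proof -
  obtain T' where T': "smooth T'" "\<And>x. x \<in> closure \<Omega> \<Longrightarrow> T' x = T x"
    using assms(2) unfolding smooth_up_to_boundary_def by blast
  have bd: "T' p = T p" if "p \<in> frontier \<Omega>" for p using T'(2) that by (simp add: frontier_def)
  have int: "T x = T' x" if "x \<in> \<Omega>" for x using T'(2) that closure_subset[of \<Omega>] by (simp add: subset_iff)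
  have "tangential \<Omega> T'" "complex_transversal \<Omega> T'"
    using assms(3,4) unfolding tangential_def complex_transversal_def by (simp_all add: bd)
  from tfield_exists[OF assms(1) T'(1) this]
  obtain \<rho> w c L B \<delta> \<eta> K \<gamma> \<theta> where "tfield \<Omega> \<rho> w c L B \<delta> \<eta> K T' \<gamma> \<theta>" by blast
  then interpret tfield \<Omega> \<rho> w c L B \<delta> \<eta> K T' \<gamma> \<theta> .
  obtain C where C: "C \<ge> 0" "\<And>g N f. weak_system k\<^sub>1 g N \<Longrightarrow> f \<in> L2 \<Omega> \<Longrightarrow> AE z in lebesgue_on \<Omega>. f z - g 0 z = 0 \<Longrightarrow>
    bergman_projection \<Omega> f \<in> sobolev \<Omega> k\<^sub>2 \<and> sobolev_norm \<Omega> k\<^sub>2 (bergman_projection \<Omega> f) \<le> C * N"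
    using projection_estimate[OF assms(5) bspec[OF assms(8)] assms(7)] by blast
  show ?thesis
  proof (intro exI[of _ "C + 1"] conjI ballI)
    show "C + 1 > 0" using C by simp
    fix f assume f: "f \<in> sobolev_field \<Omega> T k\<^sub>1"
    note ws = sobolev_field_weak_system[OF f int]
    have fL: "f \<in> L2 \<Omega>" using f by (simp add: sobolev_field_def)
    note e = C(2)[OF ws(1) fL ws(2)]
    show "bergman_projection \<Omega> f \<in> sobolev \<Omega> k\<^sub>2" using e by blast
    have "C * sobolev_field_norm \<Omega> T k\<^sub>1 f \<le> (C + 1) * sobolev_field_norm \<Omega> T k\<^sub>1 f"
      using weak_systemD(3)[OF ws(1), of 0] by (intro mult_right_mono) auto
    then show "sobolev_norm \<Omega> k\<^sub>2 (bergman_projection \<Omega> f) \<le> (C + 1) * sobolev_field_norm \<Omega> T k\<^sub>1 f"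
      using e by linarith
  qed
qed

end
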